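(* Let $\Omega\subset\mathbb R^n$, $n\ge2$, be any open set with $\mathcal L^n(\Omega)<\infty$ and $\mathcal H^{n-1}(\partial\Omega)<\infty$. Let $\mu$ be a Borel measure on $\Omega$ with $\mu(\Omega)<\infty$ such that $\mu(B_r(x)\cap\Omega)\le C_\mu r^\alpha$ for all $x\in\Omega$, $r>0$, for some $\alpha\in(n-1,n]$, $C_\mu>0$. (i) Let $1<p<n$, $r>1$, $1\le\sigma,\varrho\le\infty$, $q=\min\{\frac{p\alpha}{n-p},\frac{r\alpha}{n-1}\}$, and let $\eta\ge\sigma$ if $q=\frac{p\alpha}{n-p}$ and $\eta\ge\varrho$ if $q=\frac{r\alpha}{n-1}$. Then there exists $C=C(n,p,r,\sigma,\varrho,\alpha,C_\mu)$ such that $$\|u\|_{L^{q,\eta}(\Omega,\mu)}\le C\Big(\max\{\mu(\Omega)^{\frac n\alpha},\mathcal L^n(\Omega)\}^{\frac{\alpha}{qn}-\frac{n-p}{pn}}\|\nabla u\|_{L^{p,\sigma}(\Omega)}+\max\{\mu(\Omega)^{\frac{n-1}\alpha},\mathcal H^{n-1}(\partial\Omega)\}^{\frac{\alpha}{q(n-1)}-\frac1r}\|u\|_{L^{r,\varrho}(\partial\Omega)}\Big)$$ for every $u\in V^1L^{p,\sigma}(\Omega)\cap C_b(\overline\Omega)$. (ii) Let $\sigma,\varrho>1$, $\varsigma<-\frac1\varrho$, $\eta\ge\max\{\sigma,\varrho\}$ and $\vartheta\le\min\{-1+\frac1\sigma-\frac1\eta,\ \varsigma+\frac1\varrho-\frac1\eta\}$.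 Then there exists $C=C(n,\eta,\sigma,\varrho,\vartheta,\varsigma,\alpha,C_\mu,\mathcal L^n(\Omega),\mu(\Omega),\mathcal H^{n-1}(\partial\Omega))$ such that $$\|u\|_{L^{\infty,\eta;\vartheta}(\Omega,\mu)}\le C\big(\|\nabla u\|_{L^{n,\sigma}(\Omega)}+\|u\|_{L^{\infty,\varrho;\varsigma}(\partial\Omega)}\big)$$ for every $u\in V^1L^{n,\sigma}(\Omega)\cap C_b(\overline\Omega)$. (iii) Assume that either $p=n$ and $\sigma=1$, or $p>n$ and $1\le\sigma\le\infty$. Then there exists $C=C(n,p,\sigma,\alpha,C_\mu)$ such that $$\|u\|_{L^\infty(\Omega)}\le C\big(\mathcal L^n(\Omega)^{\frac1n-\frac1p}\|\nabla u\|_{L^{p,\sigma}(\Omega)}+\|u\|_{L^\infty(\partial\Omega)}\big)$$ for every $u\in V^1L^{p,\sigma}(\Omega)\cap C_b(\overline\Omega)$.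
   Context: $\mathcal L^n$ is Lebesgue measure, $\mathcal H^{n-1}$ the $(n-1)$-dimensional Hausdorff measure on $\partial\Omega$; spaces without an indicated measure use these. $C_b(\overline\Omega)$: continuous functions on $\overline\Omega$ with bounded support; boundary norms of $u$ are norms of its restriction to $\partial\Omega$. $V^1X(\Omega)$: weakly differentiable $u$ with $|\nabla u|\in X(\Omega)$. For a measure space $(\mathcal R,m)$ the decreasing rearrangement is $\phi^*_m(t)=\inf\{\tau\ge0:m(\{|\phi|>\tau\})\le t\}$. Lorentz norm: $\|\phi\|_{L^{p,\sigma}(\mathcal R,m)}=\|t^{\frac1p-\frac1\sigma}\phi^*_m(t)\|_{L^\sigma(0,m(\mathcal R))}$; Lorentz–Zygmund functional (for $m(\mathcal R)<\infty$): $\|\phi\|_{L^{p,\sigma;\vartheta}(\mathcal R,m)}=\|t^{\frac1p-\frac1\sigma}\log^\vartheta(1+\frac{m(\mathcal R)}t)\phi^*_m(t)\|_{L^\sigma(0,m(\mathcal R))}$, with the convention $\frac1\infty=0$. *)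

theory Defs
  imports "HOL-Analysis.Analysis"
begin

definition einv :: "ereal \<Rightarrow> real" where
  "einv p = (if p = \<infinity> then 0 else 1 / real_of_ereal p)"

text \<open>Real power of an extended nonnegative real (used only for positive exponents).\<close>
definition epowr :: "ennreal \<Rightarrow> real \<Rightarrow> ennreal" where
  "epowr x a = (if x = top then top else ennreal (enn2real x powr a))"

definition rearr :: "'a measure \<Rightarrow> ('a \<Rightarrow> real) \<Rightarrow> real \<Rightarrow> ennreal" where
  "rearr M \<phi> t = Inf {ennreal \<tau> | \<tau>. \<tau> \<ge> 0 \<and>
      emeasure M {x \<in> space M. \<tau> < \<bar>\<phi> x\<bar>} \<le> ennreal t}"

definition lsig :: "ereal \<Rightarrow> (real \<Rightarrow> ennreal) \<Rightarrow> ennreal \<Rightarrow> ennreal" where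
  "lsig \<sigma> g m =
    (if \<sigma> = \<infinity> then Inf {c. AE t in lborel. (0 < t \<and> ennreal t < m) \<longrightarrow> g t \<le> c}
     else epowr (\<integral>\<^sup>+ t \<in> {t. 0 < t \<and> ennreal t < m}. epowr (g t) (real_of_ereal \<sigma>) \<partial>lborel)
                (1 / real_of_ereal \<sigma>))"

definition lorentz :: "'a measure \<Rightarrow> ereal \<Rightarrow> ereal \<Rightarrow> ('a \<Rightarrow> real) \<Rightarrow> ennreal" where
  "lorentz M p \<sigma> \<phi> =
     lsig \<sigma> (\<lambda>t. ennreal (t powr (einv p - einv \<sigma>)) * rearr M \<phi> t) (emeasure M (space M))"

definition lorentz_zygmund :: "'a measure \<Rightarrow> ereal \<Rightarrow> ereal \<Rightarrow> real \<Rightarrow> ('a \<Rightarrow> real) \<Rightarrow> ennreal" where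
  "lorentz_zygmund M p \<sigma> \<theta> \<phi> =
     lsig \<sigma> (\<lambda>t. ennreal (t powr (einv p - einv \<sigma>) * (ln (1 + measure M (space M) / t)) powr \<theta>)
                 * rearr M \<phi> t) (emeasure M (space M))"

definition linf :: "'a measure \<Rightarrow> ('a \<Rightarrow> real) \<Rightarrow> ennreal" where
  "linf M \<phi> = Inf {c. AE x in M. ennreal \<bar>\<phi> x\<bar> \<le> c}"

definition hausdorff_pre :: "real \<Rightarrow> real \<Rightarrow> 'a::metric_space set \<Rightarrow> ennreal" where
  "hausdorff_pre s \<delta> A = Inf {(\<Sum>i. ennreal (pi powr (s/2) / Gamma (s/2 + 1) * (diameter (C i) / 2) powr s)) | C.
      A \<subseteq> (\<Union>i. C i) \<and> (\<forall>i. bounded (C i) \<and> diameter (C i) \<le> \<delta>)}"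

definition hausdorff :: "real \<Rightarrow> 'a::metric_space set \<Rightarrow> ennreal" where
  "hausdorff s A = (SUP \<delta>\<in>{0<..}. hausdorff_pre s \<delta> A)"

definition hmeasure :: "real \<Rightarrow> 'a::metric_space set \<Rightarrow> 'a measure" where
  "hmeasure s S = measure_of S (sets (restrict_space borel S)) (hausdorff s)"

definition pd :: "'n::finite \<Rightarrow> (real^'n \<Rightarrow> real) \<Rightarrow> real^'n \<Rightarrow> real" where
  "pd i f x = frechet_derivative f (at x) (axis i 1)"

fun Ck :: "nat \<Rightarrow> (real^'n::finite \<Rightarrow> real) \<Rightarrow> bool" where
  "Ck 0 f = continuous_on UNIV f"
| "Ck (Suc k) f = (f differentiable_on UNIV \<and> (\<forall>i. Ck k (pd i f)))"

definition test_function :: "(real^'n::finite) set \<Rightarrow> (real^'n \<Rightarrow> real) \<Rightarrow> bool" where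
  "test_function \<Omega> \<phi> \<longleftrightarrow> (\<forall>k. Ck k \<phi>) \<and> compact (closure {x. \<phi> x \<noteq> 0})
      \<and> closure {x. \<phi> x \<noteq> 0} \<subseteq> \<Omega>"

definition has_weak_gradient :: "(real^'n::finite) set \<Rightarrow> (real^'n \<Rightarrow> real) \<Rightarrow> (real^'n \<Rightarrow> real^'n) \<Rightarrow> bool" where
  "has_weak_gradient \<Omega> u G \<longleftrightarrow>
     (\<forall>K. compact K \<and> K \<subseteq> \<Omega> \<longrightarrow> set_integrable lebesgue K u \<and> (\<forall>i. set_integrable lebesgue K (\<lambda>x. G x $ i)))
   \<and> (\<forall>\<phi> i. test_function \<Omega> \<phi> \<longrightarrow>
        (LINT x:\<Omega>|lebesgue. u x * pd i \<phi> x) = - (LINT x:\<Omega>|lebesgue. G x $ i * \<phi> x))"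

end

theory Submission
  imports Defs
begin

text \<open>Everything rests on one inequality for level sets (\<open>level_inequality\<close>): for \<open>s < t\<close>,
  \<open>(t - s) \<mu>{\<bar>u\<bar> > t}\<close> to the power \<open>(n - 1)/\<alpha>\<close> is at most a constant times the integral of
  \<open>\<bar>\<nabla>u\<bar>\<close> over \<open>{\<bar>u\<bar> > s}\<close> plus \<open>t - s\<close> times the Hausdorff measure of \<open>{\<bar>u\<bar> > s}\<close> in the boundary.
  It comes from testing the weak gradient of a truncation of \<open>u\<close> against a regularised Riesz kernel
  times a cutoff that vanishes near the part of the boundary where \<open>\<bar>u\<bar>\<close> is large; integrating the resulting
  potential estimate over the level set, the growth condition on \<open>\<mu>\<close> yields the power \<open>(n - 1)/\<alpha>\<close>.
  Applied with both \<open>\<mu>\<close> and Lebesgue measure at levels where the distribution function halves, it bounds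
  the rearrangement of \<open>u\<close> on the dyadic grid \<open>\<tau>\<^sub>k = \<tau>\<^sub>0/2\<^sup>k\<close> by the boundary rearrangement plus a sum of averaged gradient
  terms. The three norm inequalities are then discrete weighted Hardy inequalities for sequences; in the limiting
  case \<open>p = n\<close> the grid is sampled at \<open>k = 2\<^sup>m - 1\<close>, where the logarithmic weight becomes geometric.\<close>

section \<open>Sequence norms\<close>

text \<open>Nothing is assumed about the shape of the boundary, so there is no trace or extension
  operator, and a test field must have compact support in \<Omega>. The finite Hausdorff measure
  pays for this: a cutoff at scale r has slope of order 1/r on a ball of volume of order r^n, so
  covering the compact set of boundary points with large \<bar>u\<bar> costs the sum of r^(n-1). The
  second obstacle is that the gradient is measured by Lebesgue measure and u by \<mu>: to bound the
  gradient integral over a superlevel set by a rearrangement, the Lebesgue measure of that same set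
  must be small. The recursion therefore runs on the larger of the Lebesgue measure and the power
  n/\<alpha> of the \<mu>-measure, for which both level inequalities have the exponent (n-1)/n; the
  first maximum in the subcritical estimate bounds its initial value. The boundary term carries the
  factor t - s just as the left side does and is absorbed at levels above a boundary rearrangement.
  The growth condition enters through the integral of a kernel of order 1-n against \<mu>, where
  \<alpha> > n-1 makes the dyadic series converge.\<close>

definition lseq :: "ereal \<Rightarrow> (nat \<Rightarrow> ennreal) \<Rightarrow> ennreal" where
  "lseq \<sigma> x = (if \<sigma> = \<infinity> then (SUP k. x k)
     else epowr (\<Sum>k. epowr (x k) (real_of_ereal \<sigma>)) (1 / real_of_ereal \<sigma>))"

section \<open>Powers of extended nonnegative reals and their convexity\<close>

lemma epowr_ennreal: "0 \<le> x \<Longrightarrow> epowr (ennreal x) a = ennreal (x powr a)"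
  by (simp add: epowr_def)

lemma epowr_top [simp]: "epowr top a = top"
  by (simp add: epowr_def)

lemma epowr_zero [simp]: "epowr 0 a = 0"
  by (simp add: epowr_def)

lemma epowr_one [simp]: "epowr x 1 = x"
  by (cases x) (auto simp: epowr_ennreal)

lemma epowr_mono: "0 \<le> a \<Longrightarrow> x \<le> y \<Longrightarrow> epowr x a \<le> epowr y a"
  by (cases x; cases y) (auto simp: epowr_ennreal intro!: ennreal_leI powr_mono2 simp: top_unique)

lemma epowr_epowr: "epowr (epowr x a) b = epowr x (a * b)"
  by (cases x) (auto simp: epowr_ennreal powr_powr)

lemma epowr_eq_0_iff [simp]: "epowr x a = 0 \<longleftrightarrow> x = 0"
  by (cases x) (auto simp: epowr_ennreal ennreal_eq_0_iff)

lemma epowr_eq_top_iff [simp]: "epowr x a = top \<longleftrightarrow> x = top"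
  by (cases x) (auto simp: epowr_ennreal)

lemma epowr_mult: "epowr (x * y) a = epowr x a * epowr y a"
proof (cases "x = top \<or> y = top")
  case True
  then show ?thesis
    by (cases "x = 0 \<or> y = 0") (auto simp: ennreal_mult_top ennreal_top_mult)
next
  case False
  then obtain x' y' where "x = ennreal x'" "0 \<le> x'" "y = ennreal y'" "0 \<le> y'"
    by (metis ennreal_cases)
  then show ?thesis by (simp add: epowr_ennreal flip: ennreal_mult) (simp add: powr_mult ennreal_mult epowr_ennreal)
qed

lemma epowr_add: "epowr x (a + b) = epowr x a * epowr x b"
  by (cases x) (auto simp: epowr_ennreal powr_add simp flip: ennreal_mult)

lemma epowr_inverse: "a \<noteq> 0 \<Longrightarrow> epowr (epowr x a) (1 / a) = x" "a \<noteq> 0 \<Longrightarrow> epowr (epowr x (1 / a)) a = x"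
  by (simp_all add: epowr_epowr)

text \<open>Convexity of \<open>powr\<close> is quoted on the positive reals, so a vanishing
  argument is treated apart, where \<open>c powr s \<le> c\<close> for \<open>c\<close> in the unit
  interval suffices.\<close>

lemma powr_convex_combination:
  fixes x y a s :: real
  assumes s: "1 \<le> s" and xy: "0 \<le> x" "0 \<le> y" and a: "0 \<le> a" "a \<le> 1"
  shows "(a * x + (1 - a) * y) powr s \<le> a * x powr s + (1 - a) * y powr s"
proof -
  have le: "(c * z) powr s \<le> c * z powr s" if "0 \<le> c" "c \<le> 1" "0 \<le> z" for c z :: real
  proof (cases "c = 0")
    case False
    then have "c powr s \<le> c powr 1" using that s by (intro powr_mono') auto
    then show ?thesis using that by (simp add: powr_mult mult_right_mono)
  qed simp
  show ?thesis
  proof (cases "x = 0 \<or> y = 0")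
    case True
    then show ?thesis using le[of a x] le[of "1 - a" y] a xy by auto
  next
    case False
    have "((1 - (1 - a)) *\<^sub>R x + (1 - a) *\<^sub>R y) powr s \<le> (1 - (1 - a)) * x powr s + (1 - a) * y powr s"
      by (rule convex_onD[OF powr_convex[OF s]]) (use False a xy in auto)
    then show ?thesis by simp
  qed
qed

text \<open>At \<open>a = 0\<close> and \<open>a = 1\<close> an infinite argument is harmless
  because \<open>0 * top = 0\<close>; strictly between, it makes the right side infinite.\<close>

lemma epowr_convex:
  assumes "1 \<le> s" "0 \<le> a" "a \<le> 1"
  shows "epowr (ennreal a * x + ennreal (1 - a) * y) s \<le> ennreal a * epowr x s + ennreal (1 - a) * epowr y s"
proof (cases "ennreal a * epowr x s + ennreal (1 - a) * epowr y s = top")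
  case False
  consider "a = 0" | "a = 1" | "x \<noteq> top" "y \<noteq> top" "0 < a" "a < 1"
    using False assms by (cases "a = 0"; cases "a = 1") (auto simp: ennreal_add_eq_top ennreal_mult_eq_top_iff)
  then show ?thesis
  proof cases
    case 3
    from 3(1,2) obtain x' y' where "x = ennreal x'" "0 \<le> x'" "y = ennreal y'" "0 \<le> y'"
      by (metis ennreal_cases)
    with 3 assms powr_convex_combination[of s x' y' a] show ?thesis
      by (auto simp: epowr_ennreal simp flip: ennreal_mult ennreal_plus)
  qed auto
next
  case True
  then show ?thesis by (metis top_greatest)
qed

lemma ereal_ge_1_cases:
  assumes "1 \<le> (\<sigma>::ereal)"
  obtains "\<sigma> = \<infinity>" | s where "\<sigma> = ereal s" "1 \<le> s"
  using assms by (cases \<sigma>) auto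

lemma lseq_inf: "lseq \<infinity> x = (SUP k. x k)"
  by (simp add: lseq_def)

lemma lseq_real: "lseq (ereal s) x = epowr (\<Sum>k. epowr (x k) s) (1 / s)"
  by (simp add: lseq_def)

section \<open>Order, homogeneity and embedding of sequence norms\<close>

lemma lseq_leI_real:
  assumes "1 \<le> s" "(\<Sum>k. epowr (x k) s) \<le> epowr B s"
  shows "lseq (ereal s) x \<le> B"
proof -
  have "lseq (ereal s) x \<le> epowr (epowr B s) (1 / s)"
    unfolding lseq_real by (rule epowr_mono) (use assms in auto)
  then show ?thesis using assms by (simp add: epowr_inverse)
qed

lemma lseq_power_real: "1 \<le> s \<Longrightarrow> epowr (lseq (ereal s) x) s = (\<Sum>k. epowr (x k) s)"
  by (simp add: lseq_real epowr_inverse)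

lemma lseq_mono:
  assumes "1 \<le> \<sigma>" "\<And>k. x k \<le> y k"
  shows "lseq \<sigma> x \<le> lseq \<sigma> y"
  using assms(1)
proof (cases rule: ereal_ge_1_cases)
  case 1
  then show ?thesis by (auto simp: lseq_inf intro!: SUP_mono assms)
next
  case (2 s)
  then show ?thesis
    by (auto simp: lseq_real intro!: epowr_mono suminf_le assms)
qed

lemma lseq_ge:
  assumes "1 \<le> \<sigma>" shows "x k \<le> lseq \<sigma> x"
  using assms
proof (cases rule: ereal_ge_1_cases)
  case 1
  then show ?thesis by (auto simp: lseq_inf intro!: SUP_upper)
next
  case (2 s)
  have "epowr (x k) s \<le> (\<Sum>k. epowr (x k) s)"
    using sum_le_suminf[of "\<lambda>k. epowr (x k) s" "{k}"] by auto
  then have "epowr (epowr (x k) s) (1 / s) \<le> lseq (ereal s) x"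
    unfolding lseq_real by (intro epowr_mono) (use 2 in auto)
  then show ?thesis using 2 by (simp add: epowr_inverse)
qed

lemma lseq_cmult:
  assumes "1 \<le> \<sigma>" shows "lseq \<sigma> (\<lambda>k. c * x k) = c * lseq \<sigma> x"
  using assms
proof (cases rule: ereal_ge_1_cases)
  case 1
  then show ?thesis by (auto simp: lseq_inf SUP_mult_left_ennreal)
next
  case (2 s)
  then show ?thesis
    by (auto simp: lseq_real epowr_mult epowr_inverse)
qed

text \<open>The factor 2 rewrites the sum as twice a midpoint, so that convexity of the power at
  weight 1/2 takes the place of Minkowski's inequality.\<close>

lemma lseq_add:
  assumes "1 \<le> \<sigma>" shows "lseq \<sigma> (\<lambda>k. x k + y k) \<le> 2 * (lseq \<sigma> x + lseq \<sigma> y)"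
  using assms
proof (cases rule: ereal_ge_1_cases)
  case 1
  have "x k + y k \<le> 2 * (lseq \<sigma> x + lseq \<sigma> y)" for k
    using add_mono[OF lseq_ge[OF assms, of x k] lseq_ge[OF assms, of y k]]
    by (metis add_increasing mult_2 zero_le order.trans)
  then show ?thesis using 1 by (auto simp: lseq_inf intro!: SUP_least)
next
  case (2 s)
  have "lseq (ereal s) (\<lambda>k. ennreal (1/2) * x k + ennreal (1 - 1/2) * y k) \<le> lseq (ereal s) x + lseq (ereal s) y"
  proof (rule lseq_leI_real[OF 2(2)])
    have "(\<Sum>k. epowr (ennreal (1/2) * x k + ennreal (1 - 1/2) * y k) s)
        \<le> (\<Sum>k. ennreal (1/2) * epowr (x k) s + ennreal (1 - 1/2) * epowr (y k) s)"
      by (intro suminf_le epowr_convex) (use 2 in auto)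
    also have "\<dots> = ennreal (1/2) * epowr (lseq (ereal s) x) s + ennreal (1 - 1/2) * epowr (lseq (ereal s) y) s"
      using 2 by (simp add: lseq_power_real flip: suminf_add ennreal_suminf_cmult)
    also have "\<dots> \<le> ennreal (1/2) * epowr (lseq (ereal s) x + lseq (ereal s) y) s + ennreal (1 - 1/2) * epowr (lseq (ereal s) x + lseq (ereal s) y) s"
      by (intro add_mono mult_left_mono epowr_mono) (use 2 in auto)
    also have "\<dots> = (ennreal (1/2) + ennreal (1 - 1/2)) * epowr (lseq (ereal s) x + lseq (ereal s) y) s"
      by (simp add: distrib_right)
    also have "ennreal (1/2) + ennreal (1 - 1/2) = 1"
      by (subst ennreal_plus[symmetric]) auto
    finally show "(\<Sum>k. epowr (ennreal (1/2) * x k + ennreal (1 - 1/2) * y k) s)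
      \<le> epowr (lseq (ereal s) x + lseq (ereal s) y) s" by simp
  qed
  moreover have "lseq \<sigma> (\<lambda>k. x k + y k) = 2 * lseq (ereal s) (\<lambda>k. ennreal (1/2) * x k + ennreal (1 - 1/2) * y k)"
  proof -
    have h: "2 * ennreal (1/2) = 1"
      by (metis ennreal_1 ennreal_mult' ennreal_numeral mult_2 one_add_one field_sum_of_halves zero_le_numeral)
    have "x k + y k = 2 * (ennreal (1/2) * x k + ennreal (1 - 1/2) * y k)" for k
      using h by (simp add: distrib_left flip: mult.assoc)
    then have "lseq \<sigma> (\<lambda>k. x k + y k) = lseq (ereal s) (\<lambda>k. 2 * (ennreal (1/2) * x k + ennreal (1 - 1/2) * y k))"
      using 2 by (simp only: )
    also have "\<dots> = 2 * lseq (ereal s) (\<lambda>k. ennreal (1/2) * x k + ennreal (1 - 1/2) * y k)"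
      by (rule lseq_cmult) (use 2 in simp)
    finally show ?thesis .
  qed
  ultimately have "lseq \<sigma> (\<lambda>k. x k + y k) \<le> 2 * (lseq (ereal s) x + lseq (ereal s) y)"
    by (simp only: mult_left_mono zero_le)
  then show ?thesis by (simp only: 2(1))
qed

text \<open>One factor \<open>epowr (x k) (h - s)\<close> is replaced by the power of the whole
  norm, which bounds every entry; the remaining \<open>s\<close>-th powers sum to that norm
  again.\<close>

lemma lseq_embed:
  assumes "1 \<le> \<sigma>" "\<sigma> \<le> \<eta>" shows "lseq \<eta> x \<le> lseq \<sigma> x"
proof (cases "\<eta> = \<infinity>")
  case True
  then show ?thesis by (auto simp: lseq_inf intro!: SUP_least lseq_ge assms)
next
  case False
  then obtain s h where sh: "\<sigma> = ereal s" "\<eta> = ereal h" "1 \<le> s" "s \<le> h"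
    using assms by (cases \<sigma>; cases \<eta>) auto
  let ?S = "lseq \<sigma> x"
  show ?thesis unfolding sh
  proof (rule lseq_leI_real)
    have "(\<Sum>k. epowr (x k) h) \<le> (\<Sum>k. epowr ?S (h - s) * epowr (x k) s)"
    proof (intro suminf_le)
      fix k
      have "epowr (x k) h = epowr (x k) (h - s) * epowr (x k) s"
        by (simp flip: epowr_add)
      also have "\<dots> \<le> epowr ?S (h - s) * epowr (x k) s"
        by (intro mult_right_mono epowr_mono lseq_ge) (use assms sh in auto)
      finally show "epowr (x k) h \<le> epowr ?S (h - s) * epowr (x k) s" .
    qed auto
    also have "\<dots> = epowr ?S (h - s) * epowr ?S s"
      using sh by (simp add: lseq_power_real)
    also have "\<dots> = epowr ?S h" by (simp flip: epowr_add)
    finally show "(\<Sum>k. epowr (x k) h) \<le> epowr (lseq (ereal s) x) h" using sh by simp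
  qed (use sh in auto)
qed

text \<open>Forward Hardy inequality: \<open>w\<close> is controlled by a geometric average of the
  earlier \<open>c\<close>. With \<open>z = c / (1 - \<theta>)\<close> the recursion becomes a
  convex combination of \<open>w k\<close> and \<open>z k\<close>, to which the convexity of
  \<open>epowr\<close> applies termwise; hence the constant does not depend on \<sigma>.\<close>

lemma lseq_recur:
  assumes \<sigma>: "1 \<le> \<sigma>" and \<theta>: "0 \<le> \<theta>" "\<theta> < 1"
    and w0: "w 0 = 0" and w: "\<And>k. w (Suc k) \<le> ennreal \<theta> * w k + c k"
  shows "lseq \<sigma> w \<le> ennreal (1 / (1 - \<theta>)) * lseq \<sigma> c"
proof -
  define z where "z k = ennreal (1 / (1 - \<theta>)) * c k" for k
  have c: "c k = ennreal (1 - \<theta>) * z k" for k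
    using \<theta> by (simp add: z_def flip: mult.assoc ennreal_mult)
  have "lseq \<sigma> w \<le> lseq \<sigma> z"
    using \<sigma>
  proof (cases rule: ereal_ge_1_cases)
    case 1
    have "w k \<le> lseq \<sigma> z" for k
    proof (induction k)
      case (Suc k)
      have "w (Suc k) \<le> ennreal \<theta> * w k + ennreal (1 - \<theta>) * z k" using w c by simp
      also have "\<dots> \<le> ennreal \<theta> * lseq \<sigma> z + ennreal (1 - \<theta>) * lseq \<sigma> z"
        by (intro add_mono mult_left_mono Suc lseq_ge \<sigma>) auto
      also have "\<dots> = (ennreal \<theta> + ennreal (1 - \<theta>)) * lseq \<sigma> z" by (simp add: distrib_right)
      also have "ennreal \<theta> + ennreal (1 - \<theta>) = 1" using \<theta> by (simp flip: ennreal_plus)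
      finally show ?case by simp
    qed (simp add: w0)
    then show ?thesis using 1 by (auto simp: lseq_inf intro: SUP_least)
  next
    case (2 s)
    let ?r = "ennreal (\<theta> / (1 - \<theta>))" let ?R = "ennreal (1 / (1 - \<theta>))"
    have rR: "1 + ?r = ?R" "?R * ennreal \<theta> = ?r" "?R * ennreal (1 - \<theta>) = 1"
      using \<theta> by (auto simp: field_simps simp flip: ennreal_1 ennreal_plus ennreal_mult)
    \<comment> \<open>The surplus \<open>?r * epowr (w N) s\<close> carries the next step:
      \<open>?R = 1 + ?r\<close> copies of the new term use up exactly \<open>?r\<close> copies of
      the old one, by the identities \<open>rR\<close>.\<close>
    have fin: "(\<Sum>k\<le>N. epowr (w k) s) + ?r * epowr (w N) s \<le> (\<Sum>k<N. epowr (z k) s)" for N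
    proof (induction N)
      case (Suc N)
      have "epowr (w (Suc N)) s \<le> epowr (ennreal \<theta> * w N + ennreal (1 - \<theta>) * z N) s"
        by (intro epowr_mono) (use 2 w c in auto)
      also have "\<dots> \<le> ennreal \<theta> * epowr (w N) s + ennreal (1 - \<theta>) * epowr (z N) s"
        by (intro epowr_convex) (use 2 \<theta> in auto)
      finally have a: "epowr (w (Suc N)) s \<le> ennreal \<theta> * epowr (w N) s + ennreal (1 - \<theta>) * epowr (z N) s" .
      have "epowr (w (Suc N)) s + ?r * epowr (w (Suc N)) s = ?R * epowr (w (Suc N)) s"
        by (simp add: distrib_right flip: rR(1))
      also have "\<dots> \<le> ?R * (ennreal \<theta> * epowr (w N) s + ennreal (1 - \<theta>) * epowr (z N) s)"
        by (intro mult_left_mono a) auto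
      also have "\<dots> = ?r * epowr (w N) s + epowr (z N) s"
        using rR(2,3) by (simp add: distrib_left flip: mult.assoc)
      finally have "(\<Sum>k\<le>Suc N. epowr (w k) s) + ?r * epowr (w (Suc N)) s
        \<le> (\<Sum>k\<le>N. epowr (w k) s) + (?r * epowr (w N) s + epowr (z N) s)"
        by (simp add: add.assoc add_left_mono)
      also have "\<dots> \<le> (\<Sum>k<N. epowr (z k) s) + epowr (z N) s"
        using add_right_mono[OF Suc] by (simp add: add.assoc)
      finally show ?case by simp
    qed (simp add: w0)
    have "(\<Sum>k<N. epowr (w k) s) \<le> (\<Sum>k. epowr (z k) s)" for N
    proof -
      have "(\<Sum>k<N. epowr (w k) s) \<le> (\<Sum>k\<le>N. epowr (w k) s)"
        by (intro sum_mono2) auto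
      also have "\<dots> \<le> (\<Sum>k<N. epowr (z k) s)" using fin[of N] by (metis le_iff_add order.trans)
      also have "\<dots> \<le> (\<Sum>k. epowr (z k) s)" by (intro sum_le_suminf) auto
      finally show ?thesis .
    qed
    then have "(\<Sum>k. epowr (w k) s) \<le> (\<Sum>k. epowr (z k) s)"
      by (intro suminf_le_const) auto
    then show ?thesis using 2 by (auto simp: lseq_real intro!: epowr_mono)
  qed
  also have "lseq \<sigma> z = ennreal (1 / (1 - \<theta>)) * lseq \<sigma> c"
    unfolding z_def by (rule lseq_cmult[OF \<sigma>])
  finally show ?thesis .
qed

text \<open>Subtracting the multiple of \<open>S\<close> is legitimate only for finite
  \<open>S\<close>; an infinite \<open>Z\<close> is trivial.\<close>

lemma ennreal_absorb:
  assumes "S \<le> ennreal \<theta> * S + ennreal (1 - \<theta>) * Z" "S \<noteq> top" "0 \<le> \<theta>" "\<theta> < 1"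
  shows "S \<le> Z"
proof (cases "Z = top")
  case False
  obtain s z where sz: "S = ennreal s" "0 \<le> s" "Z = ennreal z" "0 \<le> z"
    using assms(2) False by (metis ennreal_cases)
  have "s \<le> \<theta> * s + (1 - \<theta>) * z"
    using assms sz by (simp flip: ennreal_mult ennreal_plus)
  then have "(1 - \<theta>) * s \<le> (1 - \<theta>) * z" by (simp add: algebra_simps)
  then show ?thesis using sz assms by (simp add: mult_le_cancel_left)
qed simp

text \<open>Backward counterpart of \<open>lseq_recur\<close>, for geometric tails. The recursion
  \<open>e k = a k + \<theta> * e (Suc k)\<close> has no initial value to start from, so absorbing
  \<open>e\<close> into the left side requires its summability beforehand.\<close>

lemma lseq_recur_back:
  assumes \<sigma>: "1 \<le> \<sigma>" and \<theta>: "0 \<le> \<theta>" "\<theta> < 1"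
    and e: "\<And>k. e k = (\<Sum>j. ennreal (\<theta> ^ j) * a (k + j))"
  shows "lseq \<sigma> e \<le> ennreal (1 / (1 - \<theta>)) * lseq \<sigma> a"
proof -
  define z where "z k = ennreal (1 / (1 - \<theta>)) * a k" for k
  have a: "a k = ennreal (1 - \<theta>) * z k" for k
    using \<theta> by (simp add: z_def flip: mult.assoc ennreal_mult)
  have lz: "lseq \<sigma> z = ennreal (1 / (1 - \<theta>)) * lseq \<sigma> a"
    unfolding z_def by (rule lseq_cmult[OF \<sigma>])
  have geo: "(\<Sum>j. ennreal (\<theta> ^ j)) = ennreal (1 / (1 - \<theta>))"
    using \<theta> by (subst suminf_ennreal2) (auto simp: suminf_geometric summable_geometric)
  have sup: "e k \<le> lseq \<sigma> z" for k
  proof -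
    have "e k \<le> (\<Sum>j. ennreal (\<theta> ^ j) * lseq \<sigma> a)"
      unfolding e by (intro suminf_le mult_left_mono lseq_ge \<sigma>) auto
    then show ?thesis using lz geo by simp
  qed
  have rec: "e k = a k + ennreal \<theta> * e (Suc k)" for k
  proof -
    have "e k = ennreal (\<theta> ^ 0) * a (k + 0) + (\<Sum>j. ennreal (\<theta> ^ Suc j) * a (k + Suc j))"
      unfolding e by (subst suminf_offset[where i=1]) (auto simp: add.commute)
    also have "(\<Sum>j. ennreal (\<theta> ^ Suc j) * a (k + Suc j)) = ennreal \<theta> * e (Suc k)"
      unfolding e using \<theta> by (simp add: ennreal_mult mult.assoc flip: ennreal_suminf_cmult)
    finally show ?thesis by simp
  qed
  have "lseq \<sigma> e \<le> lseq \<sigma> z"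
    using \<sigma>
  proof (cases rule: ereal_ge_1_cases)
    case 1
    then show ?thesis using sup by (auto simp: lseq_inf intro: SUP_least)
  next
    case (2 s)
    show ?thesis
    proof (cases "lseq \<sigma> z = top")
      case False
      let ?E = "\<lambda>k. epowr (e k) s" and ?Z = "\<Sum>k. epowr (z k) s"
      have Zfin: "?Z \<noteq> top" using False 2 by (auto simp: lseq_real)
      have step: "?E k \<le> ennreal \<theta> * ?E (Suc k) + ennreal (1 - \<theta>) * epowr (z k) s" for k
        using epowr_convex[of s \<theta> "e (Suc k)" "z k"] 2 \<theta> by (simp add: rec[of k] a add.commute)
      have Efin: "?E k \<le> epowr (lseq \<sigma> z) s" for k
        by (intro epowr_mono sup) (use 2 in auto)
      \<comment> \<open>A crude bound for the partial sums: the index shift brings in one more term,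
        which is at most \<open>epowr (lseq \<sigma> z) s\<close> by \<open>sup\<close>. It serves
        to make the full sum finite, after which the absorption is repeated without that
        loss.\<close>
      have part: "(\<Sum>k<N. ?E k) \<le> ennreal (1 / (1 - \<theta>)) * epowr (lseq \<sigma> z) s + ?Z" for N
      proof (rule ennreal_absorb[OF _ _ \<theta>])
        let ?P = "epowr (lseq \<sigma> z) s"
        have "(\<Sum>k<N. ?E k) \<le> (\<Sum>k<N. ennreal \<theta> * ?E (Suc k) + ennreal (1 - \<theta>) * epowr (z k) s)"
          by (intro sum_mono step)
        also have "\<dots> = ennreal \<theta> * (\<Sum>k<N. ?E (Suc k)) + ennreal (1 - \<theta>) * (\<Sum>k<N. epowr (z k) s)"
          by (simp add: sum.distrib sum_distrib_left)
        also have "\<dots> \<le> ennreal \<theta> * ((\<Sum>k<N. ?E k) + ?P) + ennreal (1 - \<theta>) * ?Z"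
        proof (intro add_mono mult_left_mono)
          have "(\<Sum>k<N. ?E (Suc k)) \<le> (\<Sum>k<Suc N. ?E k)"
            by (subst sum.lessThan_Suc_shift) auto
          also have "\<dots> \<le> (\<Sum>k<N. ?E k) + ?P" using Efin by (simp add: add_left_mono)
          finally show "(\<Sum>k<N. ?E (Suc k)) \<le> (\<Sum>k<N. ?E k) + ?P" .
        qed (auto intro: sum_le_suminf)
        also have "\<dots> = ennreal \<theta> * (\<Sum>k<N. ?E k) + (ennreal \<theta> * ?P + ennreal (1 - \<theta>) * ?Z)"
          by (simp add: distrib_left add.assoc)
        also have "\<dots> \<le> ennreal \<theta> * (\<Sum>k<N. ?E k) + (1 * ?P + ennreal (1 - \<theta>) * ?Z)"
          by (intro add_mono mult_right_mono order_refl) (use \<theta> in auto)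
        also have "1 * ?P = ennreal (1 - \<theta>) * (ennreal (1 / (1 - \<theta>)) * ?P)"
          using \<theta> by (simp flip: mult.assoc ennreal_mult)
        finally show "(\<Sum>k<N. ?E k) \<le> ennreal \<theta> * (\<Sum>k<N. ?E k)
            + ennreal (1 - \<theta>) * (ennreal (1 / (1 - \<theta>)) * ?P + ?Z)"
          by (simp add: distrib_left)
        show "(\<Sum>k<N. ?E k) \<noteq> top"
          using sup False by (auto simp: less_top[symmetric] top_unique) (metis sup top_unique)
      qed
      have "(\<Sum>k. ?E k) \<le> ennreal (1 / (1 - \<theta>)) * epowr (lseq \<sigma> z) s + ?Z"
        by (intro suminf_le_const part) auto
      moreover have "ennreal (1 / (1 - \<theta>)) * epowr (lseq \<sigma> z) s + ?Z \<noteq> top"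
        using Zfin False by (auto simp: ennreal_mult_eq_top_iff)
      ultimately have S: "(\<Sum>k. ?E k) \<noteq> top" by (metis top_unique)
      have "(\<Sum>k. ?E k) \<le> ?Z"
      proof (rule ennreal_absorb[OF _ S \<theta>])
        have "(\<Sum>k. ?E k) \<le> (\<Sum>k. ennreal \<theta> * ?E (Suc k) + ennreal (1 - \<theta>) * epowr (z k) s)"
          by (intro suminf_le step) auto
        also have "\<dots> = ennreal \<theta> * (\<Sum>k. ?E (Suc k)) + ennreal (1 - \<theta>) * ?Z"
          by (simp flip: suminf_add)
        also have "(\<Sum>k. ?E (Suc k)) \<le> (\<Sum>k. ?E k)"
        proof (rule suminf_le_const)
          fix N
          have "(\<Sum>k<N. ?E (Suc k)) \<le> (\<Sum>k<Suc N. ?E k)"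
            by (subst sum.lessThan_Suc_shift) auto
          also have "\<dots> \<le> (\<Sum>k. ?E k)" by (intro sum_le_suminf) auto
          finally show "(\<Sum>k<N. ?E (Suc k)) \<le> (\<Sum>k. ?E k)" .
        qed auto
        finally show "(\<Sum>k. ?E k) \<le> ennreal \<theta> * (\<Sum>k. ?E k) + ennreal (1 - \<theta>) * ?Z"
          by (simp add: add_mono mult_left_mono)
      qed
      then show ?thesis using 2 by (auto simp: lseq_real intro!: epowr_mono)
    qed simp
  qed
  then show ?thesis using lz by simp
qed

abbreviation hdiam :: "real \<Rightarrow> 'a::metric_space set \<Rightarrow> ennreal" where
  "hdiam s C \<equiv> ennreal (pi powr (s/2) / Gamma (s/2 + 1) * (diameter C / 2) powr s)"

section \<open>Hausdorff measure\<close>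

lemma hausdorff_pre_le:
  assumes "A \<subseteq> (\<Union>i. C i)" "\<And>i. bounded (C i)" "\<And>i. diameter (C i) \<le> \<delta>"
  shows "hausdorff_pre s \<delta> A \<le> (\<Sum>i. hdiam s (C i))"
  unfolding hausdorff_pre_def by (rule Inf_lower) (use assms in blast)

lemma hausdorff_pre_obtain:
  assumes "hausdorff_pre s \<delta> A < h"
  obtains C where "A \<subseteq> (\<Union>i::nat. C i)" "\<And>i. bounded (C i)" "\<And>i. diameter (C i) \<le> \<delta>"
    "(\<Sum>i. hdiam s (C i)) < h"
  using assms unfolding hausdorff_pre_def Inf_less_iff by blast

lemma hausdorff_pre_greatest:
  assumes "\<And>C. A \<subseteq> (\<Union>i::nat. C i) \<Longrightarrow> (\<And>i. bounded (C i)) \<Longrightarrow> (\<And>i. diameter (C i) \<le> \<delta>) \<Longrightarrow>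
    h \<le> (\<Sum>i. hdiam s (C i))"
  shows "h \<le> hausdorff_pre s \<delta> A"
  unfolding hausdorff_pre_def by (rule Inf_greatest) (use assms in blast)

lemma hausdorff_pre_mono: "A \<subseteq> B \<Longrightarrow> hausdorff_pre s \<delta> A \<le> hausdorff_pre s \<delta> B"
  by (intro hausdorff_pre_greatest hausdorff_pre_le) auto

lemma hausdorff_pre_antimono: "\<delta> \<le> \<delta>' \<Longrightarrow> hausdorff_pre s \<delta>' A \<le> hausdorff_pre s \<delta> A"
  by (intro hausdorff_pre_greatest hausdorff_pre_le) (auto intro: order.trans)

lemma hausdorff_mono: "A \<subseteq> B \<Longrightarrow> hausdorff s A \<le> hausdorff s B"
  unfolding hausdorff_def by (auto intro!: SUP_mono' hausdorff_pre_mono)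

lemma hausdorff_pre_le_hausdorff: "0 < \<delta> \<Longrightarrow> hausdorff_pre s \<delta> A \<le> hausdorff s A"
  unfolding hausdorff_def by (auto intro!: SUP_upper)

lemma hausdorff_empty: "hausdorff s ({}::'a::metric_space set) = 0"
proof -
  have "hausdorff_pre s \<delta> ({}::'a set) \<le> (\<Sum>i::nat. hdiam s ({}::'a set))" if "0 < \<delta>" for \<delta>
    by (rule hausdorff_pre_le) (use that in auto)
  then show ?thesis
    unfolding hausdorff_def by (auto intro!: SUP_least antisym)
qed

lemma hausdorff_pre_UN:
  "hausdorff_pre s \<delta> (\<Union>i::nat. A i) \<le> (\<Sum>i. hausdorff_pre s \<delta> (A i))"
proof (cases "(\<Sum>i. hausdorff_pre s \<delta> (A i)) = top")
  case False
  have fin: "hausdorff_pre s \<delta> (A i) < top" for i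
    using False sum_le_suminf[of "\<lambda>i. hausdorff_pre s \<delta> (A i)" "{i}"] by (auto simp: less_top[symmetric] top_unique)
  show ?thesis
  proof (rule ennreal_le_epsilon)
    fix e :: real assume e: "0 < e"
    have "\<exists>C. A i \<subseteq> (\<Union>j::nat. C j) \<and> (\<forall>j. bounded (C j)) \<and> (\<forall>j. diameter (C j) \<le> \<delta>) \<and>
      (\<Sum>j. hdiam s (C j)) < hausdorff_pre s \<delta> (A i) + ennreal (e * (1/2) ^ Suc i)" for i
    proof -
      have "hausdorff_pre s \<delta> (A i) < hausdorff_pre s \<delta> (A i) + ennreal (e * (1/2) ^ Suc i)"
        using fin[of i] e by (cases "hausdorff_pre s \<delta> (A i)") (auto simp flip: ennreal_plus simp: ennreal_less_iff)
      then show ?thesis by (rule hausdorff_pre_obtain) blast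
    qed
    then obtain C where C: "\<And>i. A i \<subseteq> (\<Union>j::nat. C i j)" "\<And>i j. bounded (C i j)" "\<And>i j. diameter (C i j) \<le> \<delta>"
      "\<And>i. (\<Sum>j. hdiam s (C i j)) < hausdorff_pre s \<delta> (A i) + ennreal (e * (1/2) ^ Suc i)"
      by metis
    have "hausdorff_pre s \<delta> (\<Union>i. A i) \<le> (\<Sum>k. hdiam s (case_prod C (prod_decode k)))"
    proof (rule hausdorff_pre_le)
      show "(\<Union>i. A i) \<subseteq> (\<Union>k. case_prod C (prod_decode k))"
      proof
        fix x assume "x \<in> (\<Union>i. A i)"
        then obtain i j where "x \<in> C i j" using C(1) by blast
        then show "x \<in> (\<Union>k. case_prod C (prod_decode k))"
          by (intro UN_I[of "prod_encode (i, j)"]) auto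
      qed
    qed (auto split: prod.split simp: C)
    also have "\<dots> = (\<Sum>i. \<Sum>j. hdiam s (C i j))"
      by (subst suminf_ennreal_2dimen[where f="\<lambda>p. hdiam s (case_prod C p)", symmetric]) auto
    also have "\<dots> \<le> (\<Sum>i. hausdorff_pre s \<delta> (A i) + ennreal (e * (1/2) ^ Suc i))"
      by (intro suminf_le less_imp_le C) auto
    also have "\<dots> = (\<Sum>i. hausdorff_pre s \<delta> (A i)) + (\<Sum>i. ennreal (e * (1/2) ^ Suc i))"
      by (rule suminf_add[symmetric]) auto
    also have "(\<Sum>i. ennreal (e * (1/2) ^ Suc i)) = ennreal e"
      using e sums_mult[OF power_half_series, of e] by (intro suminf_ennreal_eq) auto
    finally show "hausdorff_pre s \<delta> (\<Union>i. A i) \<le> (\<Sum>i. hausdorff_pre s \<delta> (A i)) + ennreal e" .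
  qed
qed simp

lemma hausdorff_UN:
  "hausdorff s (\<Union>i::nat. A i) \<le> (\<Sum>i. hausdorff s (A i))"
proof -
  have "hausdorff_pre s \<delta> (\<Union>i. A i) \<le> (\<Sum>i. hausdorff s (A i))" if "0 < \<delta>" for \<delta>
    by (rule order.trans[OF hausdorff_pre_UN]) (auto intro!: suminf_le hausdorff_pre_le_hausdorff that)
  then show ?thesis by (subst hausdorff_def) (auto intro: SUP_least)
qed

lemma hausdorff_Un: "hausdorff s (A \<union> B) \<le> hausdorff s A + hausdorff s B"
proof -
  have "hausdorff s (\<Union>i. binaryset A B i) \<le> (\<Sum>i. hausdorff s (binaryset A B i))"
    by (rule hausdorff_UN)
  also have "\<dots> = hausdorff s A + hausdorff s B"
    using suminf_binaryset_eq[of "hausdorff s" A B] by (simp add: hausdorff_empty)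
  finally show ?thesis by (simp add: UN_binaryset_eq)
qed

text \<open>Restricts the supremum to a sequence of shrinking scales; along a monotone sequence the
  supremum of a sum is the sum of the suprema, as additivity on separated sets requires.\<close>

lemma hausdorff_eq_SUP:
  assumes "0 < d"
  shows "hausdorff s A = (SUP n::nat. hausdorff_pre s (d / (n + 1)) A)"
proof (rule antisym)
  show "hausdorff s A \<le> (SUP n::nat. hausdorff_pre s (d / (n + 1)) A)"
    unfolding hausdorff_def
  proof (rule SUP_least)
    fix \<delta> :: real assume "\<delta> \<in> {0<..}"
    then obtain n :: nat where "d / \<delta> < n" using reals_Archimedean2 by blast
    then have "d / (n + 1) \<le> \<delta>" using assms \<open>\<delta> \<in> _\<close>
      by (simp add: field_simps)
    then show "hausdorff_pre s \<delta> A \<le> (SUP n::nat. hausdorff_pre s (d / (n + 1)) A)"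
      by (intro SUP_upper2[of n] hausdorff_pre_antimono) (auto simp: add.commute)
  qed
  show "(SUP n::nat. hausdorff_pre s (d / (n + 1)) A) \<le> hausdorff s A"
    by (intro SUP_least hausdorff_pre_le_hausdorff) (use assms in auto)
qed

text \<open>A covering set of diameter below \<open>d\<close> cannot meet both \<open>A\<close> and
  \<open>B\<close>, so every fine cover of the union splits into covers of the two sets.\<close>

lemma hausdorff_metric_Un:
  assumes d: "0 < d" "\<And>x y. x \<in> A \<Longrightarrow> y \<in> B \<Longrightarrow> d \<le> dist x y"
  shows "hausdorff s A + hausdorff s B \<le> hausdorff s (A \<union> B)"
proof -
  have *: "hausdorff_pre s \<delta> A + hausdorff_pre s \<delta> B \<le> hausdorff s (A \<union> B)" if "0 < \<delta>" "\<delta> < d" for \<delta>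
  proof -
    have "hausdorff_pre s \<delta> A + hausdorff_pre s \<delta> B \<le> hausdorff_pre s \<delta> (A \<union> B)"
    proof (rule hausdorff_pre_greatest)
      fix C :: "nat \<Rightarrow> 'a set"
      assume C: "A \<union> B \<subseteq> (\<Union>i. C i)" "\<And>i. bounded (C i)" "\<And>i. diameter (C i) \<le> \<delta>"
      let ?CA = "\<lambda>i. if C i \<inter> A \<noteq> {} then C i else {}"
      let ?CB = "\<lambda>i. if C i \<inter> B \<noteq> {} then C i else {}"
      have "hausdorff_pre s \<delta> A \<le> (\<Sum>i. hdiam s (?CA i))"
        by (rule hausdorff_pre_le) (use C that in \<open>force+\<close>)
      moreover have "hausdorff_pre s \<delta> B \<le> (\<Sum>i. hdiam s (?CB i))"
        by (rule hausdorff_pre_le) (use C that in \<open>force+\<close>)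
      ultimately have "hausdorff_pre s \<delta> A + hausdorff_pre s \<delta> B \<le> (\<Sum>i. hdiam s (?CA i) + hdiam s (?CB i))"
        by (subst suminf_add[symmetric]) (auto intro: add_mono)
      also have "\<dots> \<le> (\<Sum>i. hdiam s (C i))"
      proof (intro suminf_le)
        fix i
        have "\<not> (C i \<inter> A \<noteq> {} \<and> C i \<inter> B \<noteq> {})"
        proof
          assume "C i \<inter> A \<noteq> {} \<and> C i \<inter> B \<noteq> {}"
          then obtain x y where "x \<in> C i" "x \<in> A" "y \<in> C i" "y \<in> B" by blast
          then show False
            using d(2)[of x y] diameter_bounded_bound[OF C(2), of x i y] C(3)[of i] that by simp
        qed
        then show "hdiam s (?CA i) + hdiam s (?CB i) \<le> hdiam s (C i)" by auto
      qed auto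
      finally show "hausdorff_pre s \<delta> A + hausdorff_pre s \<delta> B \<le> (\<Sum>i. hdiam s (C i))" .
    qed
    also have "\<dots> \<le> hausdorff s (A \<union> B)" using that by (rule_tac hausdorff_pre_le_hausdorff)
    finally show ?thesis .
  qed
  have inc: "incseq (\<lambda>n::nat. hausdorff_pre s (d / 2 / (n + 1)) X)" for X :: "'a set"
    using d by (auto simp: incseq_def frac_le intro!: hausdorff_pre_antimono)
  have "hausdorff s A + hausdorff s B =
    (SUP n::nat. hausdorff_pre s (d / 2 / (n + 1)) A + hausdorff_pre s (d / 2 / (n + 1)) B)"
    unfolding ennreal_SUP_add[OF inc inc] using d by (subst (1 2) hausdorff_eq_SUP[of "d/2"]) auto
  also have "\<dots> \<le> hausdorff s (A \<union> B)"
  proof (intro SUP_least *)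
    fix n :: nat
    show "0 < d / 2 / (real n + 1)" using d by simp
    have "d / 2 / (real n + 1) \<le> d / 2 / 1" using d by (intro divide_left_mono) auto
    then show "d / 2 / (real n + 1) < d" using d by linarith
  qed
  finally show ?thesis .
qed

text \<open>The gap \<open>d k\<close> may shrink with \<open>k\<close>: the sets are split off one
  at a time from the front, and each split uses the gap between one set and all later ones.\<close>

lemma hausdorff_sum_separated:
  assumes d: "\<And>k::nat. 0 < d k" "\<And>k l x y. k < l \<Longrightarrow> x \<in> R k \<Longrightarrow> y \<in> R l \<Longrightarrow> d k \<le> dist x y"
    and R: "\<And>k. R k \<subseteq> X"
  shows "(\<Sum>k. hausdorff s (R k)) \<le> hausdorff s X"
proof (rule suminf_le_const)
  fix N
  have "(\<Sum>k<N. hausdorff s (R (m + k))) \<le> hausdorff s (\<Union>k<N. R (m + k))" for m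
  proof (induction N arbitrary: m)
    case (Suc N)
    have "(\<Sum>k<Suc N. hausdorff s (R (m + k))) = hausdorff s (R m) + (\<Sum>k<N. hausdorff s (R (Suc m + k)))"
      by (subst sum.lessThan_Suc_shift) simp
    also have "\<dots> \<le> hausdorff s (R m) + hausdorff s (\<Union>k<N. R (Suc m + k))"
      by (intro add_left_mono Suc)
    also have "\<dots> \<le> hausdorff s (R m \<union> (\<Union>k<N. R (Suc m + k)))"
    proof (rule hausdorff_metric_Un[OF d(1)[of m]])
      fix x y assume "x \<in> R m" "y \<in> (\<Union>k<N. R (Suc m + k))"
      then obtain k where "y \<in> R (Suc m + k)" by blast
      then show "d m \<le> dist x y" using d(2)[of m "Suc m + k" x y] \<open>x \<in> R m\<close> by simp
    qed
    also have "\<dots> \<le> hausdorff s (\<Union>k<Suc N. R (m + k))"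
    proof (rule hausdorff_mono)
      show "R m \<union> (\<Union>k<N. R (Suc m + k)) \<subseteq> (\<Union>k<Suc N. R (m + k))"
      proof
        fix x assume "x \<in> R m \<union> (\<Union>k<N. R (Suc m + k))"
        then consider "x \<in> R (m + 0)" | k where "k < N" "x \<in> R (m + Suc k)" by auto
        then show "x \<in> (\<Union>k<Suc N. R (m + k))" by cases blast+
      qed
    qed
    finally show ?case .
  qed (simp add: hausdorff_empty)
  from this[of 0] show "(\<Sum>k<N. hausdorff s (R k)) \<le> hausdorff s X"
    using hausdorff_mono[of "\<Union>k<N. R (0 + k)" X s] R by (auto simp: UN_subset_iff intro: order.trans)
qed auto

lemma ennreal_suminf_tail:
  fixes f :: "nat \<Rightarrow> ennreal"
  assumes "(\<Sum>k. f k) \<noteq> top"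
  shows "(\<lambda>n. \<Sum>k. f (k + n)) \<longlonglongrightarrow> 0"
proof -
  have top: "f k \<noteq> top" for k
    using assms sum_le_suminf[of f "{k}"] by (auto simp: top_unique)
  define r where "r k = enn2real (f k)" for k
  have f: "f k = ennreal (r k)" "0 \<le> r k" for k
    using top by (auto simp: r_def less_top)
  have "summable r" by (rule summable_suminf_not_top) (use assms f in auto)
  then have "(\<lambda>n. ennreal (\<Sum>k. r (k + n))) \<longlonglongrightarrow> ennreal 0"
    by (intro tendsto_ennrealI suminf_exist_split2)
  moreover have "ennreal (\<Sum>k. r (k + n)) = (\<Sum>k. f (k + n))" for n
    using \<open>summable r\<close> f by (simp add: suminf_ennreal2 summable_ignore_initial_segment)
  ultimately show ?thesis by simp
qed

text \<open>Caratheodory's criterion for a metric outer measure. The part of \<open>X\<close>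
  outside \<open>F\<close> is exhausted by the sets \<open>Y n\<close>, each at positive distance
  from \<open>F\<close>; what is left lies in thin shells \<open>R k\<close>, whose measures turn
  out to be summable.\<close>

lemma hausdorff_closed_split:
  fixes F X :: "'a::metric_space set"
  assumes F: "closed F" "F \<noteq> {}"
  shows "hausdorff s (X \<inter> F) + hausdorff s (X - F) \<le> hausdorff s X"
proof (cases "hausdorff s X = top")
  case False
  define Y where "Y n = {x \<in> X. 1 / (real n + 1) \<le> infdist x F}" for n :: nat
  define R where "R k = {x \<in> X. 1 / (real k + 2) \<le> infdist x F \<and> infdist x F < 1 / (real k + 1)}" for k :: nat
  have dist_R: "1 / (real k + 2) - 1 / (real l + 1) \<le> dist x y" if "x \<in> R k" "y \<in> R l" for k l x y
    using that infdist_triangle[of x F y] by (auto simp: R_def)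
  \<comment> \<open>Neighbouring shells touch, but shells of equal parity are separated by the shell
    between them. Odd and even shells are therefore summed separately.\<close>
  have even: "(\<Sum>k. hausdorff s (R (2 * k + e))) \<le> hausdorff s X" for e
  proof (rule hausdorff_sum_separated)
    fix k l x y assume kl: "k < (l::nat)" "x \<in> R (2 * k + e)" "y \<in> R (2 * l + e)"
    have "1 / (real (2 * k + e) + 2) - 1 / (real (2 * k + e) + 3) \<le> 1 / (real (2 * k + e) + 2) - 1 / (real (2 * l + e) + 1)"
      using kl(1) by (intro diff_left_mono divide_left_mono) auto
    also have "\<dots> \<le> dist x y" by (rule dist_R[OF kl(2,3)])
    finally show "1 / (real (2 * k + e) + 2) - 1 / (real (2 * k + e) + 3) \<le> dist x y" .
  next
    show "0 < 1 / (real (2 * k + e) + 2) - 1 / (real (2 * k + e) + 3)" for k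
      by (simp add: divide_strict_left_mono)
    show "R (2 * k + e) \<subseteq> X" for k by (auto simp: R_def)
  qed
  have fin: "(\<Sum>k. hausdorff s (R k)) \<noteq> top"
  proof -
    have "(\<Sum>k<2*N. hausdorff s (R k)) \<le> hausdorff s X + hausdorff s X" for N
    proof -
      have "(\<Sum>k<2*N. f k) = (\<Sum>k<N. f (2*k)) + (\<Sum>k<N. f (2*k+1))" for f :: "nat \<Rightarrow> ennreal"
        by (induction N) (auto simp: ac_simps)
      then have "(\<Sum>k<2*N. hausdorff s (R k)) = (\<Sum>k<N. hausdorff s (R (2*k+0))) + (\<Sum>k<N. hausdorff s (R (2*k+1)))"
        by simp
      also have "\<dots> \<le> hausdorff s X + hausdorff s X"
        by (intro add_mono; rule order.trans[OF sum_le_suminf even]) auto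
      finally show ?thesis .
    qed
    moreover have "(\<Sum>k<N. hausdorff s (R k)) \<le> (\<Sum>k<2*N. hausdorff s (R k))" for N
      by (intro sum_mono2) auto
    ultimately have "(\<Sum>k<N. hausdorff s (R k)) \<le> hausdorff s X + hausdorff s X" for N
      by (meson order.trans)
    then have "(\<Sum>k. hausdorff s (R k)) \<le> hausdorff s X + hausdorff s X"
      by (intro suminf_le_const) auto
    then show ?thesis using False by (auto simp: top_unique)
  qed
  \<comment> \<open>\<open>X \<inter> F\<close> and \<open>Y n\<close> are separated, so they add
    up; the error is the tail of the shell sum, which vanishes as \<open>n\<close> grows.\<close>
  have main: "hausdorff s (X \<inter> F) + hausdorff s (X - F) \<le> hausdorff s X + (\<Sum>k. hausdorff s (R (k + n)))" for n
  proof -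
    have "X - F \<subseteq> Y n \<union> (\<Union>k. R (k + n))"
    proof
      fix x assume x: "x \<in> X - F"
      then have pos: "0 < infdist x F"
        using F in_closed_iff_infdist_zero[of F x] infdist_nonneg[of x F] by (auto simp: less_le)
      show "x \<in> Y n \<union> (\<Union>k. R (k + n))"
      proof (cases "1 / (real n + 1) \<le> infdist x F")
        case False
        define m where "m = (LEAST m::nat. 1 / (real m + 1) \<le> infdist x F)"
        obtain m0 :: nat where "1 / infdist x F < m0" using reals_Archimedean2 by blast
        then have "1 / (real m0 + 1) \<le> infdist x F" using pos by (auto simp: field_simps)
        then have m: "1 / (real m + 1) \<le> infdist x F" unfolding m_def by (rule LeastI)
        have "n < m"
        proof (rule ccontr)
          assume "\<not> n < m"
          then have "1 / (real n + 1) \<le> 1 / (real m + 1)" by (auto simp: field_simps)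
          then show False using m False by linarith
        qed
        have "\<not> 1 / (real (m - 1) + 1) \<le> infdist x F"
          unfolding m_def by (rule not_less_Least) (use \<open>n < m\<close> in \<open>simp add: m_def[symmetric]\<close>)
        moreover have "real (m - 1) = real m - 1" using \<open>n < m\<close> by simp
        ultimately have "x \<in> R (m - 1)" using m x by (auto simp: R_def algebra_simps)
        then show ?thesis using \<open>n < m\<close> by (auto intro!: exI[of _ "m - 1 - n"])
      qed (use x in \<open>auto simp: Y_def\<close>)
    qed
    then have "hausdorff s (X - F) \<le> hausdorff s (Y n \<union> (\<Union>k. R (k + n)))" by (rule hausdorff_mono)
    also have "\<dots> \<le> hausdorff s (Y n) + (\<Sum>k. hausdorff s (R (k + n)))"
      by (rule order.trans[OF hausdorff_Un add_left_mono]) (rule hausdorff_UN)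
    finally have 1: "hausdorff s (X - F) \<le> hausdorff s (Y n) + (\<Sum>k. hausdorff s (R (k + n)))" .
    have "hausdorff s (X \<inter> F) + hausdorff s (Y n) \<le> hausdorff s ((X \<inter> F) \<union> Y n)"
    proof (rule hausdorff_metric_Un[of "1 / (real n + 1)"])
      fix x y assume "x \<in> X \<inter> F" "y \<in> Y n"
      then show "1 / (real n + 1) \<le> dist x y"
        using infdist_le[of x F y] by (auto simp: Y_def dist_commute)
    qed auto
    also have "\<dots> \<le> hausdorff s X" by (rule hausdorff_mono) (auto simp: Y_def)
    finally have "hausdorff s (X \<inter> F) + hausdorff s (Y n) \<le> hausdorff s X" .
    from add_left_mono[OF 1, of "hausdorff s (X \<inter> F)"] add_right_mono[OF this, of "\<Sum>k. hausdorff s (R (k + n))"]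
    show ?thesis unfolding add.assoc by (rule order.trans)
  qed
  have "(\<lambda>n. hausdorff s X + (\<Sum>k. hausdorff s (R (k + n)))) \<longlonglongrightarrow> hausdorff s X + 0"
    by (intro tendsto_add tendsto_const ennreal_suminf_tail fin)
  then show ?thesis
    by (intro LIMSEQ_le_const[where X="\<lambda>n. hausdorff s X + (\<Sum>k. hausdorff s (R (k + n)))"]) (auto intro: main)
qed simp

text \<open>Closed sets satisfy Caratheodory's condition, so the Borel sets lie in the lambda
  system, on which the outer measure is countably additive.\<close>

lemma hausdorff_measure_space: "measure_space UNIV (sets (borel :: 'a::metric_space measure)) (hausdorff s :: 'a set \<Rightarrow> ennreal)"
proof -
  let ?h = "hausdorff s :: 'a set \<Rightarrow> ennreal"
  let ?L = "lambda_system UNIV (Pow UNIV) ?h"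
  have oms: "outer_measure_space (Pow UNIV) ?h"
    by (auto simp: outer_measure_space_def positive_def increasing_def countably_subadditive_def
        hausdorff_empty hausdorff_mono hausdorff_UN)
  interpret P: sigma_algebra "UNIV :: 'a set" "Pow UNIV" by (rule sigma_algebra_Pow)
  have ms: "measure_space UNIV ?L ?h" using P.caratheodory_lemma[OF oms] .
  then have sa: "sigma_algebra UNIV ?L" by (simp add: measure_space_def)
  have "F \<in> ?L" if F: "closed F" for F
  proof (cases "F = {}")
    case False
    show ?thesis unfolding P.lambda_system_eq
    proof (auto intro!: antisym)
      fix X
      show "?h (X \<inter> F) + ?h (X - F) \<le> ?h X" by (rule hausdorff_closed_split[OF F False])
      have "X = (X \<inter> F) \<union> (X - F)" by auto
      then show "?h X \<le> ?h (X \<inter> F) + ?h (X - F)" by (metis hausdorff_Un)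
    qed
  qed (simp only: P.lambda_system_eq, simp add: hausdorff_empty)
  then have "sigma_sets UNIV (Collect closed) \<subseteq> ?L"
    using sa by (intro sigma_algebra.sigma_sets_subset) auto
  moreover have "sets (borel :: 'a measure) = sigma_sets UNIV (Collect closed)"
    by (subst borel_eq_closed) simp
  ultimately have sub: "sets (borel :: 'a measure) \<subseteq> ?L" by simp
  show ?thesis
    unfolding measure_space_def
  proof safe
    show "sigma_algebra UNIV (sets (borel :: 'a measure))"
      using sets.sigma_algebra_axioms[of "borel :: 'a measure"] by simp
    show "positive (sets borel) ?h" by (simp add: positive_def hausdorff_empty)
    have "countably_additive ?L ?h" using ms by (simp add: measure_space_def)
    then show "countably_additive (sets borel) ?h"
      using sub unfolding countably_additive_def by (meson subset_iff subset_trans)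
  qed
qed

text \<open>\<open>measure_of\<close> yields the given set function only where that is a measure;
  the Caratheodory argument supplies this on the trace of the Borel sets.\<close>

lemma
  fixes S :: "'a::metric_space set"
  assumes "S \<in> sets borel"
  shows space_hmeasure: "space (hmeasure s S) = S"
    and sets_hmeasure: "sets (hmeasure s S) = sets (restrict_space borel S)"
    and emeasure_hmeasure: "A \<in> sets borel \<Longrightarrow> A \<subseteq> S \<Longrightarrow> emeasure (hmeasure s S) A = hausdorff s A"
proof -
  let ?R = "sets (restrict_space borel S)"
  have R: "A \<in> ?R \<longleftrightarrow> A \<in> sets borel \<and> A \<subseteq> S" for A
    using assms by (subst sets_restrict_space_iff) auto
  have sub: "?R \<subseteq> Pow S" using R by blast
  have sig: "sigma_sets S ?R = ?R"
    using sets.sigma_sets_eq[of "restrict_space borel S"] by (simp add: space_restrict_space)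
  show "space (hmeasure s S) = S" "sets (hmeasure s S) = ?R"
    unfolding hmeasure_def using sub by (simp_all add: space_measure_of sets_measure_of sig)
  assume A: "A \<in> sets borel" "A \<subseteq> S"
  show "emeasure (hmeasure s S) A = hausdorff s A"
    unfolding hmeasure_def
  proof (rule emeasure_measure_of_sigma)
    show "sigma_algebra S ?R"
      using sets.sigma_algebra_axioms[of "restrict_space borel S"] by (simp add: space_restrict_space)
    show "positive ?R (hausdorff s)" by (simp add: positive_def hausdorff_empty)
    have "countably_additive (sets (borel :: 'a measure)) (hausdorff s)"
      using hausdorff_measure_space[where 'a='a] by (simp add: measure_space_def)
    then show "countably_additive ?R (hausdorff s)"
      unfolding countably_additive_def by (simp add: R subset_iff image_subset_iff)
  qed (use A R in auto)
qed

text \<open>Covering sets become balls of radius their diameter plus a small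
  \<open>\<rho> i\<close>, which is positive even for sets of diameter zero and makes the cover
  open, so compactness leaves finitely many balls. One factor \<open>2 powr s\<close> undoes the
  halved diameter in the normalisation, the other splits the power of the sum; together they give
  \<open>4 powr s\<close>.\<close>

lemma hausdorff_compact_ball_cover:
  fixes K :: "'a::metric_space set"
  assumes s: "1 \<le> s" and K: "compact K" "hausdorff s K < ennreal h" and \<delta>: "0 < \<delta>"
  obtains I :: "nat set" and z r where "finite I" "K \<subseteq> (\<Union>i\<in>I. ball (z i) (r i))"
    "\<And>i. i \<in> I \<Longrightarrow> 0 < r i \<and> r i \<le> \<delta>"
    "(\<Sum>i\<in>I. r i powr s) \<le> 4 powr s * Gamma (s/2 + 1) / pi powr (s/2) * h"
proof -
  define w where "w = pi powr (s/2) / Gamma (s/2 + 1)"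
  have w: "0 < w" using s by (simp add: w_def Gamma_real_pos)
  have "hausdorff_pre s (\<delta>/2) K < ennreal h"
    using hausdorff_pre_le_hausdorff[of "\<delta>/2" s K] \<delta> K by auto
  then obtain C where C: "K \<subseteq> (\<Union>i::nat. C i)" "\<And>i. bounded (C i)" "\<And>i. diameter (C i) \<le> \<delta>/2"
    "(\<Sum>i. hdiam s (C i)) < ennreal h"
    by (rule hausdorff_pre_obtain) blast
  let ?d = "\<lambda>i. diameter (C i)"
  have d0: "0 \<le> ?d i" for i by (rule diameter_ge_0[OF C(2)])
  have h: "0 < h"
    using C(4) by (cases "0 < h") (auto simp: ennreal_neg)
  obtain S where S: "(\<Sum>i. hdiam s (C i)) = ennreal S" "0 \<le> S" "S < h"
    using C(4) h by (cases "\<Sum>i. hdiam s (C i)" rule: ennreal_cases) (auto simp: ennreal_less_iff)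
  \<comment> \<open>Half of \<delta> keeps the radii below \<delta>, the bound 1 gives
    \<open>\<rho> i powr s \<le> \<rho> i\<close>, and the last entry pays for the added radii out
    of the slack \<open>h - S\<close>, which is positive because the assumed bound is
    strict.\<close>
  define e where "e = min (\<delta>/2) (min 1 ((h - S) / w))"
  have e: "0 < e" "e \<le> \<delta>/2" "e \<le> 1" "w * e \<le> h - S"
  proof -
    show "0 < e" "e \<le> \<delta>/2" "e \<le> 1" using \<delta> S w unfolding e_def
      by (auto simp only: min_less_iff_conj intro: min.coboundedI1 min.coboundedI2) (auto intro: min.coboundedI1 min.coboundedI2)
    have "e \<le> (h - S) / w" by (simp add: e_def)
    then show "w * e \<le> h - S" using w by (simp add: field_simps)
  qed
  define \<rho> where "\<rho> i = e * (1/2) ^ Suc i" for i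
  have \<rho>: "0 < \<rho> i" "\<rho> i \<le> e" for i
  proof -
    have "e * (1/2) ^ Suc i \<le> e * 1"
      using e by (intro mult_left_mono power_le_one) auto
    then show "0 < \<rho> i" "\<rho> i \<le> e" using e by (auto simp: \<rho>_def)
  qed
  define r where "r i = ?d i + \<rho> i" for i
  define z where "z i = (SOME x. x \<in> C i)" for i
  have z: "z i \<in> C i" if "C i \<noteq> {}" for i
    unfolding z_def using that by (auto intro: someI)
  have cov: "C i \<subseteq> ball (z i) (r i)" for i
  proof
    fix x assume x: "x \<in> C i"
    then have "z i \<in> C i" using z by auto
    then show "x \<in> ball (z i) (r i)"
      using diameter_bounded_bound[OF C(2), of "z i" i x] x \<rho>(1)[of i] by (auto simp: r_def)
  qed
  obtain I where I: "finite I" "K \<subseteq> (\<Union>i\<in>I. ball (z i) (r i))"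
  proof -
    have "K \<subseteq> (\<Union>i\<in>UNIV. ball (z i) (r i))" using C(1) cov by blast
    then show ?thesis using that by (rule compactE_image[OF K(1), rotated]) auto
  qed
  have rs: "r i powr s \<le> 2 powr s * (?d i powr s + \<rho> i)" for i
  proof -
    have "r i powr s \<le> (2 * max (?d i) (\<rho> i)) powr s"
      using s d0[of i] \<rho>(1)[of i] by (intro powr_mono2) (auto simp: r_def)
    also have "\<dots> = 2 powr s * max (?d i powr s) (\<rho> i powr s)"
      using d0[of i] \<rho>(1)[of i] by (auto simp: powr_mult max_def intro: powr_mono2 antisym)
         (use s in \<open>auto intro!: antisym powr_mono2 simp: max_def\<close>)
    also have "\<dots> \<le> 2 powr s * (?d i powr s + \<rho> i)"
    proof (intro mult_left_mono)
      have "\<rho> i powr s \<le> \<rho> i powr 1"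
        using s \<rho>[of i] e by (intro powr_mono') auto
      then show "max (?d i powr s) (\<rho> i powr s) \<le> ?d i powr s + \<rho> i"
        using \<rho>(1)[of i] by (auto simp: max_def add_increasing)
    qed auto
    finally show ?thesis .
  qed
  have sumd: "(\<Sum>i\<in>I. w * (?d i / 2) powr s) \<le> S"
  proof -
    have "ennreal (\<Sum>i\<in>I. w * (?d i / 2) powr s) = (\<Sum>i\<in>I. hdiam s (C i))"
      using w unfolding w_def by (intro sum_ennreal[symmetric] mult_nonneg_nonneg) auto
    also have "\<dots> \<le> ennreal S" unfolding S(1)[symmetric] by (intro sum_le_suminf I) auto
    finally show ?thesis using S by simp
  qed
  have sum\<rho>: "(\<Sum>i\<in>I. \<rho> i) \<le> e"
  proof -
    have "\<rho> sums (e * 1)" unfolding \<rho>_def by (intro sums_mult power_half_series)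
    then have "summable \<rho>" "suminf \<rho> = e" by (simp_all add: sums_summable sums_unique[symmetric])
    then show ?thesis using sum_le_suminf[of \<rho> I] I(1) \<rho>(1) by (simp add: less_imp_le)
  qed
  have "(\<Sum>i\<in>I. r i powr s) \<le> (\<Sum>i\<in>I. 2 powr s * (?d i powr s + \<rho> i))" by (intro sum_mono rs)
  also have "\<dots> = 2 powr s * (2 powr s / w * (\<Sum>i\<in>I. w * (?d i / 2) powr s) + (\<Sum>i\<in>I. \<rho> i))"
  proof -
    have "2 powr s / w * (\<Sum>i\<in>I. w * (?d i / 2) powr s) = (\<Sum>i\<in>I. ?d i powr s)"
      unfolding sum_distrib_left
    proof (rule sum.cong[OF refl])
      fix i
      have "(?d i / 2) powr s = ?d i powr s / 2 powr s" by (rule powr_divide)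
      then show "2 powr s / w * (w * (?d i / 2) powr s) = ?d i powr s" using w by simp
    qed
    then show ?thesis by (simp add: sum_distrib_left[symmetric] sum.distrib)
  qed
  also have "\<dots> \<le> 2 powr s * (2 powr s / w * S + e)"
    by (intro mult_left_mono add_mono sumd sum\<rho>) (use w in auto)
  also have "\<dots> \<le> 2 powr s * (2 powr s / w * S + 2 powr s / w * (h - S))"
  proof (intro mult_left_mono add_left_mono)
    have "1 \<le> 2 powr s" using s by (simp add: ge_one_powr_ge_zero)
    then have "1 * (w * e) \<le> 2 powr s * (h - S)" using e w by (intro mult_mono) auto
    then show "e \<le> 2 powr s / w * (h - S)" using w by (simp add: field_simps)
  qed auto
  also have "\<dots> = 4 powr s / w * h"
  proof -
    have "4 powr s = 2 powr s * (2 powr s :: real)" using powr_mult[of 2 2 s] by simp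
    then show ?thesis by (simp only: distrib_left[symmetric]) (simp add: algebra_simps)
  qed
  finally have fin: "(\<Sum>i\<in>I. r i powr s) \<le> 4 powr s * Gamma (s/2 + 1) / pi powr (s/2) * h"
    by (simp add: w_def)
  have "0 < r i \<and> r i \<le> \<delta>" for i
    using C(3)[of i] d0[of i] \<rho>[of i] e by (auto simp: r_def)
  then show ?thesis by (rule that[OF I _ fin])
qed

section \<open>Mollification and the weak chain rule\<close>

text \<open>The power \<open>s ^ m\<close> makes this family closed under differentiation, so that the class \<open>smoothc\<close> below is stable
  under partial derivatives and consists of smooth functions.\<close>
definition gexp :: "nat \<Rightarrow> real \<Rightarrow> real" where
  "gexp m s = (if s \<le> 0 then 0 else exp (- 1 / s) / s ^ m)"

lemma gexp_nonneg: "0 \<le> gexp m s"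
  by (simp add: gexp_def)

lemma gexp_tendsto_0: "(gexp m \<longlongrightarrow> 0) (at 0)"
proof -
  have "((\<lambda>s::real. (inverse s) ^ m / exp (inverse s)) \<longlongrightarrow> 0) (at_right 0)"
    by (rule filterlim_compose[OF tendsto_power_div_exp_0 filterlim_inverse_at_top_right])
  then have "(gexp m \<longlongrightarrow> 0) (at_right 0)"
    by (rule Lim_transform_eventually)
      (auto simp: eventually_at_right_less gexp_def exp_minus field_simps power_inverse intro!: eventually_at_rightI[of 0 1])
  moreover have "(gexp m \<longlongrightarrow> 0) (at_left 0)"
    by (rule tendsto_eventually) (auto simp: gexp_def intro!: eventually_at_leftI[of "-1"])
  ultimately show ?thesis by (simp add: filterlim_split_at)
qed

lemma gexp_deriv:
  "(gexp m has_real_derivative gexp (m + 2) s - real m * gexp (m + 1) s) (at s)"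
proof -
  consider "s < 0" | "s = 0" | "0 < s" by linarith
  then show ?thesis
  proof cases
    case 1
    have "((\<lambda>_. 0) has_real_derivative 0) (at s)" by simp
    then have "(gexp m has_real_derivative 0) (at s)"
      by (rule has_field_derivative_transform_within_open[where S="{..<0}"]) (use 1 in \<open>auto simp: gexp_def\<close>)
    then show ?thesis using 1 by (simp add: gexp_def)
  next
    case 2
    have "((\<lambda>h. (gexp m (0 + h) - gexp m 0) / h) \<longlongrightarrow> 0) (at 0)"
    proof (rule Lim_transform_eventually[OF gexp_tendsto_0[of "m + 1"]])
      show "\<forall>\<^sub>F h in at 0. gexp (m + 1) h = (gexp m (0 + h) - gexp m 0) / h"
        by (rule always_eventually) (auto simp: gexp_def)
    qed
    then show ?thesis using 2 by (simp add: gexp_def DERIV_def)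
  next
    case 3
    have "((\<lambda>s. exp (- 1 / s) / s ^ m) has_real_derivative
      (exp (- 1 / s) * (1 / s\<^sup>2) * s ^ m - exp (- 1 / s) * (real m * s ^ (m - 1))) / (s ^ m * s ^ m)) (at s)"
      using 3 by (auto intro!: derivative_eq_intros simp: power2_eq_square)
    moreover have "(exp (- 1 / s) * (1 / s\<^sup>2) * s ^ m - exp (- 1 / s) * (real m * s ^ (m - 1))) / (s ^ m * s ^ m)
      = gexp (m + 2) s - real m * gexp (m + 1) s"
      using 3 by (cases m) (auto simp: gexp_def field_simps power2_eq_square)
    ultimately have "((\<lambda>s. exp (- 1 / s) / s ^ m) has_real_derivative gexp (m + 2) s - real m * gexp (m + 1) s) (at s)"
      by simp
    then show ?thesis
      by (rule has_field_derivative_transform_within_open[where S="{0<..}"]) (use 3 in \<open>auto simp: gexp_def\<close>)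
  qed
qed

inductive smoothc :: "(real^'n::finite \<Rightarrow> real) \<Rightarrow> bool" where
  const: "smoothc (\<lambda>_. c)"
| coord: "smoothc (\<lambda>x. x $ i)"
| add: "smoothc f \<Longrightarrow> smoothc g \<Longrightarrow> smoothc (\<lambda>x. f x + g x)"
| mult: "smoothc f \<Longrightarrow> smoothc g \<Longrightarrow> smoothc (\<lambda>x. f x * g x)"
| gexp: "smoothc f \<Longrightarrow> smoothc (\<lambda>x. gexp m (f x))"

lemma smoothc_sum: "finite A \<Longrightarrow> (\<And>a. a \<in> A \<Longrightarrow> smoothc (f a)) \<Longrightarrow> smoothc (\<lambda>x. \<Sum>a\<in>A. f a x)"
  by (induction A rule: finite_induct) (auto intro: smoothc.intros)

lemma smoothc_diff: "smoothc f \<Longrightarrow> smoothc g \<Longrightarrow> smoothc (\<lambda>x. f x - g x)"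
  using smoothc.add[of f "\<lambda>x. (-1) * g x"] smoothc.mult[OF smoothc.const[of "-1"], of g] by simp

text \<open>Directional derivatives stay in the class, from which \<open>Ck\<close> of every order
  follows by induction.\<close>

lemma smoothc_deriv:
  "smoothc f \<Longrightarrow> \<exists>f'. (\<forall>x. (f has_derivative f' x) (at x)) \<and> (\<forall>v. smoothc (\<lambda>x. f' x v))"
proof (induction rule: smoothc.induct)
  case (const c)
  show ?case by (rule exI[of _ "\<lambda>_ _. 0"]) (auto intro: smoothc.const)
next
  case (coord i)
  show ?case
    by (rule exI[of _ "\<lambda>_ v. v $ i"])
      (auto intro: smoothc.const bounded_linear_imp_has_derivative bounded_linear_vec_nth)
next
  case (add f g)
  then obtain f' g' where "\<forall>x. (f has_derivative f' x) (at x)" "\<forall>v. smoothc (\<lambda>x. f' x v)"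
    "\<forall>x. (g has_derivative g' x) (at x)" "\<forall>v. smoothc (\<lambda>x. g' x v)" by blast
  then show ?case
    by (intro exI[of _ "\<lambda>x v. f' x v + g' x v"]) (auto intro: smoothc.add has_derivative_add)
next
  case (mult f g)
  then obtain f' g' where "\<forall>x. (f has_derivative f' x) (at x)" "\<forall>v. smoothc (\<lambda>x. f' x v)"
    "\<forall>x. (g has_derivative g' x) (at x)" "\<forall>v. smoothc (\<lambda>x. g' x v)" by blast
  then show ?case using mult.hyps
    by (intro exI[of _ "\<lambda>x v. f x * g' x v + f' x v * g x"])
      (auto intro!: smoothc.add[OF smoothc.mult smoothc.mult] intro: has_derivative_mult)
next
  case (gexp f m)
  then obtain f' where f': "\<forall>x. (f has_derivative f' x) (at x)" "\<forall>v. smoothc (\<lambda>x. f' x v)" by blast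
  let ?d = "\<lambda>x v. (gexp (m + 2) (f x) - real m * gexp (m + 1) (f x)) * f' x v"
  have "((\<lambda>x. gexp m (f x)) has_derivative ?d x) (at x)" for x
    using has_derivative_compose[OF f'(1)[rule_format, of x] gexp_deriv[unfolded has_field_derivative_def, of m "f x"]]
    by simp
  moreover have "smoothc (\<lambda>x. ?d x v)" for v
    using f' gexp.hyps by (intro smoothc.mult smoothc_diff smoothc.gexp smoothc.const) auto
  ultimately show ?case by (intro exI[of _ ?d]) simp
qed

lemma smoothc_continuous: "smoothc f \<Longrightarrow> continuous_on A f"
  using smoothc_deriv has_derivative_continuous continuous_at_imp_continuous_on by metis

lemma pd_eq: "(f has_derivative f') (at x) \<Longrightarrow> pd i f x = f' (axis i 1)"
  unfolding pd_def by (simp add: frechet_derivative_at[symmetric])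

lemma smoothc_Ck: "smoothc f \<Longrightarrow> Ck k f"
proof (induction k arbitrary: f)
  case 0
  then show ?case by (simp add: smoothc_continuous)
next
  case (Suc k)
  obtain f' where f': "\<And>x. (f has_derivative f' x) (at x)" "\<And>v. smoothc (\<lambda>x. f' x v)"
    using smoothc_deriv[OF Suc.prems] by blast
  have "pd i f = (\<lambda>x. f' x (axis i 1))" for i using f'(1) by (auto simp: pd_eq)
  then show ?case using Suc.IH f'
    by (auto simp: differentiable_on_def differentiable_def intro: has_derivative_at_withinI)
qed

text \<open>The classical bump, normalised. The squared norm is written as a polynomial in the
  coordinates so that \<open>smoothc\<close> applies; the integral is nonzero since the bump is
  positive on a ball.\<close>

lemma mollifier:
  assumes "0 < \<epsilon>"
  obtains \<rho> :: "real^'n::finite \<Rightarrow> real" and D where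
    "\<And>z. 0 \<le> \<rho> z" "\<And>z. \<epsilon> \<le> norm z \<Longrightarrow> \<rho> z = 0"
    "\<And>x k. Ck k (\<lambda>y. \<rho> (x - y))" "\<And>z. (\<rho> has_derivative D z) (at z)"
    "\<And>v. continuous_on UNIV (\<lambda>z. D z v)" "integrable lborel \<rho>" "integral\<^sup>L lborel \<rho> = 1"
    "\<And>z. \<rho> (- z) = \<rho> z"
proof -
  define b :: "real^'n \<Rightarrow> real" where "b z = gexp 0 (\<epsilon>\<^sup>2 - (norm z)\<^sup>2)" for z
  have norm2: "(norm z)\<^sup>2 = (\<Sum>i\<in>UNIV. z $ i * z $ i)" for z :: "real^'n"
    by (simp add: power2_norm_eq_inner inner_vec_def)
  have smooth: "smoothc (\<lambda>y. c * b (x - y))" for x c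
    unfolding b_def norm2 vector_minus_component
    by (intro smoothc.mult smoothc.const smoothc.gexp smoothc_diff smoothc_sum smoothc.coord) auto
  have smooth': "smoothc (\<lambda>y. c * b y)" for c
    unfolding b_def norm2 
    by (intro smoothc.mult smoothc.const smoothc.gexp smoothc_diff smoothc_sum smoothc.coord) auto
  have b0: "0 \<le> b z" for z by (simp add: b_def gexp_nonneg)
  have bsupp: "b z = 0" if "\<epsilon> \<le> norm z" for z
    using that assms by (simp add: b_def gexp_def power_mono)
  have cont: "continuous_on UNIV b" using smoothc_continuous[OF smooth'[of 1]] by simp
  have "integrable lborel (\<lambda>z. indicator (cball 0 \<epsilon>) z *\<^sub>R b z)"
    by (rule borel_integrable_compact) (auto intro: continuous_on_subset[OF cont])
  also have "(\<lambda>z. indicator (cball 0 \<epsilon>) z *\<^sub>R b z) = b"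
    using bsupp by (auto simp: indicator_def fun_eq_iff)
  finally have int: "integrable lborel b" .
  define c where "c = integral\<^sup>L lborel b"
  have "c \<noteq> 0"
  proof
    assume "c = 0"
    then have AE0: "AE z in lborel. b z = 0"
      using integral_nonneg_eq_0_iff_AE[OF int] b0 by (simp add: c_def)
    have nz: "b z \<noteq> 0" if "z \<in> ball 0 \<epsilon>" for z
    proof -
      have "(norm z)\<^sup>2 < \<epsilon>\<^sup>2" using that by (intro power_strict_mono) auto
      then show ?thesis by (simp add: b_def gexp_def)
    qed
    have "AE z::real^'n in lborel. z \<notin> ball 0 \<epsilon>"
      by (rule AE_mp[OF AE0 AE_I2]) (use nz in auto)
    then have "ball (0::real^'n) \<epsilon> \<in> null_sets lborel"
      by (simp add: AE_iff_null_sets)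
    moreover have "0 < unit_ball_vol (real CARD('n)) * \<epsilon> ^ CARD('n)" using assms by simp
    then have "emeasure lborel (ball (0::real^'n) \<epsilon>) \<noteq> 0"
      using emeasure_ball[of \<epsilon> "0::real^'n"] assms by (metis DIM_cart DIM_real ennreal_eq_0_iff less_imp_le mult.right_neutral not_le)
    ultimately show False by auto
  qed
  moreover have "0 \<le> c" unfolding c_def using b0 by simp
  ultimately have c: "0 < c" by simp
  obtain D where D: "\<And>z. ((\<lambda>z. (1/c) * b z) has_derivative D z) (at z)" "\<And>v. smoothc (\<lambda>z. D z v)"
    using smoothc_deriv[OF smooth'[of "1/c"]] by blast
  show ?thesis
  proof (rule that[of "\<lambda>z. (1/c) * b z" D])
    show "Ck k (\<lambda>y. 1 / c * b (x - y))" for x k by (rule smoothc_Ck[OF smooth])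
    show "integral\<^sup>L lborel (\<lambda>z. 1 / c * b z) = 1" using c by (simp add: c_def[symmetric])
    show "1 / c * b (- z) = 1 / c * b z" for z by (simp add: b_def)
    show "integrable lborel (\<lambda>z. 1 / c * b z)" using int by (rule integrable_mult_right)
  qed (use c b0 bsupp D in \<open>auto simp: smoothc_continuous\<close>)
qed

section \<open>Reflection, convolution and integration by parts\<close>

lemma lborel_distr_reflect:
  "distr lborel borel (\<lambda>y. c - y) = (lborel :: 'a::euclidean_space measure)"
proof -
  have "lborel = density (distr lborel borel (\<lambda>x::'a. c + (-1) *\<^sub>R x)) (\<lambda>_. ennreal (\<bar>-1\<bar> ^ DIM('a)))"
    by (rule lborel_affine) simp
  then show ?thesis by (simp add: density_1)
qed

lemma
  fixes f :: "'a::euclidean_space \<Rightarrow> real"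
  shows integral_lborel_reflect: "f \<in> borel_measurable borel \<Longrightarrow> (\<integral>y. f (c - y) \<partial>lborel) = integral\<^sup>L lborel f"
    and integrable_lborel_reflect: "integrable lborel f \<Longrightarrow> integrable lborel (\<lambda>y. f (c - y))"
proof -
  assume f: "f \<in> borel_measurable borel"
  have "integral\<^sup>L (distr lborel borel (\<lambda>y. c - y)) f = (\<integral>y. f (c - y) \<partial>lborel)"
    by (rule integral_distr) (use f in auto)
  then show "(\<integral>y. f (c - y) \<partial>lborel) = integral\<^sup>L lborel f" by (simp add: lborel_distr_reflect)
next
  assume f: "integrable lborel f"
  then have "integrable (distr lborel borel (\<lambda>y. c - y)) f" by (simp add: lborel_distr_reflect)
  then show "integrable lborel (\<lambda>y. f (c - y))"
    by (subst (asm) integrable_distr_eq) (use f in auto)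
qed

lemma integrable_mult_bounded:
  fixes f g :: "'a::euclidean_space \<Rightarrow> real"
  assumes f: "integrable lborel f" and g: "g \<in> borel_measurable borel" "\<And>y. \<bar>g y\<bar> \<le> B"
  shows "integrable lborel (\<lambda>y. f y * g y)"
proof (rule Bochner_Integration.integrable_bound[where f="\<lambda>y. B * f y"])
  show "AE y in lborel. norm (f y * g y) \<le> norm (B * f y)"
  proof (rule AE_I2)
    fix y
    have "\<bar>g y\<bar> \<le> \<bar>B\<bar>" using g(2)[of y] by linarith
    then have "\<bar>f y\<bar> * \<bar>g y\<bar> \<le> \<bar>f y\<bar> * \<bar>B\<bar>" by (intro mult_left_mono) auto
    then show "norm (f y * g y) \<le> norm (B * f y)" by (simp add: abs_mult mult.commute)
  qed
qed (use f g in auto)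

lemma compact_support_bounded:
  fixes f :: "'a::euclidean_space \<Rightarrow> real"
  assumes "continuous_on UNIV f" "\<And>z. z \<notin> K \<Longrightarrow> f z = 0" "compact K"
  obtains B where "0 < B" "\<And>z. \<bar>f z\<bar> \<le> B"
proof -
  have "bounded (f ` K)"
    using assms by (intro compact_imp_bounded compact_continuous_image) (auto intro: continuous_on_subset)
  then obtain B where "0 < B" "\<And>z. z \<in> K \<Longrightarrow> \<bar>f z\<bar> \<le> B" by (auto simp: bounded_pos)
  then show ?thesis using that[of B] assms(2) by (metis abs_zero less_imp_le)
qed

lemma shifted_derivative:
  fixes \<rho> \<rho>' :: "'a::real_vector \<Rightarrow> real"
  assumes "\<And>z. ((\<lambda>s. \<rho> (z + s *\<^sub>R e)) has_real_derivative \<rho>' z) (at 0)"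
  shows "((\<lambda>s. \<rho> (z + s *\<^sub>R e)) has_real_derivative \<rho>' (z + t *\<^sub>R e)) (at t)"
proof -
  have "((\<lambda>s. \<rho> ((z + t *\<^sub>R e) + s *\<^sub>R e)) has_real_derivative \<rho>' (z + t *\<^sub>R e)) (at 0)" by (rule assms)
  also have "(\<lambda>s. \<rho> ((z + t *\<^sub>R e) + s *\<^sub>R e)) = (\<lambda>s. \<rho> (z + (s + t) *\<^sub>R e))"
    by (simp add: algebra_simps)
  finally show ?thesis
    using DERIV_shift[of "\<lambda>s. \<rho> (z + s *\<^sub>R e)" "\<rho>' (z + t *\<^sub>R e)" 0 t] by simp
qed

lemma directional_lipschitz:
  fixes \<rho> \<rho>' :: "'a::real_vector \<Rightarrow> real"
  assumes "\<And>z. ((\<lambda>s. \<rho> (z + s *\<^sub>R e)) has_real_derivative \<rho>' z) (at 0)" "\<And>z. \<bar>\<rho>' z\<bar> \<le> B"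
  shows "\<bar>\<rho> (z + s *\<^sub>R e) - \<rho> z\<bar> \<le> B * \<bar>s\<bar>"
proof -
  have "norm (\<rho> (z + s *\<^sub>R e) - \<rho> (z + 0 *\<^sub>R e)) \<le> B * norm (s - 0)"
    by (rule field_differentiable_bound[of UNIV "\<lambda>s. \<rho> (z + s *\<^sub>R e)" "\<lambda>t. \<rho>' (z + t *\<^sub>R e)"])
      (use shifted_derivative[of \<rho> e \<rho>'] assms in auto)
  then show ?thesis by simp
qed

text \<open>Difference quotients of \<rho> are bounded by the bound of its directional derivative,
  so \<open>B * \<bar>f y\<bar>\<close> dominates and the limit passes under the integral.\<close>

lemma convolution_deriv:
  fixes f \<rho> \<rho>' :: "'a::euclidean_space \<Rightarrow> real"
  assumes f: "integrable lborel f"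
    and \<rho>: "\<rho> \<in> borel_measurable borel" "\<And>z. \<bar>\<rho> z\<bar> \<le> B0"
    and \<rho>': "\<rho>' \<in> borel_measurable borel" "\<And>z. \<bar>\<rho>' z\<bar> \<le> B"
    and der: "\<And>z. ((\<lambda>s. \<rho> (z + s *\<^sub>R e)) has_real_derivative \<rho>' z) (at 0)"
  shows "((\<lambda>s. \<integral>y. f y * \<rho> (x + s *\<^sub>R e - y) \<partial>lborel) has_real_derivative (\<integral>y. f y * \<rho>' (x - y) \<partial>lborel)) (at 0)"
proof -
  note [measurable] = \<rho>(1) \<rho>'(1)
  have fm[measurable]: "f \<in> borel_measurable borel" using f by auto
  have int: "integrable lborel (\<lambda>y. f y * \<rho> (z - y))" for z
    by (rule integrable_mult_bounded[OF f, where B=B0]) (use \<rho> in auto)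
  let ?q = "\<lambda>h y. (\<rho> (x + h *\<^sub>R e - y) - \<rho> (x - y)) / h"
  show ?thesis unfolding DERIV_def tendsto_at_iff_sequentially comp_def
  proof (intro allI impI)
    fix X :: "nat \<Rightarrow> real" assume X: "\<forall>i. X i \<in> UNIV - {0}" "X \<longlonglongrightarrow> 0"
    have "(\<lambda>i. \<integral>y. f y * ?q (X i) y \<partial>lborel) \<longlonglongrightarrow> (\<integral>y. f y * \<rho>' (x - y) \<partial>lborel)"
    proof (rule integral_dominated_convergence[where w="\<lambda>y. B * \<bar>f y\<bar>"])
      show "AE y in lborel. (\<lambda>i. f y * ?q (X i) y) \<longlonglongrightarrow> f y * \<rho>' (x - y)"
      proof (rule AE_I2)
        fix y
        have "((\<lambda>h. (\<rho> (x - y + h *\<^sub>R e) - \<rho> (x - y)) / h) \<longlongrightarrow> \<rho>' (x - y)) (at 0)"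
          using der[of "x - y"] by (simp add: DERIV_def)
        then have "(\<lambda>i. (\<rho> (x - y + X i *\<^sub>R e) - \<rho> (x - y)) / X i) \<longlonglongrightarrow> \<rho>' (x - y)"
          using X unfolding tendsto_at_iff_sequentially comp_def by blast
        then show "(\<lambda>i. f y * ?q (X i) y) \<longlonglongrightarrow> f y * \<rho>' (x - y)"
          by (intro tendsto_mult tendsto_const) (simp add: algebra_simps)
      qed
      show "AE y in lborel. norm (f y * ?q (X i) y) \<le> B * \<bar>f y\<bar>" for i
      proof (rule AE_I2)
        fix y
        have "\<bar>\<rho> (x + X i *\<^sub>R e - y) - \<rho> (x - y)\<bar> \<le> B * \<bar>X i\<bar>"
          using directional_lipschitz[OF der \<rho>'(2), of "x - y" "X i"] by (simp add: algebra_simps)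
        then have "\<bar>?q (X i) y\<bar> \<le> B" using X(1) by (simp add: field_simps)
        then have "\<bar>f y\<bar> * \<bar>?q (X i) y\<bar> \<le> \<bar>f y\<bar> * B" by (intro mult_left_mono) auto
        then show "norm (f y * ?q (X i) y) \<le> B * \<bar>f y\<bar>" by (simp add: abs_mult mult.commute)
      qed
    qed (use f in auto)
    also have "(\<lambda>i. \<integral>y. f y * ?q (X i) y \<partial>lborel) =
      (\<lambda>i. ((\<integral>y. f y * \<rho> (x + (0 + X i) *\<^sub>R e - y) \<partial>lborel) - (\<integral>y. f y * \<rho> (x + 0 *\<^sub>R e - y) \<partial>lborel)) / X i)"
    proof
      fix i
      have "(\<integral>y. f y * ?q (X i) y \<partial>lborel) = (\<integral>y. (f y * \<rho> (x + X i *\<^sub>R e - y) - f y * \<rho> (x - y)) / X i \<partial>lborel)"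
        by (intro Bochner_Integration.integral_cong) (auto simp: algebra_simps diff_divide_distrib)
      also have "\<dots> = ((\<integral>y. f y * \<rho> (x + X i *\<^sub>R e - y) \<partial>lborel) - (\<integral>y. f y * \<rho> (x - y) \<partial>lborel)) / X i"
        using int by simp
      finally show "(\<integral>y. f y * ?q (X i) y \<partial>lborel) =
        ((\<integral>y. f y * \<rho> (x + (0 + X i) *\<^sub>R e - y) \<partial>lborel) - (\<integral>y. f y * \<rho> (x + 0 *\<^sub>R e - y) \<partial>lborel)) / X i"
        by simp
    qed
    finally show "(\<lambda>i. ((\<integral>y. f y * \<rho> (x + (0 + X i) *\<^sub>R e - y) \<partial>lborel) - (\<integral>y. f y * \<rho> (x + 0 *\<^sub>R e - y) \<partial>lborel)) / X i)
      \<longlonglongrightarrow> (\<integral>y. f y * \<rho>' (x - y) \<partial>lborel)" .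
  qed
qed

lemma convolution_continuous:
  fixes f \<rho> :: "'a::euclidean_space \<Rightarrow> real"
  assumes f: "integrable lborel f" and \<rho>: "continuous_on UNIV \<rho>" "\<And>z. \<bar>\<rho> z\<bar> \<le> B"
  shows "continuous_on UNIV (\<lambda>x. \<integral>y. f y * \<rho> (x - y) \<partial>lborel)"
proof -
  have [measurable]: "\<rho> \<in> borel_measurable borel" using \<rho>(1) by (rule borel_measurable_continuous_onI)
  have fm[measurable]: "f \<in> borel_measurable borel" using f by auto
  have "isCont (\<lambda>x. \<integral>y. f y * \<rho> (x - y) \<partial>lborel) x" for x
    unfolding continuous_at_sequentially comp_def
  proof (intro allI impI)
    fix X :: "nat \<Rightarrow> 'a" assume X: "X \<longlonglongrightarrow> x"
    show "(\<lambda>i. \<integral>y. f y * \<rho> (X i - y) \<partial>lborel) \<longlonglongrightarrow> (\<integral>y. f y * \<rho> (x - y) \<partial>lborel)"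
    proof (rule integral_dominated_convergence[where w="\<lambda>y. B * \<bar>f y\<bar>"])
      show "AE y in lborel. (\<lambda>i. f y * \<rho> (X i - y)) \<longlonglongrightarrow> f y * \<rho> (x - y)"
        by (intro AE_I2 tendsto_mult tendsto_const continuous_on_tendsto_compose[OF \<rho>(1)] tendsto_diff X) auto
      show "AE y in lborel. norm (f y * \<rho> (X i - y)) \<le> B * \<bar>f y\<bar>" for i
        using \<rho>(2) by (intro AE_I2) (simp add: abs_mult mult.commute[of B] mult_left_mono)
    qed (use f in auto)
  qed
  then show ?thesis by (simp add: continuous_at_imp_continuous_on)
qed

text \<open>Translation invariance in place of iterated integration: \<open>f\<close> equals 1 on a
  large ball, so its convolution with \<open>W\<close> at small multiples of \<open>e\<close> is the
  constant integral of \<open>W\<close>. The derivative of that constant is zero, and by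
  \<open>convolution_deriv\<close> it is also the integral of \<open>W'\<close>.\<close>

lemma integral_partial_derivative_0:
  fixes W W' :: "'a::euclidean_space \<Rightarrow> real"
  assumes W: "continuous_on UNIV W" "continuous_on UNIV W'"
    and supp: "compact K" "\<And>z. z \<notin> K \<Longrightarrow> W z = 0" "\<And>z. z \<notin> K \<Longrightarrow> W' z = 0"
    and der: "\<And>z. ((\<lambda>s. W (z + s *\<^sub>R e)) has_real_derivative W' z) (at 0)"
  shows "integral\<^sup>L lborel W' = 0"
proof -
  have m[measurable]: "W \<in> borel_measurable borel" "W' \<in> borel_measurable borel"
    using W by (auto intro: borel_measurable_continuous_onI)
  obtain B0 where B0: "\<And>z. \<bar>W z\<bar> \<le> B0" using compact_support_bounded[OF W(1) supp(2,1)] by blast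
  obtain B where B: "\<And>z. \<bar>W' z\<bar> \<le> B" using compact_support_bounded[OF W(2) supp(3,1)] by blast
  obtain R where R: "0 < R" "\<And>z. z \<in> K \<Longrightarrow> norm z \<le> R"
    using compact_imp_bounded[OF supp(1)] by (auto simp: bounded_pos)
  \<comment> \<open>The extra \<open>norm e\<close> in the radius keeps the shifted and reflected
    support inside the ball for \<bar>s\<bar> \<le> 1.\<close>
  define f :: "'a \<Rightarrow> real" where "f = indicator (cball 0 (R + norm e))"
  have f: "integrable lborel f" unfolding f_def
    using emeasure_lborel_cball_finite[of "0::'a" "R + norm e"] by (intro integrable_real_indicator) auto
  have eq: "f y * g (s *\<^sub>R e - y) = g (s *\<^sub>R e - y)" if "\<bar>s\<bar> \<le> 1" "\<And>z. z \<notin> K \<Longrightarrow> g z = 0" for y s and g :: "'a \<Rightarrow> real"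
  proof (cases "s *\<^sub>R e - y \<in> K")
    case True
    have "norm y \<le> norm (s *\<^sub>R e - y) + norm (s *\<^sub>R e)"
      by (metis norm_minus_commute norm_triangle_sub add.commute)
    also have "\<dots> \<le> R + norm e" using R(2)[OF True] that(1) by (intro add_mono) (auto intro: mult_left_le_one_le)
    finally show ?thesis by (simp add: f_def)
  qed (use that in simp)
  have 1: "((\<lambda>s. \<integral>y. f y * W (0 + s *\<^sub>R e - y) \<partial>lborel) has_real_derivative (\<integral>y. f y * W' (0 - y) \<partial>lborel)) (at 0)"
    by (rule convolution_deriv[OF f m(1) B0 m(2) B der])
  have 2: "(\<integral>y. f y * W (0 + s *\<^sub>R e - y) \<partial>lborel) = integral\<^sup>L lborel W" if "\<bar>s\<bar> < 1" for s
  proof -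
    have "(\<lambda>y. f y * W (0 + s *\<^sub>R e - y)) = (\<lambda>y. W (s *\<^sub>R e - y))"
    proof
      show "f y * W (0 + s *\<^sub>R e - y) = W (s *\<^sub>R e - y)" for y
        unfolding add_0 by (rule eq) (use supp(2) that in auto)
    qed
    then show ?thesis using integral_lborel_reflect[OF m(1), of "s *\<^sub>R e"] by (simp only:)
  qed
  have "((\<lambda>s::real. integral\<^sup>L lborel W) has_real_derivative 0) (at 0)" by simp
  then have "((\<lambda>s. \<integral>y. f y * W (0 + s *\<^sub>R e - y) \<partial>lborel) has_real_derivative 0) (at 0)"
    by (rule has_field_derivative_transform_within_open[where S="{-1<..<1}"]) (use 2 in auto)
  then have "(\<integral>y. f y * W' (0 - y) \<partial>lborel) = 0" using 1 DERIV_unique by blast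
  moreover have "(\<lambda>y. f y * W' (0 - y)) = (\<lambda>y. W' (0 - y))"
  proof
    show "f y * W' (0 - y) = W' (0 - y)" for y
      using eq[of 0 W' y, unfolded scaleR_zero_left] supp(3) by auto
  qed
  ultimately show ?thesis using integral_lborel_reflect[OF m(2), of 0] by (simp only:)
qed

text \<open>Stated for an arbitrary \<open>c\<close>: at a limit value it gives convergence, and
  with \<open>c = 0\<close> a uniform bound on mollifications.\<close>

lemma mollifier_approx:
  fixes k \<rho> :: "'a::euclidean_space \<Rightarrow> real"
  assumes \<rho>: "\<And>z. 0 \<le> \<rho> z" "\<And>z. \<epsilon> \<le> norm z \<Longrightarrow> \<rho> z = 0" "integrable lborel \<rho>" "integral\<^sup>L lborel \<rho> = 1"
    and k: "k \<in> borel_measurable borel" "\<And>y. norm (x - y) < \<epsilon> \<Longrightarrow> \<bar>k y - c\<bar> \<le> \<eta>"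
  shows "\<bar>(\<integral>y. k y * \<rho> (x - y) \<partial>lborel) - c\<bar> \<le> \<eta>"
proof -
  have [measurable]: "\<rho> \<in> borel_measurable borel" using \<rho>(3) by auto
  note [measurable] = k(1)
  have i1: "integrable lborel (\<lambda>y. \<rho> (x - y))" by (rule integrable_lborel_reflect[OF \<rho>(3)])
  have le: "\<bar>(k y - c) * \<rho> (x - y)\<bar> \<le> \<eta> * \<rho> (x - y)" for y
    using k(2)[of y] \<rho>(1,2)[of "x - y"]
    by (cases "norm (x - y) < \<epsilon>") (auto simp: abs_mult intro: mult_right_mono)
  have i2: "integrable lborel (\<lambda>y. (k y - c) * \<rho> (x - y))"
    by (rule Bochner_Integration.integrable_bound[where f="\<lambda>y. \<eta> * \<rho> (x - y)"])
      (use i1 le in \<open>auto intro!: AE_I2 intro: order.trans[OF _ abs_ge_self]\<close>)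
  have one: "(\<integral>y. \<rho> (x - y) \<partial>lborel) = 1" using \<rho>(4) by (simp add: integral_lborel_reflect)
  have "(\<integral>y. k y * \<rho> (x - y) \<partial>lborel) = (\<integral>y. (k y - c) * \<rho> (x - y) + c * \<rho> (x - y) \<partial>lborel)"
    by (simp add: algebra_simps)
  also have "\<dots> = (\<integral>y. (k y - c) * \<rho> (x - y) \<partial>lborel) + c"
    using i1 i2 one by simp
  finally have "\<bar>(\<integral>y. k y * \<rho> (x - y) \<partial>lborel) - c\<bar> = \<bar>\<integral>y. (k y - c) * \<rho> (x - y) \<partial>lborel\<bar>" by simp
  also have "\<dots> \<le> (\<integral>y. \<bar>(k y - c) * \<rho> (x - y)\<bar> \<partial>lborel)" by (rule integral_abs_bound)
  also have "\<dots> \<le> (\<integral>y. \<eta> * \<rho> (x - y) \<partial>lborel)"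
    by (rule integral_mono) (use i1 i2 le in auto)
  also have "\<dots> = \<eta>" using one by simp
  finally show ?thesis .
qed

lemma mollifier_test:
  fixes \<Omega> :: "(real^'n::finite) set"
  assumes \<rho>: "\<And>z. \<epsilon> \<le> norm z \<Longrightarrow> \<rho> z = 0" "\<And>k. Ck k (\<lambda>y. \<rho> (x - y))"
    and x: "cball x \<epsilon> \<subseteq> \<Omega>"
  shows "test_function \<Omega> (\<lambda>y. \<rho> (x - y))"
proof -
  have "closure {y. \<rho> (x - y) \<noteq> 0} \<subseteq> cball x \<epsilon>"
    using \<rho>(1) by (intro closure_minimal) (auto simp: dist_norm not_le intro: less_imp_le, meson linear)
  then show ?thesis
    using \<rho>(2) x unfolding test_function_def
    by (meson bounded_cball bounded_subset closed_closure compact_eq_bounded_closed order.trans)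
qed

text \<open>The test function is \<open>\<lambda>y. \<rho> (x - y)\<close>, whose derivative in
  \<open>y\<close> has the opposite sign, cancelling the minus in the definition of a weak gradient.
  Since \<open>G\<close> is only Lebesgue measurable, \<open>f\<close> and \<open>g\<close> are
  Borel versions of \<open>u\<close> and of a component of \<open>G\<close> cut off to
  \<open>K\<close>, which loses nothing because the test function vanishes off
  \<open>K\<close>.\<close>

lemma mollified_weak_gradient:
  fixes u :: "real^'n::finite \<Rightarrow> real" and i :: 'n
  assumes wg: "has_weak_gradient \<Omega> u G"
    and \<rho>: "\<And>z. \<epsilon> \<le> norm z \<Longrightarrow> \<rho> z = 0" "\<And>k. Ck k (\<lambda>y. \<rho> (x - y))"
      "\<And>z. (\<rho> has_derivative D z) (at z)" "continuous_on UNIV (\<lambda>z. D z (axis i 1))"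
      "\<And>z. \<epsilon> < norm z \<Longrightarrow> D z (axis i 1) = 0"
    and x: "cball x \<epsilon> \<subseteq> K" "K \<subseteq> \<Omega>"
    and f: "f \<in> borel_measurable borel" "\<And>y. f y = indicator K y * u y"
    and g: "g \<in> borel_measurable borel" "AE y in lebesgue. g y = indicator K y * G y $ i"
    and Gm: "(\<lambda>y. indicator K y * G y $ i) \<in> borel_measurable lebesgue"
  shows "(\<integral>y. f y * D (x - y) (axis i 1) \<partial>lborel) = (\<integral>y. g y * \<rho> (x - y) \<partial>lborel)"
proof -
  let ?e = "axis i 1 :: real^'n"
  have cont\<rho>: "continuous_on UNIV \<rho>"
    using \<rho>(3) by (meson continuous_at_imp_continuous_on has_derivative_continuous)
  have [measurable]: "\<rho> \<in> borel_measurable borel" "(\<lambda>z. D z ?e) \<in> borel_measurable borel"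
    using cont\<rho> \<rho>(4) by (auto intro: borel_measurable_continuous_onI)
  note [measurable] = f(1) g(1)
  have far: "\<epsilon> < norm (x - y)" if "y \<notin> K" for y
    using that x(1) by (force simp: dist_norm)
  have "test_function \<Omega> (\<lambda>y. \<rho> (x - y))"
    by (rule mollifier_test[OF \<rho>(1,2)]) (use x in auto)
  then have eq: "(LINT y:\<Omega>|lebesgue. u y * pd i (\<lambda>y. \<rho> (x - y)) y) = - (LINT y:\<Omega>|lebesgue. G y $ i * \<rho> (x - y))"
    using wg unfolding has_weak_gradient_def by blast
  have pd: "pd i (\<lambda>y. \<rho> (x - y)) y = - D (x - y) ?e" for y
  proof -
    have "((\<lambda>y. x - y) has_derivative (\<lambda>v. - v)) (at y)"
      by (auto intro!: derivative_eq_intros)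
    from has_derivative_compose[OF this \<rho>(3)]
    have "pd i (\<lambda>y. \<rho> (x - y)) y = D (x - y) (- ?e)" by (rule pd_eq)
    then show ?thesis
      using linear_neg[OF has_derivative_linear[OF \<rho>(3)[of "x - y"]]] by simp
  qed
  have "(LINT y:\<Omega>|lebesgue. u y * pd i (\<lambda>y. \<rho> (x - y)) y) = (\<integral>y. - (f y * D (x - y) ?e) \<partial>lebesgue)"
    unfolding set_lebesgue_integral_def
  proof (rule Bochner_Integration.integral_cong[OF refl])
    fix y
    show "indicat_real \<Omega> y *\<^sub>R (u y * pd i (\<lambda>y. \<rho> (x - y)) y) = - (f y * D (x - y) ?e)"
      using x(2) \<rho>(5)[of "x - y"] far[of y] by (cases "y \<in> K") (auto simp: pd f(2) indicator_def)
  qed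
  also have "\<dots> = - (\<integral>y. f y * D (x - y) ?e \<partial>lborel)"
    by (subst integral_completion) auto
  finally have 1: "(LINT y:\<Omega>|lebesgue. u y * pd i (\<lambda>y. \<rho> (x - y)) y) = - (\<integral>y. f y * D (x - y) ?e \<partial>lborel)" .
  have "(LINT y:\<Omega>|lebesgue. G y $ i * \<rho> (x - y)) = (\<integral>y. (indicator K y * G y $ i) * \<rho> (x - y) \<partial>lebesgue)"
    unfolding set_lebesgue_integral_def
  proof (rule Bochner_Integration.integral_cong[OF refl])
    fix y
    show "indicat_real \<Omega> y *\<^sub>R (G y $ i * \<rho> (x - y)) = (indicator K y * G y $ i) * \<rho> (x - y)"
      using x(2) \<rho>(1)[of "x - y"] far[of y] by (cases "y \<in> K") (auto simp: indicator_def)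
  qed
  also have "\<dots> = (\<integral>y. g y * \<rho> (x - y) \<partial>lebesgue)"
  proof (rule integral_cong_AE)
    show "AE y in lebesgue. (indicator K y * G y $ i) * \<rho> (x - y) = g y * \<rho> (x - y)"
      using g(2) by eventually_elim simp
    have "(\<lambda>y. \<rho> (x - y)) \<in> borel_measurable lebesgue" by (intro measurable_completion) simp
    then show "(\<lambda>y. (indicator K y * G y $ i) * \<rho> (x - y)) \<in> borel_measurable lebesgue"
      using Gm by (rule borel_measurable_times[rotated])
    show "(\<lambda>y. g y * \<rho> (x - y)) \<in> borel_measurable lebesgue" by (intro measurable_completion) simp
  qed
  also have "\<dots> = (\<integral>y. g y * \<rho> (x - y) \<partial>lborel)"
    by (subst integral_completion) auto
  finally show ?thesis using 1 eq by simp
qed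

text \<open>For the mollification \<open>U n\<close> the identity is the classical product rule for
  a compactly supported function. The mollified gradient need not be followed to its limit: Fubini
  moves the mollifier from the merely integrable \<open>g\<close> onto the continuous factor
  \<open>h n\<close>, where pointwise convergence and domination by a multiple of
  \<open>\<bar>g\<bar>\<close> suffice.\<close>

lemma weak_chain_rule:
  fixes \<Omega> :: "(real^'n::finite) set" and i :: 'n
  assumes \<Omega>: "open \<Omega>" and u: "continuous_on \<Omega> u" and wg: "has_weak_gradient \<Omega> u G"
    and \<Phi>: "\<And>s. (\<Phi> has_real_derivative \<Phi>' s) (at s)" "continuous_on UNIV \<Phi>'"
    and K: "compact K" "K \<subseteq> \<Omega>"
    and \<psi>: "continuous_on UNIV \<psi>" "continuous_on UNIV \<psi>'" "\<And>x. x \<notin> K \<Longrightarrow> \<psi> x = 0" "\<And>x. x \<notin> K \<Longrightarrow> \<psi>' x = 0"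
      "\<And>x. ((\<lambda>s. \<psi> (x + s *\<^sub>R axis i 1)) has_real_derivative \<psi>' x) (at 0)"
  shows "(\<integral>x. indicator K x * (\<Phi> (u x) * \<psi>' x) \<partial>lebesgue) = - (\<integral>x. indicator K x * (\<Phi>' (u x) * G x $ i * \<psi> x) \<partial>lebesgue)"
proof -
  let ?e = "axis i 1 :: real^'n"
  obtain \<delta> where \<delta>: "0 < \<delta>" "(\<Union>x\<in>K. cball x \<delta>) \<subseteq> \<Omega>"
    using compact_subset_open_imp_cball_epsilon_subset[OF K(1) \<Omega> K(2)] by blast
  \<comment> \<open>A compact neighbourhood of \<open>K\<close> inside \<Omega>, since mollification
    at points of \<open>K\<close> reads \<open>u\<close> and \<open>G\<close> nearby. As a sum of
    compact sets it is compact at once.\<close>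
  define K2 where "K2 = {x + y |x y. x \<in> K \<and> y \<in> cball 0 \<delta>}"
  have K2_eq: "K2 = (\<Union>x\<in>K. cball x \<delta>)"
  proof (safe)
    fix z assume "z \<in> K2"
    then show "z \<in> (\<Union>x\<in>K. cball x \<delta>)" by (force simp: K2_def dist_norm)
  next
    fix x z assume "x \<in> K" "z \<in> cball x \<delta>"
    then have "z = x + (z - x)" "z - x \<in> cball 0 \<delta>" by (auto simp: dist_norm norm_minus_commute)
    then show "z \<in> K2" using \<open>x \<in> K\<close> unfolding K2_def by blast
  qed
  have K2: "compact K2" "K2 \<subseteq> \<Omega>" "K \<subseteq> K2"
  proof -
    show "compact K2" unfolding K2_def by (rule compact_sums[OF K(1) compact_cball])
    show "K2 \<subseteq> \<Omega>" "K \<subseteq> K2" using \<delta> by (auto simp: K2_eq intro!: bexI)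
  qed
  define f where "f y = indicator K2 y * u y" for y
  have "integrable lborel (\<lambda>y. indicator K2 y *\<^sub>R u y)"
    by (rule borel_integrable_compact[OF K2(1)]) (use u K2 in \<open>auto intro: continuous_on_subset\<close>)
  then have f: "integrable lborel f" by (simp add: f_def[abs_def])
  then have fm[measurable]: "f \<in> borel_measurable borel" by auto
  have "set_integrable lebesgue K2 (\<lambda>x. G x $ i)"
    using wg K2 unfolding has_weak_gradient_def by blast
  then have G: "integrable lebesgue (\<lambda>y. indicator K2 y * G y $ i)"
    by (simp add: set_integrable_def)
  then have Gm: "(\<lambda>y. indicator K2 y * G y $ i) \<in> borel_measurable lebesgue" by auto
  obtain g where gm[measurable]: "g \<in> borel_measurable borel" and gAE: "AE y in lborel. indicator K2 y * G y $ i = g y"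
    using completion_ex_borel_measurable_real[OF Gm] by auto
  have gAE': "AE y in lebesgue. g y = indicator K2 y * G y $ i"
    using AE_completion[OF gAE] by eventually_elim simp
  have "integrable lebesgue g"
    using G gAE' Gm by (subst integrable_cong_AE[where g="\<lambda>y. indicator K2 y * G y $ i"]) (auto intro: measurable_completion)
  then have g: "integrable lborel g" by (simp add: integrable_completion)
  obtain B\<psi> where B\<psi>: "0 < B\<psi>" "\<And>x. \<bar>\<psi> x\<bar> \<le> B\<psi>" using compact_support_bounded[OF \<psi>(1,3) K(1)] by blast
  obtain B\<psi>' where B\<psi>': "0 < B\<psi>'" "\<And>x. \<bar>\<psi>' x\<bar> \<le> B\<psi>'" using compact_support_bounded[OF \<psi>(2,4) K(1)] by blast
  have \<Phi>c: "continuous_on UNIV \<Phi>" using \<Phi>(1) by (meson DERIV_continuous continuous_at_imp_continuous_on)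
  have [measurable]: "\<psi> \<in> borel_measurable borel" "\<psi>' \<in> borel_measurable borel" "\<Phi> \<in> borel_measurable borel" "\<Phi>' \<in> borel_measurable borel"
    using \<psi>(1,2) \<Phi>c \<Phi>(2) by (auto intro: borel_measurable_continuous_onI)
  have Kb: "K \<in> sets borel" using K(1) by (simp add: compact_imp_closed)
  then have [measurable]: "K \<in> sets lborel" by simp
  have "bounded (u ` K2)" using u K2 by (intro compact_imp_bounded compact_continuous_image) (auto intro: continuous_on_subset)
  then obtain Bu where Bu: "0 < Bu" "\<And>x. x \<in> K2 \<Longrightarrow> \<bar>u x\<bar> \<le> Bu" by (auto simp: bounded_pos)
  define \<epsilon> where "\<epsilon> n = \<delta> / real (n + 2)" for n
  have \<epsilon>: "0 < \<epsilon> n" "\<epsilon> n \<le> \<delta> / 2" for n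
  proof -
    show "0 < \<epsilon> n" using \<delta> by (simp add: \<epsilon>_def)
    show "\<epsilon> n \<le> \<delta> / 2" unfolding \<epsilon>_def using \<delta> by (intro divide_left_mono) auto
  qed
  have \<epsilon>0: "\<epsilon> \<longlonglongrightarrow> 0"
    unfolding \<epsilon>_def by (rule LIMSEQ_ignore_initial_segment[OF lim_const_over_n])
  define P where "P n \<rho> D \<longleftrightarrow> (\<forall>z. 0 \<le> \<rho> z) \<and> (\<forall>z. \<epsilon> n \<le> norm z \<longrightarrow> \<rho> z = 0) \<and>
    (\<forall>x k. Ck k (\<lambda>y. \<rho> (x - y))) \<and> (\<forall>z. (\<rho> has_derivative D z) (at z)) \<and>
    (\<forall>v. continuous_on UNIV (\<lambda>z. D z v)) \<and> integrable lborel \<rho> \<and> integral\<^sup>L lborel \<rho> = 1 \<and>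
    (\<forall>z. \<rho> (- z) = \<rho> z)" for n and \<rho> :: "real^'n \<Rightarrow> real" and D
  have "\<exists>\<rho> D. P n \<rho> D" for n
  proof (rule mollifier[OF \<epsilon>(1)[of n], where 'n='n])
    fix \<rho> :: "real^'n \<Rightarrow> real" and D
    assume "\<And>z. 0 \<le> \<rho> z" "\<And>z. \<epsilon> n \<le> norm z \<Longrightarrow> \<rho> z = 0"
      "\<And>x k. Ck k (\<lambda>y. \<rho> (x - y))" "\<And>z. (\<rho> has_derivative D z) (at z)"
      "\<And>v. continuous_on UNIV (\<lambda>z. D z v)" "integrable lborel \<rho>" "integral\<^sup>L lborel \<rho> = 1"
      "\<And>z. \<rho> (- z) = \<rho> z"
    then have "P n \<rho> D" by (simp add: P_def)
    then show "\<exists>\<rho> D. P n \<rho> D" by blast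
  qed
  then have "\<forall>n. \<exists>\<rho> D. P n \<rho> D" by simp
  then obtain \<rho> where "\<forall>n. \<exists>D. P n (\<rho> n) D" by (rule choice[THEN exE])
  then obtain D where "\<forall>n. P n (\<rho> n) (D n)" by (rule choice[THEN exE])
  then have \<rho>: "\<And>n z. 0 \<le> \<rho> n z" "\<And>n z. \<epsilon> n \<le> norm z \<Longrightarrow> \<rho> n z = 0"
    "\<And>n x k. Ck k (\<lambda>y. \<rho> n (x - y))" "\<And>n z. (\<rho> n has_derivative D n z) (at z)"
    "\<And>n v. continuous_on UNIV (\<lambda>z. D n z v)" "\<And>n. integrable lborel (\<rho> n)" "\<And>n. integral\<^sup>L lborel (\<rho> n) = 1"
    "\<And>n z. \<rho> n (- z) = \<rho> n z" by (simp_all add: P_def)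
  have \<rho>c: "continuous_on UNIV (\<rho> n)" for n
    using \<rho>(4) by (meson continuous_at_imp_continuous_on has_derivative_continuous)
  have [measurable]: "\<rho> n \<in> borel_measurable borel" "(\<lambda>z. D n z ?e) \<in> borel_measurable borel" for n
    using \<rho>c \<rho>(5) by (auto intro: borel_measurable_continuous_onI)
  have D0: "D n z v = 0" if "\<epsilon> n < norm z" for n z v
  proof -
    have "((\<lambda>_. 0) has_derivative (\<lambda>_. 0)) (at z)" by simp
    then have "(\<rho> n has_derivative (\<lambda>_. 0)) (at z)"
      by (rule has_derivative_transform_within_open[where s="{z. \<epsilon> n < norm z}"])
        (use that \<rho>(2)[of n] in \<open>auto intro: open_Collect_less continuous_intros\<close>)
    then show ?thesis using has_derivative_unique[OF \<rho>(4)] by metis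
  qed
  have \<rho>B: "\<exists>B. \<forall>z. \<bar>\<rho> n z\<bar> \<le> B" for n
    using compact_support_bounded[OF \<rho>c, of "cball 0 (\<epsilon> n)" n] \<rho>(2)[of n]
    by (metis compact_cball less_imp_le mem_cball_0 not_le)
  have DB: "\<exists>B. \<forall>z. \<bar>D n z ?e\<bar> \<le> B" for n
    using compact_support_bounded[OF \<rho>(5), of "cball 0 (\<epsilon> n)" n ?e] D0[of n _ ?e]
    by (metis compact_cball mem_cball_0 not_le)
  define U where "U n x = (\<integral>y. f y * \<rho> n (x - y) \<partial>lborel)" for n x
  define V where "V n x = (\<integral>y. g y * \<rho> n (x - y) \<partial>lborel)" for n x
  have Uc: "continuous_on UNIV (U n)" for n
    unfolding U_def using \<rho>B[of n] convolution_continuous[OF f \<rho>c[of n]] by blast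
  have Vc: "continuous_on UNIV (V n)" for n
    unfolding V_def using \<rho>B[of n] convolution_continuous[OF g \<rho>c[of n]] by blast
  note [measurable] = borel_measurable_continuous_onI[OF Uc] borel_measurable_continuous_onI[OF Vc]
  have dir: "((\<lambda>s. \<rho> n (z + s *\<^sub>R ?e)) has_real_derivative D n z ?e) (at 0)" for n z
  proof -
    have "((\<lambda>s. z + s *\<^sub>R ?e) has_derivative (\<lambda>s. s *\<^sub>R ?e)) (at 0)"
      by (auto intro!: derivative_eq_intros)
    from has_derivative_compose[OF this, of "\<rho> n" "D n z"] \<rho>(4)[of n z]
    have "((\<lambda>s. \<rho> n (z + s *\<^sub>R ?e)) has_derivative (\<lambda>s. D n z (s *\<^sub>R ?e))) (at 0)" by simp
    moreover have "(\<lambda>s. D n z (s *\<^sub>R ?e)) = (*) (D n z ?e)"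
      using linear_scale[OF has_derivative_linear[OF \<rho>(4)[of n z]]] by (auto simp: fun_eq_iff)
    ultimately show ?thesis by (simp add: has_field_derivative_def)
  qed
  have Uder: "((\<lambda>s. U n (x + s *\<^sub>R ?e)) has_real_derivative V n x) (at 0)" if "x \<in> K" for n x
  proof -
    obtain B0 B where B: "\<And>z. \<bar>\<rho> n z\<bar> \<le> B0" "\<And>z. \<bar>D n z ?e\<bar> \<le> B" using \<rho>B[of n] DB[of n] by blast
    have "((\<lambda>s. U n (x + s *\<^sub>R ?e)) has_real_derivative (\<integral>y. f y * D n (x - y) ?e \<partial>lborel)) (at 0)"
      unfolding U_def by (rule convolution_deriv[OF f _ B(1) _ B(2) dir]) auto
    also have "(\<integral>y. f y * D n (x - y) ?e \<partial>lborel) = V n x"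
      unfolding V_def
    proof (rule mollified_weak_gradient[OF wg \<rho>(2)[of n] \<rho>(3) \<rho>(4) \<rho>(5) D0 _ K2(2) fm f_def gm gAE' Gm])
      show "cball x (\<epsilon> n) \<subseteq> K2"
        using \<epsilon>(2)[of n] \<delta>(1) that by (auto simp: K2_eq intro!: bexI[of _ x])
    qed
    finally show ?thesis .
  qed
  have Ulim: "\<bar>U n x - u x0\<bar> \<le> \<eta>"
    if "\<And>y. norm (x - y) < \<epsilon> n \<Longrightarrow> \<bar>u y - u x0\<bar> \<le> \<eta>" "x0 \<in> K" "norm (x0 - x) \<le> \<epsilon> n" for n x x0 \<eta>
    unfolding U_def
  proof (rule mollifier_approx[OF \<rho>(1,2) \<rho>(6,7) fm])
    fix y assume y: "norm (x - y) < \<epsilon> n"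
    then have "norm (x0 - y) \<le> \<delta>"
      using \<epsilon>(2)[of n] that(3) norm_triangle_ineq[of "x0 - x" "x - y"] by simp
    then have "y \<in> K2" using that(2) by (auto simp: K2_eq dist_norm)
    then show "\<bar>f y - u x0\<bar> \<le> \<eta>" using that(1)[OF y] by (simp add: f_def)
  qed
  have UB: "\<bar>U n x\<bar> \<le> Bu" for n x
  proof -
    have "\<bar>U n x - 0\<bar> \<le> Bu" unfolding U_def
      by (rule mollifier_approx[OF \<rho>(1,2) \<rho>(6,7) fm]) (use Bu in \<open>auto simp: f_def indicator_def\<close>)
    then show ?thesis by simp
  qed
  have near: "\<exists>d>0. \<forall>y. norm (x0 - y) < d \<longrightarrow> \<bar>u y - u x0\<bar> \<le> \<eta>" if x\<eta>: "x0 \<in> K" "0 < \<eta>" for x0 \<eta>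
  proof -
    have "isCont u x0" using u \<Omega> K x\<eta> by (meson continuous_on_eq_continuous_at subsetD)
    then obtain d where "0 < d" "\<And>y. dist y x0 < d \<Longrightarrow> dist (u y) (u x0) < \<eta>"
      using x\<eta>(2) unfolding continuous_at_eps_delta by blast
    then show ?thesis by (intro exI[of _ d]) (auto simp: dist_norm norm_minus_commute intro: less_imp_le)
  qed
  \<comment> \<open>Uniform over the ball of radius \<open>\<epsilon> n\<close> about
    \<open>x0\<close>, because \<open>hlim\<close> averages \<open>h n\<close> over such a
    ball.\<close>
  have conv: "\<exists>N. \<forall>n\<ge>N. \<forall>x. norm (x0 - x) \<le> \<epsilon> n \<longrightarrow> \<bar>U n x - u x0\<bar> \<le> r" if x0: "x0 \<in> K" "0 < r" for x0 r
  proof -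
    obtain d where d: "0 < d" "\<And>y. norm (x0 - y) < d \<Longrightarrow> \<bar>u y - u x0\<bar> \<le> r"
      using near[OF x0] by auto
    obtain N where N: "\<And>n. N \<le> n \<Longrightarrow> \<epsilon> n < d / 2"
      using order_tendstoD(2)[OF \<epsilon>0, of "d/2"] d(1) by (auto simp: eventually_sequentially)
    have "\<bar>U n x - u x0\<bar> \<le> r" if n: "N \<le> n" and x: "norm (x0 - x) \<le> \<epsilon> n" for n x
    proof (rule Ulim[OF d(2) x0(1) x])
      fix y assume "norm (x - y) < \<epsilon> n"
      then show "norm (x0 - y) < d"
        using N[OF n] x norm_triangle_ineq[of "x0 - x" "x - y"] by simp
    qed
    then show ?thesis by blast
  qed
  have convp: "(\<lambda>n. U n x) \<longlonglongrightarrow> u x" if xK: "x \<in> K" for x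
  proof (rule metric_LIMSEQ_I)
    fix r :: real assume "0 < r"
    then have "\<exists>N. \<forall>n\<ge>N. \<forall>z. norm (x - z) \<le> \<epsilon> n \<longrightarrow> \<bar>U n z - u x\<bar> \<le> r / 2"
      using conv[OF xK, of "r/2"] by simp
    then obtain N where N: "\<forall>n\<ge>N. \<forall>z. norm (x - z) \<le> \<epsilon> n \<longrightarrow> \<bar>U n z - u x\<bar> \<le> r / 2" ..
    show "\<exists>N. \<forall>n\<ge>N. dist (U n x) (u x) < r"
    proof (intro exI[of _ N] allI impI)
      fix n assume "N \<le> n"
      moreover have "norm (x - x) \<le> \<epsilon> n" using \<epsilon>(1)[of n] by simp
      ultimately have "\<bar>U n x - u x\<bar> \<le> r / 2" using N by blast
      then show "dist (U n x) (u x) < r" using \<open>0 < r\<close> by (simp add: dist_real_def)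
    qed
  qed
  define h where "h n x = \<Phi>' (U n x) * \<psi> x" for n x
  define h0 where "h0 x = indicator K x * (\<Phi>' (u x) * \<psi> x)" for x
  have hm[measurable]: "h n \<in> borel_measurable borel" for n unfolding h_def by measurable
  have "compact {-Bu..Bu}" by simp
  then have "bounded (\<Phi>' ` {-Bu..Bu})" "bounded (\<Phi> ` {-Bu..Bu})"
    using \<Phi>(2) \<Phi>c by (auto intro!: compact_imp_bounded compact_continuous_image intro: continuous_on_subset)
  then obtain B1 B2 where B1: "0 < B1" "\<And>s. \<bar>s\<bar> \<le> Bu \<Longrightarrow> \<bar>\<Phi>' s\<bar> \<le> B1" and B2: "0 < B2" "\<And>s. \<bar>s\<bar> \<le> Bu \<Longrightarrow> \<bar>\<Phi> s\<bar> \<le> B2"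
    unfolding bounded_pos by (auto simp: abs_le_iff)
  have hB: "\<bar>h n x\<bar> \<le> B1 * B\<psi>" for n x
    unfolding h_def abs_mult by (intro mult_mono B1 UB B\<psi>) (use B1 in auto)
  have hK: "h n x = 0" if "x \<notin> K" for n x using \<psi>(3)[OF that] by (simp add: h_def)
  \<comment> \<open>\<open>\<Phi> (U n) * \<psi>\<close> vanishes off \<open>K\<close>, so its
    partial derivative integrates to zero. \<open>Uder\<close> is available on \<open>K\<close>
    only; off \<open>K\<close> the product is locally zero.\<close>
  have zero: "(\<integral>x. h n x * V n x + \<Phi> (U n x) * \<psi>' x \<partial>lborel) = 0" for n
  proof (rule integral_partial_derivative_0[where W="\<lambda>x. \<Phi> (U n x) * \<psi> x" and e="?e" and K=K])
    show "continuous_on UNIV (\<lambda>x. \<Phi> (U n x) * \<psi> x)"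
      by (intro continuous_intros \<psi> continuous_on_compose2[OF \<Phi>c Uc]) auto
    show "continuous_on UNIV (\<lambda>x. h n x * V n x + \<Phi> (U n x) * \<psi>' x)"
      unfolding h_def
      by (intro continuous_intros \<psi> Vc continuous_on_compose2[OF \<Phi>c Uc] continuous_on_compose2[OF \<Phi>(2) Uc]) auto
    show "((\<lambda>s. \<Phi> (U n (z + s *\<^sub>R ?e)) * \<psi> (z + s *\<^sub>R ?e)) has_real_derivative h n z * V n z + \<Phi> (U n z) * \<psi>' z) (at 0)" for z
    proof (cases "z \<in> K")
      case True
      have "((\<lambda>s. \<Phi> (U n (z + s *\<^sub>R ?e))) has_real_derivative \<Phi>' (U n z) * V n z) (at 0)"
        using DERIV_chain2[OF _ Uder[OF True, of n], of \<Phi> "\<Phi>' (U n z)"] \<Phi>(1)[of "U n z"] by simp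
      from DERIV_mult[OF this \<psi>(5)[of z]] show ?thesis by (simp add: h_def algebra_simps)
    next
      case False
      have "open {s. z + s *\<^sub>R ?e \<in> - K}"
        using K(1) by (intro open_vimage[unfolded vimage_def] continuous_intros) (auto simp: compact_imp_closed)
      moreover have "((\<lambda>s::real. 0::real) has_real_derivative 0) (at 0)" by simp
      ultimately have "((\<lambda>s. \<Phi> (U n (z + s *\<^sub>R ?e)) * \<psi> (z + s *\<^sub>R ?e)) has_real_derivative 0) (at 0)"
        using False \<psi>(3) by (elim has_field_derivative_transform_within_open) auto
      then show ?thesis using hK[OF False] \<psi>(4)[OF False] by simp
    qed
  qed (use K hK \<psi> in auto)
  have intK: "integrable lborel (indicator K :: _ \<Rightarrow> real)"
    using emeasure_bounded_finite[OF compact_imp_bounded[OF K(1)]] Kb by (intro integrable_real_indicator) auto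
  \<comment> \<open>A bound that depends on \<open>n\<close> is enough, as it serves integrability
    for each fixed \<open>n\<close>.\<close>
  have VB: "\<bar>V n x\<bar> \<le> (SOME B. \<forall>z. \<bar>\<rho> n z\<bar> \<le> B) * (\<integral>y. \<bar>g y\<bar> \<partial>lborel)" for n x
  proof -
    define B where "B = (SOME B. \<forall>z. \<bar>\<rho> n z\<bar> \<le> B)"
    have B: "\<bar>\<rho> n z\<bar> \<le> B" for z unfolding B_def using someI_ex[OF \<rho>B[of n]] by blast
    have "\<bar>V n x\<bar> \<le> (\<integral>y. \<bar>g y * \<rho> n (x - y)\<bar> \<partial>lborel)" unfolding V_def by (rule integral_abs_bound)
    also have "\<dots> \<le> (\<integral>y. B * \<bar>g y\<bar> \<partial>lborel)"
    proof (rule integral_mono)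
      show "integrable lborel (\<lambda>y. \<bar>g y * \<rho> n (x - y)\<bar>)"
        by (intro integrable_abs integrable_mult_bounded[OF g _ B]) auto
      show "\<bar>g y * \<rho> n (x - y)\<bar> \<le> B * \<bar>g y\<bar>" for y
        using mult_left_mono[OF B[of "x - y"], of "\<bar>g y\<bar>"] by (simp add: abs_mult mult.commute)
    qed (use g in auto)
    finally show ?thesis by (simp add: B_def)
  qed
  have int1: "integrable lborel (\<lambda>x. h n x * V n x)" for n
  proof -
    have "integrable lborel (\<lambda>x. indicator K x * (h n x * V n x))"
      by (rule integrable_mult_bounded[OF intK, where B="(B1 * B\<psi>) * ((SOME B. \<forall>z. \<bar>\<rho> n z\<bar> \<le> B) * (\<integral>y. \<bar>g y\<bar> \<partial>lborel))"])
        (use B1(1) B\<psi>(1) in \<open>auto simp: abs_mult intro!: mult_mono hB VB\<close>)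
    also have "(\<lambda>x. indicator K x * (h n x * V n x)) = (\<lambda>x. h n x * V n x)"
      using hK by (auto simp: indicator_def fun_eq_iff)
    finally show ?thesis .
  qed
  have int2: "integrable lborel (\<lambda>x. \<Phi> (U n x) * \<psi>' x)" for n
  proof -
    have "integrable lborel (\<lambda>x. indicator K x * (\<Phi> (U n x) * \<psi>' x))"
      by (rule integrable_mult_bounded[OF intK, where B="B2 * B\<psi>'"])
        (use B2 in \<open>auto simp: abs_mult intro!: mult_mono B\<psi>' B2 UB\<close>)
    also have "(\<lambda>x. indicator K x * (\<Phi> (U n x) * \<psi>' x)) = (\<lambda>x. \<Phi> (U n x) * \<psi>' x)"
      using \<psi>(4) by (auto simp: indicator_def fun_eq_iff)
    finally show ?thesis .
  qed
  \<comment> \<open>Symmetry of the mollifier turns \<open>\<rho> n (x - y)\<close> into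
    \<open>\<rho> n (y - x)\<close>, so the inner integral is a mollification of \<open>h n\<close>
    at \<open>y\<close>.\<close>
  have fub: "(\<integral>x. h n x * V n x \<partial>lborel) = (\<integral>y. g y * (\<integral>x. h n x * \<rho> n (y - x) \<partial>lborel) \<partial>lborel)" for n
  proof -
    obtain B where B: "\<And>z. \<bar>\<rho> n z\<bar> \<le> B" using \<rho>B[of n] by blast
    have prod: "integrable (lborel \<Otimes>\<^sub>M lborel) (\<lambda>(x, y). h n x * g y)"
    proof (rule lborel_pair.Fubini_integrable)
      have "integrable lborel (\<lambda>x. indicator K x * h n x)"
        by (rule integrable_mult_bounded[OF intK _ hB]) auto
      also have "(\<lambda>x. indicator K x * h n x) = h n" using hK by (auto simp: indicator_def fun_eq_iff)
      finally have ih: "integrable lborel (h n)" .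
      show "integrable lborel (\<lambda>x. \<integral>y. norm (case (x, y) of (x, y) \<Rightarrow> h n x * g y) \<partial>lborel)"
        using ih by (simp add: abs_mult)
      show "AE x in lborel. integrable lborel (\<lambda>y. case (x, y) of (x, y) \<Rightarrow> h n x * g y)"
        using g by simp
    qed auto
    have "integrable (lborel \<Otimes>\<^sub>M lborel) (\<lambda>(x, y). h n x * (g y * \<rho> n (x - y)))"
    proof (rule Bochner_Integration.integrable_bound[OF integrable_mult_right[OF prod, of B]])
      show "(\<lambda>(x, y). h n x * (g y * \<rho> n (x - y))) \<in> borel_measurable (lborel \<Otimes>\<^sub>M lborel)"
        by measurable
      show "AE p in lborel \<Otimes>\<^sub>M lborel. norm (case p of (x, y) \<Rightarrow> h n x * (g y * \<rho> n (x - y))) \<le> norm (B * (case p of (x, y) \<Rightarrow> h n x * g y))"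
      proof (rule AE_I2)
        fix p :: "(real^'n) \<times> (real^'n)"
        obtain x y where p: "p = (x, y)" by (cases p)
        have "\<bar>\<rho> n (x - y)\<bar> \<le> \<bar>B\<bar>" using B[of "x - y"] by linarith
        from mult_left_mono[OF this, of "\<bar>h n x * g y\<bar>"]
        show "norm (case p of (x, y) \<Rightarrow> h n x * (g y * \<rho> n (x - y))) \<le> norm (B * (case p of (x, y) \<Rightarrow> h n x * g y))"
          by (simp add: p abs_mult algebra_simps)
      qed
    qed
    from lborel_pair.Fubini_integral[OF this]
    have "(\<integral>x. h n x * V n x \<partial>lborel) = (\<integral>y. (\<integral>x. h n x * (g y * \<rho> n (x - y)) \<partial>lborel) \<partial>lborel)"
      by (simp add: V_def)
    also have "\<dots> = (\<integral>y. g y * (\<integral>x. h n x * \<rho> n (y - x) \<partial>lborel) \<partial>lborel)"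
    proof (rule Bochner_Integration.integral_cong[OF refl])
      fix y
      have "h n x * (g y * \<rho> n (x - y)) = g y * (h n x * \<rho> n (y - x))" for x
        using \<rho>(8)[of n "x - y"] by simp
      then have "(\<lambda>x. h n x * (g y * \<rho> n (x - y))) = (\<lambda>x. g y * (h n x * \<rho> n (y - x)))" by blast
      then show "(\<integral>x. h n x * (g y * \<rho> n (x - y)) \<partial>lborel) = g y * (\<integral>x. h n x * \<rho> n (y - x) \<partial>lborel)"
        by (simp only: integral_mult_right_zero)
    qed
    finally show ?thesis .
  qed
  have hlim: "(\<lambda>n. \<integral>x. h n x * \<rho> n (y - x) \<partial>lborel) \<longlonglongrightarrow> h0 y" for y
  proof (rule metric_LIMSEQ_I)
    fix r :: real assume r: "0 < r"
    have "\<exists>N. \<forall>n\<ge>N. \<forall>x. norm (y - x) < \<epsilon> n \<longrightarrow> \<bar>h n x - h0 y\<bar> \<le> r / 2"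
    proof (cases "y \<in> K")
      case False
      have "open (- K)" using K(1) by (simp add: compact_imp_closed open_Compl)
      then obtain d where d: "0 < d" "ball y d \<subseteq> - K" using False by (meson ComplI openE)
      obtain N where N: "\<And>n. N \<le> n \<Longrightarrow> \<epsilon> n < d"
        using order_tendstoD(2)[OF \<epsilon>0 d(1)] by (auto simp: eventually_sequentially)
      have "\<bar>h n x - h0 y\<bar> \<le> r / 2" if "N \<le> n" "norm (y - x) < \<epsilon> n" for n x
      proof -
        have "x \<in> ball y d" using that N[of n] by (simp add: dist_norm)
        then show ?thesis using d(2) hK[of x n] False r by (auto simp: h0_def)
      qed
      then show ?thesis by blast
    next
      case True
      have "isCont \<Phi>' (u y)" using \<Phi>(2) by (simp add: continuous_on_eq_continuous_at)
      then obtain d1 where d1: "0 < d1" "\<And>a. dist a (u y) < d1 \<Longrightarrow> dist (\<Phi>' a) (\<Phi>' (u y)) < r / (4 * B\<psi>)"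
        using r B\<psi>(1) unfolding continuous_at_eps_delta by (metis divide_pos_pos mult_pos_pos zero_less_numeral)
      have "isCont \<psi> y" using \<psi>(1) by (simp add: continuous_on_eq_continuous_at)
      then obtain d2 where d2: "0 < d2" "\<And>x. dist x y < d2 \<Longrightarrow> dist (\<psi> x) (\<psi> y) < r / (4 * B1)"
        using r B1(1) unfolding continuous_at_eps_delta by (metis divide_pos_pos mult_pos_pos zero_less_numeral)
      obtain N1 where N1: "\<And>n x. N1 \<le> n \<Longrightarrow> norm (y - x) \<le> \<epsilon> n \<Longrightarrow> \<bar>U n x - u y\<bar> \<le> d1 / 2"
        using conv[OF True, of "d1/2"] d1(1) by auto
      obtain N2 where N2: "\<And>n. N2 \<le> n \<Longrightarrow> \<epsilon> n < d2"
        using order_tendstoD(2)[OF \<epsilon>0 d2(1)] by (auto simp: eventually_sequentially)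
      have "\<bar>h n x - h0 y\<bar> \<le> r / 2" if n: "max N1 N2 \<le> n" and x: "norm (y - x) < \<epsilon> n" for n x
      proof -
        have "\<bar>U n x - u y\<bar> \<le> d1 / 2" using N1[of n x] n x by simp
        then have a: "\<bar>\<Phi>' (U n x) - \<Phi>' (u y)\<bar> \<le> r / (4 * B\<psi>)"
          using d1(2)[of "U n x"] d1(1) by (simp add: dist_real_def)
        have b: "\<bar>\<psi> x - \<psi> y\<bar> \<le> r / (4 * B1)"
          using d2(2)[of x] N2[of n] n x by (simp add: dist_norm norm_minus_commute)
        have c: "\<bar>\<Phi>' (u y)\<bar> \<le> B1" using B1(2) Bu(2) True K2(3) by blast
        have "h n x - h0 y = (\<Phi>' (U n x) - \<Phi>' (u y)) * \<psi> x + \<Phi>' (u y) * (\<psi> x - \<psi> y)"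
          using True by (simp add: h_def h0_def algebra_simps)
        also have "\<bar>(\<Phi>' (U n x) - \<Phi>' (u y)) * \<psi> x + \<Phi>' (u y) * (\<psi> x - \<psi> y)\<bar>
          \<le> \<bar>\<Phi>' (U n x) - \<Phi>' (u y)\<bar> * \<bar>\<psi> x\<bar> + \<bar>\<Phi>' (u y)\<bar> * \<bar>\<psi> x - \<psi> y\<bar>"
          by (rule order.trans[OF abs_triangle_ineq]) (simp add: abs_mult)
        also have "\<dots> \<le> r / (4 * B\<psi>) * B\<psi> + B1 * (r / (4 * B1))"
          using r B\<psi>(1) B1(1) by (intro add_mono mult_mono a b c B\<psi>) auto
        also have "\<dots> = r / 2" using B\<psi>(1) B1(1) by simp
        finally show ?thesis .
      qed
      then show ?thesis by blast
    qed
    then obtain N where N: "\<And>n x. N \<le> n \<Longrightarrow> norm (y - x) < \<epsilon> n \<Longrightarrow> \<bar>h n x - h0 y\<bar> \<le> r / 2" by blast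
    show "\<exists>N. \<forall>n\<ge>N. dist (\<integral>x. h n x * \<rho> n (y - x) \<partial>lborel) (h0 y) < r"
    proof (intro exI[of _ N] allI impI)
      fix n assume "N \<le> n"
      have "\<bar>(\<integral>x. h n x * \<rho> n (y - x) \<partial>lborel) - h0 y\<bar> \<le> r / 2"
        by (rule mollifier_approx[OF \<rho>(1,2) \<rho>(6,7) hm]) (use N[OF \<open>N \<le> n\<close>] in auto)
      then show "dist (\<integral>x. h n x * \<rho> n (y - x) \<partial>lborel) (h0 y) < r" using r by (simp add: dist_real_def)
    qed
  qed
  have h0m: "h0 \<in> borel_measurable borel"
    by (rule borel_measurable_LIMSEQ_real[OF hlim]) measurable
  have lim1: "(\<lambda>n. \<integral>x. h n x * V n x \<partial>lborel) \<longlonglongrightarrow> (\<integral>y. g y * h0 y \<partial>lborel)"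
    unfolding fub
  proof (rule integral_dominated_convergence[where w="\<lambda>y. (B1 * B\<psi>) * \<bar>g y\<bar>"])
    show "AE y in lborel. (\<lambda>n. g y * (\<integral>x. h n x * \<rho> n (y - x) \<partial>lborel)) \<longlonglongrightarrow> g y * h0 y"
      by (intro AE_I2 tendsto_mult tendsto_const hlim)
    show "AE y in lborel. norm (g y * (\<integral>x. h n x * \<rho> n (y - x) \<partial>lborel)) \<le> (B1 * B\<psi>) * \<bar>g y\<bar>" for n
    proof (rule AE_I2)
      fix y
      have "\<bar>(\<integral>x. h n x * \<rho> n (y - x) \<partial>lborel) - 0\<bar> \<le> B1 * B\<psi>"
        by (rule mollifier_approx[OF \<rho>(1,2) \<rho>(6,7) hm]) (use hB in auto)
      from mult_left_mono[OF this, of "\<bar>g y\<bar>"]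
      show "norm (g y * (\<integral>x. h n x * \<rho> n (y - x) \<partial>lborel)) \<le> (B1 * B\<psi>) * \<bar>g y\<bar>" by (simp add: abs_mult mult.commute)
    qed
  qed (use g h0m in auto)
  have lim2: "(\<lambda>n. \<integral>x. \<Phi> (U n x) * \<psi>' x \<partial>lborel) \<longlonglongrightarrow> (\<integral>x. indicator K x * (\<Phi> (f x) * \<psi>' x) \<partial>lborel)"
  proof (rule integral_dominated_convergence[where w="\<lambda>y. (B2 * B\<psi>') * indicator K y"])
    show "AE x in lborel. (\<lambda>n. \<Phi> (U n x) * \<psi>' x) \<longlonglongrightarrow> indicator K x * (\<Phi> (f x) * \<psi>' x)"
    proof (rule AE_I2)
      fix x
      show "(\<lambda>n. \<Phi> (U n x) * \<psi>' x) \<longlonglongrightarrow> indicator K x * (\<Phi> (f x) * \<psi>' x)"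
      proof (cases "x \<in> K")
        case True
        then have "(\<lambda>n. \<Phi> (U n x)) \<longlonglongrightarrow> \<Phi> (u x)"
          by (intro continuous_on_tendsto_compose[OF \<Phi>c] convp) auto
        then have "(\<lambda>n. \<Phi> (U n x) * \<psi>' x) \<longlonglongrightarrow> \<Phi> (u x) * \<psi>' x"
          by (intro tendsto_mult tendsto_const)
        moreover have "f x = u x" using True K2(3) by (auto simp: f_def)
        ultimately show ?thesis using True by simp
      qed (use \<psi>(4) in simp)
    qed
    show "AE x in lborel. norm (\<Phi> (U n x) * \<psi>' x) \<le> (B2 * B\<psi>') * indicator K x" for n
      using \<psi>(4) B2(1) by (intro AE_I2) (auto simp: indicator_def abs_mult intro!: mult_mono B2 UB B\<psi>')
  qed (use intK in auto)
  have "(\<integral>x. h n x * V n x \<partial>lborel) + (\<integral>x. \<Phi> (U n x) * \<psi>' x \<partial>lborel) = 0" for n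
    using zero[of n] int1[of n] int2[of n] by simp
  then have "(\<lambda>n. 0) \<longlonglongrightarrow> (\<integral>y. g y * h0 y \<partial>lborel) + (\<integral>x. indicator K x * (\<Phi> (f x) * \<psi>' x) \<partial>lborel)"
    using tendsto_add[OF lim1 lim2] by simp
  then have fin: "(\<integral>y. g y * h0 y \<partial>lborel) + (\<integral>x. indicator K x * (\<Phi> (f x) * \<psi>' x) \<partial>lborel) = 0"
    by (simp add: LIMSEQ_const_iff)
  have "(\<integral>x. indicator K x * (\<Phi> (f x) * \<psi>' x) \<partial>lborel) = (\<integral>x. indicator K x * (\<Phi> (f x) * \<psi>' x) \<partial>lebesgue)"
    by (subst integral_completion) auto
  also have "\<dots> = (\<integral>x. indicator K x * (\<Phi> (u x) * \<psi>' x) \<partial>lebesgue)"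
    using K2(3) by (intro Bochner_Integration.integral_cong) (auto simp: f_def indicator_def)
  finally have e1: "(\<integral>x. indicator K x * (\<Phi> (f x) * \<psi>' x) \<partial>lborel) = (\<integral>x. indicator K x * (\<Phi> (u x) * \<psi>' x) \<partial>lebesgue)" .
  have "(\<integral>y. g y * h0 y \<partial>lborel) = (\<integral>y. g y * h0 y \<partial>lebesgue)"
    using h0m by (subst integral_completion) auto
  also have "\<dots> = (\<integral>y. (indicator K2 y * G y $ i) * h0 y \<partial>lebesgue)"
  proof (rule integral_cong_AE)
    have h0l: "h0 \<in> borel_measurable lebesgue" using h0m by (intro measurable_completion) simp
    show "(\<lambda>y. g y * h0 y) \<in> borel_measurable lebesgue" using h0m by (intro measurable_completion) simp
    show "(\<lambda>y. (indicator K2 y * G y $ i) * h0 y) \<in> borel_measurable lebesgue"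
      by (rule borel_measurable_times[OF Gm h0l])
    show "AE y in lebesgue. g y * h0 y = (indicator K2 y * G y $ i) * h0 y"
      using gAE' by eventually_elim simp
  qed
  also have "\<dots> = (\<integral>x. indicator K x * (\<Phi>' (u x) * G x $ i * \<psi> x) \<partial>lebesgue)"
    using K2(3) by (intro Bochner_Integration.integral_cong) (auto simp: h0_def indicator_def)
  finally show ?thesis using fin e1 by simp
qed

lemma pos_part_square_deriv: "((\<lambda>x::real. (max 0 x)\<^sup>2) has_real_derivative 2 * max 0 x) (at x)"
proof -
  consider "x < 0" | "x = 0" | "0 < x" by linarith
  then show ?thesis
  proof cases
    case 1
    have "((\<lambda>_. 0) has_real_derivative 2 * max 0 x) (at x)" using 1 by simp
    then show ?thesis
      by (rule has_field_derivative_transform_within_open[where S="{..<0}"]) (use 1 in auto)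
  next
    case 2
    have "((\<lambda>h. ((max 0 (0 + h))\<^sup>2 - (max 0 0)\<^sup>2) / h) \<longlongrightarrow> 0) (at (0::real))"
    proof (rule Lim_null_comparison)
      show "\<forall>\<^sub>F h in at 0. norm (((max 0 (0 + h))\<^sup>2 - (max 0 0)\<^sup>2) / h) \<le> \<bar>h::real\<bar>"
        by (rule always_eventually) (auto simp: max_def power2_eq_square)
      show "((\<lambda>h::real. \<bar>h\<bar>) \<longlongrightarrow> 0) (at 0)" by (rule tendsto_rabs_zero) (rule tendsto_ident_at)
    qed
    then show ?thesis using 2 by (simp add: DERIV_def)
  next
    case 3
    have "((\<lambda>x. x\<^sup>2) has_real_derivative 2 * max 0 x) (at x)"
      using 3 by (auto intro!: derivative_eq_intros)
    then show ?thesis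
      by (rule has_field_derivative_transform_within_open[where S="{0<..}"]) (use 3 in auto)
  qed
qed

section \<open>Cutoffs and the regularised Riesz kernel\<close>

text \<open>A quadratic spline rising from 0 to 1 on the unit interval with slope at most 2. A
  continuous first derivative is enough: \<open>weak_chain_rule\<close> accepts such \<Phi> and such
  test factors.\<close>

definition hstep :: "real \<Rightarrow> real" where
  "hstep x = 2 * ((max 0 x)\<^sup>2 - 2 * (max 0 (x - 1/2))\<^sup>2 + (max 0 (x - 1))\<^sup>2)"

definition hstep' :: "real \<Rightarrow> real" where
  "hstep' x = 4 * (max 0 x - 2 * max 0 (x - 1/2) + max 0 (x - 1))"

lemma hstep_deriv: "(hstep has_real_derivative hstep' x) (at x)"
proof -
  have *: "((\<lambda>x::real. (max 0 (x - a))\<^sup>2) has_real_derivative 2 * max 0 (x - a)) (at x)" for a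
  proof -
    have "((\<lambda>x. x - a) has_real_derivative 1) (at x)" by (auto intro!: derivative_eq_intros)
    from DERIV_chain2[where f="\<lambda>x. (max 0 x)\<^sup>2" and g="\<lambda>x. x - a", OF pos_part_square_deriv this]
    show ?thesis by simp
  qed
  have "((\<lambda>x. 2 * ((max 0 x)\<^sup>2 - 2 * (max 0 (x - 1/2))\<^sup>2 + (max 0 (x - 1))\<^sup>2)) has_real_derivative
    2 * (2 * max 0 x - 2 * (2 * max 0 (x - 1/2)) + 2 * max 0 (x - 1))) (at x)"
    by (intro DERIV_cmult DERIV_add DERIV_diff pos_part_square_deriv *)
  then show ?thesis by (simp add: hstep_def[abs_def] hstep'_def algebra_simps)
qed

lemma hstep_eq_0: "x \<le> 0 \<Longrightarrow> hstep x = 0" "x \<le> 0 \<Longrightarrow> hstep' x = 0"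
  by (auto simp: hstep_def hstep'_def max_def)

lemma hstep_eq_1: "1 \<le> x \<Longrightarrow> hstep x = 1" "1 \<le> x \<Longrightarrow> hstep' x = 0"
  by (auto simp: hstep_def hstep'_def max_def power2_eq_square algebra_simps)

lemma hstep'_bounds: "0 \<le> hstep' x" "hstep' x \<le> 2"
  by (auto simp: hstep'_def max_def)

lemma hstep_bounds: "0 \<le> hstep x" "hstep x \<le> 1"
proof -
  have "mono hstep"
    by (rule monoI) (meson DERIV_nonneg_imp_nondecreasing hstep_deriv hstep'_bounds(1))
  then have "hstep (min x 0) \<le> hstep x" "hstep x \<le> hstep (max x 1)"
    by (auto simp: mono_def)
  then show "0 \<le> hstep x" "hstep x \<le> 1" by (simp_all add: hstep_eq_0 hstep_eq_1)
qed

lemma continuous_hstep: "continuous_on A hstep" "continuous_on A hstep'"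
  unfolding hstep_def[abs_def] hstep'_def[abs_def] by (intro continuous_intros)+

lemma norm2_directional_deriv:
  fixes y z e :: "'a::real_inner"
  shows "((\<lambda>s. (norm (y + s *\<^sub>R e - z))\<^sup>2) has_real_derivative 2 * ((y - z) \<bullet> e)) (at 0)"
proof -
  have eq: "(norm (y + s *\<^sub>R e - z))\<^sup>2 = (norm (y - z))\<^sup>2 + s * (2 * ((y - z) \<bullet> e)) + s\<^sup>2 * (e \<bullet> e)" for s
    unfolding power2_norm_eq_inner by (simp add: inner_simps algebra_simps inner_commute power2_eq_square)
  show ?thesis unfolding eq by (auto intro!: derivative_eq_intros)
qed

text \<open>Built on the squared norm to be differentiable at the centre; the transition takes place
  between radius \<open>r\<close> and \<open>sqrt 2 * r\<close>, hence within the doubled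
  ball.\<close>

definition zeta :: "'a::real_inner \<Rightarrow> real \<Rightarrow> 'a \<Rightarrow> real" where
  "zeta z r y = 1 - hstep ((norm (y - z))\<^sup>2 / r\<^sup>2 - 1)"

definition zeta' :: "'a::real_inner \<Rightarrow> real \<Rightarrow> 'a \<Rightarrow> 'a \<Rightarrow> real" where
  "zeta' z r e y = - (hstep' ((norm (y - z))\<^sup>2 / r\<^sup>2 - 1) * (2 * ((y - z) \<bullet> e) / r\<^sup>2))"

lemma zeta_deriv:
  "((\<lambda>s. zeta z r (y + s *\<^sub>R e)) has_real_derivative zeta' z r e y) (at 0)"
proof -
  have "((\<lambda>s. (norm (y + s *\<^sub>R e - z))\<^sup>2 / r\<^sup>2 - 1) has_real_derivative 2 * ((y - z) \<bullet> e) / r\<^sup>2) (at 0)"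
    using DERIV_diff[OF DERIV_cdivide[OF norm2_directional_deriv[of y e z], of "r\<^sup>2"] DERIV_const[of 1]] by simp
  from DERIV_chain2[OF _ this, of hstep] hstep_deriv
  have "((\<lambda>s. hstep ((norm (y + s *\<^sub>R e - z))\<^sup>2 / r\<^sup>2 - 1)) has_real_derivative
    hstep' ((norm (y - z))\<^sup>2 / r\<^sup>2 - 1) * (2 * ((y - z) \<bullet> e) / r\<^sup>2)) (at 0)" by simp
  from DERIV_diff[OF DERIV_const[of 1] this] show ?thesis by (simp add: zeta_def zeta'_def)
qed

lemma zeta_props:
  assumes r: "0 < r"
  shows "0 \<le> zeta z r y" "norm (y - z) \<le> r \<Longrightarrow> zeta z r y = 1" "2 * r \<le> norm (y - z) \<Longrightarrow> zeta z r y = 0"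
    "2 * r \<le> norm (y - z) \<Longrightarrow> zeta' z r e y = 0"
    "norm e \<le> 1 \<Longrightarrow> \<bar>zeta' z r e y\<bar> \<le> 8 / r * indicator (ball z (2 * r)) y"
proof -
  show "0 \<le> zeta z r y" using hstep_bounds by (simp add: zeta_def)
  show "zeta z r y = 1" if "norm (y - z) \<le> r"
  proof -
    have "(norm (y - z))\<^sup>2 \<le> r\<^sup>2" using that by (intro power_mono) auto
    then have "(norm (y - z))\<^sup>2 / r\<^sup>2 - 1 \<le> 0" using r by (simp add: field_simps)
    then show ?thesis by (simp add: zeta_def hstep_eq_0)
  qed
  have far: "1 \<le> (norm (y - z))\<^sup>2 / r\<^sup>2 - 1" if "2 * r \<le> norm (y - z)"
  proof -
    have "(2 * r)\<^sup>2 \<le> (norm (y - z))\<^sup>2" using that r by (intro power_mono) auto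
    moreover have "2 * r\<^sup>2 \<le> (2 * r)\<^sup>2" by (simp add: power_mult_distrib)
    ultimately have "2 * r\<^sup>2 \<le> (norm (y - z))\<^sup>2" by linarith
    then have "2 \<le> (norm (y - z))\<^sup>2 / r\<^sup>2" using r by (simp add: field_simps)
    then show ?thesis by simp
  qed
  show "zeta z r y = 0" if "2 * r \<le> norm (y - z)" using hstep_eq_1[OF far[OF that]] by (simp add: zeta_def)
  show z: "zeta' z r e y = 0" if "2 * r \<le> norm (y - z)" using hstep_eq_1[OF far[OF that]] by (simp add: zeta'_def)
  show "\<bar>zeta' z r e y\<bar> \<le> 8 / r * indicator (ball z (2 * r)) y" if e: "norm e \<le> 1"
  proof (cases "norm (y - z) < 2 * r")
    case True
    have "\<bar>(y - z) \<bullet> e\<bar> \<le> norm (y - z) * norm e" by (rule Cauchy_Schwarz_ineq2)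
    also have "\<dots> \<le> (2 * r) * 1" using True e r by (intro mult_mono) auto
    finally have i: "\<bar>2 * ((y - z) \<bullet> e) / r\<^sup>2\<bar> \<le> 4 / r" using r by (simp add: field_simps power2_eq_square abs_mult)
    have "\<bar>zeta' z r e y\<bar> \<le> 2 * (4 / r)"
      unfolding zeta'_def abs_minus_cancel abs_mult using hstep'_bounds
      by (intro mult_mono i[unfolded abs_mult]) (use r in auto)
    then show ?thesis using True by (simp add: dist_norm norm_minus_commute)
  qed (use z r in \<open>auto simp: not_less\<close>)
qed

lemma continuous_zeta: "continuous_on A (zeta z r)" "continuous_on A (zeta' z r e)"
  unfolding zeta_def[abs_def] zeta'_def[abs_def]
  by (auto intro!: continuous_intros continuous_on_compose2[OF continuous_hstep(1)[of UNIV]]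
      continuous_on_compose2[OF continuous_hstep(2)[of UNIV]] simp: divide_inverse)

text \<open>Composing the sum of the bumps with \<open>hstep\<close> caps it at 1 while keeping it
  differentiable, and the derivative is bounded by a plain sum over the balls, however much they
  overlap.\<close>

definition cutoff :: "'i set \<Rightarrow> ('i \<Rightarrow> 'a::real_inner) \<Rightarrow> ('i \<Rightarrow> real) \<Rightarrow> 'a \<Rightarrow> real" where
  "cutoff I z r y = hstep (\<Sum>i\<in>I. zeta (z i) (r i) y)"

definition cutoff' :: "'i set \<Rightarrow> ('i \<Rightarrow> 'a::real_inner) \<Rightarrow> ('i \<Rightarrow> real) \<Rightarrow> 'a \<Rightarrow> 'a \<Rightarrow> real" where
  "cutoff' I z r e y = hstep' (\<Sum>i\<in>I. zeta (z i) (r i) y) * (\<Sum>i\<in>I. zeta' (z i) (r i) e y)"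

lemma cutoff_deriv:
  "((\<lambda>s. cutoff I z r (y + s *\<^sub>R e)) has_real_derivative cutoff' I z r e y) (at 0)"
proof -
  have "((\<lambda>s. \<Sum>i\<in>I. zeta (z i) (r i) (y + s *\<^sub>R e)) has_real_derivative (\<Sum>i\<in>I. zeta' (z i) (r i) e y)) (at 0)"
    by (rule DERIV_sum) (rule zeta_deriv)
  from DERIV_chain2[OF _ this, of hstep] hstep_deriv show ?thesis
    by (simp add: cutoff_def[abs_def] cutoff'_def)
qed

lemma continuous_cutoff: "continuous_on A (cutoff I z r)" "continuous_on A (cutoff' I z r e)"
  unfolding cutoff_def[abs_def] cutoff'_def[abs_def]
  by (auto intro!: continuous_intros continuous_zeta continuous_on_compose2[OF continuous_hstep(1)[of UNIV]]
      continuous_on_compose2[OF continuous_hstep(2)[of UNIV]])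

lemma cutoff_bounds: "0 \<le> cutoff I z r y" "cutoff I z r y \<le> 1"
  by (simp_all add: cutoff_def hstep_bounds)

lemma cutoff_inside:
  assumes "finite I" "\<And>i. i \<in> I \<Longrightarrow> 0 < r i" "y \<in> (\<Union>i\<in>I. cball (z i) (r i))"
  shows "cutoff I z r y = 1" "cutoff' I z r e y = 0"
proof -
  obtain i where i: "i \<in> I" "norm (y - z i) \<le> r i"
    using assms(3) by (auto simp: dist_norm norm_minus_commute)
  have "zeta (z i) (r i) y \<le> (\<Sum>i\<in>I. zeta (z i) (r i) y)"
    using assms i zeta_props(1) by (intro member_le_sum) auto
  then have "1 \<le> (\<Sum>i\<in>I. zeta (z i) (r i) y)" using zeta_props(2)[OF assms(2)[OF i(1)] i(2)] by simp
  then show "cutoff I z r y = 1" "cutoff' I z r e y = 0"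
    by (simp_all add: cutoff_def cutoff'_def hstep_eq_1)
qed

lemma cutoff_outside:
  assumes "\<And>i. i \<in> I \<Longrightarrow> 0 < r i" "y \<notin> (\<Union>i\<in>I. ball (z i) (2 * r i))"
  shows "cutoff I z r y = 0" "cutoff' I z r e y = 0"
proof -
  have "zeta (z i) (r i) y = 0" if "i \<in> I" for i
    using zeta_props(3)[OF assms(1)[OF that]] assms(2) that by (auto simp: dist_norm norm_minus_commute not_less)
  then have "(\<Sum>i\<in>I. zeta (z i) (r i) y) = 0" by simp
  then show "cutoff I z r y = 0" "cutoff' I z r e y = 0"
    by (simp_all add: cutoff_def cutoff'_def hstep_eq_0)
qed

lemma cutoff'_bound:
  assumes "\<And>i. i \<in> I \<Longrightarrow> 0 < r i" "norm e \<le> 1"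
  shows "\<bar>cutoff' I z r e y\<bar> \<le> (\<Sum>i\<in>I. 16 / r i * indicator (ball (z i) (2 * r i)) y)"
proof -
  have "\<bar>\<Sum>i\<in>I. zeta' (z i) (r i) e y\<bar> \<le> (\<Sum>i\<in>I. 8 / r i * indicator (ball (z i) (2 * r i)) y)"
    by (rule order.trans[OF sum_abs]) (intro sum_mono zeta_props(5) assms)
  then have "\<bar>cutoff' I z r e y\<bar> \<le> 2 * (\<Sum>i\<in>I. 8 / r i * indicator (ball (z i) (2 * r i)) y)"
    unfolding cutoff'_def abs_mult using hstep'_bounds by (intro mult_mono) auto
  then show ?thesis by (simp add: sum_distrib_left mult.assoc[symmetric])
qed

context
  fixes x :: "real^'n::finite" and \<epsilon> :: real
  assumes \<epsilon>: "0 < \<epsilon>"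
begin

text \<open>A regularisation of the field \<open>(y - x) / \<bar>y - x\<bar>\<^sup>n\<close>. Its divergence is nonnegative and concentrates at \<open>x\<close> as
  \<open>\<epsilon>\<close> tends to zero.\<close>

definition rk :: "'n \<Rightarrow> real^'n \<Rightarrow> real" where
  "rk i y = (y - x) $ i * ((norm (y - x))\<^sup>2 + \<epsilon>\<^sup>2) powr (- real CARD('n) / 2)"

definition rk' :: "'n \<Rightarrow> real^'n \<Rightarrow> real" where
  "rk' i y = ((norm (y - x))\<^sup>2 + \<epsilon>\<^sup>2) powr (- real CARD('n) / 2)
     - real CARD('n) * ((y - x) $ i)\<^sup>2 * ((norm (y - x))\<^sup>2 + \<epsilon>\<^sup>2) powr (- real CARD('n) / 2 - 1)"

lemma rk_pos: "0 < (norm (y - x))\<^sup>2 + \<epsilon>\<^sup>2"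
  using \<epsilon> by (simp add: add_nonneg_pos)

lemma rk_deriv: "((\<lambda>s. rk i (y + s *\<^sub>R axis i 1)) has_real_derivative rk' i y) (at 0)"
proof -
  let ?D = "\<lambda>y. (norm (y - x))\<^sup>2 + \<epsilon>\<^sup>2" and ?a = "- real CARD('n) / 2"
  have 1: "((\<lambda>s. ?D (y + s *\<^sub>R axis i 1)) has_real_derivative 2 * ((y - x) \<bullet> axis i 1)) (at 0)"
    using DERIV_add[OF norm2_directional_deriv[of y "axis i 1" x] DERIV_const[of "\<epsilon>\<^sup>2"]] by simp
  have "((\<lambda>t. t powr ?a) has_real_derivative ?a * ?D y powr (?a - 1)) (at (?D (y + 0 *\<^sub>R axis i 1)))"
    using has_real_derivative_powr[of "?D y" ?a] rk_pos[of y] by simp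
  from DERIV_chain2[OF this 1]
  have 2: "((\<lambda>s. ?D (y + s *\<^sub>R axis i 1) powr ?a) has_real_derivative
      ?a * ?D y powr (?a - 1) * (2 * ((y - x) \<bullet> axis i 1))) (at 0)" .
  have 3: "((\<lambda>s. (y + s *\<^sub>R axis i 1 - x) $ i) has_real_derivative 1) (at 0)"
    by (auto intro!: derivative_eq_intros)
  show ?thesis unfolding rk_def[abs_def]
    by (rule DERIV_cong[OF DERIV_mult[OF 3 2]])
      (simp add: rk'_def inner_axis power2_eq_square field_simps)
qed

lemma continuous_rk: "continuous_on A (rk i)" "continuous_on A (rk' i)"
  unfolding rk_def[abs_def] rk'_def[abs_def] using rk_pos
  by (auto intro!: continuous_intros simp: less_imp_neq[THEN not_sym])

text \<open>At the exponent \<open>- n / 2\<close> the terms in the squared norm cancel, so that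
  only a positive multiple of \<open>\<epsilon>\<^sup>2\<close> survives.\<close>

lemma rk_divergence:
  "(\<Sum>i\<in>UNIV. rk' i y) = real CARD('n) * \<epsilon>\<^sup>2 * ((norm (y - x))\<^sup>2 + \<epsilon>\<^sup>2) powr (- real CARD('n) / 2 - 1)"
proof -
  let ?D = "(norm (y - x))\<^sup>2 + \<epsilon>\<^sup>2" and ?a = "- real CARD('n) / 2"
  have n2: "(\<Sum>i\<in>UNIV. ((y - x) $ i)\<^sup>2) = (norm (y - x))\<^sup>2"
    unfolding power2_norm_eq_inner inner_vec_def by (simp add: power2_eq_square)
  have p: "?D powr ?a = ?D * ?D powr (?a - 1)"
    using rk_pos[of y] powr_mult_base[of ?D "?a - 1"] by simp
  have "(\<Sum>i\<in>UNIV. rk' i y) = real CARD('n) * ?D powr ?a - real CARD('n) * (\<Sum>i\<in>UNIV. ((y - x) $ i)\<^sup>2) * ?D powr (?a - 1)"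
    by (simp add: rk'_def sum_subtractf sum_distrib_left sum_distrib_right)
  then show ?thesis unfolding n2 p by (simp add: algebra_simps)
qed

lemma rk_bound: "\<bar>rk i y\<bar> \<le> norm (x - y) powr (1 - real CARD('n))"
proof (cases "y = x")
  case False
  let ?d = "norm (y - x)"
  have d: "0 < ?d" using False by simp
  have "\<bar>rk i y\<bar> \<le> ?d * (?d\<^sup>2 + \<epsilon>\<^sup>2) powr (- real CARD('n) / 2)"
    unfolding rk_def abs_mult by (intro mult_mono) (use component_le_norm_cart[of "y - x" i] in auto)
  also have "\<dots> \<le> ?d * (?d\<^sup>2) powr (- real CARD('n) / 2)"
    using d by (intro mult_left_mono powr_mono2') auto
  also have "(?d\<^sup>2) powr (- real CARD('n) / 2) = ?d powr (- real CARD('n))"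
    using d powr_powr[of ?d 2 "- real CARD('n) / 2"] by simp
  also have "?d * ?d powr (- real CARD('n)) = ?d powr (1 - real CARD('n))"
    using d powr_mult_base[of ?d "- real CARD('n)"] by simp
  finally show ?thesis by (simp add: norm_minus_commute)
qed (simp add: rk_def)

end

text \<open>Data for a second cutoff, compactly supported in \<Omega> and equal to 1 on
  \<open>K\<close>; it makes a test field admissible without changing it on
  \<open>K\<close>.\<close>

lemma compact_inner_cover:
  fixes K :: "'a::euclidean_space set"
  assumes "compact K" "open \<Omega>" "K \<subseteq> \<Omega>"
  obtains I and r where "finite I" "\<And>p. p \<in> I \<Longrightarrow> 0 < r p" "K \<subseteq> (\<Union>p\<in>I. ball p (r p))"
    "(\<Union>p\<in>I. cball p (2 * r p)) \<subseteq> \<Omega>"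
proof -
  obtain \<delta> where \<delta>: "0 < \<delta>" "(\<Union>x\<in>K. cball x \<delta>) \<subseteq> \<Omega>"
    using compact_subset_open_imp_cball_epsilon_subset[OF assms] by blast
  have "K \<subseteq> (\<Union>p\<in>K. ball p (\<delta> / 2))" using \<delta>(1) by auto
  then obtain I where I: "I \<subseteq> K" "finite I" "K \<subseteq> (\<Union>p\<in>I. ball p (\<delta> / 2))"
    by (rule compactE_image[OF assms(1), rotated]) auto
  show ?thesis
    by (rule that[of I "\<lambda>_. \<delta> / 2"]) (use I \<delta> in auto)
qed

lemma ennreal_linear_combination:
  "0 \<le> a \<Longrightarrow> 0 \<le> b \<Longrightarrow> 0 \<le> q \<Longrightarrow> 0 \<le> k \<Longrightarrow>
    ennreal ((a + b * q) * k) = (ennreal a + ennreal b * ennreal q) * ennreal k"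
  by (simp add: ennreal_mult)

text \<open>The test field is \<open>\<Phi>(u) \<eta> k\<close> with \<open>k\<close> the kernel above, \<open>\<eta>\<close> the cutoff and \<open>\<Phi>\<close> a step from \<open>0\<close> to \<open>1\<close> between
  the levels \<open>s\<close> and \<open>t\<close>. A single small \<open>\<epsilon>\<close> suffices, since only a lower bound for the divergence part near \<open>x\<close> is needed.\<close>

lemma pointwise_potential:
  fixes \<Omega> :: "(real^'n::finite) set" and u :: "real^'n \<Rightarrow> real" and z :: "'i \<Rightarrow> real^'n" and r :: "'i \<Rightarrow> real"
  defines "n \<equiv> real CARD('n)"
  assumes \<Omega>: "open \<Omega>" and u: "continuous_on (closure \<Omega>) u" "bounded {x \<in> closure \<Omega>. u x \<noteq> 0}"
    and wg: "has_weak_gradient \<Omega> u G"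
    and st: "0 < s" "s < t"
    and I: "finite I" "\<And>i. i \<in> I \<Longrightarrow> 0 < r i"
      "{y \<in> frontier \<Omega>. s \<le> \<bar>u y\<bar>} \<subseteq> (\<Union>i\<in>I. ball (z i) (r i))"
    and x: "x \<in> \<Omega>" "t < \<bar>u x\<bar>" "x \<notin> (\<Union>i\<in>I. cball (z i) (2 * r i))"
  shows "ennreal (n * 2 powr (- n / 2 - 1) * unit_ball_vol n) \<le>
    (\<integral>\<^sup>+y. (ennreal (n * (\<Sum>i\<in>I. 16 / r i * indicator (ball (z i) (2 * r i)) y))
       + ennreal (4 * n / (t - s)) * (ennreal (norm (G y)) * indicator {y \<in> \<Omega>. s < \<bar>u y\<bar>} y))
       * ennreal (norm (x - y) powr (1 - n)) \<partial>lebesgue)"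
proof -
  have n1: "1 \<le> n" unfolding n_def by (metis One_nat_def Suc_leI of_nat_1 of_nat_le_iff zero_less_card_finite)
  have u\<Omega>: "continuous_on \<Omega> u" using u(1) closure_subset continuous_on_subset by blast
  define N where "N = {y \<in> closure \<Omega>. s \<le> \<bar>u y\<bar>}"
  have "closed N"
    unfolding N_def by (intro continuous_closed_preimage[of "closure \<Omega>" "\<lambda>y. \<bar>u y\<bar>" "{s..}", unfolded vimage_def Int_def, simplified] continuous_intros u)
  moreover have "bounded N"
    by (rule bounded_subset[OF u(2)]) (use st in \<open>auto simp: N_def\<close>)
  ultimately have N: "compact N" by (simp add: compact_eq_bounded_closed)
  \<comment> \<open>Removing the balls leaves no boundary point, since the boundary part of
    \<open>N\<close> is covered; this is what makes the relevant support compact in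
    \<Omega>.\<close>
  define K where "K = N - (\<Union>i\<in>I. ball (z i) (r i))"
  have K: "compact K" unfolding K_def by (intro compact_diff N) auto
  have K\<Omega>: "K \<subseteq> \<Omega>"
  proof
    fix y assume y: "y \<in> K"
    then have "y \<notin> frontier \<Omega>" "y \<in> closure \<Omega>" using I(3) by (auto simp: K_def N_def)
    then show "y \<in> \<Omega>" using \<Omega> by (simp add: frontier_def interior_open)
  qed
  obtain J :: "(real^'n) set" and R where J: "finite J" "\<And>p. p \<in> J \<Longrightarrow> 0 < R p" "K \<subseteq> (\<Union>p\<in>J. ball p (R p))"
    "(\<Union>p\<in>J. cball p (2 * R p)) \<subseteq> \<Omega>"
    using compact_inner_cover[OF K \<Omega> K\<Omega>] by metis
  define K' where "K' = (\<Union>p\<in>J. cball p (2 * R p))"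
  have K': "compact K'" "K' \<subseteq> \<Omega>" using J by (auto simp: K'_def)
  have KK': "K \<subseteq> K'"
  proof
    fix y assume "y \<in> K"
    then obtain p where p: "p \<in> J" "dist p y < R p" using J(3) by auto
    then have "dist p y \<le> 2 * R p" using J(2)[of p] by linarith
    then show "y \<in> K'" using p(1) by (auto simp: K'_def)
  qed
  let ?d = "t - s"
  \<comment> \<open>The steps for positive and for negative values are added, so that the absolute
    value never has to be differentiated.\<close>
  define \<Phi> where "\<Phi> v = hstep ((v - s) / ?d) + hstep ((- v - s) / ?d)" for v
  define \<Phi>' where "\<Phi>' v = hstep' ((v - s) / ?d) * (1 / ?d) + hstep' ((- v - s) / ?d) * (- 1 / ?d)" for v
  have d: "0 < ?d" using st by simp
  have \<Phi>der: "(\<Phi> has_real_derivative \<Phi>' v) (at v)" for v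
  proof -
    have a': "((\<lambda>v. v - s) has_real_derivative 1) (at v)" "((\<lambda>v. - v - s) has_real_derivative - 1) (at v)"
      by (auto intro!: derivative_eq_intros)
    note a = a'[THEN DERIV_cdivide, of ?d]
    show ?thesis unfolding \<Phi>_def[abs_def] \<Phi>'_def
      by (intro DERIV_add DERIV_chain2[OF hstep_deriv a(1)] DERIV_chain2[OF hstep_deriv a(2)])
  qed
  have \<Phi>'c: "continuous_on UNIV \<Phi>'"
    unfolding \<Phi>'_def[abs_def] using d
    by (intro continuous_intros continuous_on_compose2[OF continuous_hstep(2)[of UNIV]]) auto
  have \<Phi>c: "continuous_on UNIV \<Phi>"
    using \<Phi>der by (meson DERIV_continuous continuous_at_imp_continuous_on)
  have \<Phi>0: "\<Phi> v = 0" "\<Phi>' v = 0" if "\<bar>v\<bar> \<le> s" for v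
    using that d by (auto simp: \<Phi>_def \<Phi>'_def hstep_eq_0 divide_nonpos_pos abs_le_iff)
  have \<Phi>1: "\<Phi> v = 1" if "t < \<bar>v\<bar>" for v
  proof (cases "0 \<le> v")
    case True
    then have "1 \<le> (v - s) / ?d" "(- v - s) / ?d \<le> 0" using that st d by (auto simp: field_simps)
    then show ?thesis by (simp add: \<Phi>_def hstep_eq_0 hstep_eq_1)
  next
    case False
    then have "1 \<le> (- v - s) / ?d" "(v - s) / ?d \<le> 0" using that st d by (auto simp: field_simps)
    then show ?thesis by (simp add: \<Phi>_def hstep_eq_0 hstep_eq_1)
  qed
  have \<Phi>b: "0 \<le> \<Phi> v" "\<Phi> v \<le> 1" for v
  proof -
    show "0 \<le> \<Phi> v" by (simp add: \<Phi>_def hstep_bounds)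
    have "(v - s) / ?d \<le> 0 \<or> (- v - s) / ?d \<le> 0" using st d by (cases "0 \<le> v") (auto simp: divide_nonpos_pos)
    then show "\<Phi> v \<le> 1" using hstep_bounds(2) by (auto simp: \<Phi>_def hstep_eq_0)
  qed
  have \<Phi>'b: "\<bar>\<Phi>' v\<bar> \<le> 4 / ?d" for v
  proof -
    have "\<bar>\<Phi>' v\<bar> \<le> \<bar>hstep' ((v - s) / ?d) * (1 / ?d)\<bar> + \<bar>hstep' ((- v - s) / ?d) * (- 1 / ?d)\<bar>"
      unfolding \<Phi>'_def by (rule abs_triangle_ineq)
    also have "\<dots> \<le> 2 * (1 / ?d) + 2 * (1 / ?d)"
      unfolding abs_mult using d hstep'_bounds by (intro add_mono mult_mono) auto
    finally show ?thesis by simp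
  qed
  define w where "w = cutoff I z r"
  define w' where "w' i = cutoff' I z r (axis i (1::real))" for i :: 'n
  \<comment> \<open>\<omega> provides compact support on the whole space. Within \<Omega> the
    product \<open>\<Phi> (u y) * (1 - w y)\<close> vanishes off \<open>K\<close>, and on
    \<open>K\<close> one has \<open>\<omega> = 1\<close> with zero derivative, so the derivative of
    \<omega> drops out of \<open>A_eq\<close>.\<close>
  define \<omega> where "\<omega> = cutoff J (\<lambda>p. p) R"
  define \<omega>' where "\<omega>' i = cutoff' J (\<lambda>p. p) R (axis i (1::real))" for i :: 'n
  have wb: "0 \<le> w y" "w y \<le> 1" "0 \<le> \<omega> y" "\<omega> y \<le> 1" for y
    by (simp_all add: w_def \<omega>_def cutoff_bounds)
  have suppK: "y \<in> K" if "\<Phi> (u y) * (1 - w y) \<noteq> 0" "y \<in> \<Omega>" for y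
  proof -
    have "s < \<bar>u y\<bar>" using \<Phi>0[of "u y"] that(1) by (auto simp: not_less[symmetric])
    then have "y \<in> N" using that(2) closure_subset by (auto simp: N_def)
    moreover have "y \<notin> (\<Union>i\<in>I. cball (z i) (r i))"
      using cutoff_inside(1)[where I=I and r=r and y=y and z=z] I(1,2) that(1) by (auto simp: w_def)
    ultimately show ?thesis by (force simp: K_def)
  qed
  have \<omega>K: "\<omega> y = 1" "\<omega>' i y = 0" if "y \<in> K" for y i
  proof -
    have "y \<in> (\<Union>p\<in>J. cball p (R p))" using that J(3) by force
    then show "\<omega> y = 1" "\<omega>' i y = 0"
      using cutoff_inside[where I=J and r=R and y=y and z="\<lambda>p. p"] J(1,2) by (simp_all add: \<omega>_def \<omega>'_def)
  qed
  have \<omega>out: "\<omega> y = 0" "\<omega>' i y = 0" if "y \<notin> K'" for y i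
  proof -
    have "y \<notin> (\<Union>p\<in>J. ball p (2 * R p))" using that by (auto simp: K'_def)
    then show "\<omega> y = 0" "\<omega>' i y = 0"
      using cutoff_outside[where y=y and z="\<lambda>p. p" and I=J and r=R] J(2) by (simp_all add: \<omega>_def \<omega>'_def)
  qed
  have w'b: "\<bar>w' i y\<bar> \<le> (\<Sum>j\<in>I. 16 / r j * indicator (ball (z j) (2 * r j)) y)" for i y
    unfolding w'_def by (rule cutoff'_bound) (use I in auto)
  \<comment> \<open>Near \<open>x\<close> the truncation is 1 and the cutoff \<open>w\<close> is 0;
    \<epsilon> is chosen so that \<open>ball x \<epsilon>\<close> lies in this region.\<close>
  define U where "U = {y \<in> \<Omega>. t < \<bar>u y\<bar>} - (\<Union>i\<in>I. cball (z i) (2 * r i))"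
  have "open {y \<in> \<Omega>. t < \<bar>u y\<bar>}"
    using continuous_open_preimage[of \<Omega> "\<lambda>y. \<bar>u y\<bar>" "{t<..}"] u\<Omega> \<Omega>
    by (auto simp: vimage_def Int_def intro: continuous_intros)
  then have "open U" unfolding U_def by (intro open_Diff) (use I(1) in auto)
  moreover have "x \<in> U" using x by (auto simp: U_def)
  ultimately obtain \<epsilon> where \<epsilon>: "0 < \<epsilon>" "ball x \<epsilon> \<subseteq> U" by (rule openE)
  define k where "k = rk x \<epsilon>"
  define k' where "k' = rk' x \<epsilon>"
  have kder: "((\<lambda>s. k i (y + s *\<^sub>R axis i 1)) has_real_derivative k' i y) (at 0)" for i y
    unfolding k_def k'_def by (rule rk_deriv[OF \<epsilon>(1)])
  have kc: "continuous_on A (k i)" "continuous_on A (k' i)" for i A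
    unfolding k_def k'_def by (rule continuous_rk[OF \<epsilon>(1)])+
  define \<psi> where "\<psi> i y = \<omega> y * ((1 - w y) * k i y)" for i y
  define \<psi>' where "\<psi>' i y = \<omega>' i y * ((1 - w y) * k i y) + (((0 - w' i y) * k i y + k' i y * (1 - w y)) * \<omega> y)" for i y
  have \<psi>der: "((\<lambda>s. \<psi> i (y + s *\<^sub>R axis i 1)) has_real_derivative \<psi>' i y) (at 0)" for i y
  proof -
    have 1: "((\<lambda>s. \<omega> (y + s *\<^sub>R axis i 1)) has_real_derivative \<omega>' i y) (at 0)"
      unfolding \<omega>_def \<omega>'_def by (rule cutoff_deriv)
    have 2: "((\<lambda>s. 1 - w (y + s *\<^sub>R axis i 1)) has_real_derivative 0 - w' i y) (at 0)"
      unfolding w_def w'_def by (rule DERIV_diff[OF DERIV_const cutoff_deriv])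
    from DERIV_mult[OF 1 DERIV_mult[OF 2 kder[of i y]]] show ?thesis
      by (simp add: \<psi>_def \<psi>'_def)
  qed
  have cts: "continuous_on UNIV \<omega>" "continuous_on UNIV w" "continuous_on UNIV (\<omega>' i)" "continuous_on UNIV (w' i)" for i
    unfolding w_def w'_def \<omega>_def \<omega>'_def by (rule continuous_cutoff)+
  have \<psi>c: "continuous_on UNIV (\<psi> i)" "continuous_on UNIV (\<psi>' i)" for i
    unfolding \<psi>_def \<psi>'_def by (intro continuous_intros cts kc)+
  have \<psi>out: "\<psi> i y = 0" "\<psi>' i y = 0" if "y \<notin> K'" for i y
    using \<omega>out[OF that] by (simp_all add: \<psi>_def \<psi>'_def)
  have chain: "(\<integral>y. indicator K' y * (\<Phi> (u y) * \<psi>' i y) \<partial>lebesgue) = - (\<integral>y. indicator K' y * (\<Phi>' (u y) * G y $ i * \<psi> i y) \<partial>lebesgue)" for i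
    by (rule weak_chain_rule[OF \<Omega> u\<Omega> wg \<Phi>der \<Phi>'c K' \<psi>c \<psi>out \<psi>der])
  have uK': "continuous_on K' u" using u\<Omega> K'(2) by (rule continuous_on_subset)
  have \<Phi>u: "continuous_on K' (\<lambda>y. \<Phi> (u y))" "continuous_on K' (\<lambda>y. \<Phi>' (u y))"
    by (auto intro: continuous_on_compose2[OF \<Phi>c uK'] continuous_on_compose2[OF \<Phi>'c uK'])
  have intc: "integrable lebesgue (\<lambda>y. indicator K' y * f y)" if "continuous_on K' f" for f :: "real^'n \<Rightarrow> real"
  proof -
    have "integrable lborel (\<lambda>y. indicator K' y *\<^sub>R f y)" by (rule borel_integrable_compact[OF K'(1) that])
    then show ?thesis by (simp add: integrable_completion borel_measurable_integrable)
  qed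
  define F where "F i y = indicator K' y * (\<Phi> (u y) * \<psi>' i y)" for i y
  define g where "g i y = indicator K' y * (\<Phi>' (u y) * G y $ i * \<psi> i y)" for i y
  have Fi: "integrable lebesgue (F i)" for i
    unfolding F_def by (intro intc continuous_intros \<Phi>u continuous_on_subset[OF \<psi>c(2)]) auto
  have gi: "integrable lebesgue (g i)" for i
  proof -
    have "set_integrable lebesgue K' (\<lambda>y. G y $ i)" using wg K' unfolding has_weak_gradient_def by blast
    then have Gi: "integrable lebesgue (\<lambda>y. indicator K' y * G y $ i)" by (simp add: set_integrable_def)
    have c: "continuous_on K' (\<lambda>y. \<Phi>' (u y) * \<psi> i y)"
      by (intro continuous_intros \<Phi>u continuous_on_subset[OF \<psi>c(1)]) auto
    then have "bounded ((\<lambda>y. \<Phi>' (u y) * \<psi> i y) ` K')"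
      using K'(1) by (intro compact_imp_bounded compact_continuous_image)
    then obtain B where B: "0 < B" "\<And>y. y \<in> K' \<Longrightarrow> \<bar>\<Phi>' (u y) * \<psi> i y\<bar> \<le> B" by (auto simp: bounded_pos)
    have "(\<lambda>y. (indicator K' y * G y $ i) * (indicator K' y * (\<Phi>' (u y) * \<psi> i y))) \<in> borel_measurable lebesgue"
      by (intro borel_measurable_times borel_measurable_integrable[OF Gi] borel_measurable_integrable[OF intc[OF c]])
    also have "(\<lambda>y. (indicator K' y * G y $ i) * (indicator K' y * (\<Phi>' (u y) * \<psi> i y))) = g i"
      by (auto simp: g_def indicator_def fun_eq_iff)
    finally have gm: "g i \<in> borel_measurable lebesgue" .
    show ?thesis
    proof (rule Bochner_Integration.integrable_bound[OF integrable_mult_right[OF Gi, of B] gm], rule AE_I2)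
      fix y
      show "norm (g i y) \<le> norm (B * (indicator K' y * G y $ i))"
      proof (cases "y \<in> K'")
        case True
        have "\<bar>G y $ i\<bar> * \<bar>\<Phi>' (u y) * \<psi> i y\<bar> \<le> \<bar>G y $ i\<bar> * B" using B(2)[OF True] by (intro mult_left_mono) auto
        then show ?thesis using True B(1) by (simp add: g_def abs_mult algebra_simps)
      qed (simp add: g_def)
    qed
  qed
  define h where "h y = indicator K' y * (\<omega> y * (\<Phi> (u y) * (\<Sum>i\<in>UNIV. w' i y * k i y)))" for y
  have hi: "integrable lebesgue h"
    unfolding h_def
    by (intro intc continuous_intros \<Phi>u continuous_on_subset[OF cts(1)] continuous_on_subset[OF cts(4)] kc) auto
  \<comment> \<open>Summed over the coordinates, \<open>F\<close> splits into the divergence part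
    \<open>A\<close> and minus the part \<open>h\<close>, where the derivative falls on
    \<open>w\<close>. \<open>A\<close> is nonnegative and bounded below near \<open>x\<close>, while
    \<open>h\<close> and \<open>g\<close> produce the two terms on the right.\<close>
  define A where "A y = indicator K' y * (\<Phi> (u y) * (1 - w y) * (\<Sum>i\<in>UNIV. k' i y))" for y
  have A_eq: "A y = (\<Sum>i\<in>UNIV. F i y) + h y" for y
  proof (cases "y \<in> K'")
    case True
    then have y\<Omega>: "y \<in> \<Omega>" using K' by blast
    have "\<Phi> (u y) * \<psi>' i y + \<omega> y * (\<Phi> (u y) * (w' i y * k i y)) = \<Phi> (u y) * (1 - w y) * k' i y" for i
    proof (cases "\<Phi> (u y) * (1 - w y) = 0")
      case True
      have "\<Phi> (u y) * \<psi>' i y + \<omega> y * (\<Phi> (u y) * (w' i y * k i y))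
        = (\<Phi> (u y) * (1 - w y)) * (\<omega>' i y * k i y + k' i y * \<omega> y)"
        by (simp add: \<psi>'_def algebra_simps)
      then show ?thesis using True by simp
    next
      case False
      then have "y \<in> K" using suppK y\<Omega> by blast
      then show ?thesis using \<omega>K by (simp add: \<psi>'_def algebra_simps)
    qed
    then have "(\<Sum>i\<in>UNIV. \<Phi> (u y) * \<psi>' i y + \<omega> y * (\<Phi> (u y) * (w' i y * k i y))) = (\<Sum>i\<in>UNIV. \<Phi> (u y) * (1 - w y) * k' i y)"
      by simp
    then show ?thesis using True
      by (simp add: A_def F_def h_def sum.distrib sum_distrib_left)
  qed (simp add: A_def F_def h_def)
  have A_int: "integrable lebesgue A" unfolding A_eq[abs_def] by (intro Bochner_Integration.integrable_add Bochner_Integration.integrable_sum Fi hi)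
  have div: "(\<Sum>i\<in>UNIV. k' i y) = n * \<epsilon>\<^sup>2 * ((norm (y - x))\<^sup>2 + \<epsilon>\<^sup>2) powr (- n / 2 - 1)" for y
    unfolding k'_def n_def by (rule rk_divergence[OF \<epsilon>(1)])
  have A0: "0 \<le> A y" for y unfolding A_def div using \<Phi>b wb n1 by simp
  have "(\<integral>y. A y \<partial>lebesgue) = (\<Sum>i\<in>UNIV. \<integral>y. F i y \<partial>lebesgue) + (\<integral>y. h y \<partial>lebesgue)"
    unfolding A_eq using Fi hi by (simp add: Bochner_Integration.integrable_sum)
  also have "(\<Sum>i\<in>UNIV. \<integral>y. F i y \<partial>lebesgue) = - (\<Sum>i\<in>UNIV. \<integral>y. g i y \<partial>lebesgue)"
    unfolding F_def g_def chain by (simp add: sum_negf)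
  also have "- (\<Sum>i\<in>UNIV. \<integral>y. g i y \<partial>lebesgue) + (\<integral>y. h y \<partial>lebesgue) = (\<integral>y. h y - (\<Sum>i\<in>UNIV. g i y) \<partial>lebesgue)"
    using gi hi by (simp add: Bochner_Integration.integrable_sum)
  also have "\<dots> \<le> (\<integral>y. \<bar>h y\<bar> + (\<Sum>i\<in>UNIV. \<bar>g i y\<bar>) \<partial>lebesgue)"
  proof (rule integral_mono)
    show "integrable lebesgue (\<lambda>y. h y - (\<Sum>i\<in>UNIV. g i y))" "integrable lebesgue (\<lambda>y. \<bar>h y\<bar> + (\<Sum>i\<in>UNIV. \<bar>g i y\<bar>))"
      using gi hi by (auto intro!: Bochner_Integration.integrable_sum)
    fix y
    have "- (\<Sum>i\<in>UNIV. g i y) \<le> (\<Sum>i\<in>UNIV. \<bar>g i y\<bar>)" by (simp add: sum_negf[symmetric] sum_mono)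
    then show "h y - (\<Sum>i\<in>UNIV. g i y) \<le> \<bar>h y\<bar> + (\<Sum>i\<in>UNIV. \<bar>g i y\<bar>)" by linarith
  qed
  finally have upper: "ennreal (\<integral>y. A y \<partial>lebesgue) \<le> ennreal (\<integral>y. \<bar>h y\<bar> + (\<Sum>i\<in>UNIV. \<bar>g i y\<bar>) \<partial>lebesgue)"
    by (rule ennreal_leI)
  also have "\<dots> = (\<integral>\<^sup>+y. ennreal (\<bar>h y\<bar> + (\<Sum>i\<in>UNIV. \<bar>g i y\<bar>)) \<partial>lebesgue)"
    using gi hi by (intro nn_integral_eq_integral[symmetric]) (auto intro!: Bochner_Integration.integrable_sum AE_I2 add_nonneg_nonneg sum_nonneg)
  also have "\<dots> \<le> (\<integral>\<^sup>+y. (ennreal (n * (\<Sum>i\<in>I. 16 / r i * indicator (ball (z i) (2 * r i)) y))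
       + ennreal (4 * n / (t - s)) * (ennreal (norm (G y)) * indicator {y \<in> \<Omega>. s < \<bar>u y\<bar>} y))
       * ennreal (norm (x - y) powr (1 - n)) \<partial>lebesgue)"
  proof (rule nn_integral_mono)
    fix y
    define P where "P = (\<Sum>i\<in>I. 16 / r i * indicator (ball (z i) (2 * r i)) y)"
    define \<kappa> where "\<kappa> = norm (x - y) powr (1 - n)"
    define q where "q = norm (G y) * indicator {y \<in> \<Omega>. s < \<bar>u y\<bar>} y"
    have P0: "0 \<le> P" unfolding P_def using I(2) by (intro sum_nonneg) (auto simp: less_imp_le)
    have q0: "0 \<le> q" by (simp add: q_def)
    have \<kappa>0: "0 \<le> \<kappa>" by (simp add: \<kappa>_def)
    have kb: "\<bar>k i y\<bar> \<le> \<kappa>" for i unfolding k_def \<kappa>_def n_def by (rule rk_bound[OF \<epsilon>(1)])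
    have w'P: "\<bar>w' i y\<bar> \<le> P" for i unfolding P_def by (rule w'b)
    have "\<bar>\<Sum>i\<in>UNIV. w' i y * k i y\<bar> \<le> (\<Sum>i\<in>(UNIV::'n set). P * \<kappa>)"
      by (rule order.trans[OF sum_abs]) (intro sum_mono, unfold abs_mult, intro mult_mono kb w'P P0 abs_ge_zero)
    then have W: "\<bar>\<Sum>i\<in>UNIV. w' i y * k i y\<bar> \<le> n * (P * \<kappa>)" by (simp add: n_def)
    have "\<bar>h y\<bar> = indicator K' y * (\<omega> y * (\<Phi> (u y) * \<bar>\<Sum>i\<in>UNIV. w' i y * k i y\<bar>))"
      using wb \<Phi>b by (simp add: h_def abs_mult)
    also have "\<dots> \<le> 1 * (1 * (1 * (n * (P * \<kappa>))))"
      by (intro mult_mono W wb \<Phi>b mult_nonneg_nonneg) (use wb \<Phi>b n1 P0 \<kappa>0 in \<open>auto simp: indicator_def\<close>)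
    finally have hb: "\<bar>h y\<bar> \<le> n * P * \<kappa>" by (simp add: mult.assoc)
    have gb: "\<bar>g i y\<bar> \<le> 4 / ?d * q * \<kappa>" for i
    proof (cases "y \<in> K' \<and> s < \<bar>u y\<bar>")
      case True
      then have q: "q = norm (G y)" using K' by (auto simp: q_def)
      have "\<bar>\<psi> i y\<bar> \<le> 1 * (1 * \<kappa>)"
        unfolding \<psi>_def abs_mult by (intro mult_mono kb) (use wb in auto)
      moreover have "\<bar>G y $ i\<bar> \<le> q" unfolding q by (rule component_le_norm_cart)
      ultimately have "\<bar>\<Phi>' (u y)\<bar> * \<bar>G y $ i\<bar> * \<bar>\<psi> i y\<bar> \<le> 4 / ?d * q * \<kappa>"
        using d q0 by (intro mult_mono \<Phi>'b) auto
      then show ?thesis using True by (simp add: g_def abs_mult)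
    next
      case False
      then have "g i y = 0" using \<Phi>0(2)[of "u y"] by (auto simp: g_def not_less)
      then show ?thesis using d q0 \<kappa>0 by simp
    qed
    have "(\<Sum>i\<in>UNIV. \<bar>g i y\<bar>) \<le> (\<Sum>i\<in>(UNIV::'n set). 4 / ?d * q * \<kappa>)" by (intro sum_mono gb)
    then have gs: "(\<Sum>i\<in>UNIV. \<bar>g i y\<bar>) \<le> 4 * n / ?d * q * \<kappa>" by (simp add: n_def mult_ac)
    have "ennreal (\<bar>h y\<bar> + (\<Sum>i\<in>UNIV. \<bar>g i y\<bar>)) \<le> ennreal ((n * P + 4 * n / ?d * q) * \<kappa>)"
      using hb gs by (intro ennreal_leI) (simp add: distrib_right)
    also have "\<dots> = (ennreal (n * P) + ennreal (4 * n / ?d) * ennreal q) * ennreal \<kappa>"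
      using n1 P0 d q0 \<kappa>0 by (intro ennreal_linear_combination) auto
    also have "ennreal q = ennreal (norm (G y)) * indicator {y \<in> \<Omega>. s < \<bar>u y\<bar>} y"
      by (simp add: q_def indicator_def)
    finally show "ennreal (\<bar>h y\<bar> + (\<Sum>i\<in>UNIV. \<bar>g i y\<bar>)) \<le> (ennreal (n * (\<Sum>i\<in>I. 16 / r i * indicator (ball (z i) (2 * r i)) y))
       + ennreal (4 * n / (t - s)) * (ennreal (norm (G y)) * indicator {y \<in> \<Omega>. s < \<bar>u y\<bar>} y))
       * ennreal (norm (x - y) powr (1 - n))"
      by (simp add: P_def \<kappa>_def)
  qed
  finally have up: "ennreal (\<integral>y. A y \<partial>lebesgue) \<le> \<dots>" .
  \<comment> \<open>A lower bound for the divergence of the kernel on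
    \<open>ball x \<epsilon>\<close>. Multiplied by the volume of the ball, all powers of \<epsilon>
    cancel.\<close>
  define c where "c = n * \<epsilon>\<^sup>2 * (2 * \<epsilon>\<^sup>2) powr (- n / 2 - 1)"
  have c0: "0 \<le> c" using n1 by (simp add: c_def)
  have lowA: "c * indicator (ball x \<epsilon>) y \<le> A y" for y
  proof (cases "y \<in> ball x \<epsilon>")
    case True
    then have yU: "y \<in> U" using \<epsilon>(2) by blast
    then have "\<Phi> (u y) = 1" using \<Phi>1 by (simp add: U_def)
    moreover have "w y = 0"
      unfolding w_def by (rule cutoff_outside(1)[OF I(2)]) (use yU in \<open>auto simp: U_def\<close>)
    moreover have "y \<in> K'" using suppK[of y] KK' yU calculation by (auto simp: U_def)
    moreover have "(2 * \<epsilon>\<^sup>2) powr (- n / 2 - 1) \<le> ((norm (y - x))\<^sup>2 + \<epsilon>\<^sup>2) powr (- n / 2 - 1)"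
    proof (rule powr_mono2')
      have "(norm (y - x))\<^sup>2 \<le> \<epsilon>\<^sup>2" using True by (intro power_mono) (auto simp: dist_norm norm_minus_commute)
      then show "(norm (y - x))\<^sup>2 + \<epsilon>\<^sup>2 \<le> 2 * \<epsilon>\<^sup>2" by simp
      show "0 < (norm (y - x))\<^sup>2 + \<epsilon>\<^sup>2" by (rule rk_pos[OF \<epsilon>(1)])
    qed (use n1 in auto)
    ultimately show ?thesis using n1 True by (simp add: A_def div c_def mult_left_mono)
  qed (use A0 in simp)
  have vol: "measure lebesgue (ball x \<epsilon>) = unit_ball_vol n * \<epsilon> ^ CARD('n)"
    using content_ball[of \<epsilon> x] \<epsilon>(1) by (simp add: n_def)
  have ib: "integrable lebesgue (\<lambda>y. c * indicator (ball x \<epsilon>) y)"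
    using emeasure_lborel_ball_finite[of x \<epsilon>] by (intro integrable_mult_right integrable_real_indicator) auto
  have "c * (unit_ball_vol n * \<epsilon> ^ CARD('n)) = (\<integral>y. c * indicator (ball x \<epsilon>) y \<partial>lebesgue)"
    using vol by simp
  also have "\<dots> \<le> (\<integral>y. A y \<partial>lebesgue)" by (rule integral_mono[OF ib A_int lowA])
  finally have "c * (unit_ball_vol n * \<epsilon> ^ CARD('n)) \<le> (\<integral>y. A y \<partial>lebesgue)" .
  moreover have "c * (unit_ball_vol n * \<epsilon> ^ CARD('n)) = n * 2 powr (- n / 2 - 1) * unit_ball_vol n"
  proof -
    have e1: "(\<epsilon>\<^sup>2) powr (- n / 2 - 1) = \<epsilon> powr (- n - 2)"
      using \<epsilon>(1) powr_powr[of \<epsilon> 2 "- n / 2 - 1"] by (simp add: algebra_simps)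
    have e2: "\<epsilon> ^ CARD('n) = \<epsilon> powr n" using \<epsilon>(1) by (simp add: n_def powr_realpow)
    have e3: "\<epsilon>\<^sup>2 = \<epsilon> powr 2" using \<epsilon>(1) by simp
    have "\<epsilon> powr 2 * (\<epsilon> powr (- n - 2) * \<epsilon> powr n) = 1"
      unfolding powr_add[symmetric] using \<epsilon>(1) by simp
    then have e4: "\<epsilon>\<^sup>2 * ((\<epsilon>\<^sup>2) powr (- n / 2 - 1) * \<epsilon> ^ CARD('n)) = 1"
      unfolding e1 e2 unfolding e3 .
    have "c * (unit_ball_vol n * \<epsilon> ^ CARD('n))
      = n * 2 powr (- n / 2 - 1) * unit_ball_vol n * (\<epsilon>\<^sup>2 * ((\<epsilon>\<^sup>2) powr (- n / 2 - 1) * \<epsilon> ^ CARD('n)))"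
      unfolding c_def powr_mult by (simp only: mult_ac)
    then show ?thesis by (simp only: e4 mult_1_right)
  qed
  ultimately have "ennreal (n * 2 powr (- n / 2 - 1) * unit_ball_vol n) \<le> ennreal (\<integral>y. A y \<partial>lebesgue)"
    by (intro ennreal_leI) simp
  also note up
  finally show ?thesis .
qed

lemma ennreal_suminf_ge: "f j \<le> (\<Sum>j. f j)" for f :: "nat \<Rightarrow> ennreal"
  using sum_le_suminf[of f "{j}"] by simp

section \<open>The level set inequality\<close>

lemma dyadic_shell:
  fixes d R :: real
  assumes "0 < d" "d < R"
  obtains j :: nat where "R * (1/2) ^ Suc j \<le> d" "d < R * (1/2) ^ j"
proof -
  have ex: "\<exists>j::nat. R * (1/2) ^ Suc j \<le> d"
  proof -
    have "0 < d / R" using assms by simp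
    then obtain j where "(1/2 :: real) ^ j < d / R"
      using real_arch_pow_inv[of "d / R" "1/2"] by auto
    then have "R * (1/2) ^ j < d" using assms by (simp add: field_simps)
    moreover have "R * (1/2) ^ Suc j \<le> R * (1/2) ^ j" using assms by simp
    ultimately show ?thesis by (intro exI[of _ j]) linarith
  qed
  define j where "j = (LEAST j::nat. R * (1/2) ^ Suc j \<le> d)"
  have j: "R * (1/2) ^ Suc j \<le> d" "\<And>i. i < j \<Longrightarrow> \<not> R * (1/2) ^ Suc i \<le> d"
    unfolding j_def using ex by (rule LeastI_ex) (rule not_less_Least)
  have "d < R * (1/2) ^ j"
    using assms j(2)[of "j - 1"] by (cases j) auto
  then show ?thesis using that j(1) by blast
qed

text \<open>The integral is split at the radius \<open>R\<close> with
  \<open>R powr \<alpha> = measure \<mu> E\<close>: beyond it the kernel is at most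
  \<open>R powr (1 - n)\<close>; inside it dyadic shells and the growth condition give a geometric
  series, convergent since \<alpha> exceeds \<open>n - 1\<close>. Both parts scale like
  \<open>R powr (\<alpha> - n + 1)\<close>.\<close>

lemma potential_integral_bound:
  fixes \<mu> :: "(real^'n::finite) measure" and \<alpha> C :: real
  defines "n \<equiv> real CARD('n)"
  assumes \<alpha>: "n - 1 < \<alpha>" and C: "0 < C"
    and \<mu>: "sets \<mu> = sets (restrict_space borel \<Omega>)" "emeasure \<mu> \<Omega> < \<infinity>" "\<Omega> \<in> sets borel"
    and ball: "\<And>x \<rho>. x \<in> \<Omega> \<Longrightarrow> 0 < \<rho> \<Longrightarrow> emeasure \<mu> (ball x \<rho> \<inter> \<Omega>) \<le> ennreal (C * \<rho> powr \<alpha>)"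
    and E: "E \<in> sets \<mu>"
  shows "(\<integral>\<^sup>+x. ennreal (norm (x - y) powr (1 - n)) * indicator E x \<partial>\<mu>)
    \<le> ennreal ((1 + C * 2 powr (\<alpha> + n - 1) / (1 - (1/2) powr (\<alpha> - n + 1))) * measure \<mu> E powr (1 - (n - 1) / \<alpha>))"
proof -
  have n1: "1 \<le> n" unfolding n_def by (metis One_nat_def Suc_leI of_nat_1 of_nat_le_iff zero_less_card_finite)
  have sp: "space \<mu> = \<Omega>" using sets_eq_imp_space_eq[OF \<mu>(1)] by (simp add: space_restrict_space)
  have id[measurable]: "(\<lambda>x. x) \<in> measurable \<mu> borel"
    by (subst measurable_cong_sets[OF \<mu>(1) refl]) (rule measurable_restrict_space1, simp)
  note [measurable] = E
  have fin: "emeasure \<mu> A \<noteq> top" for A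
    using \<mu>(2) emeasure_space[of \<mu> A] by (auto simp: sp top_unique)
  define m where "m = measure \<mu> E"
  have m0: "0 \<le> m" by (simp add: m_def)
  have Em: "emeasure \<mu> E = ennreal m" using fin[of E] by (simp add: m_def emeasure_eq_ennreal_measure)
  show ?thesis
  proof (cases "m = 0")
    case True
    then have "E \<in> null_sets \<mu>" using E Em by auto
    then have "AE x in \<mu>. x \<notin> E" by (rule AE_not_in)
    then have "AE x in \<mu>. ennreal (norm (x - y) powr (1 - n)) * indicator E x = 0"
      by eventually_elim simp
    then have "(\<integral>\<^sup>+x. ennreal (norm (x - y) powr (1 - n)) * indicator E x \<partial>\<mu>) = 0"
      by (subst nn_integral_cong_AE[where v="\<lambda>_. 0"]) auto
    then show ?thesis by simp
  next
    case False
    then have m: "0 < m" using m0 by simp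
    have \<alpha>0: "0 < \<alpha>" using \<alpha> n1 by linarith
    define R where "R = m powr (1 / \<alpha>)"
    have R: "0 < R" "R powr \<alpha> = m" using m \<alpha>0 by (auto simp: R_def powr_powr)
    define \<beta> where "\<beta> = \<alpha> - n + 1"
    have \<beta>: "0 < \<beta>" using \<alpha> by (simp add: \<beta>_def)
    have Rm: "R powr \<beta> = m powr (1 - (n - 1) / \<alpha>)"
      using \<alpha>0 by (simp add: R_def powr_powr \<beta>_def field_simps)
    \<comment> \<open>\<open>y\<close> ranges over the whole space while growth is assumed at points
      of \<Omega>; recentring at a point of the intersection doubles the radius.\<close>
    have ball2: "emeasure \<mu> (ball y \<rho> \<inter> \<Omega>) \<le> ennreal (C * (2 * \<rho>) powr \<alpha>)" if "0 < \<rho>" for \<rho>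
    proof (cases "ball y \<rho> \<inter> \<Omega> = {}")
      case False
      then obtain z where z: "z \<in> \<Omega>" "dist y z < \<rho>" by auto
      have "ball y \<rho> \<inter> \<Omega> \<subseteq> ball z (2 * \<rho>) \<inter> \<Omega>"
        using z(2) by (auto simp: dist_commute) (metis dist_commute dist_triangle_lt mult_2 add_strict_mono dist_triangle order_le_less_trans)
      then have "emeasure \<mu> (ball y \<rho> \<inter> \<Omega>) \<le> emeasure \<mu> (ball z (2 * \<rho>) \<inter> \<Omega>)"
        using \<mu>(3) by (intro emeasure_mono) (auto simp: \<mu>(1) sets_restrict_space)
      also have "\<dots> \<le> ennreal (C * (2 * \<rho>) powr \<alpha>)" using ball[OF z(1), of "2 * \<rho>"] that by simp
      finally show ?thesis .
    qed simp
    let ?s = "\<lambda>j::nat. R * (1/2) ^ j"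
    let ?k = "\<lambda>x. ennreal (norm (x - y) powr (1 - n))"
    have ptw: "?k x * indicator E x \<le> ennreal (R powr (1 - n)) * indicator E x
      + (\<Sum>j. ennreal (?s (Suc j) powr (1 - n)) * indicator (ball y (?s j) \<inter> \<Omega>) x)" if x: "x \<in> space \<mu>" for x
    proof -
      consider "x = y" | "x \<noteq> y" "R \<le> norm (x - y)" | "x \<noteq> y" "norm (x - y) < R" by linarith
      then show ?thesis
      proof cases
        case 2
        have "norm (x - y) powr (1 - n) \<le> R powr (1 - n)"
          using 2 R n1 by (intro powr_mono2') auto
        then have "?k x * indicator E x \<le> ennreal (R powr (1 - n)) * indicator E x"
          by (intro mult_right_mono ennreal_leI) auto
        then show ?thesis by (simp add: add_increasing2)
      next
        case 3
        then obtain j where j: "?s (Suc j) \<le> norm (x - y)" "norm (x - y) < ?s j"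
          using dyadic_shell[of "norm (x - y)" R] by auto
        have "0 < ?s (Suc j)" using R by simp
        then have "norm (x - y) powr (1 - n) \<le> ?s (Suc j) powr (1 - n)"
          using n1 j(1) by (intro powr_mono2') auto
        then have "?k x \<le> ennreal (?s (Suc j) powr (1 - n)) * indicator (ball y (?s j) \<inter> \<Omega>) x"
          using j(2) x by (auto simp: sp indicator_def dist_norm norm_minus_commute intro!: ennreal_leI)
        also have "\<dots> \<le> (\<Sum>j. ennreal (?s (Suc j) powr (1 - n)) * indicator (ball y (?s j) \<inter> \<Omega>) x)"
          by (rule ennreal_suminf_ge)
        finally show ?thesis
          by (cases "x \<in> E") (auto simp: add_increasing)
      qed simp
    qed
    have bm[measurable]: "ball y \<rho> \<inter> \<Omega> \<in> sets \<mu>" for \<rho>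
      using \<mu>(3) by (auto simp: \<mu>(1) sets_restrict_space)
    have tm: "ennreal (?s (Suc j) powr (1 - n)) * emeasure \<mu> (ball y (?s j) \<inter> \<Omega>)
      \<le> ennreal (C * 2 powr (\<alpha> + n - 1) * R powr \<beta> * ((1/2) powr \<beta>) ^ j)" for j
    proof -
      have sj: "0 < ?s j" using R by simp
      have "ennreal (?s (Suc j) powr (1 - n)) * emeasure \<mu> (ball y (?s j) \<inter> \<Omega>)
        \<le> ennreal (?s (Suc j) powr (1 - n)) * ennreal (C * (2 * ?s j) powr \<alpha>)"
        by (intro mult_left_mono ball2 sj) auto
      also have "\<dots> = ennreal ((?s j * (1/2)) powr (1 - n) * (C * (2 * ?s j) powr \<alpha>))"
        using C by (simp flip: ennreal_mult)
      also have "(?s j * (1/2)) powr (1 - n) * (C * (2 * ?s j) powr \<alpha>) = C * ((1/2) powr (1 - n) * 2 powr \<alpha>) * (?s j powr (1 - n) * ?s j powr \<alpha>)"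
        using sj by (subst (1 2) powr_mult) (auto simp: algebra_simps)
      also have "(1/2) powr (1 - n) = 2 powr (n - 1)"
      proof -
        have "(1/2::real) powr (1 - n) = 1 / 2 powr (1 - n)" by (simp add: powr_divide)
        also have "\<dots> = 2 powr (- (1 - n))" by (simp only: powr_minus_divide)
        finally show ?thesis by simp
      qed
      also have "2 powr (n - 1) * 2 powr \<alpha> = 2 powr (\<alpha> + n - 1)"
        by (simp add: powr_add[symmetric] algebra_simps)
      also have "?s j powr (1 - n) * ?s j powr \<alpha> = ?s j powr \<beta>"
        by (simp add: powr_add[symmetric] \<beta>_def algebra_simps)
      also have "?s j powr \<beta> = R powr \<beta> * ((1/2) powr \<beta>) ^ j"
      proof -
        have "((1/2::real) ^ j) powr \<beta> = ((1/2) powr real j) powr \<beta>" by (simp only: powr_realpow zero_less_divide_1_iff zero_less_numeral)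
        also have "\<dots> = ((1/2) powr \<beta>) powr real j" by (simp only: powr_powr mult.commute)
        also have "\<dots> = ((1/2) powr \<beta>) ^ j" by (rule powr_realpow) simp
        finally show ?thesis using R by (simp only: powr_mult)
      qed
      finally show ?thesis by (simp add: mult.assoc)
    qed
    have q: "0 \<le> (1/2::real) powr \<beta>" "(1/2::real) powr \<beta> < 1"
      using powr_less_mono2[OF \<beta>, of "1/2" 1] by auto
    have "(\<integral>\<^sup>+x. ?k x * indicator E x \<partial>\<mu>) \<le> (\<integral>\<^sup>+x. ennreal (R powr (1 - n)) * indicator E x
      + (\<Sum>j. ennreal (?s (Suc j) powr (1 - n)) * indicator (ball y (?s j) \<inter> \<Omega>) x) \<partial>\<mu>)"
      by (intro nn_integral_mono ptw)
    also have "\<dots> = ennreal (R powr (1 - n)) * emeasure \<mu> E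
      + (\<Sum>j. ennreal (?s (Suc j) powr (1 - n)) * emeasure \<mu> (ball y (?s j) \<inter> \<Omega>))"
      by (subst nn_integral_add) (auto simp: nn_integral_suminf nn_integral_cmult_indicator)
    also have "\<dots> \<le> ennreal (R powr \<beta>) + (\<Sum>j. ennreal (C * 2 powr (\<alpha> + n - 1) * R powr \<beta> * ((1/2) powr \<beta>) ^ j))"
    proof (intro add_mono suminf_le tm)
      have "R powr (1 - n) * R powr \<alpha> = R powr \<beta>" by (simp add: powr_add[symmetric] \<beta>_def algebra_simps)
      then show "ennreal (R powr (1 - n)) * emeasure \<mu> E \<le> ennreal (R powr \<beta>)"
        using R(2) by (simp add: Em ennreal_mult'[symmetric])
    qed auto
    also have "(\<Sum>j. ennreal (C * 2 powr (\<alpha> + n - 1) * R powr \<beta> * ((1/2) powr \<beta>) ^ j))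
      = ennreal (C * 2 powr (\<alpha> + n - 1) * R powr \<beta> * (1 / (1 - (1/2) powr \<beta>)))"
      using q C by (intro suminf_ennreal_eq sums_mult geometric_sums) auto
    also have "ennreal (R powr \<beta>) + \<dots> = ennreal ((1 + C * 2 powr (\<alpha> + n - 1) / (1 - (1/2) powr \<beta>)) * R powr \<beta>)"
      using q C by (subst ennreal_plus[symmetric]) (auto simp: algebra_simps)
    finally show ?thesis by (simp only: Rm m_def[symmetric] \<beta>_def[symmetric])
  qed
qed

text \<open>The definition of a weak gradient gives integrability on compact subsets, so
  measurability on \<Omega> comes from an exhaustion by compact sets.\<close>

lemma weak_gradient_measurable:
  fixes G :: "real^'n::finite \<Rightarrow> real^'n"
  assumes \<Omega>: "open \<Omega>" and wg: "has_weak_gradient \<Omega> u G"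
  shows "(\<lambda>y. ennreal (norm (G y)) * indicator \<Omega> y) \<in> borel_measurable lebesgue"
proof -
  obtain C where C: "\<And>n. compact (C n)" "\<And>n. C n \<subseteq> \<Omega>" "\<And>n. C n \<subseteq> interior (C (Suc n))" "(\<Union>n. C n) = \<Omega>"
    using open_Union_compact_subsets[OF \<Omega>] by (metis (no_types, lifting))
  have inc: "C m \<subseteq> C k" if "m \<le> k" for m k
    using that by (induction rule: dec_induct) (use C(3) interior_subset in blast)+
  have Gi: "(\<lambda>y. indicator \<Omega> y * G y $ i) \<in> borel_measurable lebesgue" for i
  proof (rule borel_measurable_LIMSEQ_real)
    fix y
    show "(\<lambda>n. indicator (C n) y * G y $ i) \<longlonglongrightarrow> indicator \<Omega> y * G y $ i"
    proof (cases "y \<in> \<Omega>")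
      case True
      then obtain m where "y \<in> C m" using C(4) by blast
      then have "y \<in> C n" if "m \<le> n" for n using inc[OF that] by blast
      then have "\<forall>\<^sub>F n in sequentially. indicator (C n) y * G y $ i = indicator \<Omega> y * G y $ i"
        using True by (auto simp: eventually_sequentially intro!: exI[of _ m])
      then show ?thesis by (rule tendsto_eventually)
    next
      case False
      then have "y \<notin> C n" for n using C(2) by blast
      then show ?thesis using False by simp
    qed
  next
    fix n
    have "set_integrable lebesgue (C n) (\<lambda>y. G y $ i)"
      using wg C(1)[of n] C(2)[of n] unfolding has_weak_gradient_def by blast
    then have "integrable lebesgue (\<lambda>y. indicator (C n) y * G y $ i)" by (simp add: set_integrable_def)
    then show "(\<lambda>y. indicator (C n) y * G y $ i) \<in> borel_measurable lebesgue"
      by (rule borel_measurable_integrable)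
  qed
  have "ennreal (norm (G y)) * indicator \<Omega> y = ennreal (sqrt (\<Sum>i\<in>UNIV. (indicator \<Omega> y * G y $ i)\<^sup>2))" for y
    by (auto simp: indicator_def norm_vec_def L2_set_def)
  moreover have "(\<lambda>y. ennreal (sqrt (\<Sum>i\<in>UNIV. (indicator \<Omega> y * G y $ i)\<^sup>2))) \<in> borel_measurable lebesgue"
    using Gi by measurable
  ultimately show ?thesis by simp
qed

text \<open>The constant of \<open>potential_integral_bound\<close>: 1 for the far part, the rest
  for the geometric series over the shells.\<close>

definition levelA :: "real \<Rightarrow> real \<Rightarrow> real \<Rightarrow> real" where
  "levelA C \<alpha> n = 1 + C * 2 powr (\<alpha> + n - 1) / (1 - (1/2) powr (\<alpha> - n + 1))"

lemma levelA_pos: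
  assumes "n - 1 < \<alpha>" "0 < C" shows "1 \<le> levelA C \<alpha> n"
proof -
  have "(1/2::real) powr (\<alpha> - n + 1) < 1" using powr_less_mono2[of "\<alpha> - n + 1" "1/2" 1] assms by auto
  then show ?thesis using assms by (simp add: levelA_def)
qed

text \<open>\<open>pointwise_potential\<close> is integrated over \<open>E\<close> against \<mu> and
  the order of integration is exchanged. \<open>potential_integral_bound\<close> bounds the inner
  integral by a multiple of \<open>m powr (1 - \<theta>)\<close>, uniformly in \<open>y\<close>, and
  dividing by this power leaves \<open>m powr \<theta>\<close>.\<close>

lemma level_cover_inequality:
  fixes \<Omega> :: "(real^'n::finite) set" and u :: "real^'n \<Rightarrow> real" and z :: "'i \<Rightarrow> real^'n" and r :: "'i \<Rightarrow> real"
    and \<mu> :: "(real^'n) measure"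
  defines "n \<equiv> real CARD('n)"
  assumes \<Omega>: "open \<Omega>" and u: "continuous_on (closure \<Omega>) u" "bounded {x \<in> closure \<Omega>. u x \<noteq> 0}"
    and wg: "has_weak_gradient \<Omega> u G"
    and \<alpha>: "n - 1 < \<alpha>" and C: "0 < C"
    and \<mu>: "sets \<mu> = sets (restrict_space borel \<Omega>)" "emeasure \<mu> \<Omega> < \<infinity>"
    and ball: "\<And>x \<rho>. x \<in> \<Omega> \<Longrightarrow> 0 < \<rho> \<Longrightarrow> emeasure \<mu> (ball x \<rho> \<inter> \<Omega>) \<le> ennreal (C * \<rho> powr \<alpha>)"
    and st: "0 < s" "s < t"
    and I: "finite I" "\<And>i. i \<in> I \<Longrightarrow> 0 < r i"
      "{y \<in> frontier \<Omega>. s \<le> \<bar>u y\<bar>} \<subseteq> (\<Union>i\<in>I. ball (z i) (r i))"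
    and E: "E \<in> sets \<mu>" "\<And>x. x \<in> E \<Longrightarrow> x \<in> \<Omega> \<and> t < \<bar>u x\<bar> \<and> x \<notin> (\<Union>i\<in>I. cball (z i) (2 * r i))"
  shows "ennreal (n * 2 powr (- n / 2 - 1) * unit_ball_vol n * measure \<mu> E powr ((n - 1) / \<alpha>))
    \<le> ennreal (levelA C \<alpha> n) * (ennreal (n * 16 * 2 powr n * unit_ball_vol n * (\<Sum>i\<in>I. r i powr (n - 1)))
        + ennreal (4 * n / (t - s)) * (\<integral>\<^sup>+y. ennreal (norm (G y)) * indicator {y \<in> \<Omega>. s < \<bar>u y\<bar>} y \<partial>lebesgue))"
proof -
  have n1: "1 \<le> n" unfolding n_def by (metis One_nat_def Suc_leI of_nat_1 of_nat_le_iff zero_less_card_finite)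
  have \<alpha>0: "0 < \<alpha>" using \<alpha> n1 by linarith
  have u\<Omega>: "continuous_on \<Omega> u" using u(1) closure_subset continuous_on_subset by blast
  have sp: "space \<mu> = \<Omega>" using sets_eq_imp_space_eq[OF \<mu>(1)] by (simp add: space_restrict_space)
  have id[measurable]: "(\<lambda>x. x) \<in> measurable \<mu> borel"
    by (subst measurable_cong_sets[OF \<mu>(1) refl]) (rule measurable_restrict_space1, simp)
  note [measurable] = E(1)
  have fin: "emeasure \<mu> A \<noteq> top" for A
    using \<mu>(2) emeasure_space[of \<mu> A] by (auto simp: sp top_unique)
  interpret \<mu>: finite_measure \<mu> by standard (use fin in auto)
  interpret P: pair_sigma_finite \<mu> "lborel :: (real^'n) measure" ..
  define m where "m = measure \<mu> E"
  define c where "c = n * 2 powr (- n / 2 - 1) * unit_ball_vol n"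
  have c: "0 < c" using n1 by (simp add: c_def)
  define A where "A = levelA C \<alpha> n"
  define \<theta> where "\<theta> = (n - 1) / \<alpha>"
  define W where "W = {y \<in> \<Omega>. s < \<bar>u y\<bar>}"
  define g where "g y = ennreal (norm (G y)) * indicator W y" for y
  define F where "F y = ennreal (n * (\<Sum>i\<in>I. 16 / r i * indicator (ball (z i) (2 * r i)) y)) + ennreal (4 * n / (t - s)) * g y" for y
  have "open W"
    using continuous_open_preimage[of \<Omega> "\<lambda>y. \<bar>u y\<bar>" "{s<..}"] u\<Omega> \<Omega>
    by (auto simp: W_def vimage_def Int_def intro: continuous_intros)
  then have Wm: "W \<in> sets lebesgue" by simp
  have gm: "g \<in> borel_measurable lebesgue"
  proof -
    have "g = (\<lambda>y. (ennreal (norm (G y)) * indicator \<Omega> y) * indicator W y)"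
      by (auto simp: g_def W_def indicator_def)
    moreover have "(\<lambda>y. (ennreal (norm (G y)) * indicator \<Omega> y) * indicator W y) \<in> borel_measurable lebesgue"
      by (rule borel_measurable_times_ennreal[OF weak_gradient_measurable[OF \<Omega> wg] borel_measurable_indicator[OF Wm]])
    ultimately show ?thesis by simp
  qed
  have F_eq: "F y = (\<Sum>i\<in>I. ennreal (n * 16 / r i) * indicator (ball (z i) (2 * r i)) y) + ennreal (4 * n / (t - s)) * g y" for y
  proof -
    have "ennreal (n * (\<Sum>i\<in>I. 16 / r i * indicator (ball (z i) (2 * r i)) y))
      = (\<Sum>i\<in>I. ennreal (n * 16 / r i * indicator (ball (z i) (2 * r i)) y))"
      using n1 I(2) by (subst sum_ennreal) (auto simp: sum_distrib_left less_imp_le mult_ac)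
    also have "\<dots> = (\<Sum>i\<in>I. ennreal (n * 16 / r i) * indicator (ball (z i) (2 * r i)) y)"
      by (intro sum.cong) (auto simp: indicator_def)
    finally show ?thesis by (simp add: F_def)
  qed
  have bl: "indicator (ball p q) \<in> borel_measurable (lebesgue :: (real^'n) measure)" for p :: "real^'n" and q
    by (intro borel_measurable_indicator) simp
  have Fm: "F \<in> borel_measurable lebesgue"
    unfolding F_eq[abs_def]
    by (intro borel_measurable_add borel_measurable_sum borel_measurable_times_ennreal bl gm borel_measurable_const)
  \<comment> \<open>A Borel version of the density, so that the integrals over \<mu> and
    \<open>lborel\<close> can be exchanged; \<open>FF0\<close> shows that no integral
    changes.\<close>
  obtain F0 where F0[measurable]: "F0 \<in> borel_measurable lborel" and F0AE: "AE y in lborel. F y = F0 y"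
    using completion_ex_borel_measurable[OF Fm] by auto
  have FF0: "(\<integral>\<^sup>+y. F y * k y \<partial>lebesgue) = (\<integral>\<^sup>+y. F0 y * k y \<partial>lborel)" for k
  proof -
    have "AE y in lebesgue. F y * k y = F0 y * k y"
      using AE_completion[OF F0AE] by eventually_elim simp
    then have "(\<integral>\<^sup>+y. F y * k y \<partial>lebesgue) = (\<integral>\<^sup>+y. F0 y * k y \<partial>lebesgue)"
      by (rule nn_integral_cong_AE)
    then show ?thesis by (simp add: nn_integral_completion)
  qed
  let ?k = "\<lambda>x y. ennreal (norm (x - y) powr (1 - n))"
  have intF: "(\<integral>\<^sup>+y. F0 y \<partial>lborel) = ennreal (n * 16 * 2 powr n * unit_ball_vol n * (\<Sum>i\<in>I. r i powr (n - 1)))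
      + ennreal (4 * n / (t - s)) * (\<integral>\<^sup>+y. g y \<partial>lebesgue)"
  proof -
    have "(\<integral>\<^sup>+y. F0 y \<partial>lborel) = (\<integral>\<^sup>+y. F y \<partial>lebesgue)" using FF0[of "\<lambda>_. 1"] by simp
    also have "\<dots> = (\<Sum>i\<in>I. ennreal (n * 16 / r i) * emeasure lebesgue (ball (z i) (2 * r i))) + ennreal (4 * n / (t - s)) * (\<integral>\<^sup>+y. g y \<partial>lebesgue)"
    proof -
      have "(\<integral>\<^sup>+y. F y \<partial>lebesgue) = (\<integral>\<^sup>+y. (\<Sum>i\<in>I. ennreal (n * 16 / r i) * indicator (ball (z i) (2 * r i)) y) \<partial>lebesgue)
        + (\<integral>\<^sup>+y. ennreal (4 * n / (t - s)) * g y \<partial>lebesgue)"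
        unfolding F_eq
        by (intro nn_integral_add borel_measurable_sum borel_measurable_times_ennreal bl gm borel_measurable_const)
      also have "(\<integral>\<^sup>+y. (\<Sum>i\<in>I. ennreal (n * 16 / r i) * indicator (ball (z i) (2 * r i)) y) \<partial>lebesgue)
        = (\<Sum>i\<in>I. \<integral>\<^sup>+y. ennreal (n * 16 / r i) * indicator (ball (z i) (2 * r i)) y \<partial>lebesgue)"
        by (intro nn_integral_sum borel_measurable_times_ennreal bl borel_measurable_const)
      also have "\<dots> = (\<Sum>i\<in>I. ennreal (n * 16 / r i) * emeasure lebesgue (ball (z i) (2 * r i)))"
        by (intro sum.cong refl nn_integral_cmult_indicator) simp
      also have "(\<integral>\<^sup>+y. ennreal (4 * n / (t - s)) * g y \<partial>lebesgue) = ennreal (4 * n / (t - s)) * (\<integral>\<^sup>+y. g y \<partial>lebesgue)"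
        by (rule nn_integral_cmult[OF gm])
      finally show ?thesis .
    qed
    also have "(\<Sum>i\<in>I. ennreal (n * 16 / r i) * emeasure lebesgue (ball (z i) (2 * r i))) = (\<Sum>i\<in>I. ennreal (n * 16 * 2 powr n * unit_ball_vol n * r i powr (n - 1)))"
    proof (rule sum.cong[OF refl])
      fix i assume i: "i \<in> I"
      have ri: "0 < r i" by (rule I(2)[OF i])
      have "emeasure lebesgue (ball (z i) (2 * r i)) = ennreal (unit_ball_vol n * (2 * r i) ^ CARD('n))"
        using emeasure_ball[of "2 * r i" "z i"] ri by (simp add: n_def)
      also have "(2 * r i) ^ CARD('n) = 2 powr n * (r i * r i powr (n - 1))"
        using ri powr_mult_base[of "r i" "n - 1"] by (simp add: n_def powr_realpow[symmetric] powr_mult)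
      finally have e: "emeasure lebesgue (ball (z i) (2 * r i)) = ennreal (unit_ball_vol n * (2 powr n * (r i * r i powr (n - 1))))" .
      show "ennreal (n * 16 / r i) * emeasure lebesgue (ball (z i) (2 * r i)) = ennreal (n * 16 * 2 powr n * unit_ball_vol n * r i powr (n - 1))"
        unfolding e using ri n1 by (subst ennreal_mult[symmetric]) (auto simp: algebra_simps)
    qed
    also have "\<dots> = ennreal (n * 16 * 2 powr n * unit_ball_vol n * (\<Sum>i\<in>I. r i powr (n - 1)))"
      using n1 by (subst sum_ennreal) (auto simp: sum_distrib_left)
    finally show ?thesis .
  qed
  have "ennreal c * ennreal m = (\<integral>\<^sup>+x. ennreal c * indicator E x \<partial>\<mu>)"
    using fin[of E] by (simp add: nn_integral_cmult_indicator m_def emeasure_eq_ennreal_measure)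
  also have "\<dots> \<le> (\<integral>\<^sup>+x. (\<integral>\<^sup>+y. F0 y * (?k x y * indicator E x) \<partial>lborel) \<partial>\<mu>)"
  proof (rule nn_integral_mono)
    fix x
    show "ennreal c * indicator E x \<le> (\<integral>\<^sup>+y. F0 y * (?k x y * indicator E x) \<partial>lborel)"
    proof (cases "x \<in> E")
      case True
      have "ennreal c \<le> (\<integral>\<^sup>+y. F y * ?k x y \<partial>lebesgue)"
        unfolding c_def F_def g_def W_def n_def
        by (rule pointwise_potential[OF \<Omega> u wg st I]) (use E(2)[OF True] in auto)
      then show ?thesis using True by (simp add: FF0)
    qed simp
  qed
  also have "\<dots> = (\<integral>\<^sup>+y. (\<integral>\<^sup>+x. F0 y * (?k x y * indicator E x) \<partial>\<mu>) \<partial>lborel)"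
    by (rule P.Fubini'[symmetric]) measurable
  also have "\<dots> = (\<integral>\<^sup>+y. F0 y * (\<integral>\<^sup>+x. ?k x y * indicator E x \<partial>\<mu>) \<partial>lborel)"
    by (intro nn_integral_cong nn_integral_cmult) measurable
  also have "\<dots> \<le> (\<integral>\<^sup>+y. F0 y * ennreal (A * m powr (1 - \<theta>)) \<partial>lborel)"
    unfolding A_def m_def \<theta>_def levelA_def n_def
    by (intro nn_integral_mono mult_left_mono potential_integral_bound[OF \<alpha>[unfolded n_def] C \<mu> _ ball E(1)])
      (use \<Omega> in auto)
  also have "\<dots> = (\<integral>\<^sup>+y. F0 y \<partial>lborel) * ennreal (A * m powr (1 - \<theta>))"
    by (rule nn_integral_multc) measurable
  finally have main: "ennreal c * ennreal m \<le> (\<integral>\<^sup>+y. F0 y \<partial>lborel) * ennreal (A * m powr (1 - \<theta>))" .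
  have A1: "1 \<le> A" unfolding A_def by (rule levelA_pos[OF \<alpha> C])
  have "ennreal (c * m powr \<theta>) \<le> ennreal A * (\<integral>\<^sup>+y. F0 y \<partial>lborel)"
  proof (cases "m = 0")
    case False
    then have m: "0 < m" by (simp add: m_def less_le)
    have "ennreal (c * m powr \<theta>) = ennreal (m powr (\<theta> - 1)) * (ennreal c * ennreal m)"
      using m c powr_mult_base[of m "\<theta> - 1"] by (simp add: ennreal_mult[symmetric] algebra_simps)
    also have "\<dots> \<le> ennreal (m powr (\<theta> - 1)) * ((\<integral>\<^sup>+y. F0 y \<partial>lborel) * ennreal (A * m powr (1 - \<theta>)))"
      by (intro mult_left_mono main) simp
    also have "\<dots> = ennreal (m powr (\<theta> - 1) * (A * m powr (1 - \<theta>))) * (\<integral>\<^sup>+y. F0 y \<partial>lborel)"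
      using A1 by (simp add: ennreal_mult mult_ac)
    also have "m powr (\<theta> - 1) * (A * m powr (1 - \<theta>)) = A"
      using m by (simp add: powr_add[symmetric] mult.left_commute)
    finally show ?thesis .
  qed simp
  then show ?thesis unfolding intF by (simp only: c_def m_def \<theta>_def A_def g_def[abs_def] W_def)
qed

text \<open>The denominator is the lower bound of \<open>pointwise_potential\<close>. The second
  line collects the mass of the cutoff gradient times the covering constant of
  \<open>hausdorff_compact_ball_cover\<close>, and \<open>8 * n\<close>, which is
  \<open>4 * n\<close> doubled because half of the gap between the levels is given away.\<close>

definition levelK :: "real \<Rightarrow> real \<Rightarrow> real \<Rightarrow> real" where
  "levelK C \<alpha> n = levelA C \<alpha> n / (n * 2 powr (- n / 2 - 1) * unit_ball_vol n) *
    (n * 16 * 2 powr n * unit_ball_vol n * (4 powr (n - 1) * Gamma ((n - 1)/2 + 1) / pi powr ((n - 1)/2)) + 8 * n)"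

text \<open>The covers come with radii tending to zero. Points of the superlevel set farther than
  \<open>3 * \<delta> k\<close> from the complement of \<Omega> avoid all doubled balls, so
  \<open>level_cover_inequality\<close> applies to them, and they exhaust the set as
  \<open>k\<close> grows.\<close>

lemma level_inequality:
  fixes \<Omega> :: "(real^'n::finite) set" and u :: "real^'n \<Rightarrow> real" and \<mu> :: "(real^'n) measure"
  defines "n \<equiv> real CARD('n)"
  assumes n2: "2 \<le> CARD('n)"
    and \<Omega>: "open \<Omega>" "emeasure lebesgue \<Omega> < \<infinity>" "hausdorff (n - 1) (frontier \<Omega>) < \<infinity>"
    and u: "continuous_on (closure \<Omega>) u" "bounded {x \<in> closure \<Omega>. u x \<noteq> 0}"
    and wg: "has_weak_gradient \<Omega> u G"
    and \<alpha>: "n - 1 < \<alpha>" and C: "0 < C"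
    and \<mu>: "sets \<mu> = sets (restrict_space borel \<Omega>)" "emeasure \<mu> \<Omega> < \<infinity>"
    and ball: "\<And>x \<rho>. x \<in> \<Omega> \<Longrightarrow> 0 < \<rho> \<Longrightarrow> emeasure \<mu> (ball x \<rho> \<inter> \<Omega>) \<le> ennreal (C * \<rho> powr \<alpha>)"
    and st: "0 \<le> s" "s < t"
  shows "ennreal ((t - s) * measure \<mu> {x \<in> \<Omega>. t < \<bar>u x\<bar>} powr ((n - 1) / \<alpha>))
    \<le> ennreal (levelK C \<alpha> n) * ((\<integral>\<^sup>+y. ennreal (norm (G y)) * indicator {y \<in> \<Omega>. s < \<bar>u y\<bar>} y \<partial>lebesgue)
        + ennreal (t - s) * hausdorff (n - 1) {y \<in> frontier \<Omega>. s < \<bar>u y\<bar>})"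
proof (cases "\<Omega> = {}")
  case True
  then show ?thesis by simp
next
  case False
  have n1: "2 \<le> n" unfolding n_def using n2 by simp
  have \<alpha>0: "0 < \<alpha>" using \<alpha> n1 by linarith
  have u\<Omega>: "continuous_on \<Omega> u" using u(1) closure_subset continuous_on_subset by blast
  have sp: "space \<mu> = \<Omega>" using sets_eq_imp_space_eq[OF \<mu>(1)] by (simp add: space_restrict_space)
  have fin: "emeasure \<mu> A \<noteq> top" for A
    using \<mu>(2) emeasure_space[of \<mu> A] by (auto simp: sp top_unique)
  interpret \<mu>: finite_measure \<mu> by standard (use fin in auto)
  have "\<Omega> \<noteq> UNIV" using \<Omega>(2) by auto
  then have ne: "- \<Omega> \<noteq> {}" by auto
  \<comment> \<open>The intermediate level allows a closed, hence compact, boundary set that still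
    lies where \<bar>u\<bar> exceeds \<open>s\<close>; it is positive even for
    \<open>s = 0\<close>.\<close>
  define s' where "s' = (s + t) / 2"
  have s': "0 < s'" "s' < t" "s < s'" "t - s' = (t - s) / 2" using st by (auto simp: s'_def field_simps)
  define X where "X = (\<integral>\<^sup>+y. ennreal (norm (G y)) * indicator {y \<in> \<Omega>. s < \<bar>u y\<bar>} y \<partial>lebesgue)"
  define H where "H = hausdorff (n - 1) {y \<in> frontier \<Omega>. s < \<bar>u y\<bar>}"
  define H0 where "H0 = enn2real H"
  have "H \<le> hausdorff (n - 1) (frontier \<Omega>)" unfolding H_def by (rule hausdorff_mono) auto
  then have "H < top" using \<Omega>(3) by (simp add: order_le_less_trans)
  then have H0: "H = ennreal H0" "0 \<le> H0" by (simp_all add: H0_def)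
  define K0 where "K0 = {y \<in> frontier \<Omega>. s' \<le> \<bar>u y\<bar>}"
  have K0: "compact K0"
  proof -
    have "closed K0"
      unfolding K0_def
      using continuous_closed_preimage[of "frontier \<Omega>" "\<lambda>y. \<bar>u y\<bar>" "{s'..}"]
        continuous_on_subset[OF u(1), of "frontier \<Omega>"]
      by (auto simp: vimage_def Int_def frontier_def closed_Diff intro!: continuous_intros)
    moreover have "bounded K0"
      by (rule bounded_subset[OF u(2)]) (use s' in \<open>auto simp: K0_def frontier_def\<close>)
    ultimately show ?thesis by (simp add: compact_eq_bounded_closed)
  qed
  have HK0: "hausdorff (n - 1) K0 \<le> ennreal H0"
    unfolding H0(1)[symmetric] H_def by (rule hausdorff_mono) (use s' in \<open>auto simp: K0_def\<close>)
  define \<delta> where "\<delta> k = 1 / (real k + 1)" for k :: nat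
  have \<delta>: "0 < \<delta> k" for k by (simp add: \<delta>_def)
  have \<delta>lim: "\<delta> \<longlonglongrightarrow> 0" unfolding \<delta>_def using LIMSEQ_inverse_real_of_nat by (simp add: inverse_eq_divide add.commute)
  define E where "E = {x \<in> \<Omega>. t < \<bar>u x\<bar>}"
  \<comment> \<open>The factor 3 is 2 for the doubled ball plus 1 for the distance from its centre
    to a boundary point inside it, see \<open>sub\<close>.\<close>
  define Ek where "Ek k = {x \<in> \<Omega>. t < \<bar>u x\<bar> \<and> 3 * \<delta> k < infdist x (- \<Omega>)}" for k
  have oE: "open E"
    using continuous_open_preimage[of \<Omega> "\<lambda>y. \<bar>u y\<bar>" "{t<..}"] u\<Omega> \<Omega>(1)
    by (auto simp: E_def vimage_def Int_def intro: continuous_intros)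
  have oI: "open {x. 3 * \<delta> k < infdist x (- \<Omega>)}" for k
    by (intro open_Collect_less continuous_intros)
  have oEk: "open (Ek k)" for k
    using open_Int[OF oE oI[of k]] by (simp add: Ek_def E_def Int_def conj_assoc)
  have sets: "S \<in> sets \<mu>" if "open S" "S \<subseteq> \<Omega>" for S
    unfolding \<mu>(1) using \<Omega>(1) that by (subst sets_restrict_space_iff) auto
  have Es: "E \<in> sets \<mu>" "Ek k \<in> sets \<mu>" for k
    using oE oEk by (auto intro!: sets simp: E_def Ek_def)
  define c where "c = n * 2 powr (- n / 2 - 1) * unit_ball_vol n"
  have c: "0 < c" using n1 by (simp add: c_def)
  define A where "A = levelA C \<alpha> n"
  have A1: "1 \<le> A" unfolding A_def by (rule levelA_pos[OF \<alpha> C])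
  define c1 where "c1 = n * 16 * 2 powr n * unit_ball_vol n"
  have c1: "0 \<le> c1" using n1 by (simp add: c1_def)
  define c2 where "c2 = 4 powr (n - 1) * Gamma ((n - 1)/2 + 1) / pi powr ((n - 1)/2)"
  have "0 < (n - 1)/2 + 1"
    by (rule add_nonneg_pos[OF divide_nonneg_pos]) (use n1 in linarith)+
  then have Gp: "0 < Gamma ((n - 1)/2 + 1)" by (rule Gamma_real_pos)
  have c2: "0 \<le> c2" unfolding c2_def using Gp by (intro divide_nonneg_nonneg mult_nonneg_nonneg) auto
  define \<theta> where "\<theta> = (n - 1) / \<alpha>"
  have \<theta>: "0 < \<theta>" using n1 \<alpha>0 by (simp add: \<theta>_def)
  have step: "ennreal (c * measure \<mu> (Ek k) powr \<theta>)
    \<le> ennreal A * (ennreal (c1 * (c2 * (H0 + \<delta> k))) + ennreal (4 * n / (t - s')) * X)" for k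
  proof -
    \<comment> \<open>The cover lemma wants a strict bound; the added \<open>\<delta> k\<close>
      disappears in the limit.\<close>
    have h1: "hausdorff (n - 1) K0 < ennreal (H0 + \<delta> k)"
      using HK0 H0(2) \<delta>[of k] by (auto intro: order_le_less_trans simp: ennreal_less_iff)
    have h2: "1 \<le> n - 1" using n1 by simp
    obtain I :: "nat set" and z r where I: "finite I" "K0 \<subseteq> (\<Union>i\<in>I. ball (z i) (r i))"
      "\<And>i. i \<in> I \<Longrightarrow> 0 < r i \<and> r i \<le> \<delta> k"
      "(\<Sum>i\<in>I. r i powr (n - 1)) \<le> 4 powr (n - 1) * Gamma ((n - 1)/2 + 1) / pi powr ((n - 1)/2) * (H0 + \<delta> k)"
      by (rule hausdorff_compact_ball_cover[OF h2 K0 h1 \<delta>[of k]]) blast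
    \<comment> \<open>Balls missing \<open>K0\<close> are discarded, since a ball is known to lie
      near the complement of \<Omega> only if it meets the boundary.\<close>
    define I' where "I' = {i \<in> I. ball (z i) (r i) \<inter> K0 \<noteq> {}}"
    have I': "finite I'" "\<And>i. i \<in> I' \<Longrightarrow> 0 < r i" using I by (auto simp: I'_def)
    have cov: "{y \<in> frontier \<Omega>. s' \<le> \<bar>u y\<bar>} \<subseteq> (\<Union>i\<in>I'. ball (z i) (r i))"
      using I(2) unfolding K0_def[symmetric] I'_def by blast
    have sub: "x \<notin> (\<Union>i\<in>I'. cball (z i) (2 * r i))" if x: "x \<in> Ek k" for x
    proof
      assume "x \<in> (\<Union>i\<in>I'. cball (z i) (2 * r i))"
      then obtain i where i: "i \<in> I'" "dist (z i) x \<le> 2 * r i" by auto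
      then obtain y where y: "dist (z i) y < r i" "y \<in> K0" by (auto simp: I'_def)
      have "y \<in> - \<Omega>" using y(2) \<Omega>(1) by (auto simp: K0_def frontier_def interior_open)
      then have "infdist x (- \<Omega>) \<le> dist x y" by (rule infdist_le)
      also have "\<dots> \<le> dist x (z i) + dist (z i) y" by (rule dist_triangle)
      also have "\<dots> \<le> 3 * r i" using i(2) y(1) by (simp add: dist_commute)
      also have "\<dots> \<le> 3 * \<delta> k" using I(3)[of i] i(1) by (simp add: I'_def)
      finally show False using x by (simp add: Ek_def)
    qed
    have "ennreal (c * measure \<mu> (Ek k) powr \<theta>) \<le> ennreal A * (ennreal (c1 * (\<Sum>i\<in>I'. r i powr (n - 1)))
        + ennreal (4 * n / (t - s')) * (\<integral>\<^sup>+y. ennreal (norm (G y)) * indicator {y \<in> \<Omega>. s' < \<bar>u y\<bar>} y \<partial>lebesgue))"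
      unfolding c_def A_def c1_def \<theta>_def n_def
      by (rule level_cover_inequality[OF \<Omega>(1) u wg \<alpha>[unfolded n_def] C \<mu> ball s'(1,2) I' cov Es(2)])
        (use sub in \<open>auto simp: Ek_def\<close>)
    also have "\<dots> \<le> ennreal A * (ennreal (c1 * (c2 * (H0 + \<delta> k))) + ennreal (4 * n / (t - s')) * X)"
    proof (intro mult_left_mono add_mono ennreal_leI)
      have "(\<Sum>i\<in>I'. r i powr (n - 1)) \<le> (\<Sum>i\<in>I. r i powr (n - 1))"
        using I(1) by (intro sum_mono2) (auto simp: I'_def)
      then show "(\<Sum>i\<in>I'. r i powr (n - 1)) \<le> c2 * (H0 + \<delta> k)" using I(4) unfolding c2_def by linarith
      show "(\<integral>\<^sup>+y. ennreal (norm (G y)) * indicator {y \<in> \<Omega>. s' < \<bar>u y\<bar>} y \<partial>lebesgue) \<le> X"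
        unfolding X_def using s'(3) by (intro nn_integral_mono mult_left_mono) (auto simp: indicator_def)
    qed (use c1 in auto)
    finally show ?thesis .
  qed
  have mlim: "(\<lambda>k. measure \<mu> (Ek k)) \<longlonglongrightarrow> measure \<mu> E"
  proof -
    have "incseq Ek"
    proof (rule incseq_SucI)
      fix k
      have "\<delta> (Suc k) \<le> \<delta> k" by (simp add: \<delta>_def field_simps)
      then show "Ek k \<subseteq> Ek (Suc k)" by (auto simp: Ek_def)
    qed
    moreover have "(\<Union>k. Ek k) = E"
    proof
      show "E \<subseteq> (\<Union>k. Ek k)"
      proof
        fix x assume x: "x \<in> E"
        have "closed (- \<Omega>)" using \<Omega>(1) by (rule closed_Compl)
        then have "0 < infdist x (- \<Omega>)"
          using x ne in_closed_iff_infdist_zero[of "- \<Omega>" x] infdist_nonneg[of x "- \<Omega>"] by (auto simp: E_def less_le)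
        then have "\<forall>\<^sub>F k in sequentially. \<delta> k < infdist x (- \<Omega>) / 3"
          by (intro order_tendstoD(2)[OF \<delta>lim]) simp
        then obtain k where "\<delta> k < infdist x (- \<Omega>) / 3" by (auto simp: eventually_sequentially)
        then show "x \<in> (\<Union>k. Ek k)" using x by (auto simp: Ek_def E_def intro!: exI[of _ k])
      qed
    qed (auto simp: E_def Ek_def)
    ultimately show ?thesis using \<mu>.finite_Lim_measure_incseq[of Ek] Es(2) by auto
  qed
  have lk: "A / c * (c1 * c2 + 8 * n) = levelK C \<alpha> n"
    unfolding levelK_def A_def c_def c1_def c2_def by (rule refl)
  have "0 < 8 * n" using n1 by linarith
  then have lkpos: "0 < levelK C \<alpha> n"
    unfolding lk[symmetric] using A1 c c1 c2
    by (intro mult_pos_pos divide_pos_pos add_nonneg_pos mult_nonneg_nonneg) linarith+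
  show ?thesis
  proof (cases "X = top")
    case True
    have "ennreal (levelK C \<alpha> n) * (X + ennreal (t - s) * H) = top"
      using True lkpos by (simp add: ennreal_mult_top)
    then show ?thesis by (simp only: X_def H_def top_greatest)
  next
    case False
    then obtain X0 where X0: "X = ennreal X0" "0 \<le> X0" by (metis ennreal_cases)
    have "c * measure \<mu> (Ek k) powr \<theta> \<le> A * (c1 * (c2 * (H0 + \<delta> k)) + 4 * n / (t - s') * X0)" for k
    proof -
      have nn: "0 \<le> c1 * (c2 * (H0 + \<delta> k))" "0 \<le> 4 * n / (t - s')"
        using c1 c2 H0 \<delta>[of k] n1 s' by auto
      have "ennreal A * (ennreal (c1 * (c2 * (H0 + \<delta> k))) + ennreal (4 * n / (t - s')) * X)
        = ennreal (A * (c1 * (c2 * (H0 + \<delta> k)) + 4 * n / (t - s') * X0))"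
        unfolding X0(1) using nn X0(2) A1
        by (subst mult.commute, subst mult.commute[of A], intro ennreal_linear_combination[symmetric]) auto
      then have "ennreal (c * measure \<mu> (Ek k) powr \<theta>) \<le> ennreal (A * (c1 * (c2 * (H0 + \<delta> k)) + 4 * n / (t - s') * X0))"
        using step[of k] by simp
      moreover have "0 \<le> A * (c1 * (c2 * (H0 + \<delta> k)) + 4 * n / (t - s') * X0)"
        by (intro mult_nonneg_nonneg add_nonneg_nonneg nn X0(2) order.trans[OF zero_le_one A1])
      ultimately show ?thesis by (rule ennreal_le_iff[THEN iffD1, rotated])
    qed
    moreover have "(\<lambda>k. c * measure \<mu> (Ek k) powr \<theta>) \<longlonglongrightarrow> c * measure \<mu> E powr \<theta>"
      using \<theta> by (intro tendsto_mult tendsto_const tendsto_powr' mlim) auto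
    moreover have "(\<lambda>k. A * (c1 * (c2 * (H0 + \<delta> k)) + 4 * n / (t - s') * X0)) \<longlonglongrightarrow> A * (c1 * (c2 * (H0 + 0)) + 4 * n / (t - s') * X0)"
      by (intro tendsto_mult tendsto_add tendsto_const \<delta>lim)
    ultimately have "c * measure \<mu> E powr \<theta> \<le> A * (c1 * (c2 * (H0 + 0)) + 4 * n / (t - s') * X0)"
      by (intro LIMSEQ_le) auto
    then have "(t - s) * (c * measure \<mu> E powr \<theta>) \<le> (t - s) * (A * (c1 * (c2 * H0) + 4 * n / (t - s') * X0))"
      using st by (intro mult_left_mono) auto
    also have "\<dots> = A * (c1 * c2 * ((t - s) * H0) + 8 * n * X0)"
    proof -
      have e: "(t - s) * (4 * n / (t - s')) = 8 * n" using st unfolding s'(4) by simp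
      have "(t - s) * (A * (c1 * (c2 * H0) + q * X0)) = A * (c1 * c2 * ((t - s) * H0) + ((t - s) * q) * X0)" for q
        by (simp only: algebra_simps)
      then show ?thesis by (simp only: e)
    qed
    also have "\<dots> \<le> A * ((c1 * c2 + 8 * n) * (X0 + (t - s) * H0))"
    proof (rule mult_left_mono)
      have "0 \<le> c1 * c2 * X0" "0 \<le> 8 * n * ((t - s) * H0)"
        using c1 c2 X0(2) H0(2) st n1 by auto
      then show "c1 * c2 * ((t - s) * H0) + 8 * n * X0 \<le> (c1 * c2 + 8 * n) * (X0 + (t - s) * H0)"
        unfolding distrib_left distrib_right by linarith
    qed (use A1 in linarith)
    finally have pre: "(t - s) * (c * measure \<mu> E powr \<theta>) \<le> A * ((c1 * c2 + 8 * n) * (X0 + (t - s) * H0))" .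
    have "(t - s) * measure \<mu> E powr \<theta> \<le> A / c * (c1 * c2 + 8 * n) * (X0 + (t - s) * H0)"
      (is "?l \<le> _")
    proof -
      have "(t - s) * (c * measure \<mu> E powr \<theta>) \<le> A * ((c1 * c2 + 8 * n) * (X0 + (t - s) * H0))" by (rule pre)
      then have "c * ?l \<le> A * ((c1 * c2 + 8 * n) * (X0 + (t - s) * H0))" by (simp only: mult_ac)
      then have "?l \<le> A * ((c1 * c2 + 8 * n) * (X0 + (t - s) * H0)) / c" using c by (simp only: pos_le_divide_eq mult.commute)
      then show ?thesis by (simp only: times_divide_eq_left mult.assoc)
    qed
    also note lk
    finally have fin: "(t - s) * measure \<mu> E powr \<theta> \<le> levelK C \<alpha> n * (X0 + (t - s) * H0)" .
    have K0: "0 \<le> levelK C \<alpha> n" using lkpos by linarith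
    have "ennreal ((t - s) * measure \<mu> E powr \<theta>) \<le> ennreal (levelK C \<alpha> n * (X0 + (t - s) * H0))"
      by (rule ennreal_leI[OF fin])
    also have "\<dots> = ennreal (levelK C \<alpha> n) * (X + ennreal (t - s) * H)"
      unfolding X0(1) H0(1) using K0 X0 H0 st
      by (subst mult.commute, subst mult.commute[of "ennreal (levelK C \<alpha> n)"], intro ennreal_linear_combination) auto
    finally show ?thesis by (simp only: E_def \<theta>_def X_def H_def)
  qed
qed

section \<open>Rearrangements on decreasing grids\<close>

lemma rearr_antimono: "t \<le> t' \<Longrightarrow> rearr M \<phi> t' \<le> rearr M \<phi> t"
  unfolding rearr_def by (rule Inf_superset_mono) (use ennreal_leI order.trans in blast)

lemma rearr_le: "0 \<le> \<tau> \<Longrightarrow> emeasure M {x \<in> space M. \<tau> < \<bar>\<phi> x\<bar>} \<le> ennreal t \<Longrightarrow> rearr M \<phi> t \<le> ennreal \<tau>"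
  unfolding rearr_def by (rule Inf_lower) auto

lemma rearr_zero:
  assumes "emeasure M (space M) \<le> ennreal t" shows "rearr M \<phi> t = 0"
proof -
  have "{x \<in> space M. 0 < \<bar>\<phi> x\<bar>} \<subseteq> space M" by auto
  then have "emeasure M {x \<in> space M. 0 < \<bar>\<phi> x\<bar>} \<le> emeasure M (space M)" by (intro emeasure_mono) auto
  then have "rearr M \<phi> t \<le> ennreal 0" using assms by (intro rearr_le) auto
  then show ?thesis by simp
qed

text \<open>Continuity from below: the superlevel set at \<tau> is the increasing union of those at
  slightly higher levels, each of which meets the bound by the definition of the infimum.\<close>

lemma rearr_attained:
  assumes m: "\<And>\<tau>. {x \<in> space M. \<tau> < \<bar>\<phi> x\<bar>} \<in> sets M"
    and \<tau>: "rearr M \<phi> t \<le> ennreal \<tau>" "0 \<le> \<tau>"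
  shows "emeasure M {x \<in> space M. \<tau> < \<bar>\<phi> x\<bar>} \<le> ennreal t"
proof -
  let ?S = "\<lambda>n::nat. {x \<in> space M. \<tau> + 1 / (real n + 1) < \<bar>\<phi> x\<bar>}"
  have b: "emeasure M (?S n) \<le> ennreal t" for n
  proof -
    have "ennreal \<tau> < ennreal (\<tau> + 1 / (real n + 1))" using \<tau>(2) by (auto simp: ennreal_less_iff)
    then have "rearr M \<phi> t < ennreal (\<tau> + 1 / (real n + 1))" using \<tau>(1) by (rule order_le_less_trans[rotated])
    then obtain \<tau>' where \<tau>': "0 \<le> \<tau>'" "emeasure M {x \<in> space M. \<tau>' < \<bar>\<phi> x\<bar>} \<le> ennreal t"
      "ennreal \<tau>' < ennreal (\<tau> + 1 / (real n + 1))"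
      unfolding rearr_def Inf_less_iff by blast
    then have "\<tau>' < \<tau> + 1 / (real n + 1)" by (simp add: ennreal_less_iff)
    then have "emeasure M (?S n) \<le> emeasure M {x \<in> space M. \<tau>' < \<bar>\<phi> x\<bar>}"
      by (intro emeasure_mono m) auto
    then show ?thesis using \<tau>'(2) by (rule order.trans)
  qed
  have "(\<Union>n. ?S n) = {x \<in> space M. \<tau> < \<bar>\<phi> x\<bar>}"
  proof safe
    fix x n assume "\<tau> + 1 / (real n + 1) < \<bar>\<phi> x\<bar>"
    moreover have "0 < 1 / (real n + 1)" by simp
    ultimately show "\<tau> < \<bar>\<phi> x\<bar>" by linarith
  next
    fix x assume x: "x \<in> space M" "\<tau> < \<bar>\<phi> x\<bar>"
    then obtain n :: nat where "1 / (\<bar>\<phi> x\<bar> - \<tau>) < real n" using reals_Archimedean2 by blast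
    then have "1 < (real n + 1) * (\<bar>\<phi> x\<bar> - \<tau>)" using x(2) by (simp add: field_simps)
    then have "\<tau> + 1 / (real n + 1) < \<bar>\<phi> x\<bar>" by (simp add: field_simps)
    then show "x \<in> (\<Union>n. ?S n)" using x(1) by auto
  qed
  moreover have "incseq ?S"
  proof (rule incseq_SucI, safe)
    fix n x assume "\<tau> + 1 / (real n + 1) < \<bar>\<phi> x\<bar>"
    moreover have "1 / (real (Suc n) + 1) \<le> 1 / (real n + 1)" by (intro divide_left_mono) auto
    ultimately show "\<tau> + 1 / (real (Suc n) + 1) < \<bar>\<phi> x\<bar>" by linarith
  qed
  moreover have "range ?S \<subseteq> sets M" using m by blast
  ultimately have "emeasure M {x \<in> space M. \<tau> < \<bar>\<phi> x\<bar>} = (SUP n. emeasure M (?S n))"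
    using SUP_emeasure_incseq[of ?S M] by simp
  also have "\<dots> \<le> ennreal t" by (rule SUP_least) (rule b)
  finally show ?thesis .
qed

lemma nn_integral_inverse_block:
  assumes "0 < a" "a \<le> b"
  shows "(\<integral>\<^sup>+t. ennreal (1 / t) * indicator {a..<b} t \<partial>lborel) = ennreal (ln (b / a))"
proof -
  have "(\<integral>\<^sup>+t. ennreal (1 / t) * indicator {a..b} t \<partial>lborel) = ennreal (ln b - ln a)"
  proof (rule nn_integral_FTC_Icc)
    show "(\<lambda>t::real. 1 / t) \<in> borel_measurable borel" by measurable
    show "(ln has_real_derivative 1 / t) (at t)" if "t \<in> {a..b}" for t
      using that assms by (auto intro!: derivative_eq_intros)
  qed (use assms in auto)
  moreover have "(\<integral>\<^sup>+t. ennreal (1 / t) * indicator {a..<b} t \<partial>lborel) = (\<integral>\<^sup>+t. ennreal (1 / t) * indicator {a..b} t \<partial>lborel)"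
  proof (rule nn_integral_cong_AE)
    show "AE t in lborel. ennreal (1 / t) * indicator {a..<b} t = ennreal (1 / t) * indicator {a..b} t"
      using AE_lborel_singleton[of b] by eventually_elim (auto simp: indicator_def)
  qed
  ultimately show ?thesis using assms by (simp add: ln_div)
qed

text \<open>A null sequence that cuts the interval from 0 to \<open>x 0\<close> into blocks. With
  respect to \<open>dt / t\<close> a block has mass \<open>ln (x k / x (Suc k))\<close>, constant
  for geometric grids and of order \<open>2 ^ k\<close> for the doubly exponential one; the locale
  serves both.\<close>

locale grid =
  fixes x :: "nat \<Rightarrow> real"
  assumes pos: "0 < x k" and dec: "x (Suc k) < x k" and lim: "x \<longlonglongrightarrow> 0"
begin

lemma block_exists:
  assumes "0 < t" "t < x 0"
  obtains k where "x (Suc k) \<le> t" "t < x k"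
proof -
  have "\<forall>\<^sub>F k in sequentially. x k < t" using lim assms(1) by (rule order_tendstoD(2))
  then have ex: "\<exists>k. x k \<le> t" by (auto simp: eventually_sequentially intro: less_imp_le)
  define j where "j = (LEAST k. x k \<le> t)"
  have j: "x j \<le> t" "\<And>i. i < j \<Longrightarrow> \<not> x i \<le> t"
    unfolding j_def using ex by (rule LeastI_ex) (rule not_less_Least)
  have "j \<noteq> 0" using j(1) assms(2) by (cases j) auto
  then obtain i where i: "j = Suc i" using not0_implies_Suc by blast
  show ?thesis by (rule that[of i]) (use j i in \<open>auto simp: not_le\<close>)
qed

lemma antimono: "j \<le> k \<Longrightarrow> x k \<le> x j"
  by (induction rule: dec_induct) (auto intro: order.trans less_imp_le[OF dec])

lemma block_unique:
  assumes "x (Suc k) \<le> t" "t < x k" "x (Suc j) \<le> t" "t < x j" shows "j = k"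
proof (rule ccontr)
  assume "j \<noteq> k"
  then consider "Suc j \<le> k" | "Suc k \<le> j" by linarith
  then show False using assms antimono by cases (meson le_less_trans not_less order.trans)+
qed

lemma block_integral:
  "(\<integral>\<^sup>+t. (\<Sum>k. ennreal (1 / t) * indicator {x (Suc k)..<x k} t * c k) \<partial>lborel)
    = (\<Sum>k. ennreal (ln (x k / x (Suc k))) * c k)"
proof -
  have "(\<integral>\<^sup>+t. (\<Sum>k. ennreal (1 / t) * indicator {x (Suc k)..<x k} t * c k) \<partial>lborel)
    = (\<Sum>k. \<integral>\<^sup>+t. ennreal (1 / t) * indicator {x (Suc k)..<x k} t * c k \<partial>lborel)"
    by (rule nn_integral_suminf) measurable
  also have "\<dots> = (\<Sum>k. ennreal (ln (x k / x (Suc k))) * c k)"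
    using pos dec by (intro suminf_cong) (simp add: nn_integral_multc nn_integral_inverse_block less_imp_le)
  finally show ?thesis .
qed

lemma block_sum:
  assumes "x (Suc k) \<le> t" "t < x k"
  shows "(\<Sum>j. ennreal (1 / t) * indicator {x (Suc j)..<x j} t * c j) = ennreal (1 / t) * c k"
proof -
  have "(\<Sum>j. ennreal (1 / t) * indicator {x (Suc j)..<x j} t * c j) = (\<Sum>j\<in>{k}. ennreal (1 / t) * indicator {x (Suc j)..<x j} t * c j)"
    using block_unique[OF assms] by (intro suminf_finite) (auto simp: indicator_def)
  then show ?thesis using assms by simp
qed

lemma ln_pos: "0 < ln (x k / x (Suc k))"
  using pos[of k] pos[of "Suc k"] dec[of k] by simp

lemma weight_power:
  assumes "1 \<le> h" "0 < t" shows "epowr (ennreal (t powr (- (1 / h))) * c) h = ennreal (1 / t) * epowr c h"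
proof -
  have "(t powr (- (1 / h))) powr h = t powr (- 1)" using assms unfolding powr_powr by simp
  also have "\<dots> = 1 / t" using assms(2) by (simp add: powr_minus_divide)
  finally show ?thesis by (simp only: epowr_mult epowr_ennreal powr_ge_zero)
qed

lemma lseq_block_power:
  assumes "1 \<le> h"
  shows "(\<Sum>k. epowr (ennreal (ln (x k / x (Suc k)) powr (1 / h)) * T k) h) = (\<Sum>k. ennreal (ln (x k / x (Suc k))) * epowr (T k) h)"
  using assms ln_pos by (intro suminf_cong) (simp add: epowr_mult epowr_ennreal powr_powr less_imp_le)

text \<open>Once \<open>t powr (- einv \<eta>)\<close> is split off, the functional is an integral
  norm for \<open>dt / t\<close>, and a bound by \<open>T k\<close> on each block turns it into a
  sequence norm weighted by powers of the block masses.\<close>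

lemma lsig_upper:
  assumes \<eta>: "1 \<le> \<eta>" and m: "m \<le> ennreal (x 0)"
    and g: "\<And>k t. x (Suc k) \<le> t \<Longrightarrow> t < x k \<Longrightarrow> ennreal t < m \<Longrightarrow> g t \<le> ennreal (t powr (- einv \<eta>)) * T k"
  shows "lsig \<eta> g m \<le> lseq \<eta> (\<lambda>k. ennreal (ln (x k / x (Suc k)) powr einv \<eta>) * T k)"
proof -
  have blk: "\<exists>k. x (Suc k) \<le> t \<and> t < x k" if t: "0 < t" "ennreal t < m" for t
  proof -
    have "t < x 0" using t m by (metis ennreal_less_iff less_imp_le order_less_le_trans)
    then show ?thesis using block_exists[OF t(1)] by blast
  qed
  show ?thesis using \<eta>
  proof (cases rule: ereal_ge_1_cases)
    case 1
    have "g t \<le> lseq \<eta> (\<lambda>k. ennreal (ln (x k / x (Suc k)) powr einv \<eta>) * T k)" if t: "0 < t" "ennreal t < m" for t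
    proof -
      obtain k where k: "x (Suc k) \<le> t" "t < x k" using blk[OF t] by blast
      have "g t \<le> T k" using g[OF k t(2)] t(1) 1 by (simp add: einv_def)
      also have "T k = ennreal (ln (x k / x (Suc k)) powr einv \<eta>) * T k"
        using 1 ln_pos[of k] by (simp add: einv_def)
      also have "\<dots> \<le> lseq \<eta> (\<lambda>k. ennreal (ln (x k / x (Suc k)) powr einv \<eta>) * T k)"
        by (rule lseq_ge[OF \<eta>])
      finally show ?thesis .
    qed
    then show ?thesis using 1 by (simp only: lsig_def if_True) (auto intro: Inf_lower)
  next
    case (2 h)
    have e: "einv \<eta> = 1 / h" using 2 by (simp add: einv_def)
    have "(\<integral>\<^sup>+t. epowr (g t) h * indicator {t. 0 < t \<and> ennreal t < m} t \<partial>lborel)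
      \<le> (\<integral>\<^sup>+t. (\<Sum>k. ennreal (1 / t) * indicator {x (Suc k)..<x k} t * epowr (T k) h) \<partial>lborel)"
    proof (rule nn_integral_mono)
      fix t
      show "epowr (g t) h * indicator {t. 0 < t \<and> ennreal t < m} t \<le> (\<Sum>k. ennreal (1 / t) * indicator {x (Suc k)..<x k} t * epowr (T k) h)"
      proof (cases "0 < t \<and> ennreal t < m")
        case True
        then obtain k where k: "x (Suc k) \<le> t" "t < x k" using blk by blast
        have "epowr (g t) h \<le> epowr (ennreal (t powr (- (1 / h))) * T k) h"
          using g[OF k] True 2(2) by (intro epowr_mono) (auto simp: e)
        also have "\<dots> = ennreal (1 / t) * epowr (T k) h" using True by (intro weight_power 2) auto
        finally show ?thesis unfolding block_sum[OF k] using True by simp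
      qed simp
    qed
    also have "\<dots> = (\<Sum>k. ennreal (ln (x k / x (Suc k))) * epowr (T k) h)" by (rule block_integral)
    finally have "(\<integral>\<^sup>+t. epowr (g t) h * indicator {t. 0 < t \<and> ennreal t < m} t \<partial>lborel)
      \<le> (\<Sum>k. epowr (ennreal (ln (x k / x (Suc k)) powr (1 / h)) * T k) h)" by (simp only: lseq_block_power[OF 2(2)])
    then show ?thesis using 2 by (auto simp: lsig_def lseq_real einv_def intro!: epowr_mono)
  qed
qed

text \<open>Converse of \<open>lsig_upper\<close>. The hypothesis is restricted to
  \<open>T k \<noteq> 0\<close> so that blocks beyond the total measure \<open>m\<close>, where
  rearrangements vanish, impose nothing.\<close>

lemma lsig_lower:
  assumes \<eta>: "1 \<le> \<eta>"
    and g: "\<And>k t. T k \<noteq> 0 \<Longrightarrow> x (Suc k) \<le> t \<Longrightarrow> t < x k \<Longrightarrow> ennreal t < m \<and> ennreal (t powr (- einv \<eta>)) * T k \<le> g t"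
  shows "lseq \<eta> (\<lambda>k. ennreal (ln (x k / x (Suc k)) powr einv \<eta>) * T k) \<le> lsig \<eta> g m"
  using \<eta>
proof (cases rule: ereal_ge_1_cases)
  case 1
  have "T k \<le> c" if c: "AE t in lborel. 0 < t \<and> ennreal t < m \<longrightarrow> g t \<le> c" for c k
  proof (cases "T k = 0")
    case False
    \<comment> \<open>An essential bound may fail at single points, but the block has positive
      length and so contains a point at which it holds.\<close>
    have "\<exists>t\<in>{x (Suc k)..<x k}. 0 < t \<and> ennreal t < m \<longrightarrow> g t \<le> c"
    proof (rule ccontr)
      assume n: "\<not> ?thesis"
      have "AE t in lborel. t \<notin> {x (Suc k)..<x k}" using c by eventually_elim (use n in blast)
      then have "{x (Suc k)..<x k} \<in> null_sets lborel" by (simp add: AE_iff_null_sets)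
      then show False using dec[of k] by (simp add: null_sets_def)
    qed
    then obtain t where "t \<in> {x (Suc k)..<x k}" and t3: "0 < t \<and> ennreal t < m \<longrightarrow> g t \<le> c" by blast
    then have t: "x (Suc k) \<le> t" "t < x k" by auto
    then have t0: "0 < t" using pos[of "Suc k"] by linarith
    from g[OF False t(1,2)] t3 t0 1 show ?thesis by (auto simp: einv_def)
  qed simp
  then have "T k \<le> lsig \<eta> g m" for k using 1 by (auto simp: lsig_def intro: Inf_greatest)
  moreover have "ennreal (ln (x k / x (Suc k)) powr einv \<eta>) * T k = T k" for k
    using 1 ln_pos[of k] by (simp add: einv_def)
  ultimately show ?thesis using 1 by (simp add: lseq_inf SUP_least)
next
  case (2 h)
  have e: "einv \<eta> = 1 / h" using 2 by (simp add: einv_def)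
  have "(\<integral>\<^sup>+t. (\<Sum>k. ennreal (1 / t) * indicator {x (Suc k)..<x k} t * epowr (T k) h) \<partial>lborel)
    \<le> (\<integral>\<^sup>+t. epowr (g t) h * indicator {t. 0 < t \<and> ennreal t < m} t \<partial>lborel)"
  proof (rule nn_integral_mono)
    fix t
    show "(\<Sum>k. ennreal (1 / t) * indicator {x (Suc k)..<x k} t * epowr (T k) h) \<le> epowr (g t) h * indicator {t. 0 < t \<and> ennreal t < m} t"
    proof (cases "\<exists>k. x (Suc k) \<le> t \<and> t < x k \<and> T k \<noteq> 0")
      case True
      then obtain k where k: "x (Suc k) \<le> t" "t < x k" "T k \<noteq> 0" by blast
      have t0: "0 < t" using pos[of "Suc k"] k(1) by linarith
      have "ennreal (1 / t) * epowr (T k) h = epowr (ennreal (t powr (- (1 / h))) * T k) h"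
        by (rule weight_power[symmetric]) (use 2 t0 in auto)
      also have "\<dots> \<le> epowr (g t) h" using g[OF k(3,1,2)] 2(2) by (intro epowr_mono) (auto simp: e)
      finally show ?thesis unfolding block_sum[OF k(1,2)] using g[OF k(3,1,2)] t0 by simp
    next
      case False
      then have "ennreal (1 / t) * indicator {x (Suc k)..<x k} t * epowr (T k) h = 0" for k
        by (auto simp: indicator_def)
      then have "(\<Sum>k. ennreal (1 / t) * indicator {x (Suc k)..<x k} t * epowr (T k) h) = (\<Sum>k::nat. 0)"
        by (intro suminf_cong)
      then show ?thesis by simp
    qed
  qed
  then have "(\<Sum>k. epowr (ennreal (ln (x k / x (Suc k)) powr (1 / h)) * T k) h)
    \<le> (\<integral>\<^sup>+t. epowr (g t) h * indicator {t. 0 < t \<and> ennreal t < m} t \<partial>lborel)"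
    by (simp only: lseq_block_power[OF 2(2)] block_integral)
  then show ?thesis using 2 by (auto simp: lsig_def lseq_real einv_def intro!: epowr_mono)
qed

end

section \<open>Shifts, geometric weights and block sums\<close>

lemma lseq_shift: assumes "1 \<le> \<sigma>" shows "lseq \<sigma> (\<lambda>k. x (Suc k)) \<le> lseq \<sigma> x"
  using assms
proof (cases rule: ereal_ge_1_cases)
  case 1
  then show ?thesis by (auto simp: lseq_inf intro!: SUP_least SUP_upper)
next
  case (2 s)
  have "(\<Sum>k. epowr (x (Suc k)) s) \<le> (\<Sum>k. epowr (x k) s)"
  proof (rule suminf_le_const)
    fix N
    have "(\<Sum>k<N. epowr (x (Suc k)) s) \<le> (\<Sum>k<Suc N. epowr (x k) s)"
      by (subst sum.lessThan_Suc_shift) auto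
    also have "\<dots> \<le> (\<Sum>k. epowr (x k) s)" by (intro sum_le_suminf) auto
    finally show "(\<Sum>k<N. epowr (x (Suc k)) s) \<le> (\<Sum>k. epowr (x k) s)" .
  qed auto
  then show ?thesis using 2 by (auto simp: lseq_real intro!: epowr_mono)
qed

lemma lseq_one: "lseq 1 x = (\<Sum>k. x k)"
  using lseq_real[of 1 x] by (simp add: one_ereal_def)

lemma lseq_le_suminf: "1 \<le> \<eta> \<Longrightarrow> lseq \<eta> x \<le> (\<Sum>k. x k)"
  using lseq_embed[of 1 \<eta> x] by (simp add: lseq_one)

lemma suminf_ennreal_geometric: "0 \<le> \<theta> \<Longrightarrow> \<theta> < 1 \<Longrightarrow> (\<Sum>k. ennreal (\<theta> ^ k)) = ennreal (1 / (1 - \<theta>))"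
  by (intro suminf_ennreal_eq geometric_sums) auto

text \<open>Strict decay links arbitrary exponents: each entry is at most the norm, and the weights
  are summable.\<close>

lemma lseq_geometric_weight:
  assumes "1 \<le> \<sigma>" "1 \<le> \<eta>" "0 \<le> \<theta>" "\<theta> < 1"
  shows "lseq \<eta> (\<lambda>k. ennreal (\<theta> ^ k) * z k) \<le> ennreal (1 / (1 - \<theta>)) * lseq \<sigma> z"
proof -
  have "lseq \<eta> (\<lambda>k. ennreal (\<theta> ^ k) * z k) \<le> (\<Sum>k. ennreal (\<theta> ^ k) * z k)"
    by (rule lseq_le_suminf[OF assms(2)])
  also have "\<dots> \<le> (\<Sum>k. ennreal (\<theta> ^ k) * lseq \<sigma> z)"
    by (intro suminf_le mult_left_mono lseq_ge assms) auto
  also have "\<dots> = ennreal (1 / (1 - \<theta>)) * lseq \<sigma> z"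
    using suminf_ennreal_geometric[OF assms(3,4)] by simp
  finally show ?thesis .
qed

text \<open>The sum starts at the first index below the threshold and is geometric from there, so it
  is governed by \<open>Y\<close> and not by the initial value \<open>v\<close>. In the boundary
  estimate this puts the boundary measure in place of \<open>\<tau>0\<close>.\<close>

lemma suminf_geometric_below:
  fixes v Y \<theta> :: real
  assumes v: "0 \<le> v" and \<theta>: "0 \<le> \<theta>" "\<theta> < 1" and Y: "0 \<le> Y"
  shows "(\<Sum>k. ennreal (if v * \<theta> ^ k \<le> Y then v * \<theta> ^ k else 0)) \<le> ennreal (Y / (1 - \<theta>))"
proof (cases "\<exists>k. v * \<theta> ^ k \<le> Y")
  case True
  define j where "j = (LEAST k. v * \<theta> ^ k \<le> Y)"
  have j: "v * \<theta> ^ j \<le> Y" "\<And>k. k < j \<Longrightarrow> \<not> v * \<theta> ^ k \<le> Y"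
    unfolding j_def using True by (rule LeastI_ex) (rule not_less_Least)
  let ?f = "\<lambda>k. ennreal (if v * \<theta> ^ k \<le> Y then v * \<theta> ^ k else 0)"
  have "(\<Sum>k. ?f k) = (\<Sum>k. ?f (k + j)) + (\<Sum>k<j. ?f k)"
    by (rule suminf_offset) auto
  also have "(\<Sum>k<j. ?f k) = 0" using j(2) by simp
  also have "(\<Sum>k. ?f (k + j)) \<le> (\<Sum>k. ennreal (Y * \<theta> ^ k))"
  proof (intro suminf_le ennreal_leI)
    fix k
    have "v * \<theta> ^ (k + j) = (v * \<theta> ^ j) * \<theta> ^ k" by (simp add: power_add)
    also have "\<dots> \<le> Y * \<theta> ^ k" using j(1) \<theta> by (intro mult_right_mono) auto
    finally show "(if v * \<theta> ^ (k + j) \<le> Y then v * \<theta> ^ (k + j) else 0) \<le> Y * \<theta> ^ k"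
      using Y \<theta> by auto
  qed auto
  also have "(\<Sum>k. ennreal (Y * \<theta> ^ k)) = ennreal (Y * (1 / (1 - \<theta>)))"
    using \<theta> Y by (intro suminf_ennreal_eq sums_mult geometric_sums) auto
  finally show ?thesis by simp
next
  case False
  then show ?thesis by simp
qed

text \<open>Two-term Hoelder inequality, read off from convexity at weight 1/2.\<close>

lemma half_power_sum:
  assumes s: "1 \<le> s"
  shows "X + Y \<le> ennreal (2 powr (1 - 1 / s)) * epowr (epowr X s + epowr Y s) (1 / s)"
proof -
  have h: "ennreal (1/2) * X + ennreal (1 - 1/2) * Y = ennreal (1/2) * (X + Y)" by (simp add: distrib_left)
  have "epowr (ennreal (1/2) * (X + Y)) s \<le> ennreal (1/2) * epowr X s + ennreal (1 - 1/2) * epowr Y s"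
    using epowr_convex[OF s, of "1/2" X Y] unfolding h by simp
  also have "\<dots> = ennreal (1/2) * (epowr X s + epowr Y s)" by (simp add: distrib_left)
  finally have "epowr (epowr (ennreal (1/2) * (X + Y)) s) (1 / s) \<le> epowr (ennreal (1/2) * (epowr X s + epowr Y s)) (1 / s)"
    using s by (intro epowr_mono) auto
  then have "ennreal (1/2) * (X + Y) \<le> ennreal ((1/2) powr (1 / s)) * epowr (epowr X s + epowr Y s) (1 / s)"
  proof -
    have "epowr (epowr (ennreal (1/2) * (X + Y)) s) (1 / s) = ennreal (1/2) * (X + Y)"
      using s by (intro epowr_inverse) auto
    moreover have "epowr (ennreal (1/2) * Z) (1 / s) = ennreal ((1/2) powr (1 / s)) * epowr Z (1 / s)" for Z
      unfolding epowr_mult by (subst epowr_ennreal) auto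
    ultimately show "epowr (epowr (ennreal (1/2) * (X + Y)) s) (1 / s) \<le> epowr (ennreal (1/2) * (epowr X s + epowr Y s)) (1 / s) \<Longrightarrow> ?thesis"
      by (simp only:)
  qed
  then have "ennreal 2 * (ennreal (1/2) * (X + Y)) \<le> ennreal 2 * (ennreal ((1/2) powr (1 / s)) * epowr (epowr X s + epowr Y s) (1 / s))"
    by (rule mult_left_mono) simp
  moreover have "ennreal 2 * (ennreal (1/2) * (X + Y)) = X + Y"
    unfolding mult.assoc[symmetric] by (subst ennreal_mult[symmetric]) auto
  moreover have "2 * (1/2) powr (1 / s) = (2::real) powr (1 - 1 / s)"
    by (simp add: powr_divide powr_diff)
  then have "ennreal 2 * (ennreal ((1/2) powr (1 / s)) * epowr (epowr X s + epowr Y s) (1 / s))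
    = ennreal (2 powr (1 - 1 / s)) * epowr (epowr X s + epowr Y s) (1 / s)"
    unfolding mult.assoc[symmetric] by (subst ennreal_mult[symmetric]) auto
  ultimately show ?thesis by simp
qed

text \<open>Hoelder's inequality on \<open>2 ^ m\<close> terms by repeated halving; each halving
  contributes one factor \<open>2 powr (1 - 1 / s)\<close>.\<close>

lemma block_hoelder_real:
  fixes k m :: nat
  assumes s: "1 \<le> s"
  shows "(\<Sum>i=k..<k+2^m. x i) \<le> ennreal ((2 powr (1 - 1 / s)) ^ m) * epowr (\<Sum>i=k..<k+2^m. epowr (x i) s) (1 / s)"
proof (induction m arbitrary: k)
  case 0
  have "{k..<k+2^0} = {k}" by (auto simp del: One_nat_def)
  then show ?case unfolding \<open>{k..<k+2^0} = {k}\<close> using s by (simp add: epowr_inverse)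
next
  case (Suc m)
  let ?\<gamma> = "2 powr (1 - 1 / s)"
  have split: "(\<Sum>i=k..<k+2^Suc m. f i) = (\<Sum>i=k..<k+2^m. f i) + (\<Sum>i=k+2^m..<k+2^m+2^m. f i)" for f :: "nat \<Rightarrow> ennreal"
    by (subst sum.atLeastLessThan_concat) (auto simp: mult_2 add.assoc)
  let ?A = "\<Sum>i=k..<k+2^m. epowr (x i) s" and ?B = "\<Sum>i=k+2^m..<k+2^m+2^m. epowr (x i) s"
  have "(\<Sum>i=k..<k+2^Suc m. x i) \<le> ennreal (?\<gamma> ^ m) * epowr ?A (1 / s) + ennreal (?\<gamma> ^ m) * epowr ?B (1 / s)"
    unfolding split by (intro add_mono Suc)
  also have "\<dots> = ennreal (?\<gamma> ^ m) * (epowr ?A (1 / s) + epowr ?B (1 / s))" by (simp add: distrib_left)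
  also have "\<dots> \<le> ennreal (?\<gamma> ^ m) * (ennreal ?\<gamma> * epowr (epowr (epowr ?A (1 / s)) s + epowr (epowr ?B (1 / s)) s) (1 / s))"
    by (intro mult_left_mono half_power_sum s) simp
  also have "\<dots> = ennreal (?\<gamma> ^ Suc m) * epowr (?A + ?B) (1 / s)"
    using s by (simp add: epowr_inverse ennreal_mult mult_ac)
  finally show ?case unfolding split .
qed

text \<open>The norm of the block of indices \<open>2^m - 1, \<dots>, 2^(m+1) - 2\<close>; for \<open>\<sigma> = \<infinity>\<close> the supremum over all indices is good enough.\<close>

definition dblock :: "ereal \<Rightarrow> (nat \<Rightarrow> ennreal) \<Rightarrow> nat \<Rightarrow> ennreal" where
  "dblock \<sigma> x m = (if \<sigma> = \<infinity> then (SUP i. x i)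
    else epowr (\<Sum>i=2^m-1..<2^m-1+2^m. epowr (x i) (real_of_ereal \<sigma>)) (1 / real_of_ereal \<sigma>))"

lemma einv_ereal [simp]: "einv (ereal s) = 1 / s"
  by (simp add: einv_def)

lemma einv_infty [simp]: "einv \<infinity> = 0"
  by (simp add: einv_def)

lemma dblock_sum:
  assumes "1 \<le> \<sigma>"
  shows "(\<Sum>i=2^m-1..<2^m-1+2^m. x i) \<le> ennreal ((2 powr (1 - einv \<sigma>)) ^ m) * dblock \<sigma> x m"
  using assms
proof (cases rule: ereal_ge_1_cases)
  case 1
  have "(\<Sum>i=2^m-1..<2^m-1+2^m. x i) \<le> (\<Sum>i=2^m-1..<2^m-1+2^m::nat. (SUP i. x i))"
    by (intro sum_mono SUP_upper) auto
  also have "\<dots> = ennreal (2 ^ m) * (SUP i. x i)"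
    by (simp add: ennreal_power[symmetric])
  finally show ?thesis using 1 by (simp add: dblock_def)
next
  case (2 s)
  then show ?thesis using block_hoelder_real[where s=s and k="2^m-1" and m=m and x=x] by (simp add: dblock_def)
qed

text \<open>For finite \<sigma> the dyadic blocks tile the indices, so the powers of the block norms
  add up to at most the power of the whole norm.\<close>

lemma dblock_lseq:
  assumes "1 \<le> \<sigma>"
  shows "lseq \<sigma> (dblock \<sigma> x) \<le> lseq \<sigma> x"
  using assms
proof (cases rule: ereal_ge_1_cases)
  case 1
  then show ?thesis by (simp add: dblock_def lseq_inf)
next
  case (2 s)
  have p: "(\<Sum>m<N. \<Sum>i=2^m-1..<2^m-1+2^m. f i) = (\<Sum>i<2^N-1. f i)" for N and f :: "nat \<Rightarrow> ennreal"
  proof (induction N)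
    case (Suc N)
    have "(\<Sum>i<2^N-1. f i) + (\<Sum>i=2^N-1..<2^N-1+2^N. f i) = (\<Sum>i=0..<2^N-1+2^N. f i)"
      by (subst sum.atLeastLessThan_concat[symmetric, of 0 "2^N-1"]) (auto simp: lessThan_atLeast0)
    then show ?case using Suc by (simp add: lessThan_atLeast0 mult_2)
  qed simp
  have "(\<Sum>m. epowr (dblock \<sigma> x m) s) = (\<Sum>m. \<Sum>i=2^m-1..<2^m-1+2^m. epowr (x i) s)"
    using 2 by (simp add: dblock_def epowr_inverse)
  also have "\<dots> \<le> (\<Sum>i. epowr (x i) s)"
  proof (rule suminf_le_const)
    show "(\<Sum>m<N. \<Sum>i=2^m-1..<2^m-1+2^m. epowr (x i) s) \<le> (\<Sum>i. epowr (x i) s)" for N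
      unfolding p by (intro sum_le_suminf) auto
  qed auto
  finally show ?thesis using 2 by (auto simp: lseq_real intro!: epowr_mono)
qed

section \<open>Lorentz functionals as sequence norms\<close>

lemma einv_bounds: assumes "1 \<le> \<sigma>" shows "0 \<le> einv \<sigma>" "einv \<sigma> \<le> 1"
  using assms by (cases rule: ereal_ge_1_cases; simp)+

lemma powr_einv_ge:
  assumes "0 < c" "c \<le> 1" "1 \<le> \<sigma>" shows "c \<le> c powr einv \<sigma>"
  using powr_mono'[of "einv \<sigma>" 1 c] assms einv_bounds[OF assms(3)] by simp

text \<open>\<open>c\<close> bounds the block masses from below; being at most 1 it is below
  \<open>c powr einv \<sigma>\<close> for every \<sigma>, which makes the constant
  \<open>1 / c\<close> independent of \<sigma>.\<close>

lemma (in grid) lorentz_lower: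
  assumes \<sigma>: "1 \<le> \<sigma>" and p: "0 < p" and R: "\<And>k. c \<le> ln (x k / x (Suc k))" "0 < c" "c \<le> 1"
  shows "lseq \<sigma> (\<lambda>k. ennreal (x (Suc k) powr (1 / p)) * rearr M \<phi> (x k)) \<le> ennreal (1 / c) * lorentz M (ereal p) \<sigma> \<phi>"
proof -
  let ?T = "\<lambda>k. ennreal (x (Suc k) powr (1 / p)) * rearr M \<phi> (x k)"
  have low: "lseq \<sigma> (\<lambda>k. ennreal (ln (x k / x (Suc k)) powr einv \<sigma>) * ?T k) \<le> lorentz M (ereal p) \<sigma> \<phi>"
    unfolding lorentz_def
  proof (rule lsig_lower[OF \<sigma>], intro conjI)
    fix k t assume k: "?T k \<noteq> 0" "x (Suc k) \<le> t" "t < x k"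
    then have "rearr M \<phi> (x k) \<noteq> 0" by auto
    then have "ennreal (x k) < emeasure M (space M)" using rearr_zero[of M "x k" \<phi>] by (auto simp: not_le[symmetric])
    then show "ennreal t < emeasure M (space M)" using k(3) by (meson ennreal_leI less_imp_le order_le_less_trans)
    have t0: "0 < t" using pos[of "Suc k"] k(2) by linarith
    have "ennreal (t powr - einv \<sigma>) * ?T k \<le> ennreal (t powr - einv \<sigma>) * (ennreal (t powr (1 / p)) * rearr M \<phi> t)"
      using pos[of "Suc k"] p k by (intro mult_left_mono mult_mono ennreal_leI powr_mono2 rearr_antimono) auto
    also have "\<dots> = ennreal (t powr (einv (ereal p) - einv \<sigma>)) * rearr M \<phi> t"
      using t0 by (simp add: mult.assoc[symmetric] ennreal_mult[symmetric] powr_add[symmetric])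
    finally show "ennreal (t powr - einv \<sigma>) * ?T k \<le> ennreal (t powr (einv (ereal p) - einv \<sigma>)) * rearr M \<phi> t" .
  qed
  have "ennreal c * lseq \<sigma> ?T = lseq \<sigma> (\<lambda>k. ennreal c * ?T k)" by (rule lseq_cmult[OF \<sigma>, symmetric])
  also have "\<dots> \<le> lseq \<sigma> (\<lambda>k. ennreal (ln (x k / x (Suc k)) powr einv \<sigma>) * ?T k)"
  proof (intro lseq_mono[OF \<sigma>] mult_right_mono ennreal_leI)
    fix k
    have "c \<le> c powr einv \<sigma>" by (rule powr_einv_ge[OF R(2,3) \<sigma>])
    also have "\<dots> \<le> ln (x k / x (Suc k)) powr einv \<sigma>"
      using R einv_bounds[OF \<sigma>] by (intro powr_mono2) auto
    finally show "c \<le> ln (x k / x (Suc k)) powr einv \<sigma>" .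
  qed simp
  finally have "ennreal c * lseq \<sigma> ?T \<le> lorentz M (ereal p) \<sigma> \<phi>" using low by simp
  then have "ennreal (1 / c) * (ennreal c * lseq \<sigma> ?T) \<le> ennreal (1 / c) * lorentz M (ereal p) \<sigma> \<phi>"
    by (rule mult_left_mono) simp
  then show ?thesis using R(2) by (simp add: mult.assoc[symmetric] ennreal_mult[symmetric])
qed

lemma (in grid) lorentz_upper:
  assumes \<eta>: "1 \<le> \<eta>" and q: "0 < q" and R: "\<And>k. ln (x k / x (Suc k)) \<le> 1"
    and m: "emeasure M (space M) \<le> ennreal (x 0)"
  shows "lorentz M (ereal q) \<eta> \<phi> \<le> lseq \<eta> (\<lambda>k. ennreal (x k powr (1 / q)) * rearr M \<phi> (x (Suc k)))"
proof -
  let ?T = "\<lambda>k. ennreal (x k powr (1 / q)) * rearr M \<phi> (x (Suc k))"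
  have "lorentz M (ereal q) \<eta> \<phi> \<le> lseq \<eta> (\<lambda>k. ennreal (ln (x k / x (Suc k)) powr einv \<eta>) * ?T k)"
    unfolding lorentz_def
  proof (rule lsig_upper[OF \<eta> m])
    fix k t assume k: "x (Suc k) \<le> t" "t < x k"
    have t0: "0 < t" using pos[of "Suc k"] k by linarith
    have "ennreal (t powr (einv (ereal q) - einv \<eta>)) * rearr M \<phi> t = ennreal (t powr - einv \<eta>) * (ennreal (t powr (1 / q)) * rearr M \<phi> t)"
      using t0 by (simp add: mult.assoc[symmetric] ennreal_mult[symmetric] powr_add[symmetric])
    also have "\<dots> \<le> ennreal (t powr - einv \<eta>) * ?T k"
      using t0 q k by (intro mult_left_mono mult_mono ennreal_leI powr_mono2 rearr_antimono) auto
    finally show "ennreal (t powr (einv (ereal q) - einv \<eta>)) * rearr M \<phi> t \<le> ennreal (t powr - einv \<eta>) * ?T k" .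
  qed
  also have "\<dots> \<le> lseq \<eta> ?T"
  proof (rule lseq_mono[OF \<eta>])
    fix k
    have "ln (x k / x (Suc k)) powr einv \<eta> \<le> 1"
      using R[of k] ln_pos[of k] einv_bounds[OF \<eta>] by (intro powr_le1) auto
    then have "ennreal (ln (x k / x (Suc k)) powr einv \<eta>) * ?T k \<le> 1 * ?T k"
      by (intro mult_right_mono) auto
    then show "ennreal (ln (x k / x (Suc k)) powr einv \<eta>) * ?T k \<le> ?T k" by simp
  qed
  finally show ?thesis .
qed

lemma lsig_null: "1 \<le> \<eta> \<Longrightarrow> lsig \<eta> g 0 = 0"
  by (erule ereal_ge_1_cases) (auto simp: lsig_def bot_ennreal)

text \<open>Discrete Hardy-Littlewood bound by layers. The points where the function first drops to
  \<open>\<gamma> j\<close> lie in the superlevel set of the previous level, of measure at most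
  \<open>\<tau> j\<close>; the first layer lies in \<open>E\<close> itself.\<close>

lemma integral_le_rearr_sum:
  fixes \<phi> :: "'a \<Rightarrow> real" and \<tau> :: "nat \<Rightarrow> real"
  assumes m: "\<And>\<tau>. {x \<in> space N. \<tau> < \<bar>\<phi> x\<bar>} \<in> sets N"
    and \<tau>: "\<And>j. 0 < \<tau> j" "\<tau> \<longlonglongrightarrow> 0"
    and E: "E \<in> sets N" "emeasure N E \<le> ennreal (\<tau> 0)"
  shows "(\<integral>\<^sup>+x. ennreal \<bar>\<phi> x\<bar> * indicator E x \<partial>N) \<le> (\<Sum>j. ennreal (\<tau> j) * rearr N \<phi> (\<tau> (Suc j)))"
proof (cases "\<exists>j. rearr N \<phi> (\<tau> (Suc j)) = top")
  case True
  then obtain j where "rearr N \<phi> (\<tau> (Suc j)) = top" by blast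
  then have "ennreal (\<tau> j) * rearr N \<phi> (\<tau> (Suc j)) = top" using \<tau>(1)[of j] by (simp add: ennreal_mult_top)
  then have "(\<Sum>j. ennreal (\<tau> j) * rearr N \<phi> (\<tau> (Suc j))) = top"
    using ennreal_suminf_ge[of "\<lambda>j. ennreal (\<tau> j) * rearr N \<phi> (\<tau> (Suc j))" j] by (simp add: top_unique)
  then show ?thesis by simp
next
  case False
  define \<gamma> where "\<gamma> j = enn2real (rearr N \<phi> (\<tau> (Suc j)))" for j
  have \<gamma>: "rearr N \<phi> (\<tau> (Suc j)) = ennreal (\<gamma> j)" "0 \<le> \<gamma> j" for j
    using False by (auto simp: \<gamma>_def less_top[symmetric])
  define B where "B j = {x \<in> space N. \<gamma> j < \<bar>\<phi> x\<bar>}" for j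
  have B: "B j \<in> sets N" "emeasure N (B j) \<le> ennreal (\<tau> (Suc j))" for j
    unfolding B_def using \<gamma>[of j] by (auto intro!: m rearr_attained)
  define A where "A j = (case j of 0 \<Rightarrow> E | Suc i \<Rightarrow> B i)" for j
  have A: "A j \<in> sets N" "emeasure N (A j) \<le> ennreal (\<tau> j)" for j
    using B E by (auto simp: A_def split: nat.split)
  \<comment> \<open>Points above every level form a null set because the bounds
    \<open>\<tau> (Suc j)\<close> tend to zero; all others have a first index
    \<open>j\<close>.\<close>
  have null: "(\<Inter>j. B j) \<in> null_sets N"
  proof -
    have "emeasure N (\<Inter>j. B j) \<le> ennreal (\<tau> (Suc j))" for j
      by (rule order.trans[OF emeasure_mono B(2)[of j]]) (use B in auto)
    moreover have "(\<lambda>j. ennreal (\<tau> (Suc j))) \<longlonglongrightarrow> ennreal 0"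
      by (intro tendsto_ennrealI LIMSEQ_Suc \<tau>(2))
    ultimately have "emeasure N (\<Inter>j. B j) \<le> ennreal 0"
      by (intro LIMSEQ_le_const[where X="\<lambda>j. ennreal (\<tau> (Suc j))"]) auto
    then show ?thesis using B(1) by (auto simp: null_sets_def)
  qed
  have "(\<integral>\<^sup>+x. ennreal \<bar>\<phi> x\<bar> * indicator E x \<partial>N) \<le> (\<integral>\<^sup>+x. (\<Sum>j. ennreal (\<gamma> j) * indicator (A j) x) \<partial>N)"
  proof (rule nn_integral_mono_AE)
    show "AE x in N. ennreal \<bar>\<phi> x\<bar> * indicator E x \<le> (\<Sum>j. ennreal (\<gamma> j) * indicator (A j) x)"
      using AE_not_in[OF null] AE_space
    proof eventually_elim
      case (elim x)
      show ?case
      proof (cases "x \<in> E")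
        case True
        have ex: "\<exists>j. \<bar>\<phi> x\<bar> \<le> \<gamma> j" using elim by (auto simp: B_def not_less)
        define j where "j = (LEAST j. \<bar>\<phi> x\<bar> \<le> \<gamma> j)"
        have j: "\<bar>\<phi> x\<bar> \<le> \<gamma> j" "\<And>i. i < j \<Longrightarrow> \<not> \<bar>\<phi> x\<bar> \<le> \<gamma> i"
          unfolding j_def using ex by (rule LeastI_ex) (rule not_less_Least)
        have "x \<in> A j"
          using True j(2) elim(2) by (auto simp: A_def B_def not_le split: nat.split)
        then have "ennreal \<bar>\<phi> x\<bar> * indicator E x \<le> ennreal (\<gamma> j) * indicator (A j) x"
          using True j(1) by (simp add: ennreal_leI)
        also have "\<dots> \<le> (\<Sum>j. ennreal (\<gamma> j) * indicator (A j) x)" by (rule ennreal_suminf_ge)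
        finally show ?thesis .
      qed simp
    qed
  qed
  also have "\<dots> = (\<Sum>j. ennreal (\<gamma> j) * emeasure N (A j))"
    using A(1) by (subst nn_integral_suminf) (auto simp: nn_integral_cmult_indicator)
  also have "\<dots> \<le> (\<Sum>j. ennreal (\<tau> j) * rearr N \<phi> (\<tau> (Suc j)))"
  proof (intro suminf_le)
    fix j
    have "ennreal (\<gamma> j) * emeasure N (A j) \<le> ennreal (\<gamma> j) * ennreal (\<tau> j)" by (intro mult_left_mono A) auto
    then show "ennreal (\<gamma> j) * emeasure N (A j) \<le> ennreal (\<tau> j) * rearr N \<phi> (\<tau> (Suc j))"
      by (simp add: \<gamma>(1) mult.commute)
  qed auto
  finally show ?thesis .
qed

section \<open>The rearrangement estimate\<close>

text \<open>If \<open>T (Suc k)\<close> exceeded \<open>max (T k) (b k) + D k\<close>, then \<open>L\<close> between two levels in this gap would be violated: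
  the boundary term is absorbed because \<open>2 * K\<close> times its size is at most \<open>\<tau> (Suc k) powr \<beta>\<close>.\<close>

lemma level_recursion:
  fixes M :: "real \<Rightarrow> real" and X Hf :: "real \<Rightarrow> ennreal" and S b T :: "nat \<Rightarrow> ennreal" and \<tau> :: "nat \<Rightarrow> real" and \<beta> K :: real
  assumes \<tau>: "\<And>k. 0 < \<tau> k" and \<beta>: "0 < \<beta>" and K: "0 < K"
    and M: "\<And>s t. 0 \<le> s \<Longrightarrow> s \<le> t \<Longrightarrow> M t \<le> M s" "M 0 \<le> \<tau> 0"
    and L: "\<And>s t. 0 \<le> s \<Longrightarrow> s < t \<Longrightarrow> ennreal ((t - s) * M t powr \<beta>) \<le> ennreal K * (X s + ennreal (t - s) * Hf s)"
    and XS: "\<And>s k. 0 \<le> s \<Longrightarrow> M s \<le> \<tau> k \<Longrightarrow> X s \<le> S k"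
    and HB: "\<And>s k. 0 \<le> s \<Longrightarrow> b k \<le> ennreal s \<Longrightarrow> Hf s \<le> ennreal (\<tau> (Suc k) powr \<beta> / (2 * K))"
    and b: "\<And>k. b k \<le> b (Suc k)"
    and T: "\<And>k. T k = Inf {ennreal t | t. 0 \<le> t \<and> M t \<le> \<tau> k}"
  shows "T (Suc k) \<le> b k + (\<Sum>i\<le>k. ennreal (2 * K * \<tau> (Suc i) powr (- \<beta>)) * S i)"
proof -
  let ?D = "\<lambda>i. ennreal (2 * K * \<tau> (Suc i) powr (- \<beta>)) * S i"
  have T0: "T 0 = 0"
    using M(2) by (auto simp: T intro!: antisym Inf_lower2[of 0] exI[of _ 0])
  have step: "T (Suc k) \<le> max (T k) (b k) + ?D k" for k
  proof (rule ccontr)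
    assume "\<not> ?thesis"
    then have lt: "max (T k) (b k) + ?D k < T (Suc k)" by simp
    then obtain t' where t': "max (T k) (b k) + ?D k < t'" "t' < T (Suc k)" using dense by blast
    then have "t' \<noteq> top" by auto
    then obtain t where t: "t' = ennreal t" "0 \<le> t" by (metis ennreal_cases)
    have "max (T k) (b k) + ?D k < top" using lt by (rule order_less_le_trans) simp
    then obtain p d where pd: "max (T k) (b k) = ennreal p" "0 \<le> p" "?D k = ennreal d" "0 \<le> d"
      by (metis ennreal_add_eq_top ennreal_cases less_irrefl)
    have ptd: "p + d < t" using t'(1) pd t by (simp add: ennreal_less_iff flip: ennreal_plus)
    \<comment> \<open>\<open>s\<close> halves the room left by the gap: it stays above
      \<open>max (T k) (b k)\<close>, so \<open>M s \<le> \<tau> k\<close> and the boundary term is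
      small, and yet \<open>t - s\<close> exceeds the value of \<open>?D k\<close>, against the
      level inequality.\<close>
    define s where "s = (p + t - d) / 2"
    have s: "p < s" "s + d < t" using ptd by (auto simp: s_def field_simps)
    have s0: "0 \<le> s" "s < t" using s pd by auto
    have "T k < ennreal s"
      using s(1) pd(1,2) by (metis ennreal_less_iff max.cobounded1 order_le_less_trans)
    then obtain r where r: "0 \<le> r" "M r \<le> \<tau> k" "ennreal r < ennreal s"
      unfolding T Inf_less_iff by blast
    then have "r \<le> s" by (simp add: ennreal_less_iff)
    then have Ms: "M s \<le> \<tau> k" using M(1)[OF r(1)] r(2) by (meson order.trans)
    have bs: "b k \<le> ennreal s"
      using s(1) pd(1,2) by (metis ennreal_leI less_imp_le max.cobounded2 order.trans)
    have Mt: "\<tau> (Suc k) < M t"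
    proof (rule ccontr)
      assume "\<not> \<tau> (Suc k) < M t"
      then have "T (Suc k) \<le> ennreal t" unfolding T using t(2) by (intro Inf_lower) auto
      then show False using t'(2) t(1) by simp
    qed
    define q where "q = \<tau> (Suc k) powr \<beta>"
    have q: "0 < q" using \<tau>[of "Suc k"] by (simp add: q_def)
    have "ennreal ((t - s) * q) \<le> ennreal ((t - s) * M t powr \<beta>)"
      unfolding q_def using s0 Mt \<tau>[of "Suc k"] \<beta> by (intro ennreal_leI mult_left_mono powr_mono2) auto
    also have "\<dots> \<le> ennreal K * (X s + ennreal (t - s) * Hf s)" by (rule L[OF s0])
    also have "\<dots> \<le> ennreal K * (S k + ennreal (t - s) * ennreal (q / (2 * K)))"
      unfolding q_def by (intro mult_left_mono add_mono XS HB s0 Ms bs) auto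
    also have "\<dots> = ennreal K * S k + ennreal ((t - s) * q / 2)"
      using K q s0 by (simp add: distrib_left ennreal_mult[symmetric])
    finally have 1: "ennreal ((t - s) * q) \<le> ennreal K * S k + ennreal ((t - s) * q / 2)" .
    have "S k \<noteq> top"
    proof
      assume "S k = top"
      then have "?D k = top" using K \<tau>[of "Suc k"] by (simp add: ennreal_mult_top)
      then show False using pd(3) by simp
    qed
    then obtain S' where S': "S k = ennreal S'" "0 \<le> S'" by (metis ennreal_cases)
    have e: "ennreal K * S k + ennreal ((t - s) * q / 2) = ennreal (K * S' + (t - s) * q / 2)"
      using K S' s0 q by (simp add: ennreal_mult)
    have "0 \<le> K * S' + (t - s) * q / 2" using K S' s0 q by simp
    then have "(t - s) * q \<le> K * S' + (t - s) * q / 2"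
      using 1[unfolded e] by (rule ennreal_le_iff[THEN iffD1])
    then have "(t - s) * q \<le> 2 * K * S'" by simp
    then have "t - s \<le> 2 * K * S' / q" using q by (simp only: pos_le_divide_eq)
    also have "2 * K * S' / q = d"
    proof -
      have "ennreal d = ennreal (2 * K * \<tau> (Suc k) powr (- \<beta>) * S')"
        using pd(3) S' K by (simp add: ennreal_mult)
      then have "d = 2 * K * \<tau> (Suc k) powr (- \<beta>) * S'" using pd(4) S'(2) K by simp
      then show ?thesis by (simp add: q_def powr_minus divide_inverse)
    qed
    finally show False using s(2) by simp
  qed
  show ?thesis
  proof (induction k)
    case 0
    show ?case using step[of 0] T0 by simp
  next
    case (Suc k)
    have "T (Suc (Suc k)) \<le> max (T (Suc k)) (b (Suc k)) + ?D (Suc k)" by (rule step)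
    \<comment> \<open>Keeping a maximum in the recursion pays off here: \<open>b\<close> is
      nondecreasing, so only its last value survives instead of a sum over all steps.\<close>
    also have "max (T (Suc k)) (b (Suc k)) \<le> b (Suc k) + (\<Sum>i\<le>k. ?D i)"
      using Suc b[of k] by (auto intro: order.trans[OF Suc] add_right_mono simp: add_increasing2)
    finally show ?case by (simp add: add.assoc add_right_mono)
  qed
qed

text \<open>Two instances of \<open>level_inequality\<close> are merged, one for \<mu> and one for
  Lebesgue measure, which satisfies the growth condition with exponent \<open>n\<close> and the
  volume of the unit ball as constant; hence the maximum in \<open>K\<close>.\<close>

lemma rearrangement_estimate:
  fixes \<Omega> :: "(real^'n::finite) set" and u :: "real^'n \<Rightarrow> real" and \<mu> :: "(real^'n) measure" and C \<alpha> \<tau>0 :: real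
  defines "n \<equiv> real CARD('n)"
  defines "K \<equiv> max (levelK C \<alpha> n) (levelK (unit_ball_vol n) n n)"
  assumes n2: "2 \<le> CARD('n)"
    and \<Omega>: "open \<Omega>" "emeasure lebesgue \<Omega> < \<infinity>" "hausdorff (n - 1) (frontier \<Omega>) < \<infinity>"
    and u: "continuous_on (closure \<Omega>) u" "bounded {x \<in> closure \<Omega>. u x \<noteq> 0}"
    and wg: "has_weak_gradient \<Omega> u G"
    and \<alpha>: "n - 1 < \<alpha>" and C: "0 < C"
    and \<mu>: "sets \<mu> = sets (restrict_space borel \<Omega>)" "emeasure \<mu> \<Omega> < \<infinity>"
    and ball: "\<And>x \<rho>. x \<in> \<Omega> \<Longrightarrow> 0 < \<rho> \<Longrightarrow> emeasure \<mu> (ball x \<rho> \<inter> \<Omega>) \<le> ennreal (C * \<rho> powr \<alpha>)"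
    and \<tau>0: "0 < \<tau>0" "measure \<mu> \<Omega> powr (n / \<alpha>) \<le> \<tau>0" "measure lebesgue \<Omega> \<le> \<tau>0"
    and \<tau>: "\<And>k. \<tau> k = \<tau>0 * (1/2) ^ k"
  shows "rearr \<mu> u (\<tau> (Suc k) powr (\<alpha> / n)) \<le>
    rearr (hmeasure (n - 1) (frontier \<Omega>)) u (\<tau> (Suc k) powr ((n - 1) / n) / (2 * K))
    + (\<Sum>i\<le>k. ennreal (2 * K * \<tau> (Suc i) powr (- ((n - 1) / n))) *
        (\<Sum>j. ennreal (\<tau> (i + j)) * rearr (restrict_space lebesgue \<Omega>) (\<lambda>x. norm (G x)) (\<tau> (i + Suc j))))"
proof -
  have n1: "2 \<le> n" unfolding n_def using n2 by simp
  have \<alpha>0: "0 < \<alpha>" using \<alpha> n1 by linarith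
  have u\<Omega>: "continuous_on \<Omega> u" using u(1) closure_subset continuous_on_subset by blast
  have sp: "space \<mu> = \<Omega>" using sets_eq_imp_space_eq[OF \<mu>(1)] by (simp add: space_restrict_space)
  have fin: "emeasure \<mu> A \<noteq> top" for A
    using \<mu>(2) emeasure_space[of \<mu> A] by (auto simp: sp top_unique)
  interpret \<mu>: finite_measure \<mu> by standard (use fin in auto)
  define \<beta> where "\<beta> = (n - 1) / n"
  have \<beta>: "0 < \<beta>" using n1 by (simp add: \<beta>_def)
  define E where "E t = {x \<in> \<Omega>. t < \<bar>u x\<bar>}" for t
  have oE: "open (E t)" for t
    using continuous_open_preimage[of \<Omega> "\<lambda>y. \<bar>u y\<bar>" "{t<..}"] u\<Omega> \<Omega>(1)
    by (auto simp: E_def vimage_def Int_def intro: continuous_intros)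
  have E\<Omega>: "E t \<subseteq> \<Omega>" for t by (auto simp: E_def)
  have E\<mu>: "E t \<in> sets \<mu>" for t
    unfolding \<mu>(1) using \<Omega>(1) oE[of t] E\<Omega>[of t] by (subst sets_restrict_space_iff) auto
  have Efin: "emeasure lebesgue (E t) < \<infinity>" for t
    using \<Omega> oE[of t] emeasure_mono[OF E\<Omega>[of t], of lebesgue] by (auto simp: order_le_less_trans)
  define N where "N = restrict_space lebesgue \<Omega>"
  have spN: "space N = \<Omega>" by (simp add: N_def space_restrict_space)
  have \<Omega>l: "\<Omega> \<in> sets lebesgue" using \<Omega>(1) by simp
  have setsN: "A \<in> sets N \<longleftrightarrow> A \<in> sets lebesgue \<and> A \<subseteq> \<Omega>" for A
    unfolding N_def using \<Omega>l by (subst sets_restrict_space_iff) auto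
  have emN: "emeasure N A = emeasure lebesgue A" if "A \<subseteq> \<Omega>" for A
    unfolding N_def using \<Omega>l that by (subst emeasure_restrict_space) auto
  define g where "g = rearr N (\<lambda>x. norm (G x))"
  define Hm where "Hm = hmeasure (n - 1) (frontier \<Omega>)"
  have K1: "levelK C \<alpha> n \<le> K" "levelK (unit_ball_vol n) n n \<le> K" by (auto simp: K_def)
  have Kpos: "0 < K"
  proof -
    have A1: "1 \<le> levelA (unit_ball_vol n) n n" by (rule levelA_pos) (use n1 in auto)
    have "0 < (n - 1) / 2 + 1" by (rule add_nonneg_pos[OF divide_nonneg_pos]) (use n1 in linarith)+
    then have Gp: "0 < Gamma ((n - 1)/2 + 1)" by (rule Gamma_real_pos)
    have v: "0 < unit_ball_vol n" using n1 by simp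
    have "0 < levelK (unit_ball_vol n) n n"
      unfolding levelK_def
      by (intro mult_pos_pos divide_pos_pos add_pos_pos Gp v) (use A1 n1 in \<open>auto intro: less_le_trans[of 0 1]\<close>)
    then show ?thesis using K1(2) by linarith
  qed
  define M where "M t = max (measure \<mu> (E t) powr (n / \<alpha>)) (measure lebesgue (E t))" for t
  define X where "X s = (\<integral>\<^sup>+y. ennreal (norm (G y)) * indicator (E s) y \<partial>lebesgue)" for s
  define Hf where "Hf s = hausdorff (n - 1) {y \<in> frontier \<Omega>. s < \<bar>u y\<bar>}" for s
  define S where "S i = (\<Sum>j. ennreal (\<tau> (i + j)) * g (\<tau> (i + Suc j)))" for i
  define b where "b k = rearr Hm u (\<tau> (Suc k) powr \<beta> / (2 * K))" for k
  define T where "T k = Inf {ennreal t | t. 0 \<le> t \<and> M t \<le> \<tau> k}" for k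
  have \<tau>pos: "0 < \<tau> k" for k using \<tau>0(1) by (simp add: \<tau>)
  have \<tau>lim: "\<tau> \<longlonglongrightarrow> 0"
  proof -
    have "(\<lambda>k. \<tau>0 * (1/2) ^ k) \<longlonglongrightarrow> \<tau>0 * 0" by (intro tendsto_mult tendsto_const LIMSEQ_power_zero) simp
    then show ?thesis by (simp add: \<tau>[abs_def])
  qed
  have level1: "ennreal ((t - s) * measure \<mu> (E t) powr ((n - 1) / \<alpha>)) \<le> ennreal K * (X s + ennreal (t - s) * Hf s)"
    if st: "0 \<le> s" "s < t" for s t
  proof -
    have "ennreal ((t - s) * measure \<mu> (E t) powr ((n - 1) / \<alpha>)) \<le> ennreal (levelK C \<alpha> n) * (X s + ennreal (t - s) * Hf s)"
      unfolding E_def X_def Hf_def n_def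
      by (rule level_inequality[OF n2 \<Omega>[unfolded n_def] u wg \<alpha>[unfolded n_def] C \<mu> ball st])
    also have "\<dots> \<le> ennreal K * (X s + ennreal (t - s) * Hf s)"
      by (intro mult_right_mono ennreal_leI K1) auto
    finally show ?thesis .
  qed
  \<comment> \<open>Lebesgue measure on Borel sets, as \<open>level_inequality\<close> asks for the
    trace of the Borel sigma-algebra.\<close>
  define lam where "lam = restrict_space lborel \<Omega>"
  have emlam: "emeasure lam A = emeasure lborel A" if "A \<subseteq> \<Omega>" for A
    unfolding lam_def using \<Omega>(1) that by (subst emeasure_restrict_space) auto
  have level2: "ennreal ((t - s) * measure lebesgue (E t) powr ((n - 1) / n)) \<le> ennreal K * (X s + ennreal (t - s) * Hf s)"
    if st: "0 \<le> s" "s < t" for s t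
  proof -
    have setslam: "sets lam = sets (restrict_space borel \<Omega>)"
      unfolding lam_def by (rule sets_restrict_space_cong) simp
    have finlam: "emeasure lam \<Omega> < \<infinity>" using \<Omega>(1,2) by (simp add: emlam)
    have balllam: "emeasure lam (ball x \<rho> \<inter> \<Omega>) \<le> ennreal (unit_ball_vol n * \<rho> powr n)" if "x \<in> \<Omega>" "0 < \<rho>" for x \<rho>
    proof -
      have "emeasure lam (ball x \<rho> \<inter> \<Omega>) = emeasure lborel (ball x \<rho> \<inter> \<Omega>)" by (rule emlam) auto
      also have "\<dots> \<le> emeasure lborel (ball x \<rho>)" by (rule emeasure_mono) auto
      also have "\<dots> = ennreal (unit_ball_vol n * \<rho> powr n)"
        using emeasure_ball[of \<rho> x] that by (simp add: n_def powr_realpow)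
      finally show ?thesis .
    qed
    have v: "0 < unit_ball_vol n" using n1 by simp
    have "ennreal ((t - s) * measure lam (E t) powr ((n - 1) / n)) \<le> ennreal (levelK (unit_ball_vol n) n n) * (X s + ennreal (t - s) * Hf s)"
      unfolding E_def X_def Hf_def n_def
      by (rule level_inequality[OF n2 \<Omega>[unfolded n_def] u wg _ v[unfolded n_def] setslam finlam balllam[unfolded n_def] st]) simp
    also have "\<dots> \<le> ennreal K * (X s + ennreal (t - s) * Hf s)"
      by (intro mult_right_mono ennreal_leI K1) auto
    also have "measure lam (E t) = measure lebesgue (E t)"
      using emlam[OF E\<Omega>] oE[of t] by (simp add: measure_def)
    finally show ?thesis .
  qed
  have TS: "T (Suc k) \<le> b k + (\<Sum>i\<le>k. ennreal (2 * K * \<tau> (Suc i) powr (- \<beta>)) * S i)"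
  proof (rule level_recursion[OF \<tau>pos \<beta> Kpos _ _ _ _ _ _ T_def])
    fix s t :: real assume "0 \<le> s" "s \<le> t"
    then have sub: "E t \<subseteq> E s" by (auto simp: E_def)
    show "M t \<le> M s"
      unfolding M_def
    proof (rule max.mono)
      show "measure \<mu> (E t) powr (n / \<alpha>) \<le> measure \<mu> (E s) powr (n / \<alpha>)"
        using \<mu>.finite_measure_mono[OF sub E\<mu>] n1 \<alpha>0 by (intro powr_mono2) auto
      show "measure lebesgue (E t) \<le> measure lebesgue (E s)"
        by (rule measure_mono_fmeasurable[OF sub]) (use oE Efin in \<open>auto simp: fmeasurable_def\<close>)
    qed
  next
    have "measure \<mu> (E 0) powr (n / \<alpha>) \<le> measure \<mu> \<Omega> powr (n / \<alpha>)"
      using \<mu>.finite_measure_mono[OF E\<Omega>[of 0]] n1 \<alpha>0 sets.top[of \<mu>] by (intro powr_mono2) (auto simp: sp)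
    moreover have "measure lebesgue (E 0) \<le> measure lebesgue \<Omega>"
      by (rule measure_mono_fmeasurable[OF E\<Omega>]) (use oE \<Omega> in \<open>auto simp: fmeasurable_def\<close>)
    ultimately show "M 0 \<le> \<tau> 0" using \<tau>0 by (simp add: M_def \<tau>)
  next
    fix s t :: real assume st: "0 \<le> s" "s < t"
    \<comment> \<open>Whichever entry of the maximum \<open>M t\<close> is larger, its power \<beta>
      is the quantity on the left of the corresponding level inequality.\<close>
    show "ennreal ((t - s) * M t powr \<beta>) \<le> ennreal K * (X s + ennreal (t - s) * Hf s)"
    proof (cases "measure lebesgue (E t) \<le> measure \<mu> (E t) powr (n / \<alpha>)")
      case True
      then have "M t powr \<beta> = measure \<mu> (E t) powr ((n - 1) / \<alpha>)"
        using n1 by (simp add: M_def \<beta>_def powr_powr)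
      then show ?thesis using level1[OF st] by simp
    next
      case False
      then have "M t = measure lebesgue (E t)" by (simp add: M_def)
      then show ?thesis using level2[OF st] by (simp add: \<beta>_def)
    qed
  next
    fix s :: real and k assume s: "0 \<le> s" "M s \<le> \<tau> k"
    have mG: "{x \<in> space N. t < \<bar>norm (G x)\<bar>} \<in> sets N" for t
    proof (cases "0 \<le> t")
      case True
      have "{x \<in> space N. t < \<bar>norm (G x)\<bar>} = (\<lambda>y. ennreal (norm (G y)) * indicator \<Omega> y) -` {ennreal t<..} \<inter> space lebesgue"
        using True by (auto simp: spN ennreal_less_iff split: split_indicator split_indicator_asm)
      moreover have "\<dots> \<in> sets lebesgue"
        by (rule measurable_sets[OF weak_gradient_measurable[OF \<Omega>(1) wg]]) simp
      ultimately show ?thesis unfolding setsN by (auto simp: spN)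
    next
      case False
      then have "{x \<in> space N. t < \<bar>norm (G x)\<bar>} = \<Omega>" by (auto simp: spN) (smt (verit) norm_ge_zero)
      then show ?thesis using setsN \<Omega>l by simp
    qed
    have "X s = (\<integral>\<^sup>+y. (ennreal \<bar>norm (G y)\<bar> * indicator (E s) y) * indicator \<Omega> y \<partial>lebesgue)"
      unfolding X_def using E\<Omega>[of s] by (intro nn_integral_cong) (auto simp: indicator_def)
    also have "\<dots> = (\<integral>\<^sup>+y. ennreal \<bar>norm (G y)\<bar> * indicator (E s) y \<partial>N)"
      unfolding N_def using \<Omega>l by (subst nn_integral_restrict_space) auto
    also have "\<dots> \<le> (\<Sum>j. ennreal (\<tau> (k + j)) * rearr N (\<lambda>x. norm (G x)) (\<tau> (k + Suc j)))"
    proof (rule integral_le_rearr_sum[where \<tau>="\<lambda>j. \<tau> (k + j)", OF mG \<tau>pos])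
      show "(\<lambda>j. \<tau> (k + j)) \<longlonglongrightarrow> 0" using LIMSEQ_ignore_initial_segment[OF \<tau>lim, of k] by (simp add: add.commute)
      show "E s \<in> sets N" using oE[of s] E\<Omega>[of s] by (simp add: setsN)
      have "emeasure N (E s) = ennreal (measure lebesgue (E s))"
        using Efin[of s] by (simp add: emN[OF E\<Omega>] emeasure_eq_ennreal_measure less_top[symmetric])
      also have "\<dots> \<le> ennreal (\<tau> k)" using s(2) by (intro ennreal_leI) (simp add: M_def)
      finally show "emeasure N (E s) \<le> ennreal (\<tau> (k + 0))" by simp
    qed
    finally show "X s \<le> S k" by (simp add: S_def g_def)
  next
    fix s :: real and k assume s: "0 \<le> s" "b k \<le> ennreal s"
    have F: "frontier \<Omega> \<in> sets borel" by (simp add: frontier_closed)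
    have uF: "continuous_on (frontier \<Omega>) u"
      by (rule continuous_on_subset[OF u(1)]) (auto simp: frontier_def)
    have mF: "{x \<in> frontier \<Omega>. t < \<bar>u x\<bar>} \<in> sets borel" for t
    proof -
      have "closed {x \<in> frontier \<Omega>. \<bar>u x\<bar> \<le> t}"
        using continuous_closed_preimage[of "frontier \<Omega>" "\<lambda>y. \<bar>u y\<bar>" "{..t}"] uF
        by (auto simp: vimage_def Int_def intro!: continuous_intros)
      then have "frontier \<Omega> - {x \<in> frontier \<Omega>. \<bar>u x\<bar> \<le> t} \<in> sets borel" using F by (intro sets.Diff) auto
      also have "frontier \<Omega> - {x \<in> frontier \<Omega>. \<bar>u x\<bar> \<le> t} = {x \<in> frontier \<Omega>. t < \<bar>u x\<bar>}" by auto
      finally show ?thesis .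
    qed
    have spH: "space Hm = frontier \<Omega>" unfolding Hm_def by (rule space_hmeasure[OF F])
    have "emeasure Hm {x \<in> space Hm. s < \<bar>u x\<bar>} \<le> ennreal (\<tau> (Suc k) powr \<beta> / (2 * K))"
    proof (rule rearr_attained[OF _ s(2)[unfolded b_def] s(1)])
      show "{x \<in> space Hm. t < \<bar>u x\<bar>} \<in> sets Hm" for t
        unfolding spH unfolding Hm_def sets_hmeasure[OF F]
        using mF[of t] F by (subst sets_restrict_space_iff) auto
    qed
    then show "Hf s \<le> ennreal (\<tau> (Suc k) powr \<beta> / (2 * K))"
      unfolding spH unfolding Hm_def using emeasure_hmeasure[OF F mF[of s], of "n - 1"] by (simp add: Hf_def)
  next
    fix k
    have "\<tau> (Suc (Suc k)) \<le> \<tau> (Suc k)" using \<tau>0(1) by (simp add: \<tau>)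
    then show "b k \<le> b (Suc k)"
      unfolding b_def using \<tau>pos Kpos \<beta>
      by (intro rearr_antimono divide_right_mono powr_mono2) (auto simp: less_imp_le)
  qed
  \<comment> \<open>A level admissible for \<open>T\<close> controls \<mu> as well:
    \<open>M t \<le> \<tau> (Suc k)\<close> bounds the \<mu>-measure of the superlevel set by
    \<open>\<tau> (Suc k) powr (\<alpha> / n)\<close>.\<close>
  have "rearr \<mu> u (\<tau> (Suc k) powr (\<alpha> / n)) \<le> T (Suc k)"
    unfolding T_def
  proof (rule Inf_greatest, clarify)
    fix t :: real assume t: "0 \<le> t" "M t \<le> \<tau> (Suc k)"
    have "measure \<mu> (E t) = (measure \<mu> (E t) powr (n / \<alpha>)) powr (\<alpha> / n)"
      using n1 \<alpha>0 by (simp add: powr_powr)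
    also have "\<dots> \<le> \<tau> (Suc k) powr (\<alpha> / n)"
      using t(2) n1 \<alpha>0 by (intro powr_mono2) (auto simp: M_def)
    finally have "emeasure \<mu> (E t) \<le> ennreal (\<tau> (Suc k) powr (\<alpha> / n))"
      by (simp add: \<mu>.emeasure_eq_measure ennreal_leI)
    then show "rearr \<mu> u (\<tau> (Suc k) powr (\<alpha> / n)) \<le> ennreal t"
      by (intro rearr_le t) (simp add: sp E_def)
  qed
  also note TS
  finally show ?thesis by (simp only: b_def S_def g_def \<beta>_def Hm_def N_def)
qed

section \<open>The subcritical and supercritical cases\<close>

lemma grid_geometric: assumes "0 < c" "0 < \<theta>" "\<theta> < 1" shows "grid (\<lambda>k. c * \<theta> ^ k)"
proof
  show "(\<lambda>k. c * \<theta> ^ k) \<longlonglongrightarrow> 0"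
    using tendsto_mult[OF tendsto_const LIMSEQ_power_zero, of \<theta> c] assms by simp
qed (use assms in auto)

lemma dyadic_powr:
  fixes \<tau>0 \<gamma> :: real
  assumes "0 < \<tau>0" shows "(\<tau>0 * (1/2) ^ k) powr \<gamma> = \<tau>0 powr \<gamma> * ((1/2) powr \<gamma>) ^ k"
proof -
  have "((1/2::real) ^ k) powr \<gamma> = ((1/2) powr real k) powr \<gamma>" by (simp only: powr_realpow zero_less_divide_1_iff zero_less_numeral)
  also have "\<dots> = ((1/2) powr \<gamma>) powr real k" by (simp only: powr_powr mult.commute)
  also have "\<dots> = ((1/2) powr \<gamma>) ^ k" by (rule powr_realpow) simp
  finally show ?thesis by (simp only: powr_mult)
qed

lemma half_powr_minus: "(1/2::real) powr (- x) = 2 powr x"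
  by (simp add: powr_divide powr_minus_divide)

lemma half_powr_less_1: "0 < \<gamma> \<Longrightarrow> (1/2::real) powr \<gamma> < 1"
  using powr_less_mono2[of \<gamma> "1/2" 1] by auto

text \<open>At \<open>\<kappa> = 0\<close> there is no decay to sum, and the embedding of sequence
  spaces takes over with constant 1. This is where the borderline conditions on \<eta> are
  used.\<close>

definition weight_const :: "real \<Rightarrow> real" where
  "weight_const \<kappa> = (if \<kappa> = 0 then 1 else 1 / (1 - (1/2) powr \<kappa>))"

lemma weight_const_pos: "0 \<le> \<kappa> \<Longrightarrow> 0 < weight_const \<kappa>"
  using half_powr_less_1[of \<kappa>] by (auto simp: weight_const_def)

lemma lseq_dyadic_weight:
  assumes "1 \<le> \<sigma>" "1 \<le> \<eta>" "0 \<le> \<kappa>" "\<kappa> = 0 \<Longrightarrow> \<sigma> \<le> \<eta>"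
  shows "lseq \<eta> (\<lambda>k. ennreal (((1/2) powr \<kappa>) ^ k) * z k) \<le> ennreal (weight_const \<kappa>) * lseq \<sigma> z"
proof (cases "\<kappa> = 0")
  case True
  then show ?thesis using lseq_embed[OF assms(1) assms(4)] by (simp add: weight_const_def)
next
  case False
  then show ?thesis
    using lseq_geometric_weight[OF assms(1,2), of "(1/2) powr \<kappa>" z] half_powr_less_1[of \<kappa>] assms(3)
    by (simp add: weight_const_def)
qed

lemma ln_2_half: "1/2 \<le> ln (2::real)" "ln (2::real) \<le> 1"
  using ln2_ge_two_thirds ln_2_less_1 by auto

text \<open>The factors are the Hardy constant of \<open>lseq_recur_back\<close>, the shift by two
  grid points from \<open>\<tau> j\<close> to \<open>\<tau> (Suc (Suc j))\<close>, and the inverse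
  of the lower bound 1/2 for \<open>ln 2\<close>.\<close>

definition tail_const :: "real \<Rightarrow> real" where
  "tail_const p = 1 / (1 - (1/2) powr (1 - 1 / p)) * (4 powr (1 / p) * 2)"

lemma tail_const_pos: "1 < p \<Longrightarrow> 0 < tail_const p"
  using half_powr_less_1[of "1 - 1 / p"] by (simp add: tail_const_def)

text \<open>Hardy's inequality for the averaged rearrangement: the inner sum stands for the integral
  of the rearrangement up to \<open>\<tau> i\<close>, and dividing by \<open>\<tau> i\<close> gives
  its mean. The ratio \<open>(1/2) powr (1 - 1 / p)\<close> is below 1 because
  \<open>p > 1\<close>.\<close>

lemma tail_sum_bound:
  fixes N :: "'a measure" and \<phi> :: "'a \<Rightarrow> real" and \<tau> :: "nat \<Rightarrow> real"
  assumes \<sigma>: "1 \<le> \<sigma>" and p: "1 < p" and \<tau>0: "0 < \<tau>0" and \<tau>: "\<And>k. \<tau> k = \<tau>0 * (1/2) ^ k"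
  shows "lseq \<sigma> (\<lambda>i. ennreal (\<tau> i powr (1 / p - 1)) * (\<Sum>j. ennreal (\<tau> (i + j)) * rearr N \<phi> (\<tau> (i + Suc j))))
    \<le> ennreal (tail_const p) * lorentz N (ereal p) \<sigma> \<phi>"
proof -
  have \<tau>eq: "\<tau> = (\<lambda>k. \<tau>0 * (1/2) ^ k)" using \<tau> by blast
  interpret grid \<tau> unfolding \<tau>eq by (rule grid_geometric) (use \<tau>0 in auto)
  define a where "a j = ennreal (\<tau> j powr (1 / p)) * rearr N \<phi> (\<tau> (Suc j))" for j
  define \<theta> where "\<theta> = (1/2::real) powr (1 - 1 / p)"
  have \<theta>: "0 \<le> \<theta>" "\<theta> < 1" using p half_powr_less_1[of "1 - 1 / p"] by (auto simp: \<theta>_def)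
  have e: "ennreal (\<tau> i powr (1 / p - 1)) * (\<Sum>j. ennreal (\<tau> (i + j)) * rearr N \<phi> (\<tau> (i + Suc j))) = (\<Sum>j. ennreal (\<theta> ^ j) * a (i + j))" for i
  proof -
    have "\<tau> i powr (1 / p - 1) * \<tau> (i + j) = \<theta> ^ j * \<tau> (i + j) powr (1 / p)" for j
    proof -
      have 1: "\<tau> (i + j) = \<tau> (i + j) powr (1 / p) * \<tau> (i + j) powr (1 - 1 / p)"
        using pos[of "i + j"] by (simp add: powr_add[symmetric])
      have 2: "\<tau> (i + j) powr (1 - 1 / p) = \<tau> i powr (1 - 1 / p) * \<theta> ^ j"
        using dyadic_powr[OF pos[of i], of j "1 - 1 / p"] by (simp add: \<tau> \<theta>_def power_add mult.assoc)
      have 3: "\<tau> i powr (1 / p - 1) * \<tau> i powr (1 - 1 / p) = 1"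
        using pos[of i] by (simp add: powr_add[symmetric])
      have "\<tau> i powr (1 / p - 1) * \<tau> (i + j) = \<tau> i powr (1 / p - 1) * (\<tau> (i + j) powr (1 / p) * (\<tau> i powr (1 - 1 / p) * \<theta> ^ j))"
        by (subst 1) (simp only: 2)
      also have "\<dots> = (\<tau> i powr (1 / p - 1) * \<tau> i powr (1 - 1 / p)) * (\<theta> ^ j * \<tau> (i + j) powr (1 / p))"
        by (simp only: mult_ac)
      finally show ?thesis by (simp only: 3 mult_1_left)
    qed
    then have "ennreal (\<tau> i powr (1 / p - 1)) * (ennreal (\<tau> (i + j)) * rearr N \<phi> (\<tau> (i + Suc j))) = ennreal (\<theta> ^ j) * a (i + j)" for j
      using \<theta> pos by (simp add: a_def mult.assoc[symmetric] ennreal_mult[symmetric] less_imp_le)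
    then show ?thesis by (simp flip: ennreal_suminf_cmult)
  qed
  have sc: "ennreal (tail_const p) = ennreal (1 / (1 - \<theta>)) * ennreal (4 powr (1 / p) * 2)"
    unfolding tail_const_def \<theta>_def[symmetric] using \<theta> by (intro ennreal_mult) auto
  have "lseq \<sigma> a \<le> ennreal (4 powr (1 / p) * 2) * lorentz N (ereal p) \<sigma> \<phi>"
  proof -
    define T where "T k = ennreal (\<tau> (Suc k) powr (1 / p)) * rearr N \<phi> (\<tau> k)" for k
    have aT: "a j = ennreal (4 powr (1 / p)) * T (Suc j)" for j
    proof -
      have "\<tau> j = 4 * \<tau> (Suc (Suc j))" by (simp add: \<tau>)
      then have "\<tau> j powr (1 / p) = 4 powr (1 / p) * \<tau> (Suc (Suc j)) powr (1 / p)" by (simp add: powr_mult)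
      then show ?thesis by (simp add: a_def T_def ennreal_mult mult.assoc)
    qed
    have "lseq \<sigma> a = ennreal (4 powr (1 / p)) * lseq \<sigma> (\<lambda>j. T (Suc j))"
      unfolding aT by (rule lseq_cmult[OF \<sigma>])
    also have "\<dots> \<le> ennreal (4 powr (1 / p)) * lseq \<sigma> T" by (intro mult_left_mono lseq_shift \<sigma>) simp
    also have "\<dots> \<le> ennreal (4 powr (1 / p)) * (ennreal (1 / (1/2)) * lorentz N (ereal p) \<sigma> \<phi>)"
      unfolding T_def
    proof (intro mult_left_mono lorentz_lower \<sigma>)
      show "1 / 2 \<le> ln (\<tau> k / \<tau> (Suc k))" for k using ln_2_half \<tau>0 by (simp add: \<tau>)
    qed (use p in auto)
    finally show ?thesis by (simp add: ennreal_mult mult.assoc)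
  qed
  then have "ennreal (1 / (1 - \<theta>)) * lseq \<sigma> a \<le> ennreal (tail_const p) * lorentz N (ereal p) \<sigma> \<phi>"
    unfolding sc mult.assoc by (rule mult_left_mono) simp
  with lseq_recur_back[OF \<sigma> \<theta> e] show ?thesis by (rule order.trans)
qed

text \<open>Dual Hardy inequality, for sums from the coarse end of the grid; the positive exponent
  makes the weight decay by a fixed factor per step.\<close>

lemma accumulated_sum_bound:
  fixes d :: "nat \<Rightarrow> ennreal"
  assumes \<sigma>: "1 \<le> \<sigma>" and \<nu>: "0 < \<nu>" and \<tau>0: "0 < \<tau>0" and \<tau>: "\<And>k. \<tau> k = \<tau>0 * (1/2) ^ k"
  shows "lseq \<sigma> (\<lambda>k. ennreal (\<tau> k powr \<nu>) * (\<Sum>i\<le>k. d i))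
    \<le> ennreal (1 / (1 - (1/2) powr \<nu>)) * lseq \<sigma> (\<lambda>i. ennreal (\<tau> i powr \<nu>) * d i)"
proof -
  define y where "y k = ennreal (\<tau> k powr \<nu>) * (\<Sum>i\<le>k. d i)" for k
  \<comment> \<open>\<open>y\<close> delayed by one index, so that the recursion starts from zero as
    \<open>lseq_recur\<close> requires.\<close>
  define w where "w k = (case k of 0 \<Rightarrow> 0 | Suc j \<Rightarrow> y j)" for k
  define e where "e i = ennreal (\<tau> i powr \<nu>) * d i" for i
  have \<tau>S: "\<tau> (Suc k) powr \<nu> = (1/2) powr \<nu> * \<tau> k powr \<nu>" for k
  proof -
    have "\<tau> (Suc k) = (1/2) * \<tau> k" by (simp add: \<tau>)
    then show ?thesis by (simp only: powr_mult)
  qed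
  have "lseq \<sigma> (\<lambda>k. w (Suc k)) \<le> lseq \<sigma> w" by (rule lseq_shift[OF \<sigma>])
  also have "\<dots> \<le> ennreal (1 / (1 - (1/2) powr \<nu>)) * lseq \<sigma> e"
  proof (rule lseq_recur[OF \<sigma>])
    fix k
    show "w (Suc k) \<le> ennreal ((1/2) powr \<nu>) * w k + e k"
    proof (cases k)
      case (Suc j)
      have "ennreal (\<tau> (Suc j) powr \<nu>) * (\<Sum>i\<le>j. d i) = ennreal ((1/2) powr \<nu>) * y j"
        unfolding \<tau>S y_def by (simp add: ennreal_mult mult.assoc)
      then show ?thesis using Suc by (simp add: w_def y_def[of "Suc j"] e_def distrib_left)
    qed (simp add: w_def y_def e_def)
  qed (use half_powr_less_1[OF \<nu>] in \<open>auto simp: w_def\<close>)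
  also have "(\<lambda>k. w (Suc k)) = y" by (simp add: w_def fun_eq_iff)
  finally show ?thesis by (simp only: y_def[abs_def] e_def[abs_def])
qed

text \<open>The exponent in \<open>weight_const\<close> is zero exactly when
  \<open>q = p * \<alpha> / (n - p)\<close>. The leading 2 comes from \<open>lseq_add\<close>, the
  power of 2 from passing between \<open>\<tau> (Suc i)\<close> and \<open>\<tau> i\<close>, the
  last two factors from the two Hardy inequalities.\<close>

definition gradient_const :: "real \<Rightarrow> real \<Rightarrow> real \<Rightarrow> real \<Rightarrow> real \<Rightarrow> real" where
  "gradient_const K n p q \<alpha> = 2 * (2 * K * 2 powr ((n - 1) / n)) * (weight_const (\<alpha> / (n * q) - (1 / p - 1 / n))
     * (1 / (1 - (1/2) powr (1 / p - 1 / n)) * tail_const p))"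

text \<open>The weight is split into \<open>\<tau> k powr \<nu>\<close> with
  \<open>\<nu> = 1 / p - 1 / n\<close>, which the accumulated gradient terms carry under Hardy's
  inequality, and the surplus \<open>\<tau> k powr \<kappa>\<close>, which decays geometrically or
  is trivial and leaves the power of \<open>\<tau>0\<close>.\<close>

lemma gradient_part_bound:
  fixes N :: "'a measure" and \<phi> :: "'a \<Rightarrow> real" and \<tau> :: "nat \<Rightarrow> real" and K n p q \<alpha> :: real
  defines "S \<equiv> \<lambda>i. \<Sum>j. ennreal (\<tau> (i + j)) * rearr N \<phi> (\<tau> (i + Suc j))"
  assumes \<sigma>: "1 \<le> \<sigma>" and \<eta>: "1 \<le> \<eta>" and p: "1 < p" "p < n" and \<tau>0: "0 < \<tau>0" and \<tau>: "\<And>k. \<tau> k = \<tau>0 * (1/2) ^ k"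
    and K: "0 < K" and \<kappa>: "0 \<le> \<alpha> / (n * q) - (1 / p - 1 / n)" "\<alpha> / (n * q) - (1 / p - 1 / n) = 0 \<Longrightarrow> \<sigma> \<le> \<eta>"
  shows "2 * lseq \<eta> (\<lambda>k. ennreal (\<tau> k powr (\<alpha> / (n * q))) * (\<Sum>i\<le>k. ennreal (2 * K * \<tau> (Suc i) powr (- ((n - 1) / n))) * S i))
    \<le> ennreal (gradient_const K n p q \<alpha> * \<tau>0 powr (\<alpha> / (n * q) - (1 / p - 1 / n))) * lorentz N (ereal p) \<sigma> \<phi>"
proof -
  define \<beta> where "\<beta> = (n - 1) / n"
  define \<nu> where "\<nu> = 1 / p - 1 / n"
  define \<kappa> where "\<kappa> = \<alpha> / (n * q) - \<nu>"
  define c where "c = 2 * K * 2 powr \<beta>"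
  have n: "1 < n" using p by simp
  have \<nu>: "0 < \<nu>" using p by (simp add: \<nu>_def field_simps)
  have \<tau>pos: "0 < \<tau> k" for k using \<tau>0 by (simp add: \<tau>)
  define d where "d i = ennreal (\<tau> i powr (- \<beta>)) * S i" for i
  have D: "ennreal (2 * K * \<tau> (Suc i) powr (- \<beta>)) * S i = ennreal c * d i" for i
  proof -
    have "\<tau> (Suc i) = (1/2) * \<tau> i" by (simp add: \<tau>)
    then have eq: "\<tau> (Suc i) powr (- \<beta>) = 2 powr \<beta> * \<tau> i powr (- \<beta>)"
      by (simp only: powr_mult half_powr_minus)
    have "ennreal (2 * K * \<tau> (Suc i) powr (- \<beta>)) = ennreal c * ennreal (\<tau> i powr (- \<beta>))"
      unfolding eq c_def mult.assoc[symmetric] using K by (intro ennreal_mult) auto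
    then show ?thesis by (simp only: d_def mult.assoc)
  qed
  have e: "ennreal (\<tau> i powr \<nu>) * d i = ennreal (\<tau> i powr (1 / p - 1)) * S i" for i
  proof -
    have "\<nu> + - \<beta> = 1 / p - 1" using n by (simp add: \<nu>_def \<beta>_def field_simps)
    then show ?thesis unfolding d_def
      by (simp add: mult.assoc[symmetric] ennreal_mult[symmetric] powr_add[symmetric])
  qed
  have dec: "ennreal (\<tau> k powr (\<alpha> / (n * q))) * (\<Sum>i\<le>k. ennreal c * d i) =
    ennreal (c * \<tau>0 powr \<kappa>) * (ennreal (((1/2) powr \<kappa>) ^ k) * (ennreal (\<tau> k powr \<nu>) * (\<Sum>i\<le>k. d i)))" for k
  proof -
    have "\<tau> k powr (\<alpha> / (n * q)) = \<tau> k powr \<kappa> * \<tau> k powr \<nu>" by (simp add: powr_add[symmetric] \<kappa>_def)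
    also have "\<tau> k powr \<kappa> = \<tau>0 powr \<kappa> * ((1/2) powr \<kappa>) ^ k" unfolding \<tau> by (rule dyadic_powr[OF \<tau>0])
    finally have eq: "\<tau> k powr (\<alpha> / (n * q)) = \<tau>0 powr \<kappa> * ((1/2) powr \<kappa>) ^ k * \<tau> k powr \<nu>" .
    have e2: "ennreal (\<tau> k powr (\<alpha> / (n * q))) = ennreal (\<tau>0 powr \<kappa>) * ennreal (((1/2) powr \<kappa>) ^ k) * ennreal (\<tau> k powr \<nu>)"
      unfolding eq by (simp add: ennreal_mult)
    have e3: "ennreal (c * \<tau>0 powr \<kappa>) = ennreal c * ennreal (\<tau>0 powr \<kappa>)"
      using K by (intro ennreal_mult) (auto simp: c_def)
    show ?thesis unfolding e2 e3 sum_distrib_left[symmetric] by (simp only: mult_ac)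
  qed
  have "lseq \<eta> (\<lambda>k. ennreal (\<tau> k powr (\<alpha> / (n * q))) * (\<Sum>i\<le>k. ennreal (2 * K * \<tau> (Suc i) powr (- \<beta>)) * S i))
    = ennreal (c * \<tau>0 powr \<kappa>) * lseq \<eta> (\<lambda>k. ennreal (((1/2) powr \<kappa>) ^ k) * (ennreal (\<tau> k powr \<nu>) * (\<Sum>i\<le>k. d i)))"
    unfolding D dec by (rule lseq_cmult[OF \<eta>])
  also have "\<dots> \<le> ennreal (c * \<tau>0 powr \<kappa>) * (ennreal (weight_const \<kappa>) * lseq \<sigma> (\<lambda>k. ennreal (\<tau> k powr \<nu>) * (\<Sum>i\<le>k. d i)))"
    using \<kappa> by (intro mult_left_mono lseq_dyadic_weight \<sigma> \<eta>) (auto simp: \<kappa>_def \<nu>_def)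
  also have "\<dots> \<le> ennreal (c * \<tau>0 powr \<kappa>) * (ennreal (weight_const \<kappa>) * (ennreal (1 / (1 - (1/2) powr \<nu>)) * lseq \<sigma> (\<lambda>i. ennreal (\<tau> i powr \<nu>) * d i)))"
    by (intro mult_left_mono accumulated_sum_bound[OF \<sigma> \<nu> \<tau>0 \<tau>]) auto
  also have "\<dots> \<le> ennreal (c * \<tau>0 powr \<kappa>) * (ennreal (weight_const \<kappa>) * (ennreal (1 / (1 - (1/2) powr \<nu>)) * (ennreal (tail_const p) * lorentz N (ereal p) \<sigma> \<phi>)))"
    unfolding e S_def by (intro mult_left_mono tail_sum_bound[OF \<sigma> p(1) \<tau>0 \<tau>]) auto
  finally have main: "lseq \<eta> (\<lambda>k. ennreal (\<tau> k powr (\<alpha> / (n * q))) * (\<Sum>i\<le>k. ennreal (2 * K * \<tau> (Suc i) powr (- \<beta>)) * S i))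
    \<le> ennreal (c * \<tau>0 powr \<kappa>) * (ennreal (weight_const \<kappa>) * (ennreal (1 / (1 - (1/2) powr \<nu>)) * (ennreal (tail_const p) * lorentz N (ereal p) \<sigma> \<phi>)))" .
  have nn: "0 \<le> c" "0 \<le> weight_const \<kappa>" "0 \<le> 1 / (1 - (1/2) powr \<nu>)" "0 \<le> tail_const p"
    using K weight_const_pos[of \<kappa>] \<kappa>(1) half_powr_less_1[OF \<nu>] tail_const_pos[OF p(1)] by (auto simp: c_def \<kappa>_def \<nu>_def)
  have "gradient_const K n p q \<alpha> * \<tau>0 powr \<kappa> = 2 * ((c * \<tau>0 powr \<kappa>) * (weight_const \<kappa> * (1 / (1 - (1/2) powr \<nu>) * tail_const p)))"
    by (simp add: gradient_const_def c_def \<kappa>_def \<nu>_def \<beta>_def)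
  then have "ennreal (gradient_const K n p q \<alpha> * \<tau>0 powr \<kappa>) * lorentz N (ereal p) \<sigma> \<phi> =
    2 * (ennreal (c * \<tau>0 powr \<kappa>) * (ennreal (weight_const \<kappa>) * (ennreal (1 / (1 - (1/2) powr \<nu>)) * (ennreal (tail_const p) * lorentz N (ereal p) \<sigma> \<phi>))))"
    using nn by (simp only: ennreal_mult mult_nonneg_nonneg zero_le_numeral powr_ge_zero mult.assoc ennreal_numeral)
  then show ?thesis using main mult_left_mono[OF main, of 2] by (simp only: \<beta>_def \<kappa>_def \<nu>_def zero_le)
qed

text \<open>Here the exponent in \<open>weight_const\<close> is zero exactly when
  \<open>q = r * \<alpha> / (n - 1)\<close>. The inverse of the power with \<open>1/4\<close>
  relates \<open>\<tau> k\<close> to the grid point \<open>A (Suc k)\<close> two dyadic steps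
  further, and the final 4 bounds the inverse of the block masses.\<close>

definition boundary_const :: "real \<Rightarrow> real \<Rightarrow> real \<Rightarrow> real \<Rightarrow> real \<Rightarrow> real" where
  "boundary_const K n r q \<alpha> = 2 * (1 / ((1/4) powr ((n - 1) / n) / (2 * K)) powr (1 / r))
     * ((2 * K * 2 powr ((n - 1) / n)) powr (\<alpha> / (q * (n - 1)) - 1 / r) * weight_const (\<alpha> / (n * q) - (n - 1) / n / r))
     * 4"

text \<open>The boundary rearrangement vanishes beyond the total boundary measure, so only indices
  with \<open>A k < h\<close> contribute. This bounds the surplus weight by a power of
  \<open>h\<close> in place of \<open>\<tau>0\<close>, which is how the boundary norm gets its own
  scaling factor.\<close>

lemma boundary_part_bound:
  fixes Hm :: "'a measure" and u :: "'a \<Rightarrow> real" and \<tau> :: "nat \<Rightarrow> real" and K n r q \<alpha> h :: real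
  assumes \<sigma>: "1 \<le> \<rho>" and \<eta>: "1 \<le> \<eta>" and n: "2 \<le> n" and r: "0 < r" and \<tau>0: "0 < \<tau>0" and \<tau>: "\<And>k. \<tau> k = \<tau>0 * (1/2) ^ k"
    and K: "0 < K" and \<kappa>: "0 \<le> \<alpha> / (n * q) - (n - 1) / n / r" "\<alpha> / (n * q) - (n - 1) / n / r = 0 \<Longrightarrow> \<rho> \<le> \<eta>"
    and h: "0 < h" "emeasure Hm (space Hm) \<le> ennreal h"
  shows "2 * lseq \<eta> (\<lambda>k. ennreal (\<tau> k powr (\<alpha> / (n * q))) * rearr Hm u (\<tau> (Suc k) powr ((n - 1) / n) / (2 * K)))
    \<le> ennreal (boundary_const K n r q \<alpha> * h powr (\<alpha> / (q * (n - 1)) - 1 / r)) * lorentz Hm (ereal r) \<rho> u"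
proof -
  define \<beta> where "\<beta> = (n - 1) / n"
  define \<kappa> where "\<kappa> = \<alpha> / (n * q) - \<beta> / r"
  define \<zeta> where "\<zeta> = \<alpha> / (q * (n - 1)) - 1 / r"
  have \<beta>: "1 / 2 \<le> \<beta>" "\<beta> < 1" using n by (auto simp: \<beta>_def field_simps)
  have \<kappa>0: "0 \<le> \<kappa>" using \<kappa>(1) by (simp add: \<kappa>_def \<beta>_def)
  have \<zeta>\<kappa>: "\<kappa> = \<beta> * \<zeta>"
  proof -
    have "\<beta> * (\<alpha> / (q * (n - 1))) = \<alpha> / (n * q)" using n by (simp add: \<beta>_def)
    then show ?thesis by (simp add: \<kappa>_def \<zeta>_def right_diff_distrib)
  qed
  then have \<zeta>0: "0 \<le> \<zeta>" using \<kappa>0 \<beta> by (simp add: zero_le_mult_iff)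
  have \<tau>pos: "0 < \<tau> k" for k using \<tau>0 by (simp add: \<tau>)
  define A where "A k = \<tau> (Suc k) powr \<beta> / (2 * K)" for k
  have AS: "A k = (\<tau>0 powr \<beta> * (1/2) powr \<beta> / (2 * K)) * ((1/2) powr \<beta>) ^ k" for k
    unfolding A_def \<tau> dyadic_powr[OF \<tau>0] by simp
  interpret grid A
    unfolding AS[abs_def] by (rule grid_geometric) (use \<tau>0 K \<beta> half_powr_less_1[of \<beta>] in auto)
  have Aratio: "ln (A k / A (Suc k)) = \<beta> * ln 2" for k
  proof -
    have "A k / A (Suc k) = 1 / (1/2) powr \<beta>" unfolding AS using \<tau>0 K by simp
    also have "\<dots> = 2 powr \<beta>" by (simp add: powr_divide)
    finally show ?thesis by (simp add: ln_powr)
  qed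
  define z where "z k = ennreal (A (Suc k) powr (1 / r)) * rearr Hm u (A k)" for k
  have z: "lseq \<rho> z \<le> ennreal 4 * lorentz Hm (ereal r) \<rho> u"
  proof -
    have "lseq \<rho> z \<le> ennreal (1 / (1/4)) * lorentz Hm (ereal r) \<rho> u"
      unfolding z_def
    proof (rule lorentz_lower[OF \<sigma> r])
      show "1 / 4 \<le> ln (A k / A (Suc k))" for k
        unfolding Aratio using mult_mono[OF \<beta>(1) ln_2_half(1)] \<beta> by simp
    qed auto
    then show ?thesis by simp
  qed
  define c3 where "c3 = ((1/4) powr \<beta> / (2 * K)) powr (1 / r)"
  have c3: "0 < c3" using K by (simp add: c3_def)
  have A2: "A (Suc k) powr (1 / r) = c3 * \<tau> k powr (\<beta> / r)" for k
  proof -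
    have "\<tau> (Suc (Suc k)) = (1/4) * \<tau> k" by (simp add: \<tau>)
    then have "\<tau> (Suc (Suc k)) powr \<beta> = (1/4) powr \<beta> * \<tau> k powr \<beta>" by (simp only: powr_mult)
    then have "A (Suc k) = ((1/4) powr \<beta> / (2 * K)) * \<tau> k powr \<beta>" by (simp add: A_def)
    then have "A (Suc k) powr (1 / r) = c3 * (\<tau> k powr \<beta>) powr (1 / r)" unfolding c3_def by (simp only: powr_mult)
    then show ?thesis by (simp add: powr_powr)
  qed
  have bz: "ennreal (\<tau> k powr (\<alpha> / (n * q))) * rearr Hm u (A k) = ennreal (1 / c3) * (ennreal (\<tau> k powr \<kappa>) * z k)" for k
  proof -
    have "\<tau> k powr (\<alpha> / (n * q)) = \<tau> k powr \<kappa> * \<tau> k powr (\<beta> / r)" by (simp add: powr_add[symmetric] \<kappa>_def)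
    also have "\<dots> = 1 / c3 * (\<tau> k powr \<kappa> * A (Suc k) powr (1 / r))" unfolding A2 using c3 by simp
    finally have e: "\<tau> k powr (\<alpha> / (n * q)) = 1 / c3 * (\<tau> k powr \<kappa> * A (Suc k) powr (1 / r))" .
    have "0 \<le> 1 / c3" using c3 by simp
    then show ?thesis unfolding e z_def
      by (simp only: ennreal_mult powr_ge_zero mult_nonneg_nonneg mult.assoc)
  qed
  define Y where "Y = (2 * K * 2 powr \<beta> * h) powr \<zeta>"
  have Y: "Y = (2 * K * 2 powr \<beta>) powr \<zeta> * h powr \<zeta>" by (simp only: Y_def powr_mult)
  have "lseq \<eta> (\<lambda>k. ennreal (\<tau> k powr \<kappa>) * z k) \<le> ennreal (Y * weight_const \<kappa>) * lseq \<rho> z"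
  proof (cases "\<kappa> = 0")
    case True
    then have "\<zeta> = 0" using \<zeta>\<kappa> \<beta> by simp
    then have "Y = 1" using K h by (simp add: Y_def)
    have "\<tau> k powr \<kappa> = 1" for k using True \<tau>pos[of k] by simp
    then show ?thesis using lseq_embed[OF \<sigma> \<kappa>(2)] True \<open>Y = 1\<close> by (simp add: weight_const_def \<kappa>_def \<beta>_def)
  next
    case False
    then have \<kappa>p: "0 < \<kappa>" using \<kappa>0 by simp
    have zY: "ennreal (\<tau> k powr \<kappa>) * z k \<le> ennreal (if \<tau>0 powr \<kappa> * ((1/2) powr \<kappa>) ^ k \<le> Y then \<tau>0 powr \<kappa> * ((1/2) powr \<kappa>) ^ k else 0) * z k" for k
    proof (cases "z k = 0")
      case False
      then have "rearr Hm u (A k) \<noteq> 0" by (auto simp: z_def)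
      then have "ennreal (A k) < emeasure Hm (space Hm)" using rearr_zero[of Hm "A k" u] by (auto simp: not_le[symmetric])
      then have "ennreal (A k) < ennreal h" using h(2) by (rule order_less_le_trans)
      then have "A k < h" using pos[of k] by (simp add: ennreal_less_iff less_imp_le)
      then have "\<tau> (Suc k) powr \<beta> \<le> 2 * K * h" using K by (simp add: A_def field_simps)
      moreover have "\<tau> k powr \<beta> = 2 powr \<beta> * \<tau> (Suc k) powr \<beta>"
        by (simp only: powr_mult[symmetric]) (simp add: \<tau>)
      ultimately have "\<tau> k powr \<beta> \<le> 2 powr \<beta> * (2 * K * h)" by (simp only: mult_left_mono powr_ge_zero)
      then have "(\<tau> k powr \<beta>) powr \<zeta> \<le> Y" unfolding Y_def using \<zeta>0 by (intro powr_mono2) (auto simp: mult_ac)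
      then have "\<tau> k powr \<kappa> \<le> Y" by (simp add: powr_powr \<zeta>\<kappa>)
      then show ?thesis unfolding \<tau> dyadic_powr[OF \<tau>0] by simp
    qed simp
    have "lseq \<eta> (\<lambda>k. ennreal (\<tau> k powr \<kappa>) * z k) \<le> (\<Sum>k. ennreal (\<tau> k powr \<kappa>) * z k)" by (rule lseq_le_suminf[OF \<eta>])
    also have "\<dots> \<le> (\<Sum>k. ennreal (if \<tau>0 powr \<kappa> * ((1/2) powr \<kappa>) ^ k \<le> Y then \<tau>0 powr \<kappa> * ((1/2) powr \<kappa>) ^ k else 0) * lseq \<rho> z)"
      by (intro suminf_le order.trans[OF zY] mult_left_mono lseq_ge \<sigma>) auto
    also have "\<dots> = (\<Sum>k. ennreal (if \<tau>0 powr \<kappa> * ((1/2) powr \<kappa>) ^ k \<le> Y then \<tau>0 powr \<kappa> * ((1/2) powr \<kappa>) ^ k else 0)) * lseq \<rho> z"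
      by (rule ennreal_suminf_multc)
    also have "\<dots> \<le> ennreal (Y / (1 - (1/2) powr \<kappa>)) * lseq \<rho> z"
      by (intro mult_right_mono suminf_geometric_below) (use half_powr_less_1[OF \<kappa>p] in \<open>auto simp: Y_def\<close>)
    finally show ?thesis using False by (simp add: weight_const_def)
  qed
  also have "\<dots> \<le> ennreal (Y * weight_const \<kappa>) * (ennreal 4 * lorentz Hm (ereal r) \<rho> u)"
    by (intro mult_left_mono z) simp
  finally have 1: "lseq \<eta> (\<lambda>k. ennreal (\<tau> k powr \<kappa>) * z k) \<le> ennreal (Y * weight_const \<kappa>) * (ennreal 4 * lorentz Hm (ereal r) \<rho> u)" .
  have "lseq \<eta> (\<lambda>k. ennreal (\<tau> k powr (\<alpha> / (n * q))) * rearr Hm u (A k)) = ennreal (1 / c3) * lseq \<eta> (\<lambda>k. ennreal (\<tau> k powr \<kappa>) * z k)"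
    unfolding bz by (rule lseq_cmult[OF \<eta>])
  also have "\<dots> \<le> ennreal (1 / c3) * (ennreal (Y * weight_const \<kappa>) * (ennreal 4 * lorentz Hm (ereal r) \<rho> u))"
    by (intro mult_left_mono 1) simp
  finally have "2 * lseq \<eta> (\<lambda>k. ennreal (\<tau> k powr (\<alpha> / (n * q))) * rearr Hm u (A k))
    \<le> ennreal 2 * (ennreal (1 / c3) * (ennreal (Y * weight_const \<kappa>) * (ennreal 4 * lorentz Hm (ereal r) \<rho> u)))"
    unfolding ennreal_numeral by (rule mult_left_mono) simp
  also have "\<dots> = ennreal (2 * (1 / c3 * (Y * weight_const \<kappa> * 4))) * lorentz Hm (ereal r) \<rho> u"
  proof -
    have "0 \<le> 1 / c3" "0 \<le> Y" "0 \<le> weight_const \<kappa>" using c3 weight_const_pos[OF \<kappa>0] by (auto simp: Y_def)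
    then show ?thesis by (simp only: ennreal_mult mult_nonneg_nonneg zero_le_numeral mult.assoc)
  qed
  also have "2 * (1 / c3 * (Y * weight_const \<kappa> * 4)) = boundary_const K n r q \<alpha> * h powr \<zeta>"
    unfolding boundary_const_def Y c3_def \<beta>_def \<kappa>_def \<zeta>_def by (simp only: mult_ac)
  finally show ?thesis by (simp only: A_def \<beta>_def \<zeta>_def)
qed

section \<open>Essential suprema and superlevel sets on the boundary\<close>

lemma rearr_le_linf:
  assumes m: "\<And>\<tau>. {x \<in> space M. \<tau> < \<bar>\<phi> x\<bar>} \<in> sets M"
  shows "rearr M \<phi> t \<le> linf M \<phi>"
  unfolding linf_def
proof (rule Inf_greatest, clarify)
  fix c assume c: "AE x in M. ennreal \<bar>\<phi> x\<bar> \<le> c"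
  show "rearr M \<phi> t \<le> c"
  proof (cases "c = top")
    case False
    then obtain c' where c': "c = ennreal c'" "0 \<le> c'" by (metis ennreal_cases)
    have "AE x in M. x \<notin> {x \<in> space M. c' < \<bar>\<phi> x\<bar>}" using c by eventually_elim (use c' in auto)
    then have "{x \<in> space M. c' < \<bar>\<phi> x\<bar>} \<in> null_sets M" by (simp only: AE_iff_null_sets[OF m])
    then have "emeasure M {x \<in> space M. c' < \<bar>\<phi> x\<bar>} = 0" by auto
    then show ?thesis unfolding c'(1) by (intro rearr_le) (use c' in auto)
  qed simp
qed

lemma linf_le_of_null:
  assumes "emeasure M {x \<in> space M. c < \<bar>\<phi> x\<bar>} = 0" "{x \<in> space M. c < \<bar>\<phi> x\<bar>} \<in> sets M"
  shows "linf M \<phi> \<le> ennreal c"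
proof -
  have "AE x in M. x \<notin> {x \<in> space M. c < \<bar>\<phi> x\<bar>}" by (rule AE_not_in) (use assms in auto)
  then have "AE x in M. ennreal \<bar>\<phi> x\<bar> \<le> ennreal c"
    using AE_space by eventually_elim (auto intro: ennreal_leI)
  then show ?thesis unfolding linf_def by (auto intro: Inf_lower)
qed

lemma closed_superlevel_measurable:
  fixes u :: "'a::metric_space \<Rightarrow> real"
  assumes "closed F" "continuous_on F u"
  shows "{x \<in> F. t < \<bar>u x\<bar>} \<in> sets borel"
proof -
  have "closed {x \<in> F. \<bar>u x\<bar> \<le> t}"
    using continuous_closed_preimage[of F "\<lambda>y. \<bar>u y\<bar>" "{..t}"] assms
    by (auto simp: vimage_def Int_def intro!: continuous_intros)
  then have "F - {x \<in> F. \<bar>u x\<bar> \<le> t} \<in> sets borel" using assms(1) by (intro sets.Diff) auto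
  also have "F - {x \<in> F. \<bar>u x\<bar> \<le> t} = {x \<in> F. t < \<bar>u x\<bar>}" by auto
  finally show ?thesis .
qed

lemma frontier_superlevel_hmeasure:
  fixes u :: "'a::metric_space \<Rightarrow> real"
  assumes "continuous_on (closure \<Omega>) u"
  shows "{x \<in> space (hmeasure s (frontier \<Omega>)). t < \<bar>u x\<bar>} \<in> sets (hmeasure s (frontier \<Omega>))"
proof -
  have F: "frontier \<Omega> \<in> sets borel" by (simp add: frontier_closed)
  have "continuous_on (frontier \<Omega>) u"
    by (rule continuous_on_subset[OF assms]) (auto simp: frontier_def)
  then have "{x \<in> frontier \<Omega>. t < \<bar>u x\<bar>} \<in> sets borel"
    by (intro closed_superlevel_measurable) (simp add: frontier_closed)
  then show ?thesis
    unfolding space_hmeasure[OF F] sets_hmeasure[OF F] using F by (subst sets_restrict_space_iff) auto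
qed

definition level_const :: "real \<Rightarrow> real \<Rightarrow> real \<Rightarrow> real" where
  "level_const C \<alpha> n = max (levelK C \<alpha> n) (levelK (unit_ball_vol n) n n)"

lemma level_const_pos: assumes "2 \<le> n" shows "0 < level_const C \<alpha> n"
proof -
  have A1: "1 \<le> levelA (unit_ball_vol n) n n" by (rule levelA_pos) (use assms in auto)
  have "0 < (n - 1) / 2 + 1" by (rule add_nonneg_pos[OF divide_nonneg_pos]) (use assms in linarith)+
  then have Gp: "0 < Gamma ((n - 1)/2 + 1)" by (rule Gamma_real_pos)
  have v: "0 < unit_ball_vol n" using assms by simp
  have "0 < levelK (unit_ball_vol n) n n"
    unfolding levelK_def
    by (intro mult_pos_pos divide_pos_pos add_pos_pos Gp v) (use A1 assms in \<open>auto intro: less_le_trans[of 0 1]\<close>)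
  then show ?thesis by (simp add: level_const_def)
qed

lemma lorentz_trace_bound:
  fixes \<Omega> :: "(real^'n::finite) set" and u :: "real^'n \<Rightarrow> real" and G :: "real^'n \<Rightarrow> real^'n" and \<mu> :: "(real^'n) measure"
    and C \<alpha> p r q :: real and \<sigma> \<rho>\<^sub>b \<eta> :: ereal
  defines "n \<equiv> real CARD('n)"
  defines "LG \<equiv> lorentz (restrict_space lebesgue \<Omega>) (ereal p) \<sigma> (\<lambda>x. norm (G x))"
    and "LB \<equiv> lorentz (hmeasure (n - 1) (frontier \<Omega>)) (ereal r) \<rho>\<^sub>b u"
    and "K \<equiv> level_const C \<alpha> n"
  assumes n2: "2 \<le> CARD('n)"
    and pr: "1 < p" "p < n" "1 < r" "1 \<le> \<sigma>" "1 \<le> \<rho>\<^sub>b"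
    and q: "q = min (p * \<alpha> / (n - p)) (r * \<alpha> / (n - 1))"
    and \<eta>: "q = p * \<alpha> / (n - p) \<longrightarrow> \<eta> \<ge> \<sigma>" "q = r * \<alpha> / (n - 1) \<longrightarrow> \<eta> \<ge> \<rho>\<^sub>b"
    and \<Omega>: "open \<Omega>" "emeasure lebesgue \<Omega> < \<infinity>" "hausdorff (n - 1) (frontier \<Omega>) < \<infinity>"
    and u: "continuous_on (closure \<Omega>) u" "bounded {x \<in> closure \<Omega>. u x \<noteq> 0}"
    and wg: "has_weak_gradient \<Omega> u G"
    and \<alpha>: "n - 1 < \<alpha>" "\<alpha> \<le> n" and C: "0 < C"
    and \<mu>: "sets \<mu> = sets (restrict_space borel \<Omega>)" "emeasure \<mu> \<Omega> < \<infinity>"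
    and ball: "\<And>x \<rho>. x \<in> \<Omega> \<Longrightarrow> 0 < \<rho> \<Longrightarrow> emeasure \<mu> (ball x \<rho> \<inter> \<Omega>) \<le> ennreal (C * \<rho> powr \<alpha>)"
  shows "lorentz \<mu> (ereal q) \<eta> u \<le> ennreal (gradient_const K n p q \<alpha> + boundary_const K n r q \<alpha>) *
     (ennreal (max (measure \<mu> \<Omega> powr (n / \<alpha>)) (measure lebesgue \<Omega>) powr (\<alpha> / (q * n) - (n - p) / (p * n))) * LG
      + ennreal (max (measure \<mu> \<Omega> powr ((n - 1) / \<alpha>)) (enn2real (hausdorff (n - 1) (frontier \<Omega>))) powr (\<alpha> / (q * (n - 1)) - 1 / r)) * LB)"
proof -
  have n1: "2 \<le> n" unfolding n_def using n2 by simp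
  have \<alpha>0: "0 < \<alpha>" using \<alpha> n1 by linarith
  have q0: "0 < q" using pr n1 \<alpha>0 by (simp add: q)
  have \<eta>1: "1 \<le> \<eta>" using \<eta> q pr(4,5) by (auto simp: min_def split: if_splits intro: order.trans)
  have sp: "space \<mu> = \<Omega>" using sets_eq_imp_space_eq[OF \<mu>(1)] by (simp add: space_restrict_space)
  have K: "0 < K" unfolding K_def by (rule level_const_pos[OF n1])
  have em: "emeasure \<mu> \<Omega> = ennreal (measure \<mu> \<Omega>)" using \<mu>(2) by (simp add: emeasure_eq_ennreal_measure less_top[symmetric])
  \<comment> \<open>A vanishing \<mu> is set apart, because the grids and the boundary estimate need
    \<open>\<tau>0\<close> and \<open>h\<close> positive, which a positive \<mu>-measure
    guarantees.\<close>
  show ?thesis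
  proof (cases "measure \<mu> \<Omega> = 0")
    case True
    then have "emeasure \<mu> (space \<mu>) = 0" by (simp add: sp em)
    then show ?thesis using lsig_null[OF \<eta>1] by (simp add: lorentz_def)
  next
    case False
    then have m0: "0 < measure \<mu> \<Omega>" by (simp add: less_le)
    define \<tau>0 where "\<tau>0 = max (measure \<mu> \<Omega> powr (n / \<alpha>)) (measure lebesgue \<Omega>)"
    have \<tau>0: "0 < \<tau>0" "measure \<mu> \<Omega> powr (n / \<alpha>) \<le> \<tau>0" "measure lebesgue \<Omega> \<le> \<tau>0"
      using m0 by (auto simp: \<tau>0_def less_max_iff_disj)
    define h where "h = max (measure \<mu> \<Omega> powr ((n - 1) / \<alpha>)) (enn2real (hausdorff (n - 1) (frontier \<Omega>)))"
    have h: "0 < h" using m0 by (auto simp: h_def less_max_iff_disj)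
    define \<tau> where "\<tau> k = \<tau>0 * (1/2) ^ k" for k
    define N where "N = restrict_space lebesgue \<Omega>"
    define Hm where "Hm = hmeasure (n - 1) (frontier \<Omega>)"
    have F: "frontier \<Omega> \<in> sets borel" by (simp add: frontier_closed)
    have Hsp: "emeasure Hm (space Hm) \<le> ennreal h"
    proof -
      have "emeasure Hm (space Hm) = hausdorff (n - 1) (frontier \<Omega>)"
        unfolding Hm_def space_hmeasure[OF F] by (rule emeasure_hmeasure[OF F F]) simp
      also have "\<dots> = ennreal (enn2real (hausdorff (n - 1) (frontier \<Omega>)))" using \<Omega>(3) by simp
      also have "\<dots> \<le> ennreal h" by (intro ennreal_leI) (simp add: h_def)
      finally show ?thesis .
    qed
    define b where "b k = rearr Hm u (\<tau> (Suc k) powr ((n - 1) / n) / (2 * K))" for k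
    define S where "S i = (\<Sum>j. ennreal (\<tau> (i + j)) * rearr N (\<lambda>x. norm (G x)) (\<tau> (i + Suc j)))" for i
    define D where "D i = ennreal (2 * K * \<tau> (Suc i) powr (- ((n - 1) / n))) * S i" for i
    have est: "rearr \<mu> u (\<tau> (Suc k) powr (\<alpha> / n)) \<le> b k + (\<Sum>i\<le>k. D i)" for k
      unfolding b_def D_def S_def N_def Hm_def K_def level_const_def n_def
      by (rule rearrangement_estimate[OF n2 \<Omega>[unfolded n_def] u wg \<alpha>(1)[unfolded n_def] C \<mu> ball \<tau>0[unfolded n_def] \<tau>_def])
    define \<gamma> where "\<gamma> = \<alpha> / n"
    have \<gamma>: "0 < \<gamma>" "\<gamma> \<le> 1" using \<alpha> \<alpha>0 n1 by (auto simp: \<gamma>_def)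
    \<comment> \<open>The power \<gamma> carries the dyadic grid over to the scale of \<mu>, at
      which \<open>est\<close> evaluates the rearrangement of \<open>u\<close>.\<close>
    define x where "x k = \<tau>0 powr \<gamma> * ((1/2) powr \<gamma>) ^ k" for k
    have x\<tau>: "x k = \<tau> k powr \<gamma>" for k unfolding x_def \<tau>_def by (rule dyadic_powr[OF \<tau>0(1), symmetric])
    interpret grid x unfolding x_def[abs_def] by (rule grid_geometric) (use \<tau>0 \<gamma> half_powr_less_1 in auto)
    have xr: "ln (x k / x (Suc k)) \<le> 1" for k
    proof -
      have "x k / x (Suc k) = 1 / (1/2) powr \<gamma>" using \<tau>0(1) by (simp add: x_def)
      also have "\<dots> = 2 powr \<gamma>" by (simp add: powr_divide)
      finally have "ln (x k / x (Suc k)) = \<gamma> * ln 2" by (simp add: ln_powr)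
      also have "\<dots> \<le> 1 * 1" using \<gamma> ln_2_half by (intro mult_mono) auto
      finally show ?thesis by simp
    qed
    have x0: "emeasure \<mu> (space \<mu>) \<le> ennreal (x 0)"
    proof -
      have "measure \<mu> \<Omega> = (measure \<mu> \<Omega> powr (n / \<alpha>)) powr \<gamma>" using m0 n1 \<alpha>0 by (simp add: powr_powr \<gamma>_def)
      also have "\<dots> \<le> \<tau>0 powr \<gamma>" using \<tau>0 \<gamma> by (intro powr_mono2) auto
      finally show ?thesis unfolding sp em x_def by (intro ennreal_leI) simp
    qed
    have xq: "x k powr (1 / q) = \<tau> k powr (\<alpha> / (n * q))" for k by (simp add: x\<tau> powr_powr \<gamma>_def)
    let ?w = "\<lambda>k. ennreal (\<tau> k powr (\<alpha> / (n * q)))"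
    have "lorentz \<mu> (ereal q) \<eta> u \<le> lseq \<eta> (\<lambda>k. ennreal (x k powr (1 / q)) * rearr \<mu> u (x (Suc k)))"
      by (rule lorentz_upper[OF \<eta>1 q0 xr x0])
    also have "\<dots> \<le> lseq \<eta> (\<lambda>k. ?w k * b k + ?w k * (\<Sum>i\<le>k. D i))"
    proof (rule lseq_mono[OF \<eta>1])
      fix k
      have "ennreal (x k powr (1 / q)) * rearr \<mu> u (x (Suc k)) \<le> ?w k * (b k + (\<Sum>i\<le>k. D i))"
        unfolding xq unfolding x\<tau> \<gamma>_def by (intro mult_left_mono est) simp
      then show "ennreal (x k powr (1 / q)) * rearr \<mu> u (x (Suc k)) \<le> ?w k * b k + ?w k * (\<Sum>i\<le>k. D i)"
        by (simp only: distrib_left)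
    qed
    also have "\<dots> \<le> 2 * (lseq \<eta> (\<lambda>k. ?w k * b k) + lseq \<eta> (\<lambda>k. ?w k * (\<Sum>i\<le>k. D i)))"
      by (rule lseq_add[OF \<eta>1])
    also have "\<dots> = 2 * lseq \<eta> (\<lambda>k. ?w k * (\<Sum>i\<le>k. D i)) + 2 * lseq \<eta> (\<lambda>k. ?w k * b k)"
      by (simp add: distrib_left add.commute)
    also have "\<dots> \<le> ennreal (gradient_const K n p q \<alpha> * \<tau>0 powr (\<alpha> / (n * q) - (1 / p - 1 / n))) * LG
      + ennreal (boundary_const K n r q \<alpha> * h powr (\<alpha> / (q * (n - 1)) - 1 / r)) * LB"
    proof (rule add_mono)
      have q1: "q \<le> p * \<alpha> / (n - p)" "q \<le> r * \<alpha> / (n - 1)" by (auto simp: q)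
      \<comment> \<open>Both critical exponents are written as values of
        \<open>\<alpha> / (n * q')\<close>, so that the two surpluses are nonnegative since
        \<open>q\<close> is a minimum, and vanish only when \<open>q\<close> equals the
        corresponding entry.\<close>
      have e1: "1 / p - 1 / n = \<alpha> / (n * (p * \<alpha> / (n - p)))" using pr n1 \<alpha>0 by (simp add: field_simps)
      have e2: "(n - 1) / n / r = \<alpha> / (n * (r * \<alpha> / (n - 1)))" using pr n1 \<alpha>0 by (simp add: field_simps)
      have inj: "\<alpha> / (n * q) = \<alpha> / (n * q') \<Longrightarrow> q = q'" if "0 < q'" for q'
        using that q0 n1 \<alpha>0 by (simp add: field_simps)
      show "2 * lseq \<eta> (\<lambda>k. ?w k * (\<Sum>i\<le>k. D i)) \<le> ennreal (gradient_const K n p q \<alpha> * \<tau>0 powr (\<alpha> / (n * q) - (1 / p - 1 / n))) * LG"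
        unfolding D_def S_def LG_def N_def[symmetric]
      proof (rule gradient_part_bound[OF pr(4) \<eta>1 pr(1,2) \<tau>0(1) \<tau>_def K])
        show "0 \<le> \<alpha> / (n * q) - (1 / p - 1 / n)"
          unfolding e1 diff_ge_0_iff_ge using q1(1) q0 n1 \<alpha>0 by (intro divide_left_mono mult_left_mono mult_pos_pos) auto
        show "\<sigma> \<le> \<eta>" if "\<alpha> / (n * q) - (1 / p - 1 / n) = 0"
          using inj[of "p * \<alpha> / (n - p)"] that \<eta>(1) pr \<alpha>0 unfolding e1 by simp
      qed
      show "2 * lseq \<eta> (\<lambda>k. ?w k * b k) \<le> ennreal (boundary_const K n r q \<alpha> * h powr (\<alpha> / (q * (n - 1)) - 1 / r)) * LB"
        unfolding b_def LB_def Hm_def[symmetric]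
      proof (rule boundary_part_bound[OF pr(5) \<eta>1 n1 _ \<tau>0(1) \<tau>_def K _ _ h Hsp])
        show "0 \<le> \<alpha> / (n * q) - (n - 1) / n / r"
          unfolding e2 diff_ge_0_iff_ge using q1(2) q0 n1 \<alpha>0 by (intro divide_left_mono mult_left_mono mult_pos_pos) auto
        show "\<rho>\<^sub>b \<le> \<eta>" if "\<alpha> / (n * q) - (n - 1) / n / r = 0"
          using inj[of "r * \<alpha> / (n - 1)"] that \<eta>(2) pr \<alpha>0 n1 unfolding e2 by simp
      qed (use pr in simp)
    qed
    also have "\<dots> \<le> ennreal (gradient_const K n p q \<alpha> + boundary_const K n r q \<alpha>) * (ennreal (\<tau>0 powr (\<alpha> / (n * q) - (1 / p - 1 / n))) * LG
      + ennreal (h powr (\<alpha> / (q * (n - 1)) - 1 / r)) * LB)"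
    proof -
      have e1: "1 / p - 1 / n = \<alpha> / (n * (p * \<alpha> / (n - p)))" using pr n1 \<alpha>0 by (simp add: field_simps)
      have e2: "(n - 1) / n / r = \<alpha> / (n * (r * \<alpha> / (n - 1)))" using pr n1 \<alpha>0 by (simp add: field_simps)
      have q1: "q \<le> p * \<alpha> / (n - p)" "q \<le> r * \<alpha> / (n - 1)" by (auto simp: q)
      have \<kappa>: "0 \<le> \<alpha> / (n * q) - (1 / p - 1 / n)" "0 \<le> \<alpha> / (n * q) - (n - 1) / n / r"
        unfolding e1 e2 diff_ge_0_iff_ge using q1 q0 n1 \<alpha>0 by (intro divide_left_mono mult_left_mono mult_pos_pos; auto)+
      have \<nu>: "0 < 1 / p - 1 / n" using pr by (simp add: field_simps)
      have g: "0 \<le> gradient_const K n p q \<alpha>"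
        unfolding gradient_const_def using K weight_const_pos[OF \<kappa>(1)] half_powr_less_1[OF \<nu>] tail_const_pos[OF pr(1)]
        by (intro mult_nonneg_nonneg divide_nonneg_nonneg) auto
      have b: "0 \<le> boundary_const K n r q \<alpha>"
        unfolding boundary_const_def using K weight_const_pos[OF \<kappa>(2)] by (intro mult_nonneg_nonneg divide_nonneg_nonneg) auto
      have "ennreal (gradient_const K n p q \<alpha> * y) * LG + ennreal (boundary_const K n r q \<alpha> * y') * LB
        \<le> ennreal (gradient_const K n p q \<alpha> + boundary_const K n r q \<alpha>) * (ennreal y * LG) + ennreal (gradient_const K n p q \<alpha> + boundary_const K n r q \<alpha>) * (ennreal y' * LB)"
        if "0 \<le> y" "0 \<le> y'" for y y'
      proof -
        have "ennreal (c * z) \<le> ennreal (gradient_const K n p q \<alpha> + boundary_const K n r q \<alpha>) * ennreal z"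
          if "0 \<le> c" "c \<le> gradient_const K n p q \<alpha> + boundary_const K n r q \<alpha>" "0 \<le> z" for c z
          unfolding ennreal_mult[OF that(1,3)] by (intro mult_right_mono ennreal_leI that) simp
        then show ?thesis using g b that unfolding mult.assoc[symmetric] by (intro add_mono mult_right_mono) auto
      qed
      then show ?thesis by (simp only: distrib_left powr_ge_zero)
    qed
    also have "\<alpha> / (n * q) - (1 / p - 1 / n) = \<alpha> / (q * n) - (n - p) / (p * n)"
      using pr n1 by (simp add: field_simps)
    finally show ?thesis by (simp only: \<tau>0_def h_def)
  qed
qed

text \<open>\<open>weight_const\<close> takes the value 1 when \<open>p = n\<close>; for
  \<open>p > n\<close> the gap \<open>1 / n - 1 / p\<close> sums the gradient contributions of all
  scales.\<close>

definition sup_const :: "real \<Rightarrow> real \<Rightarrow> real \<Rightarrow> real" where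
  "sup_const K n p = 1 + 2 * K * 2 powr ((n - 1) / n) * (weight_const (1 / n - 1 / p) * tail_const p)"

text \<open>\<open>rearrangement_estimate\<close> is used with Lebesgue measure in the role of \<mu>
  and exponent \<open>n\<close>. The gradient terms can now be summed over all scales: by geometric
  decay when \<open>p > n\<close>, and through \<sigma> = 1 when \<open>p = n\<close>. The bound is
  uniform in \<open>k\<close>, and letting the measure tend to zero gives the essential
  supremum.\<close>

lemma linf_bound:
  fixes \<Omega> :: "(real^'n::finite) set" and u :: "real^'n \<Rightarrow> real" and G :: "real^'n \<Rightarrow> real^'n" and p :: real and \<sigma> :: ereal
  defines "n \<equiv> real CARD('n)"
  defines "LG \<equiv> lorentz (restrict_space lebesgue \<Omega>) (ereal p) \<sigma> (\<lambda>x. norm (G x))"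
    and "LB \<equiv> linf (hmeasure (n - 1) (frontier \<Omega>)) u"
    and "K \<equiv> level_const (unit_ball_vol n) n n"
  assumes n2: "2 \<le> CARD('n)"
    and p: "(p = n \<and> \<sigma> = 1) \<or> (n < p \<and> 1 \<le> \<sigma>)"
    and \<Omega>: "open \<Omega>" "emeasure lebesgue \<Omega> < \<infinity>" "hausdorff (n - 1) (frontier \<Omega>) < \<infinity>"
    and u: "continuous_on (closure \<Omega>) u" "bounded {x \<in> closure \<Omega>. u x \<noteq> 0}"
    and wg: "has_weak_gradient \<Omega> u G"
  shows "linf (restrict_space lebesgue \<Omega>) u \<le> ennreal (sup_const K n p) *
     (ennreal (measure lebesgue \<Omega> powr (1 / n - 1 / p)) * LG + LB)"
proof (cases "\<Omega> = {}")
  case True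
  have "linf (restrict_space lebesgue \<Omega>) u \<le> ennreal 0"
    by (rule linf_le_of_null) (auto simp: True space_restrict_space)
  then show ?thesis by simp
next
  case False
  have n1: "2 \<le> n" unfolding n_def using n2 by simp
  have K: "0 < K" unfolding K_def by (rule level_const_pos[OF n1])
  have p1: "1 < p" "1 \<le> \<sigma>" "n \<le> p" using p n1 by auto
  define L where "L = measure lebesgue \<Omega>"
  have L: "0 < L"
  proof -
    have "emeasure lborel \<Omega> \<noteq> 0" using open_not_negligible[OF \<Omega>(1) False] \<Omega>(1)
      by (auto simp: negligible_iff_null_sets null_sets_def)
    then show ?thesis using \<Omega>(1,2) unfolding L_def measure_def by (auto simp: enn2real_positive_iff zero_less_iff_neq_zero)
  qed
  define \<tau> where "\<tau> k = L * (1/2) ^ k" for k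
  define lam where "lam = restrict_space lborel \<Omega>"
  have emlam: "emeasure lam A = emeasure lborel A" if "A \<subseteq> \<Omega>" for A
    unfolding lam_def using \<Omega>(1) that by (subst emeasure_restrict_space) auto
  have setslam: "sets lam = sets (restrict_space borel \<Omega>)"
    unfolding lam_def by (rule sets_restrict_space_cong) simp
  have splam: "space lam = \<Omega>" by (simp add: lam_def space_restrict_space)
  have finlam: "emeasure lam \<Omega> < \<infinity>" using \<Omega>(1,2) by (simp add: emlam)
  have balllam: "emeasure lam (ball x \<rho> \<inter> \<Omega>) \<le> ennreal (unit_ball_vol n * \<rho> powr n)" if "x \<in> \<Omega>" "0 < \<rho>" for x \<rho>
  proof -
    have "emeasure lam (ball x \<rho> \<inter> \<Omega>) = emeasure lborel (ball x \<rho> \<inter> \<Omega>)" by (rule emlam) auto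
    also have "\<dots> \<le> emeasure lborel (ball x \<rho>)" by (rule emeasure_mono) auto
    also have "\<dots> = ennreal (unit_ball_vol n * \<rho> powr n)"
      using emeasure_ball[of \<rho> x] that by (simp add: n_def powr_realpow)
    finally show ?thesis .
  qed
  have mlam: "measure lam \<Omega> = L" using emlam[of \<Omega>] \<Omega>(1) by (simp add: measure_def L_def)
  have v: "0 < unit_ball_vol n" using n1 by simp
  define N where "N = restrict_space lebesgue \<Omega>"
  define Hm where "Hm = hmeasure (n - 1) (frontier \<Omega>)"
  define \<beta> where "\<beta> = (n - 1) / n"
  define S where "S i = (\<Sum>j. ennreal (\<tau> (i + j)) * rearr N (\<lambda>x. norm (G x)) (\<tau> (i + Suc j)))" for i
  define D where "D i = ennreal (2 * K * \<tau> (Suc i) powr (- \<beta>)) * S i" for i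
  have L': "measure lam \<Omega> powr (n / n) \<le> L" using n1 L by (simp add: mlam)
  have est: "rearr lam u (\<tau> (Suc k) powr (n / n)) \<le> rearr Hm u (\<tau> (Suc k) powr \<beta> / (2 * K)) + (\<Sum>i\<le>k. D i)" for k
    unfolding D_def S_def N_def Hm_def K_def level_const_def n_def \<beta>_def
    by (rule rearrangement_estimate[OF n2 \<Omega>[unfolded n_def] u wg _ v[unfolded n_def] setslam finlam balllam[unfolded n_def] L L'[unfolded n_def] _ \<tau>_def])
      (auto simp: L_def)
  have \<tau>pos: "0 < \<tau> k" for k using L by (simp add: \<tau>_def)
  define \<nu> where "\<nu> = 1 / n - 1 / p"
  have \<nu>: "0 \<le> \<nu>" using p1 n1 by (simp add: \<nu>_def frac_le)
  define c where "c = 2 * K * 2 powr \<beta>"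
  define e where "e i = ennreal (\<tau> i powr (1 / p - 1)) * S i" for i
  have De: "D i = ennreal (c * L powr \<nu>) * (ennreal (((1/2) powr \<nu>) ^ i) * e i)" for i
  proof -
    have "\<tau> (Suc i) = (1/2) * \<tau> i" by (simp add: \<tau>_def)
    then have "\<tau> (Suc i) powr (- \<beta>) = 2 powr \<beta> * \<tau> i powr (- \<beta>)" by (simp only: powr_mult half_powr_minus)
    moreover have "- \<beta> = \<nu> + (1 / p - 1)" using n1 by (simp add: \<beta>_def \<nu>_def field_simps)
    then have "\<tau> i powr (- \<beta>) = L powr \<nu> * ((1/2) powr \<nu>) ^ i * \<tau> i powr (1 / p - 1)"
      by (simp only: powr_add \<tau>_def dyadic_powr[OF L])
    ultimately have e1: "2 * K * \<tau> (Suc i) powr (- \<beta>) = (c * L powr \<nu>) * (((1/2) powr \<nu>) ^ i * \<tau> i powr (1 / p - 1))"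
      by (simp only: c_def mult_ac)
    have e2: "ennreal (X * (Y * Z)) * W = ennreal X * (ennreal Y * (ennreal Z * W))" if "0 \<le> X" "0 \<le> Y" "0 \<le> Z" for X Y Z W
      using that by (simp add: ennreal_mult mult.assoc)
    show ?thesis unfolding D_def e_def e1 using K by (intro e2) (auto simp: c_def)
  qed
  have sumD: "(\<Sum>i\<le>k. D i) \<le> ennreal (c * L powr \<nu>) * (ennreal (weight_const \<nu> * tail_const p) * LG)" for k
  proof -
    have "(\<Sum>i\<le>k. D i) \<le> (\<Sum>i. D i)" by (intro sum_le_suminf) auto
    also have "\<dots> = ennreal (c * L powr \<nu>) * lseq 1 (\<lambda>i. ennreal (((1/2) powr \<nu>) ^ i) * e i)"
      unfolding De lseq_one by simp
    also have "\<dots> \<le> ennreal (c * L powr \<nu>) * (ennreal (weight_const \<nu>) * lseq \<sigma> e)"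
    proof (intro mult_left_mono lseq_dyadic_weight p1(2) \<nu>)
      \<comment> \<open>\<open>\<nu> = 0\<close> means \<open>p = n\<close>, the case in which
        \<sigma> = 1 is assumed.\<close>
      show "\<sigma> \<le> 1" if "\<nu> = 0"
        using that p n1 p1(1) by (auto simp: \<nu>_def)
    qed auto
    also have "\<dots> \<le> ennreal (c * L powr \<nu>) * (ennreal (weight_const \<nu>) * (ennreal (tail_const p) * LG))"
      unfolding e_def S_def LG_def N_def[symmetric] by (intro mult_left_mono tail_sum_bound[OF p1(2,1) L \<tau>_def]) auto
    also have "ennreal (weight_const \<nu>) * (ennreal (tail_const p) * LG) = ennreal (weight_const \<nu> * tail_const p) * LG"
      using weight_const_pos[OF \<nu>] tail_const_pos[OF p1(1)] by (simp add: ennreal_mult mult.assoc less_imp_le)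
    finally show ?thesis .
  qed
  define B where "B = LB + ennreal (c * L powr \<nu>) * (ennreal (weight_const \<nu> * tail_const p) * LG)"
  have rB: "rearr lam u (\<tau> (Suc k)) \<le> B" for k
  proof -
    have "rearr lam u (\<tau> (Suc k)) = rearr lam u (\<tau> (Suc k) powr (n / n))" using n1 \<tau>pos[of "Suc k"] by simp
    also have "\<dots> \<le> rearr Hm u (\<tau> (Suc k) powr \<beta> / (2 * K)) + (\<Sum>i\<le>k. D i)" by (rule est)
    also have "\<dots> \<le> B"
      unfolding B_def LB_def Hm_def by (intro add_mono rearr_le_linf frontier_superlevel_hmeasure[OF u(1)] sumD)
    finally show ?thesis .
  qed
  have u\<Omega>: "continuous_on \<Omega> u" using u(1) closure_subset continuous_on_subset by blast
  have oE: "open {x \<in> \<Omega>. t < \<bar>u x\<bar>}" for t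
    using continuous_open_preimage[of \<Omega> "\<lambda>y. \<bar>u y\<bar>" "{t<..}"] u\<Omega> \<Omega>(1)
    by (auto simp: vimage_def Int_def intro: continuous_intros)
  have "linf N u \<le> B"
  proof (cases "B = top")
    case False
    then obtain B' where B': "B = ennreal B'" "0 \<le> B'" by (metis ennreal_cases)
    let ?E = "{x \<in> \<Omega>. B' < \<bar>u x\<bar>}"
    have "emeasure lam ?E \<le> ennreal (\<tau> (Suc k))" for k
    proof -
      have "emeasure lam {x \<in> space lam. B' < \<bar>u x\<bar>} \<le> ennreal (\<tau> (Suc k))"
      proof (rule rearr_attained[OF _ rB[of k, unfolded B'(1)] B'(2)])
        show "{x \<in> space lam. t < \<bar>u x\<bar>} \<in> sets lam" for t
          unfolding splam setslam using oE[of t] \<Omega>(1) by (subst sets_restrict_space_iff) auto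
      qed
      then show ?thesis by (simp only: splam)
    qed
    moreover have "(\<lambda>k. ennreal (\<tau> (Suc k))) \<longlonglongrightarrow> ennreal 0"
    proof -
      have "grid (\<lambda>k. L * (1/2) ^ k)" by (rule grid_geometric) (use L in auto)
      then have "\<tau> \<longlonglongrightarrow> 0" unfolding \<tau>_def[abs_def] by (rule grid.lim)
      then show ?thesis by (intro tendsto_ennrealI LIMSEQ_Suc)
    qed
    ultimately have "emeasure lam ?E \<le> ennreal 0"
      by (intro LIMSEQ_le_const[where X="\<lambda>k. ennreal (\<tau> (Suc k))"]) auto
    then have E0: "emeasure lborel ?E = 0" using emlam[of ?E] by auto
    have "linf N u \<le> ennreal B'"
    proof (rule linf_le_of_null)
      have \<Omega>l: "\<Omega> \<in> sets lebesgue" using \<Omega>(1) by simp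
      have spN: "space N = \<Omega>" by (simp add: N_def space_restrict_space)
      show "{x \<in> space N. B' < \<bar>u x\<bar>} \<in> sets N"
        unfolding spN unfolding N_def using oE[of B'] \<Omega>l by (subst sets_restrict_space_iff) auto
      have "emeasure N ?E = emeasure lebesgue ?E"
        unfolding N_def using \<Omega>l by (subst emeasure_restrict_space) auto
      then show "emeasure N {x \<in> space N. B' < \<bar>u x\<bar>} = 0" unfolding spN using E0 oE[of B'] by simp
    qed
    then show ?thesis using B' by simp
  qed simp
  also have "B \<le> ennreal (sup_const K n p) * (ennreal (L powr \<nu>) * LG + LB)"
  proof -
    define c' where "c' = c * (weight_const \<nu> * tail_const p)"
    have nn: "0 \<le> c" "0 \<le> weight_const \<nu> * tail_const p" "0 \<le> c'"
      using K weight_const_pos[OF \<nu>] tail_const_pos[OF p1(1)] by (auto simp: c_def c'_def)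
    have "ennreal (c * L powr \<nu>) * (ennreal (weight_const \<nu> * tail_const p) * LG) = ennreal c' * (ennreal (L powr \<nu>) * LG)"
      unfolding mult.assoc[symmetric] using nn by (subst (1 2) ennreal_mult[symmetric]) (auto simp: c'_def mult_ac)
    then have "B = 1 * LB + ennreal c' * (ennreal (L powr \<nu>) * LG)" by (simp add: B_def)
    also have "\<dots> \<le> ennreal (1 + c') * LB + ennreal (1 + c') * (ennreal (L powr \<nu>) * LG)"
      using nn by (intro add_mono mult_right_mono) (auto intro!: ennreal_leI simp: ennreal_1[symmetric] simp del: ennreal_1 ennreal_plus)
    also have "\<dots> = ennreal (1 + c') * (ennreal (L powr \<nu>) * LG + LB)" by (simp only: distrib_left add.commute)
    also have "1 + c' = sup_const K n p" by (simp add: sup_const_def c'_def c_def \<beta>_def \<nu>_def)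
    finally show ?thesis .
  qed
  finally show ?thesis by (simp only: L_def \<nu>_def N_def)
qed

section \<open>The critical case\<close>

lemma grid_subseq:
  assumes "0 < c" "0 < \<psi>" "\<psi> < 1" "strict_mono r"
  shows "grid (\<lambda>k. c * \<psi> ^ r k)"
proof
  have "(\<lambda>k. c * \<psi> ^ k) \<longlonglongrightarrow> 0" by (rule grid.lim[OF grid_geometric]) (use assms in auto)
  from LIMSEQ_subseq_LIMSEQ[OF this assms(4)] show "(\<lambda>k. c * \<psi> ^ r k) \<longlonglongrightarrow> 0" by (simp add: o_def)
  show "c * \<psi> ^ r (Suc k) < c * \<psi> ^ r k" for k
    using assms by (intro mult_strict_left_mono power_strict_decreasing strict_monoD[OF assms(4)]) auto
qed (use assms in auto)

lemma double_exponent: "2 ^ Suc j - (1::nat) = (2 ^ j - 1) + 2 ^ j"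
proof -
  have "1 \<le> (2::nat) ^ j" by simp
  then show ?thesis unfolding power_Suc by linarith
qed

lemma strict_mono_double_exponent: "strict_mono (\<lambda>j. 2 ^ j - (1::nat))"
  unfolding strict_mono_Suc_iff double_exponent by (intro allI less_add_same_cancel1[THEN iffD2]) simp

lemma ln_half_powr: "ln (((1/2::real) powr \<gamma>) ^ k) = - (\<gamma> * ln 2 * real k)"
  by (simp add: ln_realpow ln_powr ln_div)

definition log_combine_const :: "real \<Rightarrow> real \<Rightarrow> real" where "log_combine_const A B = A * ln 2 / (ln 2 + max 0 B)"

lemma log_combine_const_pos: assumes "0 < A" shows "0 < log_combine_const A B"
proof -
  have "0 < ln 2 + max 0 B" by (rule add_pos_nonneg) auto
  then show ?thesis using assms by (simp add: log_combine_const_def)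
qed

text \<open>Merges a lower bound that is useful for large \<open>N\<close> with the constant bound
  \<open>ln 2\<close>: weighted by \<open>ln 2\<close> and \<open>max 0 B\<close>, their constant
  terms cancel.\<close>

lemma log_combine_const_le:
  assumes "ln 2 \<le> y" "A * N - B \<le> y"
  shows "log_combine_const A B * N \<le> y"
proof -
  let ?B = "max 0 B"
  have d: "0 < ln 2 + ?B" by (rule add_pos_nonneg) auto
  have y: "0 \<le> y" using assms(1) ln_2_half by linarith
  have "(A * N - ?B) * ln 2 + ln 2 * ?B \<le> y * ln 2 + y * ?B"
    using assms by (intro add_mono mult_right_mono) auto
  then have "A * ln 2 * N \<le> y * (ln 2 + ?B)" by (simp add: algebra_simps)
  then show ?thesis using d by (simp add: log_combine_const_def field_simps)
qed

lemma two_powr_power: "((2::real) powr s) ^ j = (2 ^ j) powr s"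
proof -
  have "((2::real) powr s) ^ j = (2 powr s) powr real j" by (simp add: powr_realpow)
  also have "\<dots> = (2 powr real j) powr s" by (simp only: powr_powr mult.commute)
  finally show ?thesis by (simp add: powr_realpow)
qed

text \<open>The second argument is what separates \<open>ln (m / x j)\<close> from
  \<open>\<gamma> * ln 2 * 2 ^ j\<close> on the grid of \<open>zygmund_upper\<close>.\<close>

definition log_weight_const :: "real \<Rightarrow> real \<Rightarrow> real \<Rightarrow> real" where
  "log_weight_const \<tau>0 \<gamma> m = log_combine_const (\<gamma> * ln 2) (\<gamma> * ln 2 + \<gamma> * ln \<tau>0 - ln m)"

text \<open>On the grid \<open>2 ^ j - 1\<close> both \<open>ln (1 + m / t)\<close> and the logarithmic length of the \<open>j\<close>-th block are of order \<open>2 ^ j\<close>.\<close>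

lemma zygmund_upper:
  assumes \<eta>: "1 \<le> \<eta>" and \<theta>: "\<theta> \<le> 0" and \<gamma>: "0 < \<gamma>" "\<gamma> \<le> 1" and \<tau>0: "0 < \<tau>0"
    and m: "0 < measure M (space M)" "emeasure M (space M) = ennreal (measure M (space M))" "measure M (space M) \<le> \<tau>0 powr \<gamma>"
  shows "lorentz_zygmund M \<infinity> \<eta> \<theta> \<phi> \<le> ennreal (log_weight_const \<tau>0 \<gamma> (measure M (space M)) powr \<theta>) *
    lseq \<eta> (\<lambda>j. ennreal ((2 powr (\<theta> + einv \<eta>)) ^ j) * rearr M \<phi> ((\<tau>0 * (1/2) ^ (2 ^ Suc j - 1)) powr \<gamma>))"
proof -
  define m where "m = measure M (space M)"
  define c where "c = log_weight_const \<tau>0 \<gamma> m"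
  have c: "0 < c" unfolding c_def log_weight_const_def by (rule log_combine_const_pos) (use \<gamma> in simp)
  define \<psi> where "\<psi> = (1/2::real) powr \<gamma>"
  define x where "x j = \<tau>0 powr \<gamma> * \<psi> ^ (2 ^ j - 1)" for j
  have \<psi>: "0 < \<psi>" "\<psi> < 1" using half_powr_less_1[OF \<gamma>(1)] by (auto simp: \<psi>_def)
  interpret grid x unfolding x_def[abs_def]
    by (rule grid_subseq[OF _ \<psi> strict_mono_double_exponent]) (use \<tau>0 in simp)
  have xS: "x (Suc j) = (\<tau>0 * (1/2) ^ (2 ^ Suc j - 1)) powr \<gamma>" for j
    unfolding x_def \<psi>_def by (rule dyadic_powr[OF \<tau>0, symmetric])
  have ratio: "ln (x j / x (Suc j)) = \<gamma> * ln 2 * 2 ^ j" for j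
  proof -
    have "x j / x (Suc j) = 1 / \<psi> ^ (2 ^ j)" unfolding x_def double_exponent power_add using \<tau>0 \<psi> by simp
    also have "ln \<dots> = - ln (\<psi> ^ (2 ^ j))" using \<psi> by (simp add: ln_div)
    finally show ?thesis unfolding \<psi>_def ln_half_powr by simp
  qed
  let ?R = "\<lambda>j. rearr M \<phi> (x (Suc j))"
  let ?T = "\<lambda>j. ennreal ((c * 2 ^ j) powr \<theta>) * ?R j"
  have "lorentz_zygmund M \<infinity> \<eta> \<theta> \<phi> \<le> lseq \<eta> (\<lambda>j. ennreal (ln (x j / x (Suc j)) powr einv \<eta>) * ?T j)"
    unfolding lorentz_zygmund_def m_def[symmetric]
  proof (rule lsig_upper[OF \<eta>])
    show "emeasure M (space M) \<le> ennreal (x 0)" unfolding m(2) using m(3) by (intro ennreal_leI) (simp add: x_def)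
    fix j t assume t: "x (Suc j) \<le> t" "t < x j" "ennreal t < emeasure M (space M)"
    have t0: "0 < t" using pos[of "Suc j"] t by linarith
    have tm: "t < m" using t(3) t0 unfolding m(2) m_def by (simp add: ennreal_less_iff)
    let ?y = "ln (1 + m / t)"
    \<comment> \<open>\<open>ln 2\<close> is the bound that serves near \<open>t = m\<close>; the
      next one takes over for small \<open>t\<close>.\<close>
    have y1: "ln 2 \<le> ?y" using t0 tm by (subst ln_le_cancel_iff) (auto simp: field_simps)
    have y2: "\<gamma> * ln 2 * 2 ^ j - (\<gamma> * ln 2 + \<gamma> * ln \<tau>0 - ln m) \<le> ?y"
    proof -
      have "ln (x j) = \<gamma> * ln \<tau>0 - \<gamma> * ln 2 * real (2 ^ j - 1)"
        unfolding x_def using \<tau>0 \<psi> by (subst ln_mult) (auto simp: ln_powr \<psi>_def ln_half_powr)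
      also have "real (2 ^ j - 1) = 2 ^ j - 1" by (simp add: of_nat_diff)
      finally have "ln m - ln (x j) = \<gamma> * ln 2 * 2 ^ j - (\<gamma> * ln 2 + \<gamma> * ln \<tau>0 - ln m)" by (simp add: algebra_simps)
      moreover have "ln m - ln (x j) = ln (m / x j)" using m(1) pos[of j] by (simp add: ln_div m_def)
      moreover have "ln (m / x j) \<le> ?y"
      proof (subst ln_le_cancel_iff)
        have "m / x j \<le> m / t" using m(1) t0 t(2) pos[of j] by (intro divide_left_mono) (auto simp: m_def)
        then show "m / x j \<le> 1 + m / t" by simp
        show "0 < m / x j" "0 < 1 + m / t" using m(1) t0 pos[of j] by (auto simp: m_def add_pos_pos)
      qed
      ultimately show ?thesis by linarith
    qed
    \<comment> \<open>The exponent \<theta> is nonpositive, so a lower bound for the logarithm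
      bounds the weight from above.\<close>
    have "c * 2 ^ j \<le> ?y" unfolding c_def log_weight_const_def by (rule log_combine_const_le[OF y1 y2])
    then have w: "?y powr \<theta> \<le> (c * 2 ^ j) powr \<theta>" using c \<theta> by (intro powr_mono2') auto
    have "ennreal (t powr (einv \<infinity> - einv \<eta>) * ?y powr \<theta>) * rearr M \<phi> t
      = ennreal (t powr - einv \<eta>) * (ennreal (?y powr \<theta>) * rearr M \<phi> t)"
      by (simp add: ennreal_mult mult.assoc)
    also have "\<dots> \<le> ennreal (t powr - einv \<eta>) * ?T j"
      by (intro mult_left_mono mult_mono ennreal_leI w rearr_antimono t) auto
    finally show "ennreal (t powr (einv \<infinity> - einv \<eta>) * ?y powr \<theta>) * rearr M \<phi> t \<le> ennreal (t powr - einv \<eta>) * ?T j" .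
  qed
  also have "\<dots> \<le> lseq \<eta> (\<lambda>j. ennreal (c powr \<theta>) * (ennreal ((2 powr (\<theta> + einv \<eta>)) ^ j) * ?R j))"
  proof (rule lseq_mono[OF \<eta>])
    fix j
    have "\<gamma> * ln 2 \<le> 1 * 1" using \<gamma> ln_2_half by (intro mult_mono) auto
    then have "ln (x j / x (Suc j)) \<le> 2 ^ j" unfolding ratio using mult_right_mono[of "\<gamma> * ln 2" 1 "2 ^ j"] by simp
    then have r: "ln (x j / x (Suc j)) powr einv \<eta> \<le> (2 ^ j) powr einv \<eta>"
      using ln_pos[of j] einv_bounds[OF \<eta>] by (intro powr_mono2) auto
    have "(2 ^ j) powr einv \<eta> * (c * 2 ^ j) powr \<theta> = c powr \<theta> * (2 powr (\<theta> + einv \<eta>)) ^ j"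
      unfolding two_powr_power by (simp only: powr_add powr_mult mult_ac)
    then have e: "ennreal ((2 ^ j) powr einv \<eta>) * ennreal ((c * 2 ^ j) powr \<theta>) = ennreal (c powr \<theta>) * ennreal ((2 powr (\<theta> + einv \<eta>)) ^ j)"
      by (simp only: ennreal_mult[symmetric] powr_ge_zero zero_le_power)
    have "ennreal (ln (x j / x (Suc j)) powr einv \<eta>) * ?T j \<le> ennreal ((2 ^ j) powr einv \<eta>) * ?T j"
      by (intro mult_right_mono ennreal_leI r) simp
    also have "\<dots> = ennreal (c powr \<theta>) * (ennreal ((2 powr (\<theta> + einv \<eta>)) ^ j) * ?R j)"
      unfolding mult.assoc[symmetric] e ..
    finally show "ennreal (ln (x j / x (Suc j)) powr einv \<eta>) * ?T j \<le> ennreal (c powr \<theta>) * (ennreal ((2 powr (\<theta> + einv \<eta>)) ^ j) * ?R j)" .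
  qed
  also have "\<dots> = ennreal (c powr \<theta>) * lseq \<eta> (\<lambda>j. ennreal ((2 powr (\<theta> + einv \<eta>)) ^ j) * ?R j)" by (rule lseq_cmult[OF \<eta>])
  finally show ?thesis unfolding xS c_def m_def .
qed

text \<open>Counterpart of \<open>zygmund_upper\<close> for the boundary. The logarithm is bounded
  from above through \<open>1 + m / t \<le> (1 + m / A) * (A / y (Suc j))\<close>, whose logarithm
  grows like \<open>2 ^ j\<close>; the block masses cost the factor 2.\<close>

lemma zygmund_lower:
  assumes \<rho>: "1 \<le> \<rho>" and \<zeta>: "\<zeta> \<le> 0" and \<beta>: "1/2 \<le> \<beta>" "\<beta> \<le> 1" and A: "0 < A"
    and m: "emeasure M (space M) = ennreal (measure M (space M))"
  shows "lseq \<rho> (\<lambda>j. ennreal ((2 powr (\<zeta> + einv \<rho>)) ^ j) * rearr M \<phi> (A * ((1/2) powr \<beta>) ^ (2 ^ Suc j - 1)))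
    \<le> ennreal (2 * (ln (1 + measure M (space M) / A) + 4) powr (- \<zeta>)) * lorentz_zygmund M \<infinity> \<rho> \<zeta> \<phi>"
proof -
  define m where "m = measure M (space M)"
  define c where "c = ln (1 + m / A) + 4"
  have m0: "0 \<le> m" by (simp add: m_def)
  have c: "0 < c" using A m0 by (simp add: c_def add_nonneg_pos)
  define \<psi> where "\<psi> = (1/2::real) powr \<beta>"
  \<comment> \<open>The exponents start at 1 rather than 0, to match the boundary scales
    \<open>\<tau> (Suc k)\<close> of the rearrangement estimate at the sampled indices.\<close>
  define y where "y j = A * \<psi> ^ (2 ^ Suc j - 1)" for j
  have \<psi>: "0 < \<psi>" "\<psi> < 1" using half_powr_less_1[of \<beta>] \<beta> by (auto simp: \<psi>_def)
  have sm: "strict_mono (\<lambda>j. 2 ^ Suc j - (1::nat))"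
    by (intro strict_monoI strict_monoD[OF strict_mono_double_exponent]) simp
  interpret grid y unfolding y_def[abs_def] by (rule grid_subseq[OF A \<psi> sm])
  have ratio: "ln (y j / y (Suc j)) = \<beta> * ln 2 * 2 ^ Suc j" for j
  proof -
    have "y j / y (Suc j) = 1 / \<psi> ^ (2 ^ Suc j)" unfolding y_def double_exponent[of "Suc j"] power_add using A \<psi> by simp
    also have "ln \<dots> = - ln (\<psi> ^ (2 ^ Suc j))" using \<psi> by (simp add: ln_div)
    finally show ?thesis unfolding \<psi>_def ln_half_powr by simp
  qed
  let ?R = "\<lambda>j. rearr M \<phi> (y j)"
  let ?T = "\<lambda>j. ennreal ((c * 2 ^ j) powr \<zeta>) * ?R j"
  have low: "lseq \<rho> (\<lambda>j. ennreal (ln (y j / y (Suc j)) powr einv \<rho>) * ?T j) \<le> lorentz_zygmund M \<infinity> \<rho> \<zeta> \<phi>"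
    unfolding lorentz_zygmund_def m_def[symmetric]
  proof (rule lsig_lower[OF \<rho>], intro conjI)
    fix j t assume j: "?T j \<noteq> 0" "y (Suc j) \<le> t" "t < y j"
    then have "?R j \<noteq> 0" by auto
    then have em: "ennreal (y j) < emeasure M (space M)" using rearr_zero[of M "y j" \<phi>] by (auto simp: not_le[symmetric])
    then show "ennreal t < emeasure M (space M)" using j(3) by (meson ennreal_leI less_imp_le order_le_less_trans)
    have mp: "0 < m" using em pos[of j] unfolding m m_def by (simp add: ennreal_less_iff less_imp_le)
    have t0: "0 < t" using pos[of "Suc j"] j(2) by linarith
    let ?y = "ln (1 + m / t)"
    have yp: "0 < ?y" by (rule ln_gt_zero) (use mp t0 in simp)
    have "?y \<le> c * 2 ^ j"
    proof -
      have yA: "y (Suc j) \<le> A" unfolding y_def using A \<psi> by (simp add: mult_le_cancel_left1 power_le_one less_imp_le)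
      have "1 + m / t \<le> 1 + m / y (Suc j)" using mp pos[of "Suc j"] j(2) t0 by (intro add_left_mono divide_left_mono) auto
      also have "\<dots> \<le> A / y (Suc j) + m / y (Suc j)" using yA pos[of "Suc j"] by simp
      also have "\<dots> = (1 + m / A) * (A / y (Suc j))" using A pos[of "Suc j"] by (simp add: field_simps)
      finally have le: "1 + m / t \<le> (1 + m / A) * (A / y (Suc j))" .
      have "0 < 1 + m / t" using mp t0 by (simp add: add_pos_pos)
      then have "?y \<le> ln ((1 + m / A) * (A / y (Suc j)))" using le by (subst ln_le_cancel_iff) linarith+
      also have "\<dots> = ln (1 + m / A) + ln (A / y (Suc j))"
      proof (rule ln_mult_pos)
        show "0 < 1 + m / A" "0 < A / y (Suc j)" using mp A pos[of "Suc j"] by (auto intro: add_pos_pos)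
      qed
      also have "A / y (Suc j) = 1 / \<psi> ^ (2 ^ Suc (Suc j) - 1)" unfolding y_def using A by simp
      also have "ln \<dots> = \<beta> * ln 2 * real (2 ^ Suc (Suc j) - 1)"
      proof -
        have "ln (1 / \<psi> ^ (2 ^ Suc (Suc j) - 1)) = - ln (\<psi> ^ (2 ^ Suc (Suc j) - 1))" using \<psi> by (simp add: ln_div)
        then show ?thesis unfolding \<psi>_def ln_half_powr by simp
      qed
      also have "\<dots> \<le> 1 * (4 * 2 ^ j)"
      proof (rule mult_mono)
        show "\<beta> * ln 2 \<le> 1" using \<beta> ln_2_half mult_mono[of \<beta> 1 "ln 2" 1] by simp
        have "real (2 ^ Suc (Suc j) - 1) \<le> real (2 ^ Suc (Suc j))" by (rule of_nat_mono) simp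
        then show "real (2 ^ Suc (Suc j) - 1) \<le> 4 * 2 ^ j" by simp
      qed (rule zero_le_one, rule of_nat_0_le_iff)
      also have "ln (1 + m / A) + 1 * (4 * 2 ^ j) \<le> ln (1 + m / A) * 2 ^ j + 4 * 2 ^ j"
        using mult_left_mono[of 1 "2 ^ j" "ln (1 + m / A)"] mp A by simp
      finally show ?thesis by (simp add: c_def distrib_right)
    qed
    then have w: "(c * 2 ^ j) powr \<zeta> \<le> ?y powr \<zeta>" using yp \<zeta> by (intro powr_mono2') auto
    have "ennreal (t powr - einv \<rho>) * ?T j \<le> ennreal (t powr - einv \<rho>) * (ennreal (?y powr \<zeta>) * rearr M \<phi> t)"
      by (intro mult_left_mono mult_mono ennreal_leI w rearr_antimono less_imp_le[OF j(3)]) auto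
    also have "\<dots> = ennreal (t powr (einv \<infinity> - einv \<rho>) * ?y powr \<zeta>) * rearr M \<phi> t"
      by (simp add: ennreal_mult mult.assoc)
    finally show "ennreal (t powr - einv \<rho>) * ?T j \<le> ennreal (t powr (einv \<infinity> - einv \<rho>) * ?y powr \<zeta>) * rearr M \<phi> t" .
  qed
  let ?Z = "\<lambda>j. ennreal ((2 powr (\<zeta> + einv \<rho>)) ^ j) * ?R j"
  have "ennreal (1/2 * c powr \<zeta>) * lseq \<rho> ?Z = lseq \<rho> (\<lambda>j. ennreal (1/2 * c powr \<zeta>) * ?Z j)"
    by (rule lseq_cmult[OF \<rho>, symmetric])
  also have "\<dots> \<le> lseq \<rho> (\<lambda>j. ennreal (ln (y j / y (Suc j)) powr einv \<rho>) * ?T j)"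
  proof (rule lseq_mono[OF \<rho>])
    fix j
    have "(1/2) * (1/2) \<le> \<beta> * ln 2" using \<beta> ln_2_half by (intro mult_mono) auto
    then have "(1/2) * 2 ^ j \<le> ln (y j / y (Suc j))" unfolding ratio using mult_right_mono[of "1/4" "\<beta> * ln 2" "2 ^ Suc j"] by simp
    then have "((1/2) * 2 ^ j) powr einv \<rho> \<le> ln (y j / y (Suc j)) powr einv \<rho>"
      using einv_bounds[OF \<rho>] by (intro powr_mono2) auto
    moreover have "1/2 * (2 ^ j) powr einv \<rho> \<le> ((1/2) * 2 ^ j) powr einv \<rho>"
      unfolding powr_mult by (intro mult_right_mono powr_einv_ge \<rho>) auto
    ultimately have r: "1/2 * (2 ^ j) powr einv \<rho> \<le> ln (y j / y (Suc j)) powr einv \<rho>" by linarith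
    have "(1/2 * c powr \<zeta>) * (2 powr (\<zeta> + einv \<rho>)) ^ j = (1/2 * (2 ^ j) powr einv \<rho>) * (c * 2 ^ j) powr \<zeta>"
      unfolding two_powr_power by (simp only: powr_add powr_mult mult_ac)
    also have "\<dots> \<le> ln (y j / y (Suc j)) powr einv \<rho> * (c * 2 ^ j) powr \<zeta>" by (intro mult_right_mono r) simp
    finally have "ennreal ((1/2 * c powr \<zeta>) * (2 powr (\<zeta> + einv \<rho>)) ^ j) \<le> ennreal (ln (y j / y (Suc j)) powr einv \<rho> * (c * 2 ^ j) powr \<zeta>)"
      by (rule ennreal_leI)
    then have "ennreal (1/2 * c powr \<zeta>) * ennreal ((2 powr (\<zeta> + einv \<rho>)) ^ j) \<le> ennreal (ln (y j / y (Suc j)) powr einv \<rho>) * ennreal ((c * 2 ^ j) powr \<zeta>)"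
      by (subst (1 2) ennreal_mult[symmetric]) auto
    then show "ennreal (1/2 * c powr \<zeta>) * ?Z j \<le> ennreal (ln (y j / y (Suc j)) powr einv \<rho>) * ?T j"
      unfolding mult.assoc[symmetric] by (rule mult_right_mono) simp
  qed
  finally have "ennreal (1/2 * c powr \<zeta>) * lseq \<rho> ?Z \<le> lorentz_zygmund M \<infinity> \<rho> \<zeta> \<phi>" using low by simp
  then have "ennreal (2 * c powr (- \<zeta>)) * (ennreal (1/2 * c powr \<zeta>) * lseq \<rho> ?Z) \<le> ennreal (2 * c powr (- \<zeta>)) * lorentz_zygmund M \<infinity> \<rho> \<zeta> \<phi>"
    by (rule mult_left_mono) simp
  moreover have "ennreal (2 * c powr (- \<zeta>)) * ennreal (1/2 * c powr \<zeta>) = 1"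
    using c by (subst ennreal_mult[symmetric]) (auto simp: powr_minus)
  ultimately have "lseq \<rho> ?Z \<le> ennreal (2 * c powr (- \<zeta>)) * lorentz_zygmund M \<infinity> \<rho> \<zeta> \<phi>"
    by (simp add: mult.assoc[symmetric])
  then show ?thesis unfolding y_def \<psi>_def c_def m_def .
qed

text \<open>Hardy's inequality in the limiting case, where the dyadic weight no longer decays. On a
  block of length \<open>2 ^ k\<close> Hoelder costs \<open>2 powr (1 - einv \<sigma>)\<close> per
  doubling, which the weight \<open>\<delta> ^ k\<close> compensates; \<sigma> > 1 makes \<delta> <
  1, so that \<open>lseq_recur\<close> applies.\<close>

lemma lseq_block_sums:
  assumes \<sigma>: "1 < \<sigma>" "\<sigma> \<le> \<eta>" and s: "s \<le> - 1 + einv \<sigma>"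
  shows "lseq \<eta> (\<lambda>j. ennreal ((2 powr s) ^ j) * (\<Sum>i\<le>2 ^ Suc j - 2. e i))
    \<le> ennreal (2 / (1 - 2 powr (einv \<sigma> - 1))) * lseq \<sigma> e"
proof -
  have \<sigma>1: "1 \<le> \<sigma>" "1 \<le> \<eta>" using \<sigma> by (auto intro: less_imp_le order.trans)
  have ev: "einv \<sigma> < 1" using \<sigma>1(1) \<sigma>(1) by (cases rule: ereal_ge_1_cases) auto
  define \<delta> where "\<delta> = (2::real) powr (einv \<sigma> - 1)"
  \<comment> \<open>The bound \<open>1/2 \<le> \<delta>\<close> turns the factor
    \<open>1 / \<delta>\<close> of the index shift into 2.\<close>
  have \<delta>: "0 < \<delta>" "\<delta> < 1" "1/2 \<le> \<delta>"
    using ev powr_mono[of "- 1" "einv \<sigma> - 1" 2] einv_bounds[OF \<sigma>1(1)] by (auto simp: \<delta>_def powr_minus powr_less_one)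
  have inv: "\<delta> * 2 powr (1 - einv \<sigma>) = 1" by (simp add: \<delta>_def powr_add[symmetric])
  \<comment> \<open>The sum stops before \<open>2 ^ k - 1\<close>, so \<open>w 0 = 0\<close> and
    each step adds exactly one block.\<close>
  define w where "w k = ennreal (\<delta> ^ k) * (\<Sum>i<2 ^ k - 1. e i)" for k
  have w: "lseq \<sigma> w \<le> ennreal (1 / (1 - \<delta>)) * lseq \<sigma> (dblock \<sigma> e)"
  proof (rule lseq_recur[OF \<sigma>1(1)])
    fix k
    have split: "(\<Sum>i<2 ^ Suc k - 1. e i) = (\<Sum>i<2 ^ k - 1. e i) + (\<Sum>i=2 ^ k - 1..<2 ^ k - 1 + 2 ^ k. e i)"
      unfolding double_exponent lessThan_atLeast0 by (subst sum.atLeastLessThan_concat) auto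
    have "ennreal (\<delta> ^ Suc k) * (\<Sum>i=2 ^ k - 1..<2 ^ k - 1 + 2 ^ k. e i)
      \<le> ennreal (\<delta> ^ Suc k) * (ennreal ((2 powr (1 - einv \<sigma>)) ^ k) * dblock \<sigma> e k)"
      by (intro mult_left_mono dblock_sum \<sigma>1) simp
    also have "\<dots> = ennreal \<delta> * dblock \<sigma> e k"
    proof -
      have "\<delta> ^ Suc k * (2 powr (1 - einv \<sigma>)) ^ k = \<delta> * (\<delta> * 2 powr (1 - einv \<sigma>)) ^ k" by (simp add: power_mult_distrib)
      then have "\<delta> ^ Suc k * (2 powr (1 - einv \<sigma>)) ^ k = \<delta>" by (simp add: inv)
      then have "ennreal (\<delta> ^ Suc k) * ennreal ((2 powr (1 - einv \<sigma>)) ^ k) = ennreal \<delta>"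
        using \<delta> by (subst ennreal_mult[symmetric]) auto
      then show ?thesis by (simp only: mult.assoc[symmetric])
    qed
    also have "\<dots> \<le> 1 * dblock \<sigma> e k" using \<delta> by (intro mult_right_mono) auto
    finally have "ennreal (\<delta> ^ Suc k) * (\<Sum>i=2 ^ k - 1..<2 ^ k - 1 + 2 ^ k. e i) \<le> dblock \<sigma> e k" by simp
    moreover have "ennreal (\<delta> ^ Suc k) * (\<Sum>i<2 ^ k - 1. e i) = ennreal \<delta> * w k"
      using \<delta> by (simp add: w_def ennreal_mult mult.assoc)
    ultimately show "w (Suc k) \<le> ennreal \<delta> * w k + dblock \<sigma> e k"
      unfolding w_def[of "Suc k"] split distrib_left by (simp only: add_left_mono)
  qed (use \<delta> in \<open>auto simp: w_def\<close>)
  have "lseq \<eta> (\<lambda>j. ennreal ((2 powr s) ^ j) * (\<Sum>i\<le>2 ^ Suc j - 2. e i)) \<le> lseq \<eta> (\<lambda>j. ennreal (1 / \<delta>) * w (Suc j))"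
  proof (rule lseq_mono[OF \<sigma>1(2)])
    fix j
    have "{..2 ^ Suc j - 2} = {..<2 ^ Suc j - (1::nat)}"
    proof -
      have "(2::nat) ^ Suc j - 1 = Suc (2 ^ Suc j - 2)" using one_le_power[of "2::nat" j] unfolding power_Suc by linarith
      then show ?thesis by (simp only: lessThan_Suc_atMost)
    qed
    moreover have "ennreal ((2 powr s) ^ j) \<le> ennreal (1 / \<delta>) * ennreal (\<delta> ^ Suc j)"
    proof -
      have "2 powr s \<le> \<delta>" unfolding \<delta>_def using s by (intro powr_mono) auto
      then have "(2 powr s) ^ j \<le> \<delta> ^ j" by (intro power_mono) auto
      also have "\<delta> ^ j = 1 / \<delta> * \<delta> ^ Suc j" using \<delta> by simp
      finally show ?thesis using \<delta> by (subst ennreal_mult[symmetric]) (auto intro: ennreal_leI)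
    qed
    ultimately show "ennreal ((2 powr s) ^ j) * (\<Sum>i\<le>2 ^ Suc j - 2. e i) \<le> ennreal (1 / \<delta>) * w (Suc j)"
      unfolding w_def mult.assoc[symmetric] by (metis mult_right_mono zero_le)
  qed
  also have "\<dots> = ennreal (1 / \<delta>) * lseq \<eta> (\<lambda>j. w (Suc j))" by (rule lseq_cmult[OF \<sigma>1(2)])
  also have "\<dots> \<le> ennreal 2 * (ennreal (1 / (1 - \<delta>)) * lseq \<sigma> e)"
  proof (rule mult_mono)
    show "ennreal (1 / \<delta>) \<le> ennreal 2" using \<delta> by (intro ennreal_leI) (simp add: field_simps)
    have "lseq \<eta> (\<lambda>j. w (Suc j)) \<le> lseq \<eta> w" by (rule lseq_shift[OF \<sigma>1(2)])
    also have "\<dots> \<le> lseq \<sigma> w" by (rule lseq_embed[OF \<sigma>1(1) \<sigma>(2)])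
    also have "\<dots> \<le> ennreal (1 / (1 - \<delta>)) * lseq \<sigma> (dblock \<sigma> e)" by (rule w)
    also have "\<dots> \<le> ennreal (1 / (1 - \<delta>)) * lseq \<sigma> e" by (intro mult_left_mono dblock_lseq \<sigma>1) simp
    finally show "lseq \<eta> (\<lambda>j. w (Suc j)) \<le> ennreal (1 / (1 - \<delta>)) * lseq \<sigma> e" .
  qed auto
  also have "\<dots> = ennreal (2 / (1 - \<delta>)) * lseq \<sigma> e"
    unfolding mult.assoc[symmetric] using \<delta> by (subst ennreal_mult[symmetric]) auto
  finally show ?thesis unfolding \<delta>_def .
qed

text \<open>\<Omega> and its measures enter only through the numbers \<open>L\<close>,
  \<open>M\<close> and \<open>H\<close>, as the order of quantifiers in the critical case
  demands.\<close>

definition zygmund_const :: "real \<Rightarrow> real \<Rightarrow> real \<Rightarrow> ereal \<Rightarrow> real \<Rightarrow> real \<Rightarrow> real \<Rightarrow> real \<Rightarrow> real \<Rightarrow> real" where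
  "zygmund_const K n \<alpha> \<sigma> \<theta> \<zeta> L M H = (let \<tau>0 = max (M powr (n / \<alpha>)) L; \<beta> = (n - 1) / n in
     log_weight_const \<tau>0 (\<alpha> / n) M powr \<theta> * (2 * (2 * (ln (1 + H / (\<tau>0 powr \<beta> / (2 * K))) + 4) powr (- \<zeta>)
       + 2 * K * 2 powr \<beta> * (2 / (1 - 2 powr (einv \<sigma> - 1)) * tail_const n))))"

text \<open>The estimate is sampled at the indices \<open>2 ^ Suc j - 2\<close>, whose successors
  belong to the grid of \<open>zygmund_upper\<close>. There the logarithmic weight together with the
  block masses becomes the geometric weight \<open>2 powr (\<theta> + einv \<eta>)\<close>, and the
  two bounds on \<theta> are what the gradient part and the boundary part need.\<close>

lemma zygmund_trace_bound:
  fixes \<Omega> :: "(real^'n::finite) set" and u :: "real^'n \<Rightarrow> real" and G :: "real^'n \<Rightarrow> real^'n" and \<mu> :: "(real^'n) measure"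
    and C \<alpha> \<theta> \<zeta> :: real and \<sigma> \<rho>\<^sub>b \<eta> :: ereal
  defines "n \<equiv> real CARD('n)"
  defines "LG \<equiv> lorentz (restrict_space lebesgue \<Omega>) (ereal n) \<sigma> (\<lambda>x. norm (G x))"
    and "LB \<equiv> lorentz_zygmund (hmeasure (n - 1) (frontier \<Omega>)) \<infinity> \<rho>\<^sub>b \<zeta> u"
    and "K \<equiv> level_const C \<alpha> n"
  assumes n2: "2 \<le> CARD('n)"
    and \<sigma>: "1 < \<sigma>" "1 < \<rho>\<^sub>b" "\<zeta> < - einv \<rho>\<^sub>b" "max \<sigma> \<rho>\<^sub>b \<le> \<eta>"
    and \<theta>: "\<theta> \<le> min (-1 + einv \<sigma> - einv \<eta>) (\<zeta> + einv \<rho>\<^sub>b - einv \<eta>)"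
    and \<Omega>: "open \<Omega>" "emeasure lebesgue \<Omega> < \<infinity>" "hausdorff (n - 1) (frontier \<Omega>) < \<infinity>"
    and u: "continuous_on (closure \<Omega>) u" "bounded {x \<in> closure \<Omega>. u x \<noteq> 0}"
    and wg: "has_weak_gradient \<Omega> u G"
    and \<alpha>: "n - 1 < \<alpha>" "\<alpha> \<le> n" and C: "0 < C"
    and \<mu>: "sets \<mu> = sets (restrict_space borel \<Omega>)" "emeasure \<mu> \<Omega> < \<infinity>"
    and ball: "\<And>x \<rho>. x \<in> \<Omega> \<Longrightarrow> 0 < \<rho> \<Longrightarrow> emeasure \<mu> (ball x \<rho> \<inter> \<Omega>) \<le> ennreal (C * \<rho> powr \<alpha>)"
  shows "lorentz_zygmund \<mu> \<infinity> \<eta> \<theta> u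
    \<le> ennreal (zygmund_const K n \<alpha> \<sigma> \<theta> \<zeta> (measure lebesgue \<Omega>) (measure \<mu> \<Omega>) (enn2real (hausdorff (n - 1) (frontier \<Omega>)))) * (LG + LB)"
proof -
  have n1: "2 \<le> n" unfolding n_def using n2 by simp
  have \<alpha>0: "0 < \<alpha>" using \<alpha> n1 by linarith
  have s1: "1 \<le> \<sigma>" "1 \<le> \<rho>\<^sub>b" "\<sigma> \<le> \<eta>" "\<rho>\<^sub>b \<le> \<eta>" using \<sigma> by auto
  have \<eta>1: "1 \<le> \<eta>" using s1 by (auto intro: order.trans)
  have sp: "space \<mu> = \<Omega>" using sets_eq_imp_space_eq[OF \<mu>(1)] by (simp add: space_restrict_space)
  have K: "0 < K" unfolding K_def by (rule level_const_pos[OF n1])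
  have em: "emeasure \<mu> \<Omega> = ennreal (measure \<mu> \<Omega>)" using \<mu>(2) by (simp add: emeasure_eq_ennreal_measure less_top[symmetric])
  show ?thesis
  proof (cases "measure \<mu> \<Omega> = 0")
    case True
    then have "emeasure \<mu> (space \<mu>) = 0" by (simp add: sp em)
    then show ?thesis using lsig_null[OF \<eta>1] by (simp add: lorentz_zygmund_def)
  next
    case False
    then have m0: "0 < measure \<mu> \<Omega>" by (simp add: less_le)
    define \<tau>0 where "\<tau>0 = max (measure \<mu> \<Omega> powr (n / \<alpha>)) (measure lebesgue \<Omega>)"
    have \<tau>0: "0 < \<tau>0" "measure \<mu> \<Omega> powr (n / \<alpha>) \<le> \<tau>0" "measure lebesgue \<Omega> \<le> \<tau>0"
      using m0 by (auto simp: \<tau>0_def less_max_iff_disj)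
    define \<tau> where "\<tau> k = \<tau>0 * (1/2) ^ k" for k
    define N where "N = restrict_space lebesgue \<Omega>"
    define Hm where "Hm = hmeasure (n - 1) (frontier \<Omega>)"
    define H where "H = enn2real (hausdorff (n - 1) (frontier \<Omega>))"
    have F: "frontier \<Omega> \<in> sets borel" by (simp add: frontier_closed)
    have Hsp: "emeasure Hm (space Hm) = ennreal (measure Hm (space Hm))" "measure Hm (space Hm) = H"
    proof -
      have "emeasure Hm (space Hm) = hausdorff (n - 1) (frontier \<Omega>)"
        unfolding Hm_def space_hmeasure[OF F] by (rule emeasure_hmeasure[OF F F]) simp
      then show "emeasure Hm (space Hm) = ennreal (measure Hm (space Hm))" "measure Hm (space Hm) = H"
        using \<Omega>(3) by (auto simp: measure_def H_def)
    qed
    define \<beta> where "\<beta> = (n - 1) / n"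
    define \<gamma> where "\<gamma> = \<alpha> / n"
    have \<beta>: "1 / 2 \<le> \<beta>" "\<beta> \<le> 1" using n1 by (auto simp: \<beta>_def field_simps)
    have \<gamma>: "0 < \<gamma>" "\<gamma> \<le> 1" using \<alpha> \<alpha>0 n1 by (auto simp: \<gamma>_def)
    define b where "b k = rearr Hm u (\<tau> (Suc k) powr \<beta> / (2 * K))" for k
    define S where "S i = (\<Sum>j. ennreal (\<tau> (i + j)) * rearr N (\<lambda>x. norm (G x)) (\<tau> (i + Suc j)))" for i
    \<comment> \<open>For \<open>p = n\<close> the Hardy exponent \<open>1 / n - 1\<close> equals
      \<open>- \<beta>\<close>, so the gradient terms carry no surplus weight and are summed as they
      stand.\<close>
    define e where "e i = ennreal (\<tau> i powr (1 / n - 1)) * S i" for i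
    define c where "c = 2 * K * 2 powr \<beta>"
    have D: "ennreal (2 * K * \<tau> (Suc i) powr (- \<beta>)) * S i = ennreal c * e i" for i
    proof -
      have "\<tau> (Suc i) = (1/2) * \<tau> i" by (simp add: \<tau>_def)
      then have "\<tau> (Suc i) powr (- \<beta>) = 2 powr \<beta> * \<tau> i powr (- \<beta>)" by (simp only: powr_mult half_powr_minus)
      moreover have "- \<beta> = 1 / n - 1" using n1 by (simp add: \<beta>_def field_simps)
      ultimately have "2 * K * \<tau> (Suc i) powr (- \<beta>) = c * \<tau> i powr (1 / n - 1)" by (simp only: c_def mult_ac)
      then have "ennreal (2 * K * \<tau> (Suc i) powr (- \<beta>)) = ennreal c * ennreal (\<tau> i powr (1 / n - 1))"
        using K by (simp only: ennreal_mult c_def powr_ge_zero mult_nonneg_nonneg zero_le_numeral less_imp_le)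
      then show ?thesis by (simp only: e_def mult.assoc)
    qed
    have est: "rearr \<mu> u (\<tau> (Suc k) powr \<gamma>) \<le> b k + (\<Sum>i\<le>k. ennreal c * e i)" for k
      unfolding D[symmetric]
      unfolding b_def S_def N_def Hm_def K_def level_const_def n_def \<beta>_def \<gamma>_def
      by (rule rearrangement_estimate[OF n2 \<Omega>[unfolded n_def] u wg \<alpha>(1)[unfolded n_def] C \<mu> ball \<tau>0[unfolded n_def] \<tau>_def])
    define s where "s = \<theta> + einv \<eta>"
    let ?w = "\<lambda>j. ennreal ((2 powr s) ^ j)"
    let ?k = "\<lambda>j. 2 ^ Suc j - (2::nat)"
    have Sk: "Suc (?k j) = 2 ^ Suc j - 1" for j
      using one_le_power[of "2::nat" j] unfolding power_Suc by linarith
    define A where "A = \<tau>0 powr \<beta> / (2 * K)"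
    have A: "0 < A" using K \<tau>0 by (simp add: A_def)
    define C1 where "C1 = 2 / (1 - 2 powr (einv \<sigma> - 1))"
    define C2 where "C2 = 2 * (ln (1 + H / A) + 4) powr (- \<zeta>)"
    have ev: "einv \<sigma> < 1" using s1(1) \<sigma>(1) by (cases rule: ereal_ge_1_cases) auto
    have C1: "0 \<le> C1" using ev by (simp add: C1_def powr_less_one less_imp_le)
    have grad: "lseq \<eta> (\<lambda>j. ?w j * (\<Sum>i\<le>?k j. ennreal c * e i)) \<le> ennreal (c * (C1 * tail_const n)) * LG"
    proof -
      have "lseq \<eta> (\<lambda>j. ?w j * (\<Sum>i\<le>?k j. ennreal c * e i)) = ennreal c * lseq \<eta> (\<lambda>j. ?w j * (\<Sum>i\<le>?k j. e i))"
        unfolding sum_distrib_left[symmetric] mult.left_commute[of _ "ennreal c"] by (rule lseq_cmult[OF \<eta>1])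
      also have "\<dots> \<le> ennreal c * (ennreal C1 * lseq \<sigma> e)"
        unfolding C1_def by (intro mult_left_mono lseq_block_sums \<sigma> s1) (use \<theta> in \<open>auto simp: s_def\<close>)
      also have "\<dots> \<le> ennreal c * (ennreal C1 * (ennreal (tail_const n) * LG))"
        unfolding e_def S_def LG_def N_def[symmetric]
        by (intro mult_left_mono tail_sum_bound[OF s1(1) _ \<tau>0(1) \<tau>_def]) (use n1 in auto)
      also have "\<dots> = ennreal (c * (C1 * tail_const n)) * LG"
        using C1 K tail_const_pos[of n] n1 by (simp add: ennreal_mult mult.assoc c_def)
      finally show ?thesis .
    qed
    have bdry: "lseq \<eta> (\<lambda>j. ?w j * b (?k j)) \<le> ennreal C2 * LB"
    proof -
      \<comment> \<open>The second bound on \<theta> says that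
        \<open>s \<le> \<zeta> + einv \<rho>\<^sub>b\<close>; the passage from \<eta> to
        \<open>\<rho>\<^sub>b\<close> is the embedding that follows.\<close>
      have "lseq \<eta> (\<lambda>j. ?w j * b (?k j)) \<le> lseq \<eta> (\<lambda>j. ennreal ((2 powr (\<zeta> + einv \<rho>\<^sub>b)) ^ j) * b (?k j))"
        by (intro lseq_mono \<eta>1 mult_right_mono ennreal_leI power_mono powr_mono) (use \<theta> in \<open>auto simp: s_def\<close>)
      also have "\<dots> \<le> lseq \<rho>\<^sub>b (\<lambda>j. ennreal ((2 powr (\<zeta> + einv \<rho>\<^sub>b)) ^ j) * b (?k j))"
        by (rule lseq_embed[OF s1(2,4)])
      also have "\<dots> = lseq \<rho>\<^sub>b (\<lambda>j. ennreal ((2 powr (\<zeta> + einv \<rho>\<^sub>b)) ^ j) * rearr Hm u (A * ((1/2) powr \<beta>) ^ (2 ^ Suc j - 1)))"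
      proof -
        have "b (?k j) = rearr Hm u (A * ((1/2) powr \<beta>) ^ (2 ^ Suc j - 1))" for j
          unfolding b_def Sk \<tau>_def dyadic_powr[OF \<tau>0(1)] A_def by simp
        then show ?thesis by (simp only:)
      qed
      also have "\<dots> \<le> ennreal C2 * LB"
        unfolding C2_def LB_def Hm_def[symmetric] Hsp(2)[symmetric]
      proof (rule zygmund_lower[OF s1(2) _ \<beta> A Hsp(1)])
        show "\<zeta> \<le> 0" using \<sigma>(3) einv_bounds[OF s1(2)] by linarith
      qed
      finally show ?thesis .
    qed
    define c0 where "c0 = log_weight_const \<tau>0 \<gamma> (measure \<mu> \<Omega>) powr \<theta>"
    have "lorentz_zygmund \<mu> \<infinity> \<eta> \<theta> u \<le> ennreal c0 * lseq \<eta> (\<lambda>j. ?w j * rearr \<mu> u (\<tau> (2 ^ Suc j - 1) powr \<gamma>))"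
      unfolding c0_def s_def \<tau>_def sp[symmetric]
    proof (rule zygmund_upper[OF \<eta>1 _ \<gamma> \<tau>0(1)])
      show "\<theta> \<le> 0" using \<theta> ev einv_bounds[OF \<eta>1] by simp
      show "0 < measure \<mu> (space \<mu>)" "emeasure \<mu> (space \<mu>) = ennreal (measure \<mu> (space \<mu>))"
        using m0 em by (auto simp: sp)
      have "measure \<mu> \<Omega> = (measure \<mu> \<Omega> powr (n / \<alpha>)) powr \<gamma>" using m0 n1 \<alpha>0 by (simp add: powr_powr \<gamma>_def)
      also have "\<dots> \<le> \<tau>0 powr \<gamma>" using \<tau>0 \<gamma> by (intro powr_mono2) auto
      finally show "measure \<mu> (space \<mu>) \<le> \<tau>0 powr \<gamma>" by (simp only: sp)
    qed
    also have "\<dots> \<le> ennreal c0 * lseq \<eta> (\<lambda>j. ?w j * b (?k j) + ?w j * (\<Sum>i\<le>?k j. ennreal c * e i))"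
    proof (intro mult_left_mono lseq_mono \<eta>1)
      fix j
      show "?w j * rearr \<mu> u (\<tau> (2 ^ Suc j - 1) powr \<gamma>) \<le> ?w j * b (?k j) + ?w j * (\<Sum>i\<le>?k j. ennreal c * e i)"
        unfolding Sk[symmetric] distrib_left[symmetric] by (rule mult_left_mono[OF est]) simp
    qed simp
    also have "\<dots> \<le> ennreal c0 * (2 * (lseq \<eta> (\<lambda>j. ?w j * b (?k j)) + lseq \<eta> (\<lambda>j. ?w j * (\<Sum>i\<le>?k j. ennreal c * e i))))"
      by (intro mult_left_mono lseq_add \<eta>1) simp
    also have "\<dots> \<le> ennreal c0 * (2 * (ennreal C2 * LB + ennreal (c * (C1 * tail_const n)) * LG))"
      by (intro mult_left_mono add_mono bdry grad) auto
    also have "\<dots> \<le> ennreal c0 * (2 * (ennreal (C2 + c * (C1 * tail_const n)) * (LG + LB)))"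
    proof (intro mult_left_mono)
      have nn: "0 \<le> C2" "0 \<le> c * (C1 * tail_const n)"
        using C1 K tail_const_pos[of n] n1 by (auto simp: C2_def c_def)
      have "ennreal C2 * LB + ennreal (c * (C1 * tail_const n)) * LG
        \<le> ennreal (C2 + c * (C1 * tail_const n)) * LB + ennreal (C2 + c * (C1 * tail_const n)) * LG"
        by (intro add_mono mult_right_mono ennreal_leI) (use nn in auto)
      then show "ennreal C2 * LB + ennreal (c * (C1 * tail_const n)) * LG \<le> ennreal (C2 + c * (C1 * tail_const n)) * (LG + LB)"
        by (simp only: distrib_left add.commute)
    qed auto
    also have "\<dots> = ennreal (c0 * (2 * (C2 + c * (C1 * tail_const n)))) * (LG + LB)"
    proof -
      have "0 \<le> c0" "0 \<le> C2 + c * (C1 * tail_const n)"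
        using C1 K tail_const_pos[of n] n1 by (auto simp: C2_def c_def c0_def)
      then show ?thesis by (simp only: ennreal_mult mult_nonneg_nonneg zero_le_numeral mult.assoc ennreal_numeral)
    qed
    also have "c0 * (2 * (C2 + c * (C1 * tail_const n))) = zygmund_const K n \<alpha> \<sigma> \<theta> \<zeta> (measure lebesgue \<Omega>) (measure \<mu> \<Omega>) H"
      by (simp only: zygmund_const_def Let_def c0_def C2_def c_def C1_def A_def \<tau>0_def \<gamma>_def \<beta>_def)
    finally show ?thesis by (simp only: H_def)
  qed
qed

theorem theorem3p3:
  fixes \<alpha> C\<^sub>\<mu> :: real
  assumes n2: "CARD('n::finite) \<ge> 2"
    and alpha: "real CARD('n) - 1 < \<alpha>" "\<alpha> \<le> real CARD('n)"
    and Cmu: "C\<^sub>\<mu> > 0"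
  shows
  "(\<forall>(p::real) (r::real) (\<sigma>::ereal) (\<rho>\<^sub>b::ereal).
      1 < p \<and> p < real CARD('n) \<and> 1 < r \<and> 1 \<le> \<sigma> \<and> 1 \<le> \<rho>\<^sub>b \<longrightarrow>
     (\<exists>C::real. \<forall>(q::real) (\<eta>::ereal) (\<Omega>::(real^'n) set) (\<mu>::(real^'n) measure)
         (u::real^'n \<Rightarrow> real) (G::real^'n \<Rightarrow> real^'n).
        q = min (p * \<alpha> / (real CARD('n) - p)) (r * \<alpha> / (real CARD('n) - 1))
      \<and> (q = p * \<alpha> / (real CARD('n) - p) \<longrightarrow> \<eta> \<ge> \<sigma>)
      \<and> (q = r * \<alpha> / (real CARD('n) - 1) \<longrightarrow> \<eta> \<ge> \<rho>\<^sub>b)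
      \<and> open \<Omega> \<and> emeasure lebesgue \<Omega> < \<infinity>
      \<and> hausdorff (real CARD('n) - 1) (frontier \<Omega>) < \<infinity>
      \<and> sets \<mu> = sets (restrict_space borel \<Omega>) \<and> emeasure \<mu> \<Omega> < \<infinity>
      \<and> (\<forall>x\<in>\<Omega>. \<forall>\<rho>>0. emeasure \<mu> (ball x \<rho> \<inter> \<Omega>) \<le> ennreal (C\<^sub>\<mu> * \<rho> powr \<alpha>))
      \<and> has_weak_gradient \<Omega> u G
      \<and> lorentz (restrict_space lebesgue \<Omega>) (ereal p) \<sigma> (\<lambda>x. norm (G x)) < \<infinity>
      \<and> continuous_on (closure \<Omega>) u \<and> bounded {x \<in> closure \<Omega>. u x \<noteq> 0}
      \<longrightarrow>
        lorentz \<mu> (ereal q) \<eta> u \<le> ennreal C *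
          (ennreal (max (measure \<mu> \<Omega> powr (real CARD('n) / \<alpha>)) (measure lebesgue \<Omega>)
                     powr (\<alpha> / (q * real CARD('n)) - (real CARD('n) - p) / (p * real CARD('n))))
             * lorentz (restrict_space lebesgue \<Omega>) (ereal p) \<sigma> (\<lambda>x. norm (G x))
           + ennreal (max (measure \<mu> \<Omega> powr ((real CARD('n) - 1) / \<alpha>))
                          (enn2real (hausdorff (real CARD('n) - 1) (frontier \<Omega>)))
                     powr (\<alpha> / (q * (real CARD('n) - 1)) - 1 / r))
             * lorentz (hmeasure (real CARD('n) - 1) (frontier \<Omega>)) (ereal r) \<rho>\<^sub>b u)))
  \<and>
   (\<forall>(\<sigma>::ereal) (\<rho>\<^sub>b::ereal) (\<eta>::ereal) (\<theta>::real) (\<zeta>::real) (L::real) (M::real) (H::real).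
      1 < \<sigma> \<and> 1 < \<rho>\<^sub>b \<and> \<zeta> < - einv \<rho>\<^sub>b \<and> max \<sigma> \<rho>\<^sub>b \<le> \<eta>
      \<and> \<theta> \<le> min (-1 + einv \<sigma> - einv \<eta>) (\<zeta> + einv \<rho>\<^sub>b - einv \<eta>) \<longrightarrow>
     (\<exists>C::real. \<forall>(\<Omega>::(real^'n) set) (\<mu>::(real^'n) measure)
         (u::real^'n \<Rightarrow> real) (G::real^'n \<Rightarrow> real^'n).
        open \<Omega> \<and> emeasure lebesgue \<Omega> < \<infinity>
      \<and> hausdorff (real CARD('n) - 1) (frontier \<Omega>) < \<infinity>
      \<and> sets \<mu> = sets (restrict_space borel \<Omega>) \<and> emeasure \<mu> \<Omega> < \<infinity>
      \<and> (\<forall>x\<in>\<Omega>. \<forall>\<rho>>0. emeasure \<mu> (ball x \<rho> \<inter> \<Omega>) \<le> ennreal (C\<^sub>\<mu> * \<rho> powr \<alpha>))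
      \<and> measure lebesgue \<Omega> = L \<and> measure \<mu> \<Omega> = M
      \<and> enn2real (hausdorff (real CARD('n) - 1) (frontier \<Omega>)) = H
      \<and> has_weak_gradient \<Omega> u G
      \<and> lorentz (restrict_space lebesgue \<Omega>) (ereal (real CARD('n))) \<sigma> (\<lambda>x. norm (G x)) < \<infinity>
      \<and> continuous_on (closure \<Omega>) u \<and> bounded {x \<in> closure \<Omega>. u x \<noteq> 0}
      \<longrightarrow>
        lorentz_zygmund \<mu> \<infinity> \<eta> \<theta> u \<le> ennreal C *
          (lorentz (restrict_space lebesgue \<Omega>) (ereal (real CARD('n))) \<sigma> (\<lambda>x. norm (G x))
           + lorentz_zygmund (hmeasure (real CARD('n) - 1) (frontier \<Omega>)) \<infinity> \<rho>\<^sub>b \<zeta> u)))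
  \<and>
   (\<forall>(p::real) (\<sigma>::ereal).
      (p = real CARD('n) \<and> \<sigma> = 1) \<or> (real CARD('n) < p \<and> 1 \<le> \<sigma>) \<longrightarrow>
     (\<exists>C::real. \<forall>(\<Omega>::(real^'n) set) (\<mu>::(real^'n) measure)
         (u::real^'n \<Rightarrow> real) (G::real^'n \<Rightarrow> real^'n).
        open \<Omega> \<and> emeasure lebesgue \<Omega> < \<infinity>
      \<and> hausdorff (real CARD('n) - 1) (frontier \<Omega>) < \<infinity>
      \<and> sets \<mu> = sets (restrict_space borel \<Omega>) \<and> emeasure \<mu> \<Omega> < \<infinity>
      \<and> (\<forall>x\<in>\<Omega>. \<forall>\<rho>>0. emeasure \<mu> (ball x \<rho> \<inter> \<Omega>) \<le> ennreal (C\<^sub>\<mu> * \<rho> powr \<alpha>))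
      \<and> has_weak_gradient \<Omega> u G
      \<and> lorentz (restrict_space lebesgue \<Omega>) (ereal p) \<sigma> (\<lambda>x. norm (G x)) < \<infinity>
      \<and> continuous_on (closure \<Omega>) u \<and> bounded {x \<in> closure \<Omega>. u x \<noteq> 0}
      \<longrightarrow>
        linf (restrict_space lebesgue \<Omega>) u \<le> ennreal C *
          (ennreal (measure lebesgue \<Omega> powr (1 / real CARD('n) - 1 / p))
             * lorentz (restrict_space lebesgue \<Omega>) (ereal p) \<sigma> (\<lambda>x. norm (G x))
           + linf (hmeasure (real CARD('n) - 1) (frontier \<Omega>)) u)))"
proof (intro conjI allI impI, goal_cases)
  case (1 p r \<sigma> \<rho>\<^sub>b)
  let ?n = "real CARD('n)" and ?q = "min (p * \<alpha> / (real CARD('n) - p)) (r * \<alpha> / (real CARD('n) - 1))"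
  \<comment> \<open>\<open>q\<close> is quantified inside the existential but determined by its
    equation, which is substituted; the witness can therefore name it as \<open>?q\<close>.\<close>
  show ?case
    using 1 n2 alpha Cmu
    by (intro exI[of _ "gradient_const (level_const C\<^sub>\<mu> \<alpha> ?n) ?n p ?q \<alpha> + boundary_const (level_const C\<^sub>\<mu> \<alpha> ?n) ?n r ?q \<alpha>"] allI impI)
      (elim conjE, hypsubst, rule lorentz_trace_bound; simp only: refl)
next
  case (2 \<sigma> \<rho>\<^sub>b \<eta> \<theta> \<zeta> L M H)
  let ?n = "real CARD('n)"
  \<comment> \<open>The equations for \<open>L\<close>, \<open>M\<close> and \<open>H\<close> are
    eliminated in the same way, which turns the witness into the constant of
    \<open>zygmund_trace_bound\<close>.\<close>
  show ?case
    using 2 n2 alpha Cmu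
    by (intro exI[of _ "zygmund_const (level_const C\<^sub>\<mu> \<alpha> ?n) ?n \<alpha> \<sigma> \<theta> \<zeta> L M H"] allI impI)
      (elim conjE, hypsubst, rule zygmund_trace_bound; simp only: refl)
next
  case (3 p \<sigma>)
  let ?n = "real CARD('n)"
  show ?case
    using 3 n2
    by (intro exI[of _ "sup_const (level_const (unit_ball_vol ?n) ?n ?n) ?n p"] allI impI)
      (elim conjE, rule linf_bound; simp only: refl)
qed

end
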